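(* Assume that $$\frac{2\sigma}{R^{\max}} + P_{\mathrm{ext}}^\ast < P_{\mathrm{int}}(\rho_{\mathrm{ext}}).$$ Then there exist an open interval $G \subseteq \mathbb{R}$ with $0 \in G$ and functions $A : G \to \mathbb{R}$ and $\varphi : G \to C^\infty([-1,1])$ such that the following hold. 1. $A(0)=0$, $\mathfrak{P}^{-1}\left(\frac{2\sigma}{R^{\max}} + P_{\mathrm{ext}}^\ast\right) < A(g) < \eta^{\max}$ for all $g \in G$, and $A$ is smooth. 2. $\varphi(0)=0$, and for every $m \in \mathbb{N}$ the induced map $\varphi : G \to C^m_b([-1,1])$ is smooth. 3. For every $g \in G$ the map $\Lambda_g : \overline{\mathbb{B}^3} \to \mathbb{R}^3$ defined by $\Lambda_g(x) = (R_{A(g)} + \varphi(g)(x_3))\, x$ is a smooth diffeomorphism onto its image. Moreover, setting $\Omega_{\mathrm{int},g} = \Lambda_g(\mathbb{B}^3)$ and $\Sigma_g = \Lambda_g(\mathbb{S}^2)$, the set $\overline{\Omega_{\mathrm{int},g}}$ is a smooth, compact, simply connected manifold with boundary, $\Sigma_g = \partial \overline{\Omega_{\mathrm{int},g}}$ is a smooth, compact, simply connected manifold, and $\overline{\Omega_{\mathrm{int},g}} \subset \Omega_{\mathrm{tot}}$, so that one may define the open set $\Omega_{\mathrm{ext},g} = \Omega_{\mathrm{tot}} \setminus \overline{\Omega_{\mathrm{int},g}}$. In particular, $\Omega_{\mathrm{int},0} = R_0 \mathbb{B}^3$ and $\Sigma_0 = R_0 \mathbb{S}^2$ with $R_0 =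 2\sigma/(P_{\mathrm{int}}(\rho_{\mathrm{ext}}) - P_{\mathrm{ext}}^\ast)$. 4. There is $r$ with $R_0 < r < R^{\max}$ such that for all $g \in G$ we have $\overline{\Omega_{\mathrm{int},g}} \subset \mathbb{R}^2 \times [-r,r]$ and $\{A(g) - g t : t \in [-r,r]\} \subseteq \eta(\mathbb{R}_+)$; hence $\rho_{\mathrm{int},g} : \overline{\Omega_{\mathrm{int},g}} \to \mathbb{R}_+$ given by $\rho_{\mathrm{int},g}(x) = \eta^{-1}(A(g) - g x_3)$ is well-defined and smooth. 5. For every $g \in G$, with $P_{\mathrm{ext}}(x) = P_{\mathrm{ext}}^\ast - g\rho_{\mathrm{ext}} x_3$, $$\begin{cases} \nabla P_{\mathrm{ext}} = -\rho_{\mathrm{ext}}\, g\, e_3 & \text{in } \Omega_{\mathrm{ext},g},\\ \nabla [P_{\mathrm{int}} \circ \rho_{\mathrm{int},g}] = -\rho_{\mathrm{int},g}\, g\, e_3 & \text{in } \Omega_{\mathrm{int},g},\\ \sigma \mathscr{K}_{\Sigma_g} = P_{\mathrm{int}} \circ \rho_{\mathrm{int},g} - P_{\mathrm{ext}} & \text{on } \Sigma_g. \end{cases}$$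
   Context: Notation: $\mathbb{R}_+ = (0,\infty)$, $\mathbb{N}=\{0,1,2,\dots\}$, $\mathbb{B}^3$ is the open unit ball in $\mathbb{R}^3$ and $\mathbb{S}^2 = \partial\mathbb{B}^3$; $e_3=(0,0,1)$. $C^m_b([-1,1])$ is the Banach space of $C^m$ functions with norm $\max_{0\le k\le m}\sup_{|\zeta|\le 1}|D^k f(\zeta)|$. Setting: $\Omega_{\mathrm{tot}} \subseteq \mathbb{R}^3$ is a given open set with $0 \in \Omega_{\mathrm{tot}}$, and $R^{\max} = \sup\{s>0 : B(0,s) \subset \Omega_{\mathrm{tot}}\} \in (0,\infty]$ (with $2\sigma/R^{\max}=0$ if $R^{\max}=\infty$). The constants $\sigma, \rho_{\mathrm{ext}}, P_{\mathrm{ext}}^\ast \in \mathbb{R}_+$ are given. The function $P_{\mathrm{int}} : \mathbb{R}_+ \to \mathbb{R}_+$ is smooth with $P_{\mathrm{int}}'>0$ and $\lim_{t\to 0} P_{\mathrm{int}}(t) = 0$; write $P_{\mathrm{int}}^{\max} = \sup_{t>0} P_{\mathrm{int}}(t) \in (0,\infty]$. Define $\eta : \mathbb{R}_+ \to \mathbb{R}$ by $\eta(z) = \int_{\rho_{\mathrm{ext}}}^z t^{-1} P_{\mathrm{int}}'(t)\,dt$; it is a smooth increasing diffeomorphism onto $\eta(\mathbb{R}_+) = (\eta^{\min},\eta^{\max})$, where $\eta^{\min} = -\int_0^{\rho_{\mathrm{ext}}} t^{-1}P_{\mathrm{int}}'(t)\,dt \in [-\infty,0)$ and $\eta^{\max}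 = \int_{\rho_{\mathrm{ext}}}^\infty t^{-1}P_{\mathrm{int}}'(t)\,dt \in (0,\infty]$. Define $\mathfrak{P} = P_{\mathrm{int}}\circ\eta^{-1} : (\eta^{\min},\eta^{\max}) \to (0,P_{\mathrm{int}}^{\max})$, a smooth increasing diffeomorphism. For $\alpha \in (\mathfrak{P}^{-1}(P_{\mathrm{ext}}^\ast), \eta^{\max})$ set $R_\alpha = \dfrac{2\sigma}{\mathfrak{P}(\alpha) - P_{\mathrm{ext}}^\ast}$. For a smooth compact surface $\Sigma$ bounding a domain, $\mathscr{K}_\Sigma$ denotes the total curvature (twice the mean curvature), normalized so that $\mathscr{K}_{\mathbb{S}^2}=2$. *)

theory Defs
  imports "HOL-Analysis.Analysis"
begin

section \<open>Smooth maps between subsets of Euclidean spaces\<close>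

text \<open>For an open set \<open>U\<close> in a finite-dimensional space, \<open>k_smooth_on n U f\<close> says that
  \<open>f\<close> is of class $C^n$ on \<open>U\<close>.\<close>

primrec k_smooth_on :: "nat \<Rightarrow> 'a::euclidean_space set \<Rightarrow> ('a \<Rightarrow> 'b::real_normed_vector) \<Rightarrow> bool" where
  "k_smooth_on 0 U f \<longleftrightarrow> continuous_on U f"
| "k_smooth_on (Suc n) U f \<longleftrightarrow>
     (\<forall>x\<in>U. f differentiable (at x)) \<and>
     (\<forall>v. k_smooth_on n U (\<lambda>x. frechet_derivative f (at x) v))"

text \<open>Smoothness on an arbitrary set means that the map extends, near every point of the set, to a
  smooth map on an open neighbourhood. For open sets this is ordinary $C^\infty$ smoothness.\<close>

definition smooth_on :: "'a::euclidean_space set \<Rightarrow> ('a \<Rightarrow> 'b::real_normed_vector) \<Rightarrow> bool" where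
  "smooth_on S f \<longleftrightarrow>
     (\<forall>x\<in>S. \<exists>U F. open U \<and> x \<in> U \<and> (\<forall>n. k_smooth_on n U F) \<and> (\<forall>y\<in>S \<inter> U. F y = f y))"

definition smooth_diffeo ::
    "'a::euclidean_space set \<Rightarrow> 'b::euclidean_space set \<Rightarrow> ('a \<Rightarrow> 'b) \<Rightarrow> bool" where
  "smooth_diffeo S T f \<longleftrightarrow> bij_betw f S T \<and> smooth_on S f \<and> smooth_on T (inv_into S f)"


section \<open>Embedded manifolds in Euclidean space\<close>

text \<open>The dimension of the manifold is that of the model space \<open>'m\<close>.\<close>

definition smooth_manifold :: "'m::euclidean_space itself \<Rightarrow> 'a::euclidean_space set \<Rightarrow> bool" where
  "smooth_manifold T M \<longleftrightarrow>
     (\<forall>x\<in>M. \<exists>U V (f :: 'a \<Rightarrow> 'm). open U \<and> x \<in> U \<and> open V \<and> smooth_diffeo (M \<inter> U) V f)"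

text \<open>A chart at \<open>x\<close> onto a relatively open subset of the half-space \<open>{y. 0 \<le> y \<bullet> b}\<close>.\<close>

definition half_space_chart ::
    "'a::euclidean_space set \<Rightarrow> 'a \<Rightarrow> 'm::euclidean_space \<Rightarrow> ('a \<Rightarrow> 'm) \<Rightarrow> bool" where
  "half_space_chart M x b f \<longleftrightarrow> b \<in> Basis \<and>
     (\<exists>U V. open U \<and> x \<in> U \<and> open V \<and> smooth_diffeo (M \<inter> U) (V \<inter> {y. 0 \<le> y \<bullet> b}) f)"

definition smooth_manifold_with_boundary ::
    "'m::euclidean_space itself \<Rightarrow> 'a::euclidean_space set \<Rightarrow> bool" where
  "smooth_manifold_with_boundary T M \<longleftrightarrow>
     (\<forall>x\<in>M. \<exists>(b :: 'm) f. half_space_chart M x b f)"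

definition manifold_boundary ::
    "'m::euclidean_space itself \<Rightarrow> 'a::euclidean_space set \<Rightarrow> 'a set" where
  "manifold_boundary T M = {x \<in> M. \<exists>(b :: 'm) f. half_space_chart M x b f \<and> f x \<bullet> b = 0}"


section \<open>Total curvature of a surface bounding a domain\<close>

definition tangent_space :: "'a::euclidean_space set \<Rightarrow> 'a \<Rightarrow> 'a set" where
  "tangent_space \<Gamma> x =
     {v. \<exists>\<epsilon>>0. \<exists>\<gamma>. smooth_on {-\<epsilon><..<\<epsilon>} \<gamma> \<and> \<gamma> ` {-\<epsilon><..<\<epsilon>} \<subseteq> \<Gamma> \<and>
           \<gamma> (0::real) = x \<and> (\<gamma> has_vector_derivative v) (at 0)}"

text \<open>The unit normal to \<open>\<Gamma>\<close> at \<open>x\<close> that points out of the domain \<open>D\<close> bounded by \<open>\<Gamma>\<close>.\<close>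

definition outward_normal :: "'a::euclidean_space set \<Rightarrow> 'a set \<Rightarrow> 'a \<Rightarrow> 'a" where
  "outward_normal D \<Gamma> x =
     (THE \<nu>. norm \<nu> = 1 \<and> (\<forall>v\<in>tangent_space \<Gamma> x. \<nu> \<bullet> v = 0) \<and>
        (\<forall>\<^sub>F t in at_right 0. x + t *\<^sub>R \<nu> \<notin> closure D))"

text \<open>The trace over the tangent space of the derivative of the outward normal (the Weingarten map),
  computed in any orthonormal basis \<open>B\<close> of the tangent space; that is, the sum of the principal
  curvatures, which is twice the mean curvature for a surface in space. The derivative is taken
  within \<open>\<Gamma>\<close> and so is determined exactly on the tangent space. The sign is such that
  spheres, as boundaries of balls, have positive curvature.\<close>

definition total_curvature :: "'a::euclidean_space set \<Rightarrow> 'a set \<Rightarrow> 'a \<Rightarrow> real" where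
  "total_curvature D \<Gamma> x =
     (THE \<kappa>. \<exists>W B. (outward_normal D \<Gamma> has_derivative W) (at x within \<Gamma>) \<and>
        pairwise orthogonal B \<and> (\<forall>b\<in>B. norm b = 1) \<and> span B = tangent_space \<Gamma> x \<and>
        \<kappa> = (\<Sum>b\<in>B. W b \<bullet> b))"


lemma k_smooth_trig:
  fixes x y :: "'b::real_normed_vector"
  shows "k_smooth_on n UNIV (\<lambda>t. cos (a * t) *\<^sub>R x + sin (a * t) *\<^sub>R y)"
proof (induction n arbitrary: x y)
  case 0 then show ?case by (auto intro!: continuous_intros)
next
  case (Suc n)
  have d: "((\<lambda>t. cos (a * t) *\<^sub>R x + sin (a * t) *\<^sub>R y) has_derivative
      (\<lambda>h. h *\<^sub>R (cos (a * t) *\<^sub>R (a *\<^sub>R y) + sin (a * t) *\<^sub>R (- a *\<^sub>R x)))) (at t)" for t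
    by (rule derivative_eq_intros refl | simp add: algebra_simps)+
  have e: "frechet_derivative (\<lambda>t. cos (a * t) *\<^sub>R x + sin (a * t) *\<^sub>R y) (at t) v
     = cos (a * t) *\<^sub>R ((v * a) *\<^sub>R y) + sin (a * t) *\<^sub>R ((- v * a) *\<^sub>R x)" for t v
    unfolding frechet_derivative_at[OF d[of t], symmetric] by (simp add: algebra_simps)
  have "(\<lambda>t. cos (a * t) *\<^sub>R x + sin (a * t) *\<^sub>R y) differentiable (at t)" for t
    using d[of t] unfolding differentiable_def by blast
  then show ?case unfolding k_smooth_on.simps e using Suc by blast
qed

lemma tangent_sphere:
  fixes x :: "'a::euclidean_space"
  assumes x: "norm x = 1"
  shows "tangent_space (sphere 0 1) x = {v. x \<bullet> v = 0}"
proof (intro set_eqI iffI)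
  fix v assume "v \<in> tangent_space (sphere 0 1) x"
  then obtain \<epsilon> \<gamma> where e: "\<epsilon>>0" "\<gamma> ` {-\<epsilon><..<\<epsilon>} \<subseteq> sphere 0 1" "\<gamma> (0::real) = x"
     "(\<gamma> has_vector_derivative v) (at 0)" unfolding tangent_space_def by blast
  have 1: "((\<lambda>t. \<gamma> t \<bullet> \<gamma> t) has_derivative (\<lambda>h. 2 * h * (x \<bullet> v))) (at 0)"
    using e(4) unfolding has_vector_derivative_def
    by (auto intro!: derivative_eq_intros simp: e(3) inner_commute)
  have 2: "((\<lambda>t. \<gamma> t \<bullet> \<gamma> t) has_derivative (\<lambda>h. 0)) (at 0)"
  proof (rule has_derivative_transform_within_open[of "\<lambda>_. 1" _ _ _ "{-\<epsilon><..<\<epsilon>}"])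
    show "1 = \<gamma> t \<bullet> \<gamma> t" if "t \<in> {-\<epsilon><..<\<epsilon>}" for t
    proof -
      have "norm (\<gamma> t) = 1" using e(2) that by (auto simp: image_subset_iff)
      then show ?thesis by (simp add: norm_eq_1)
    qed
  qed (use e in auto)
  have "(\<lambda>h. 2 * h * (x \<bullet> v)) = (\<lambda>h. 0)" using has_derivative_unique[OF 1 2] .
  from fun_cong[OF this, of 1] show "v \<in> {v. x \<bullet> v = 0}" by simp
next
  fix v assume v: "v \<in> {v. x \<bullet> v = 0}"
  define a where "a = norm v"
  define u where "u = v /\<^sub>R a"
  have u: "u \<bullet> x = 0" using v by (simp add: u_def inner_commute)
  have au: "a *\<^sub>R u = v" by (cases "v = 0") (auto simp: u_def a_def)
  define \<gamma> where "\<gamma> = (\<lambda>t. cos (a * t) *\<^sub>R x + sin (a * t) *\<^sub>R u)"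
  have s: "smooth_on {-1<..<1} \<gamma>" unfolding smooth_on_def \<gamma>_def using k_smooth_trig by blast
  have n: "norm (\<gamma> t) = 1" for t
  proof -
    have xx: "x \<bullet> x = 1" using x by (simp add: norm_eq_1)
    have "a \<noteq> 0 \<Longrightarrow> u \<bullet> u = 1" by (simp add: u_def a_def dot_square_norm power2_eq_square)
    then have "\<gamma> t \<bullet> \<gamma> t = (cos (a*t))\<^sup>2 + (sin (a*t))\<^sup>2"
      by (cases "a = 0") (auto simp: \<gamma>_def inner_add_left inner_add_right xx u inner_commute[of x u] power2_eq_square)
    then show ?thesis by (simp add: norm_eq_1)
  qed
  have d: "(\<gamma> has_vector_derivative v) (at 0)"
    unfolding \<gamma>_def has_vector_derivative_def
    by (rule derivative_eq_intros refl | simp add: au[symmetric] mult.commute)+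
  show "v \<in> tangent_space (sphere 0 1) x"
    unfolding tangent_space_def mem_Collect_eq
    by (rule exI[of _ 1], simp, rule exI[of _ \<gamma>]) (use s n d in \<open>auto simp: \<gamma>_def\<close>)
qed

lemma outward_normal_sphere:
  fixes x :: "'a::euclidean_space"
  assumes x: "norm x = 1"
  shows "outward_normal (ball 0 1) (sphere 0 1) x = x"
  unfolding outward_normal_def tangent_sphere[OF x]
proof (rule the_equality, goal_cases)
  case 1
  have "x + t *\<^sub>R x \<notin> closure (ball 0 1)" if "t > 0" for t
  proof -
    have "x + t *\<^sub>R x = (1 + t) *\<^sub>R x" by (simp add: algebra_simps)
    then have "norm (x + t *\<^sub>R x) = 1 + t" using x that by simp
    then show ?thesis using that by simp
  qed
  then show ?case using x by (auto intro: eventually_mono[OF eventually_at_right_less])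
next
  case (2 \<nu>)
  define c where "c = \<nu> \<bullet> x"
  have xx: "x \<bullet> x = 1" using x by (simp add: norm_eq_1)
  have "x \<bullet> (\<nu> - c *\<^sub>R x) = 0" by (simp add: inner_diff_right xx c_def inner_commute)
  then have "\<nu> \<bullet> (\<nu> - c *\<^sub>R x) = 0" "x \<bullet> (\<nu> - c *\<^sub>R x) = 0" using 2 by auto
  then have "(\<nu> - c *\<^sub>R x) \<bullet> (\<nu> - c *\<^sub>R x) = 0" by (simp add: inner_diff_left)
  then have nu: "\<nu> = c *\<^sub>R x" by simp
  then have "\<bar>c\<bar> = 1" using 2 x by auto
  moreover have "c \<noteq> -1"
  proof
    assume "c = -1"
    with nu 2 have "\<forall>\<^sub>F t in at_right 0. x - t *\<^sub>R x \<notin> cball 0 1" by simp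
    moreover have "\<forall>\<^sub>F t in at_right 0. (t::real) \<in> {0<..<1}"
      by (rule eventually_at_right_real) simp
    ultimately have "\<forall>\<^sub>F t in at_right (0::real). False"
    proof eventually_elim
      case (elim t)
      have "x - t *\<^sub>R x = (1 - t) *\<^sub>R x" by (simp add: algebra_simps)
      then have "norm (x - t *\<^sub>R x) = 1 - t" using x elim by simp
      then show ?case using elim by simp
    qed
    then show False by simp
  qed
  ultimately have "c = 1" by linarith
  then show ?case using nu by simp
qed

text \<open>The normalization: the unit sphere has total curvature \<open>2\<close>.\<close>

lemma total_curvature_sphere:
  fixes x :: "real^3"
  assumes x: "norm x = 1"
  shows "total_curvature (ball 0 1) (sphere 0 1) x = 2"
proof -
  have nd: "((\<lambda>x. x) has_derivative (\<lambda>x. x)) (at x within sphere 0 1)" by simp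
  let ?N = "outward_normal (ball 0 1) (sphere 0 1) :: real^3 \<Rightarrow> _"
  have N: "(?N has_derivative (\<lambda>x. x)) (at x within sphere 0 1)"
    by (rule has_derivative_transform[OF _ _ nd]) (use x in \<open>auto simp: outward_normal_sphere\<close>)
  have T: "tangent_space (sphere 0 1) x = {v. x \<bullet> v = 0}" by (rule tangent_sphere[OF x])
  have dimT: "dim {v. x \<bullet> v = 0} = 2" using x by (subst dim_hyperplane) auto
  have W: "W v = v" if W: "(?N has_derivative W) (at x within sphere 0 1)" and v: "v \<in> tangent_space (sphere 0 1) x" for W v
  proof -
    obtain \<epsilon> \<gamma> where e: "\<epsilon>>0" "\<gamma> ` {-\<epsilon><..<\<epsilon>} \<subseteq> sphere 0 1" "\<gamma> (0::real) = x"
     "(\<gamma> has_vector_derivative v) (at 0)" using v unfolding tangent_space_def by blast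
    have g: "(\<gamma> has_derivative (\<lambda>h. h *\<^sub>R v)) (at 0 within {-\<epsilon><..<\<epsilon>})"
      using e(4) unfolding has_vector_derivative_def by (rule has_derivative_at_withinI)
    have W': "(?N has_derivative W) (at (\<gamma> 0) within \<gamma> ` {-\<epsilon><..<\<epsilon>})"
      using has_derivative_subset[OF W e(2)] e(3) by simp
    have 1: "((\<lambda>t. ?N (\<gamma> t)) has_derivative (\<lambda>h. W (h *\<^sub>R v))) (at 0 within {-\<epsilon><..<\<epsilon>})"
      using diff_chain_within[OF g W'] by (simp add: o_def)
    have 2: "((\<lambda>t. ?N (\<gamma> t)) has_derivative (\<lambda>h. h *\<^sub>R v)) (at 0 within {-\<epsilon><..<\<epsilon>})"
      by (rule has_derivative_transform[OF _ _ g]) (use e in \<open>auto simp: outward_normal_sphere image_subset_iff\<close>)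
    have "(\<lambda>h. W (h *\<^sub>R v)) = (\<lambda>h. h *\<^sub>R v)"
      using has_derivative_unique 1 2 at_within_open[of "0::real" "{-\<epsilon><..<\<epsilon>}"] e(1) by auto
    from fun_cong[OF this, of 1] show ?thesis by simp
  qed
  have S: "(\<Sum>b\<in>B. W b \<bullet> b) = 2"
    if "(?N has_derivative W) (at x within sphere 0 1)" "pairwise orthogonal B" "\<forall>b\<in>B. norm b = 1"
       "span B = tangent_space (sphere 0 1) x" for W B
  proof -
    have "independent B" using that by (intro pairwise_orthogonal_independent) auto
    then have "card B = dim (span B)" by (rule dim_span_eq_card_independent[symmetric])
    then have c: "card B = 2" using that T dimT by simp
    have "W b \<bullet> b = 1" if "b \<in> B" for b
      using W[of W b] \<open>b \<in> B\<close> that \<open>(?N has_derivative W) _\<close> \<open>\<forall>b\<in>B. norm b = 1\<close> \<open>span B = _\<close> span_base[of b B]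
      by (simp add: norm_eq_1)
    then show ?thesis using c by simp
  qed
  obtain B where "B \<subseteq> {v. x \<bullet> v = 0}" "pairwise orthogonal B" "\<And>b. b \<in> B \<Longrightarrow> norm b = 1" "span B = {v. x \<bullet> v = 0}"
    using orthonormal_basis_subspace[OF subspace_hyperplane[of x]] by metis
  then have B: "(?N has_derivative (\<lambda>x. x)) (at x within sphere 0 1)" "pairwise orthogonal B"
      "\<forall>b\<in>B. norm b = 1" "span B = tangent_space (sphere 0 1) x"
    using N T by auto
  have "\<exists>W B. (?N has_derivative W) (at x within sphere 0 1) \<and> pairwise orthogonal B \<and>
      (\<forall>b\<in>B. norm b = 1) \<and> span B = tangent_space (sphere 0 1) x \<and> 2 = (\<Sum>b\<in>B. W b \<bullet> b)"
    by (rule exI[of _ "\<lambda>x. x"], rule exI[of _ B]) (use B S[OF B] in auto)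
  then show ?thesis unfolding total_curvature_def using S by (intro the_equality) auto
qed


section \<open>The spaces $C^m_b([-1,1])$\<close>

text \<open>Elements are represented by functions on the reals of which only the values on
  $[-1,1]$ matter; derivatives at the end points are one-sided.\<close>

definition deriv_I :: "nat \<Rightarrow> (real \<Rightarrow> real) \<Rightarrow> real \<Rightarrow> real" where
  "deriv_I k = (\<lambda>f \<zeta>. vector_derivative f (at \<zeta> within {-1..1})) ^^ k"

definition Cm_I :: "nat \<Rightarrow> (real \<Rightarrow> real) set" where
  "Cm_I m = {f. (\<forall>k<m. deriv_I k f differentiable_on {-1..1}) \<and>
                (\<forall>k\<le>m. continuous_on {-1..1} (deriv_I k f))}"

definition Cinf_I :: "(real \<Rightarrow> real) set" where
  "Cinf_I = (\<Inter>m. Cm_I m)"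

definition Cm_norm :: "nat \<Rightarrow> (real \<Rightarrow> real) \<Rightarrow> real" where
  "Cm_norm m f = (MAX k\<in>{..m}. SUP \<zeta>\<in>{-1..1}. \<bar>deriv_I k f \<zeta>\<bar>)"

text \<open>A curve \<open>c\<close> in $C^m_b([-1,1])$ defined on an open set \<open>G\<close> of parameters is of class
  $C^n$, all limits being taken in the norm of $C^m_b([-1,1])$.\<close>

primrec Cm_curve :: "nat \<Rightarrow> nat \<Rightarrow> real set \<Rightarrow> (real \<Rightarrow> real \<Rightarrow> real) \<Rightarrow> bool" where
  "Cm_curve m 0 G c \<longleftrightarrow> c ` G \<subseteq> Cm_I m \<and>
     (\<forall>g\<in>G. ((\<lambda>h. Cm_norm m (\<lambda>\<zeta>. c h \<zeta> - c g \<zeta>)) \<longlongrightarrow> 0) (at g))"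
| "Cm_curve m (Suc n) G c \<longleftrightarrow> c ` G \<subseteq> Cm_I m \<and>
     (\<exists>c'. Cm_curve m n G c' \<and>
       (\<forall>g\<in>G. ((\<lambda>h. Cm_norm m (\<lambda>\<zeta>. (c h \<zeta> - c g \<zeta>) / (h - g) - c' g \<zeta>)) \<longlongrightarrow> 0) (at g)))"

definition smooth_Cm_curve :: "nat \<Rightarrow> real set \<Rightarrow> (real \<Rightarrow> real \<Rightarrow> real) \<Rightarrow> bool" where
  "smooth_Cm_curve m G c \<longleftrightarrow> (\<forall>n. Cm_curve m n G c)"


section \<open>The physical quantities\<close>

definition Rmax :: "(real^3) set \<Rightarrow> ereal" where
  "Rmax \<Omega>tot = Sup {ereal s | s. 0 < s \<and> ball 0 s \<subseteq> \<Omega>tot}"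

text \<open>In extended reals, division by \<open>\<infinity>\<close> gives \<open>0\<close>.\<close>

definition min_pressure_jump :: "real \<Rightarrow> (real^3) set \<Rightarrow> real" where
  "min_pressure_jump \<sigma> \<Omega>tot = real_of_ereal (ereal (2 * \<sigma>) / Rmax \<Omega>tot)"

definition eta :: "(real \<Rightarrow> real) \<Rightarrow> real \<Rightarrow> real \<Rightarrow> real" where
  "eta Pint \<rho>ext z = (LBINT t=ereal \<rho>ext..ereal z. inverse t * deriv Pint t)"

definition eta_inv :: "(real \<Rightarrow> real) \<Rightarrow> real \<Rightarrow> real \<Rightarrow> real" where
  "eta_inv Pint \<rho>ext = inv_into {0<..} (eta Pint \<rho>ext)"

definition eta_max :: "(real \<Rightarrow> real) \<Rightarrow> real \<Rightarrow> ereal" where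
  "eta_max Pint \<rho>ext =
     enn2ereal (\<integral>\<^sup>+t\<in>{\<rho>ext<..}. ennreal (inverse t * deriv Pint t) \<partial>lborel)"

text \<open>The function $\mathfrak{P}$ and its inverse, on the domain $\eta(\mathbb{R}_+)$.\<close>

definition frakP :: "(real \<Rightarrow> real) \<Rightarrow> real \<Rightarrow> real \<Rightarrow> real" where
  "frakP Pint \<rho>ext = Pint \<circ> eta_inv Pint \<rho>ext"

definition frakP_inv :: "(real \<Rightarrow> real) \<Rightarrow> real \<Rightarrow> real \<Rightarrow> real" where
  "frakP_inv Pint \<rho>ext = inv_into (eta Pint \<rho>ext ` {0<..}) (frakP Pint \<rho>ext)"

definition bubble_radius :: "real \<Rightarrow> real \<Rightarrow> real \<Rightarrow> (real \<Rightarrow> real) \<Rightarrow> real \<Rightarrow> real" where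
  "bubble_radius \<sigma> \<rho>ext Pext_star Pint \<alpha> = 2 * \<sigma> / (frakP Pint \<rho>ext \<alpha> - Pext_star)"

end

theory Submission
  imports Defs
begin

text \<open>Neither the mass nor the position of the bubble is prescribed, so \<open>A = 0\<close> can be kept and the third
  equation becomes a prescribed mean curvature problem: the surface must have total curvature
  \<open>F (g x\<^sub>3)\<close>, where \<open>F y = (frakP (- y) + \<rho>ext y - Pext_star) / \<sigma>\<close> satisfies
  \<open>F' y = y m y\<close> with \<open>m\<close> smooth and \<open>m 0 > 0\<close>.

  Surfaces of revolution \<open>x\<^sub>1\<^sup>2 + x\<^sub>2\<^sup>2 = W (x\<^sub>3)\<close> turn this into a second-order equation for \<open>W\<close> which
  degenerates at the poles. It has the first integral \<open>(H W - g\<^sup>2 I) sqrt (W + W'\<^sup>2 / 4) = 2 W\<close>, where \<open>H\<close> is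
  the prescribed curvature and \<open>I\<close> a moment of \<open>W\<close>. This yields an
  integral equation for \<open>W\<close> divided by the distance to the pole that is a contraction near the pole, smooth in all parameters. Caps
  rising from the south pole at \<open>- a\<close> and descending from the north pole at \<open>b\<close> are matched at height \<open>0\<close>.
  The implicit function theorem yields \<open>a\<close> and \<open>b\<close> from the equality of the slopes and of the moments:
  at \<open>g = 0\<close> the derivative of the moment condition does not vanish because \<open>m 0 > 0\<close>. Equality of the
  radii then follows from the first integral. Finally, the surface is close to a sphere, hence a
  radial graph over it, and the radial map is an ambient diffeomorphism that transports charts of the ball.\<close>

section \<open>Calculus of smooth maps\<close>

text \<open>At the round sphere the linearized mean curvature has the translations as kernel, so the
  implicit function theorem does not apply to the curvature equation itself. With
  \<open>A = 0\<close> the density at height 0 is \<open>\<rho>ext\<close>; as \<open>frakP\<close>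
  has the density as its derivative, F' vanishes at 0 and the curvature at height z varies at rate
  g^2 z m (g z). The vertical position is thus fixed only at order g^2, which has to be divided out
  first. The first integral does this. With E = W + W'^2 / 4 the equation reads 2 E - W (1 + W'' /
  2) = H E^(3/2), whence (2 W / sqrt E)' = H W' = (H W)' - g^2 z m (g z) W. So g^2 multiplies the
  moment I, the integral of z m (g z) W from the pole. Squaring and differentiating again cancels W'
  and leaves W'' = - 2 - 16 g^2 W I / (H W - g^2 I)^3. All powers of the distance s to the pole
  cancel there, as W is of order s and I of order s^2. Equality of the moments at height 0 means
  that z m (g z) W has integral 0 over the whole body.\<close>

definition Cinf_on :: "'a::euclidean_space set \<Rightarrow> ('a \<Rightarrow> 'b::real_normed_vector) \<Rightarrow> bool" where
  "Cinf_on U f \<longleftrightarrow> (\<forall>n. k_smooth_on n U f)"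

lemma k_smooth_on_has_derivative:
  assumes "k_smooth_on (Suc n) U f" "x \<in> U"
  shows "(f has_derivative frechet_derivative f (at x)) (at x)"
  using assms frechet_derivative_works by auto

lemma k_smooth_on_cong:
  assumes "open U" "\<And>x. x \<in> U \<Longrightarrow> f x = g x" "k_smooth_on n U f"
  shows "k_smooth_on n U g"
  using assms(2,3)
proof (induction n arbitrary: f g)
  case 0
  then show ?case by (simp cong: continuous_on_cong)
next
  case (Suc n)
  have d: "(g has_derivative frechet_derivative f (at x)) (at x)" if "x \<in> U" for x
    using has_derivative_transform_within_open[OF k_smooth_on_has_derivative[OF Suc.prems(2) that]
      \<open>open U\<close> that Suc.prems(1)] .
  have e: "frechet_derivative f (at x) = frechet_derivative g (at x)" if "x \<in> U" for x
    using frechet_derivative_at[OF d[OF that]] .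
  have "k_smooth_on n U (\<lambda>x. frechet_derivative g (at x) v)" for v
    by (rule Suc.IH[of "\<lambda>x. frechet_derivative f (at x) v"]) (use e Suc.prems(2) in auto)
  then show ?case using d unfolding k_smooth_on.simps differentiable_def by blast
qed

text \<open>The definition is tied to \<open>frechet_derivative\<close>; this rule admits any
  formula \<open>D\<close> for the derivative, so each closure property below reduces to a
  differentiation rule and an induction on n.\<close>

lemma k_smooth_on_SucI:
  assumes "open U" "\<And>x. x \<in> U \<Longrightarrow> (f has_derivative D x) (at x)"
    "\<And>v. k_smooth_on n U (\<lambda>x. D x v)"
  shows "k_smooth_on (Suc n) U f"
proof -
  have "k_smooth_on n U (\<lambda>x. frechet_derivative f (at x) v)" for v
    by (rule k_smooth_on_cong[OF assms(1) _ assms(3)[of v]]) (simp add: frechet_derivative_at[OF assms(2), symmetric])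
  then show ?thesis using assms(2) unfolding k_smooth_on.simps differentiable_def by blast
qed

lemma k_smooth_on_SucE:
  assumes "k_smooth_on (Suc n) U f"
  obtains D where "\<And>x. x \<in> U \<Longrightarrow> (f has_derivative D x) (at x)" "\<And>v. k_smooth_on n U (\<lambda>x. D x v)"
  using that[of "\<lambda>x. frechet_derivative f (at x)"] k_smooth_on_has_derivative[OF assms] assms by auto

lemma k_smooth_on_subset:
  assumes "k_smooth_on n U f" "V \<subseteq> U"
  shows "k_smooth_on n V f"
  using assms(1) by (induction n arbitrary: f) (use assms(2) continuous_on_subset in auto)

lemma k_smooth_on_imp_continuous:
  assumes "k_smooth_on n U f" shows "continuous_on U f"
proof (cases n)
  case 0
  then show ?thesis using assms by simp
next
  case (Suc m)
  then have "\<forall>x\<in>U. f differentiable (at x)" using assms by simp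
  then show ?thesis
    by (meson continuous_at_imp_continuous_on differentiable_imp_continuous_within)
qed

lemma k_smooth_on_SucD: "k_smooth_on (Suc n) U f \<Longrightarrow> k_smooth_on n U f"
proof (induction n arbitrary: f)
  case 0
  then show ?case using k_smooth_on_imp_continuous by (metis k_smooth_on.simps(1))
next
  case (Suc n)
  have "\<forall>x\<in>U. f differentiable (at x)" "\<And>v. k_smooth_on (Suc n) U (\<lambda>x. frechet_derivative f (at x) v)"
    using Suc.prems by auto
  with Suc.IH show ?case unfolding k_smooth_on.simps(2)[of n] by blast
qed

lemma k_smooth_on_local:
  assumes "\<And>x. x \<in> U \<Longrightarrow> \<exists>V. open V \<and> x \<in> V \<and> k_smooth_on n V f"
  shows "k_smooth_on n U f"
  using assms
proof (induction n arbitrary: f)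
  case 0
  have "isCont f x" if x: "x \<in> U" for x
  proof -
    obtain V where "open V" "x \<in> V" "continuous_on V f" using 0 x by auto
    then show ?thesis using continuous_on_eq_continuous_at by blast
  qed
  then show ?case by (simp add: continuous_at_imp_continuous_on)
next
  case (Suc n)
  have "\<forall>x\<in>U. f differentiable (at x)" using Suc.prems by fastforce
  moreover have "k_smooth_on n U (\<lambda>x. frechet_derivative f (at x) v)" for v
    by (rule Suc.IH) (use Suc.prems in fastforce)
  ultimately show ?case by simp
qed

named_theorems smooth_intros

lemma k_smooth_on_const [smooth_intros]: "k_smooth_on n U (\<lambda>x. c)"
  by (induction n arbitrary: c) (auto simp: frechet_derivative_const)

lemma k_smooth_on_bounded_linear_compose:
  assumes "open U" "bounded_linear L" "k_smooth_on n U f"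
  shows "k_smooth_on n U (\<lambda>x. L (f x))"
  using assms(3)
proof (induction n arbitrary: f)
  case 0
  then show ?case using assms(2) by (simp add: bounded_linear.continuous_on)
next
  case (Suc n)
  obtain D where D: "\<And>x. x \<in> U \<Longrightarrow> (f has_derivative D x) (at x)" "\<And>v. k_smooth_on n U (\<lambda>x. D x v)"
    using k_smooth_on_SucE[OF Suc.prems] by blast
  show ?case
    by (rule k_smooth_on_SucI[OF assms(1), of _ "\<lambda>x v. L (D x v)"])
      (rule bounded_linear.has_derivative[OF assms(2) D(1)], assumption, rule Suc.IH[OF D(2)])
qed

lemma k_smooth_on_ident [smooth_intros]: "k_smooth_on n U (\<lambda>x. x)"
  by (cases n) (auto simp: frechet_derivative_ident smooth_intros)

lemma k_smooth_on_bounded_linear: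
  assumes "open U" "bounded_linear L"
  shows "k_smooth_on n U L"
  using k_smooth_on_bounded_linear_compose[OF assms, of n "\<lambda>x. x"] k_smooth_on_ident by auto

lemma k_smooth_on_add [smooth_intros]:
  assumes "open U" "k_smooth_on n U f" "k_smooth_on n U g"
  shows "k_smooth_on n U (\<lambda>x. f x + g x)"
  using assms(2,3)
proof (induction n arbitrary: f g)
  case 0
  then show ?case by (auto intro: continuous_intros)
next
  case (Suc n)
  obtain D where D: "\<And>x. x \<in> U \<Longrightarrow> (f has_derivative D x) (at x)" "\<And>v. k_smooth_on n U (\<lambda>x. D x v)"
    using k_smooth_on_SucE[OF Suc.prems(1)] by blast
  obtain D' where D': "\<And>x. x \<in> U \<Longrightarrow> (g has_derivative D' x) (at x)" "\<And>v. k_smooth_on n U (\<lambda>x. D' x v)"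
    using k_smooth_on_SucE[OF Suc.prems(2)] by blast
  show ?case
    by (rule k_smooth_on_SucI[OF assms(1), of _ "\<lambda>x v. D x v + D' x v"])
      (rule has_derivative_add[OF D(1) D'(1)], assumption+, rule Suc.IH[OF D(2) D'(2)])
qed

text \<open>One product rule serves for scalar multiples, inner products, application and
  composition of bounded operators, and the algebra of bounded continuous functions.\<close>

lemma k_smooth_on_bilinear:
  assumes "open U" "bounded_bilinear B" "k_smooth_on n U f" "k_smooth_on n U g"
  shows "k_smooth_on n U (\<lambda>x. B (f x) (g x))"
  using assms(3,4)
proof (induction n arbitrary: f g)
  case 0
  then show ?case by (auto intro: bounded_bilinear.continuous_on[OF assms(2)])
next
  case (Suc n)
  obtain D where D: "\<And>x. x \<in> U \<Longrightarrow> (f has_derivative D x) (at x)" "\<And>v. k_smooth_on n U (\<lambda>x. D x v)"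
    using k_smooth_on_SucE[OF Suc.prems(1)] by blast
  obtain D' where D': "\<And>x. x \<in> U \<Longrightarrow> (g has_derivative D' x) (at x)" "\<And>v. k_smooth_on n U (\<lambda>x. D' x v)"
    using k_smooth_on_SucE[OF Suc.prems(2)] by blast
  show ?case
    by (rule k_smooth_on_SucI[OF assms(1), of _ "\<lambda>x v. B (f x) (D' x v) + B (D x v) (g x)"])
      (rule bounded_bilinear.FDERIV[OF assms(2) D(1) D'(1)], assumption+,
        rule k_smooth_on_add[OF assms(1) Suc.IH[OF k_smooth_on_SucD[OF Suc.prems(1)] D'(2)]
          Suc.IH[OF D(2) k_smooth_on_SucD[OF Suc.prems(2)]]])
qed

lemma k_smooth_on_sum [smooth_intros]:
  assumes "open U" "\<And>i. i \<in> I \<Longrightarrow> k_smooth_on n U (f i)"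
  shows "k_smooth_on n U (\<lambda>x. \<Sum>i\<in>I. f i x)"
  using assms(2)
  by (induction I rule: infinite_finite_induct) (auto intro!: k_smooth_on_const k_smooth_on_add assms(1))

lemma k_smooth_on_compose:
  fixes f :: "'b::euclidean_space \<Rightarrow> 'c::real_normed_vector" and g :: "'a::euclidean_space \<Rightarrow> 'b"
  assumes "open U" "open V" "g ` U \<subseteq> V" "k_smooth_on n U g" "k_smooth_on n V f"
  shows "k_smooth_on n U (\<lambda>x. f (g x))"
  using assms(4,5)
proof (induction n arbitrary: f)
  case 0
  then show ?case using continuous_on_compose2 assms(3) by auto
next
  case (Suc n)
  obtain D where D: "\<And>x. x \<in> V \<Longrightarrow> (f has_derivative D x) (at x)" "\<And>v. k_smooth_on n V (\<lambda>x. D x v)"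
    using k_smooth_on_SucE[OF Suc.prems(2)] by blast
  obtain D' where D': "\<And>x. x \<in> U \<Longrightarrow> (g has_derivative D' x) (at x)" "\<And>v. k_smooth_on n U (\<lambda>x. D' x v)"
    using k_smooth_on_SucE[OF Suc.prems(1)] by blast
  show ?case
  \<comment> \<open>Smoothness of \<open>D\<close> is known for fixed directions only, while the
    direction \<open>D' x v\<close> moves with x. Expanding it in \<open>Basis\<close> leaves fixed
    directions with smooth scalar coefficients.\<close>
  proof (rule k_smooth_on_SucI[OF assms(1), of _ "\<lambda>x v. \<Sum>i\<in>Basis. (D' x v \<bullet> i) *\<^sub>R D (g x) i"])
    fix x assume x: "x \<in> U"
    have gx: "g x \<in> V" using x assms(3) by auto
    have *: "((\<lambda>x. f (g x)) has_derivative (\<lambda>v. D (g x) (D' x v))) (at x)"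
      using has_derivative_compose[OF D'(1)[OF x] D(1)[OF gx]] .
    have **: "D (g x) w = (\<Sum>i\<in>Basis. (w \<bullet> i) *\<^sub>R D (g x) i)" for w
    proof -
      have lin: "linear (D (g x))" using has_derivative_linear[OF D(1)[OF gx]] .
      have "D (g x) w = D (g x) (\<Sum>i\<in>Basis. (w \<bullet> i) *\<^sub>R i)" by (simp add: euclidean_representation)
      also have "\<dots> = (\<Sum>i\<in>Basis. (w \<bullet> i) *\<^sub>R D (g x) i)"
        using lin by (simp add: linear_sum linear_scale)
      finally show ?thesis .
    qed
    show "((\<lambda>x. f (g x)) has_derivative (\<lambda>v. \<Sum>i\<in>Basis. (D' x v \<bullet> i) *\<^sub>R D (g x) i)) (at x)"
      by (rule has_derivative_eq_rhs[OF *]) (rule ext, rule **)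
  next
    fix v
    show "k_smooth_on n U (\<lambda>x. \<Sum>i\<in>Basis. (D' x v \<bullet> i) *\<^sub>R D (g x) i)"
      using k_smooth_on_bounded_linear_compose[OF assms(1) bounded_linear_inner_left D'(2)]
        Suc.IH[OF k_smooth_on_SucD[OF Suc.prems(1)] D(2)]
      by (intro k_smooth_on_sum assms(1) k_smooth_on_bilinear[OF assms(1) bounded_bilinear_scaleR])
  qed
qed

lemma k_smooth_on_real_SucI:
  fixes f :: "real \<Rightarrow> 'b::real_normed_vector"
  assumes "open U" "\<And>x. x \<in> U \<Longrightarrow> (f has_vector_derivative f' x) (at x)" "k_smooth_on n U f'"
  shows "k_smooth_on (Suc n) U f"
  by (rule k_smooth_on_SucI[OF assms(1), of _ "\<lambda>x v. v *\<^sub>R f' x"])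
    (use assms(2,3) in \<open>auto simp: has_vector_derivative_def
      intro!: k_smooth_on_bounded_linear_compose[OF assms(1) bounded_linear_scaleR_right]\<close>)

lemma Cinf_on_k: "Cinf_on U f \<Longrightarrow> k_smooth_on n U f"
  by (simp add: Cinf_on_def)

lemma Cinf_on_cong:
  "open U \<Longrightarrow> (\<And>x. x \<in> U \<Longrightarrow> f x = g x) \<Longrightarrow> Cinf_on U f \<Longrightarrow> Cinf_on U g"
  unfolding Cinf_on_def by (intro allI, rule k_smooth_on_cong[of U f g]) auto

lemma Cinf_on_subset: "Cinf_on U f \<Longrightarrow> V \<subseteq> U \<Longrightarrow> Cinf_on V f"
  unfolding Cinf_on_def by (intro allI, rule k_smooth_on_subset) auto

lemma Cinf_on_imp_continuous_on: "Cinf_on U f \<Longrightarrow> continuous_on U f"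
  unfolding Cinf_on_def by (metis k_smooth_on.simps(1))

lemma Cinf_on_has_derivative:
  "Cinf_on U f \<Longrightarrow> x \<in> U \<Longrightarrow> (f has_derivative frechet_derivative f (at x)) (at x)"
  unfolding Cinf_on_def by (rule k_smooth_on_has_derivative) auto

lemma Cinf_on_frechet_derivative: "Cinf_on U f \<Longrightarrow> Cinf_on U (\<lambda>x. frechet_derivative f (at x) v)"
  unfolding Cinf_on_def by (intro allI) (metis k_smooth_on.simps(2))

lemma Cinf_on_derivative:
  assumes "open U" "Cinf_on U f" "\<And>x. x \<in> U \<Longrightarrow> (f has_derivative D x) (at x)"
  shows "Cinf_on U (\<lambda>x. D x v)"
  by (rule Cinf_on_cong[OF assms(1) _ Cinf_on_frechet_derivative[OF assms(2), of v]])
    (simp add: frechet_derivative_at[OF assms(3), symmetric])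

lemma Cinf_on_local:
  "(\<And>x. x \<in> U \<Longrightarrow> \<exists>V. open V \<and> x \<in> V \<and> Cinf_on V f) \<Longrightarrow> Cinf_on U f"
  unfolding Cinf_on_def by (intro allI, rule k_smooth_on_local) fast

text \<open>Useful when the derivatives stay in a family with a parameter, such as integrals with
  weight \<open>\<tau> ^ k\<close>, so that only the family and not each derivative has to be
  described.\<close>

lemma Cinf_on_coinduct_real:
  fixes f :: "real \<Rightarrow> 'b::real_normed_vector"
  assumes "open U" "P f" "\<And>f. P f \<Longrightarrow> \<exists>f'. P f' \<and> (\<forall>x\<in>U. (f has_vector_derivative f' x) (at x))"
  shows "Cinf_on U f"
proof -
  have "k_smooth_on n U f" if "P f" for n f
    using that
  proof (induction n arbitrary: f)
    case 0
    then obtain f' where "\<forall>x\<in>U. (f has_vector_derivative f' x) (at x)" using assms(3) by blast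
    then have "continuous_on U f"
      by (metis continuous_at_imp_continuous_on has_vector_derivative_continuous)
    then show ?case by simp
  next
    case (Suc n)
    then obtain f' where f': "P f'" "\<forall>x\<in>U. (f has_vector_derivative f' x) (at x)"
      using assms(3)[OF Suc.prems] by blast
    show ?case by (rule k_smooth_on_real_SucI[OF assms(1) _ Suc.IH[OF f'(1)]]) (use f'(2) in simp)
  qed
  then show ?thesis using assms(2) by (simp add: Cinf_on_def)
qed

lemma Cinf_on_const [smooth_intros]: "Cinf_on U (\<lambda>x. c)"
  and Cinf_on_ident [smooth_intros]: "Cinf_on U (\<lambda>x. x)"
  by (simp_all add: Cinf_on_def k_smooth_on_const k_smooth_on_ident)

lemma Cinf_on_add [smooth_intros]:
  "open U \<Longrightarrow> Cinf_on U f \<Longrightarrow> Cinf_on U g \<Longrightarrow> Cinf_on U (\<lambda>x. f x + g x)"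
  by (simp add: Cinf_on_def k_smooth_on_add)

lemma Cinf_on_bilinear:
  "open U \<Longrightarrow> bounded_bilinear B \<Longrightarrow> Cinf_on U f \<Longrightarrow> Cinf_on U g \<Longrightarrow> Cinf_on U (\<lambda>x. B (f x) (g x))"
  by (simp add: Cinf_on_def k_smooth_on_bilinear)

lemma Cinf_on_bounded_linear_compose:
  "open U \<Longrightarrow> bounded_linear L \<Longrightarrow> Cinf_on U f \<Longrightarrow> Cinf_on U (\<lambda>x. L (f x))"
  by (simp add: Cinf_on_def k_smooth_on_bounded_linear_compose)

lemma Cinf_on_scaleR [smooth_intros]:
  "open U \<Longrightarrow> Cinf_on U f \<Longrightarrow> Cinf_on U g \<Longrightarrow> Cinf_on U (\<lambda>x. f x *\<^sub>R g x)"
  using Cinf_on_bilinear[OF _ bounded_bilinear_scaleR] .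

lemma Cinf_on_mult [smooth_intros]:
  fixes f :: "'a::euclidean_space \<Rightarrow> 'b::real_normed_algebra"
  shows "open U \<Longrightarrow> Cinf_on U f \<Longrightarrow> Cinf_on U g \<Longrightarrow> Cinf_on U (\<lambda>x. f x * g x)"
  using Cinf_on_bilinear[OF _ bounded_bilinear_mult] .

lemma Cinf_on_inner [smooth_intros]:
  "open U \<Longrightarrow> Cinf_on U f \<Longrightarrow> Cinf_on U g \<Longrightarrow> Cinf_on U (\<lambda>x. f x \<bullet> g x)"
  using Cinf_on_bilinear[OF _ bounded_bilinear_inner] .

lemma Cinf_on_minus [smooth_intros]: "open U \<Longrightarrow> Cinf_on U f \<Longrightarrow> Cinf_on U (\<lambda>x. - f x)"
  by (rule Cinf_on_bounded_linear_compose[OF _ bounded_linear_minus[OF bounded_linear_ident]])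

lemma Cinf_on_diff [smooth_intros]:
  "open U \<Longrightarrow> Cinf_on U f \<Longrightarrow> Cinf_on U g \<Longrightarrow> Cinf_on U (\<lambda>x. f x - g x)"
  using Cinf_on_add[of U f "\<lambda>x. - g x"] Cinf_on_minus by auto

lemma Cinf_on_power [smooth_intros]:
  fixes f :: "'a::euclidean_space \<Rightarrow> 'b::real_normed_algebra_1"
  shows "open U \<Longrightarrow> Cinf_on U f \<Longrightarrow> Cinf_on U (\<lambda>x. f x ^ k)"
  by (induction k) (auto intro: smooth_intros)

lemma Cinf_on_Pair [smooth_intros]:
  assumes "open U" "Cinf_on U f" "Cinf_on U g"
  shows "Cinf_on U (\<lambda>x. (f x, g x))"
proof -
  have L: "bounded_linear (\<lambda>x. (x, 0))" "bounded_linear (\<lambda>y. (0, y))"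
    by (auto intro: bounded_linear_Pair bounded_linear_ident bounded_linear_zero)
  have "Cinf_on U (\<lambda>x. (f x, 0) + (0, g x))"
    by (rule Cinf_on_add[OF assms(1) Cinf_on_bounded_linear_compose[OF assms(1) L(1) assms(2)]
          Cinf_on_bounded_linear_compose[OF assms(1) L(2) assms(3)]])
  then show ?thesis by simp
qed

lemma Cinf_on_fst [smooth_intros]: "open U \<Longrightarrow> Cinf_on U f \<Longrightarrow> Cinf_on U (\<lambda>x. fst (f x))"
  and Cinf_on_snd [smooth_intros]: "open U \<Longrightarrow> Cinf_on U f \<Longrightarrow> Cinf_on U (\<lambda>x. snd (f x))"
  by (rule Cinf_on_bounded_linear_compose[OF _ bounded_linear_fst], assumption+)
    (rule Cinf_on_bounded_linear_compose[OF _ bounded_linear_snd], assumption+)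

lemma Cinf_on_vec_nth [smooth_intros]:
  "open U \<Longrightarrow> Cinf_on U f \<Longrightarrow> Cinf_on U (\<lambda>x. f x $ i)"
  by (rule Cinf_on_bounded_linear_compose[OF _ bounded_linear_vec_nth])

lemma Cinf_on_compose:
  "open U \<Longrightarrow> open V \<Longrightarrow> g ` U \<subseteq> V \<Longrightarrow> Cinf_on U g \<Longrightarrow> Cinf_on V f \<Longrightarrow> Cinf_on U (\<lambda>x. f (g x))"
  by (simp add: Cinf_on_def k_smooth_on_compose)

lemma Cinf_on_real_inverse: "Cinf_on (- {0}) (inverse :: real \<Rightarrow> real)"
proof -
  have "k_smooth_on n (- {0}) (inverse :: real \<Rightarrow> real)" for n
  proof (induction n)
    case (Suc n)
    have "(inverse has_vector_derivative - (inverse x * inverse x)) (at x)" if "x \<noteq> 0" for x :: real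
      using DERIV_inverse[OF that] by (simp add: has_real_derivative_iff_has_vector_derivative power2_eq_square)
    moreover have "k_smooth_on n (- {0}) (\<lambda>x. - (inverse x * inverse x :: real))"
      by (rule k_smooth_on_bounded_linear_compose[OF _ bounded_linear_minus[OF bounded_linear_ident]
            k_smooth_on_bilinear[OF _ bounded_bilinear_mult Suc Suc]]) auto
    ultimately show ?case
      using k_smooth_on_real_SucI[of "- {0}" "inverse :: real \<Rightarrow> real" "\<lambda>x. - (inverse x * inverse x)"] by auto
  qed (auto intro!: continuous_intros)
  then show ?thesis by (simp add: Cinf_on_def)
qed

lemma Cinf_on_inverse [smooth_intros]:
  fixes f :: "'a::euclidean_space \<Rightarrow> real"
  shows "open U \<Longrightarrow> Cinf_on U f \<Longrightarrow> (\<And>x. x \<in> U \<Longrightarrow> f x \<noteq> 0) \<Longrightarrow> Cinf_on U (\<lambda>x. inverse (f x))"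
  by (rule Cinf_on_compose[OF _ _ _ _ Cinf_on_real_inverse]) auto

lemma Cinf_on_divide [smooth_intros]:
  fixes f :: "'a::euclidean_space \<Rightarrow> real"
  shows "open U \<Longrightarrow> Cinf_on U f \<Longrightarrow> Cinf_on U g \<Longrightarrow> (\<And>x. x \<in> U \<Longrightarrow> g x \<noteq> 0) \<Longrightarrow> Cinf_on U (\<lambda>x. f x / g x)"
  unfolding divide_inverse by (intro smooth_intros) auto

lemma Cinf_on_real_sqrt: "Cinf_on {0<..} sqrt"
proof -
  have "k_smooth_on n {0<..} sqrt" for n
  proof (induction n)
    case (Suc n)
    have "k_smooth_on n {0<..} (\<lambda>x. inverse (sqrt x))"
      by (rule k_smooth_on_compose[of _ "- {0}" sqrt, OF _ _ _ Suc Cinf_on_k[OF Cinf_on_real_inverse]]) auto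
    then have k: "k_smooth_on n {0<..} (\<lambda>x. inverse (sqrt x) / 2)"
      by (rule k_smooth_on_bounded_linear_compose[OF _ bounded_linear_divide, rotated]) simp
    have "(sqrt has_vector_derivative inverse (sqrt x) / 2) (at x)" if "x > 0" for x
      using DERIV_real_sqrt[OF that] by (simp add: has_real_derivative_iff_has_vector_derivative)
    then show ?case
      by (intro k_smooth_on_real_SucI[OF _ _ k]) simp_all
  qed (auto intro!: continuous_intros)
  then show ?thesis by (simp add: Cinf_on_def)
qed

lemma Cinf_on_sqrt [smooth_intros]:
  fixes f :: "'a::euclidean_space \<Rightarrow> real"
  shows "open U \<Longrightarrow> Cinf_on U f \<Longrightarrow> (\<And>x. x \<in> U \<Longrightarrow> f x > 0) \<Longrightarrow> Cinf_on U (\<lambda>x. sqrt (f x))"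
  by (rule Cinf_on_compose[OF _ _ _ _ Cinf_on_real_sqrt]) auto

lemma smooth_on_open_iff:
  assumes "open U" shows "smooth_on U f \<longleftrightarrow> Cinf_on U f"
proof
  assume s: "smooth_on U f"
  show "Cinf_on U f"
  proof (rule Cinf_on_local)
    fix x assume "x \<in> U"
    with s have "\<exists>W F. open W \<and> x \<in> W \<and> Cinf_on W F \<and> (\<forall>y\<in>U \<inter> W. F y = f y)"
      unfolding smooth_on_def Cinf_on_def[symmetric] by (rule bspec)
    then obtain W where "\<exists>F. open W \<and> x \<in> W \<and> Cinf_on W F \<and> (\<forall>y\<in>U \<inter> W. F y = f y)" ..
    then obtain F where W: "open W" "x \<in> W" "Cinf_on W F" "\<forall>y\<in>U \<inter> W. F y = f y"
      by (elim exE conjE) (rule that)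
    have o: "open (U \<inter> W)" using assms W(1) by (rule open_Int)
    have "Cinf_on (U \<inter> W) f"
      by (rule Cinf_on_cong[OF o bspec[OF W(4)] Cinf_on_subset[OF W(3) Int_lower2]])
    with o \<open>x \<in> U\<close> W(2) show "\<exists>V. open V \<and> x \<in> V \<and> Cinf_on V f"
      by (intro exI[of _ "U \<inter> W"] conjI IntI)
  qed
next
  assume "Cinf_on U f"
  then show "smooth_on U f" unfolding smooth_on_def Cinf_on_def[symmetric]
    using assms by (intro ballI exI[of _ U] exI[of _ f]) auto
qed

lemma Cinf_on_imp_smooth_on:
  "Cinf_on U f \<Longrightarrow> open U \<Longrightarrow> S \<subseteq> U \<Longrightarrow> smooth_on S f"
  unfolding smooth_on_def Cinf_on_def[symmetric]
  by (intro ballI exI[of _ U] exI[of _ f]) auto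

section \<open>Smooth dependence of fixed points in Banach spaces\<close>

text \<open>Only continuity of \<open>X\<close> is assumed. With E = (X m - X l) - R (m - l),
  linearization makes E - A E small against |m - l| + |X m - X l|. As A halves norms this bounds E,
  and X m - X l is in turn bounded by E and R (m - l), so it can be absorbed.\<close>

lemma implicit_has_derivative:
  fixes N :: "'a::real_normed_vector \<times> 'e::real_normed_vector \<Rightarrow> 'e"
  assumes N: "(N has_derivative (\<lambda>(h, k). B h + A k)) (at (l, X l))"
    and fixed: "\<forall>\<^sub>F m in nhds l. X m = N (m, X m)"
    and cont: "isCont X l"
    and A: "linear A" "\<And>k. norm (A k) \<le> norm k / 2"
    and R: "bounded_linear R" "\<And>h. R h = B h + A (R h)"
  shows "(X has_derivative R) (at l)"
  unfolding has_derivative_at_alt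
proof (intro conjI R allI impI)
  fix e :: real assume e: "0 < e"
  obtain C where C: "C > 0" "\<And>h. norm (R h) \<le> norm h * C"
    using bounded_linear.pos_bounded[OF R(1)] by auto
  \<comment> \<open>Inverting 1 - A costs a factor 2; the bound \<open>1/4\<close> then lets half of
    |E| be absorbed, and what remains is 4 e1 (1 + C) |h|, which explains the second entry.\<close>
  define e1 where "e1 = min (1/4) (e / (4 * (1 + C)))"
  have e1': "e1 \<le> e / (4 * (1 + C))" and "e1 \<le> 1/4"
    unfolding e1_def by (rule min.cobounded2, rule min.cobounded1)
  have e1_pos: "e1 > 0" using e C by (simp add: e1_def)
  have e1: "e1 > 0" "e1 \<le> 1/4" "e1 * (4 * (1 + C)) \<le> e"
    using e C \<open>e1 \<le> 1/4\<close> e1' by (auto simp: pos_le_divide_eq e1_pos)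
  obtain d1 where d1: "d1 > 0" "\<And>y. norm (y - (l, X l)) < d1 \<Longrightarrow>
      norm (N y - N (l, X l) - (\<lambda>(h, k). B h + A k) (y - (l, X l))) \<le> e1 * norm (y - (l, X l))"
    using N e1(1) unfolding has_derivative_at_alt by blast
  obtain d2 where d2: "d2 > 0" "\<And>m. dist m l < d2 \<Longrightarrow> X m = N (m, X m)"
    using fixed unfolding eventually_nhds_metric by blast
  obtain d3 where d3: "d3 > 0" "\<And>m. dist m l < d3 \<Longrightarrow> dist (X m) (X l) < d1 / 2"
    using cont d1(1) unfolding continuous_at_eps_delta by (meson half_gt_zero)
  show "\<exists>d>0. \<forall>y. norm (y - l) < d \<longrightarrow> norm (X y - X l - R (y - l)) \<le> e * norm (y - l)"
  proof (intro exI[of _ "min (d1 / 2) (min d2 d3)"] conjI allI impI)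
    show "0 < min (d1 / 2) (min d2 d3)" using d1 d2 d3 by simp
    fix m assume m: "norm (m - l) < min (d1 / 2) (min d2 d3)"
    define h k where "h = m - l" and "k = X m - X l"
    define E where "E = k - R h"
    have nle: "norm (h, k) \<le> norm h + norm k" by (rule norm_Pair_le)
    have small: "norm h < d1 / 2" "norm k < d1 / 2"
      using m d3(2)[of m] by (auto simp: h_def k_def dist_norm)
    have Xm: "X m = N (m, X m)" "X l = N (l, X l)"
      using d2 m by (auto simp: dist_norm)
    have "norm ((m, X m) - (l, X l)) < d1"
      using nle small by (simp add: h_def k_def)
    from d1(2)[OF this] have "norm (k - (B h + A k)) \<le> e1 * norm (h, k)"
      using Xm by (simp add: h_def k_def)
    also have "\<dots> \<le> e1 * (norm h + norm k)"
      using nle e1 by (intro mult_left_mono) auto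
    finally have 1: "norm (k - (B h + A k)) \<le> e1 * (norm h + norm k)" .
    have "A k = A E + A (R h)" using linear_add[OF A(1), of E "R h"] by (simp add: E_def)
    then have eq: "E - A E = k - (B h + A k)"
      using R(2)[of h] by (simp add: E_def algebra_simps)
    have "norm (E - A E) \<le> e1 * (norm h + norm k)" using 1 by (simp only: eq)
    then have "norm E \<le> norm (A E) + e1 * (norm h + norm k)"
      using norm_triangle_sub[of E "A E"] by linarith
    with A(2)[of E] have 2: "norm E \<le> 2 * (e1 * (norm h + norm k))" by simp
    have "norm k \<le> norm E + norm h * C"
      using norm_triangle_ineq[of E "R h"] C(2)[of h] by (simp add: E_def)
    then have "e1 * (norm h + norm k) \<le> e1 * (norm h + (norm E + norm h * C))"
      using e1 by (intro mult_left_mono) auto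
    also have "\<dots> = e1 * (1 + C) * norm h + e1 * norm E" by (simp add: algebra_simps)
    also have "e1 * norm E \<le> 1/4 * norm E" using e1 by (intro mult_right_mono) auto
    finally have "norm E \<le> e1 * (4 * (1 + C)) * norm h" using 2 by (simp add: algebra_simps)
    also have "\<dots> \<le> e * norm h" using e1 by (intro mult_right_mono) auto
    finally show "norm (X m - X l - R (m - l)) \<le> e * norm (m - l)"
      by (simp add: E_def h_def k_def)
  qed
qed

text \<open>This is (1 - A)^(-1) b. For |A| at most 1/2 the equation is a contraction and has
  exactly one solution, so neither a series nor an inverse operator has to be handled.\<close>

definition neumann_solve :: "('e::banach \<Rightarrow>\<^sub>L 'e) \<Rightarrow> 'e \<Rightarrow> 'e" where
  "neumann_solve A b = (THE z. z = b + A z)"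

context
  fixes A :: "'e::banach \<Rightarrow>\<^sub>L 'e"
  assumes A: "norm A \<le> 1/2"
begin

lemma half_contraction: "norm (blinfun_apply A k) \<le> norm k / 2"
  using norm_blinfun[of A k] mult_right_mono[OF A, of "norm k"] by simp

lemma neumann_solve_bound:
  assumes "z = b + A z" shows "norm z \<le> 2 * norm b"
  using norm_triangle_ineq[of b "A z"] half_contraction[of z] assms by simp

lemma neumann_solve_unique:
  assumes "z = b + A z" "z' = b + A z'" shows "z = z'"
proof -
  have "z - z' = 0 + A (z - z')"
    using assms by (metis add_diff_cancel_left add_0 blinfun.diff_right)
  from neumann_solve_bound[OF this] show ?thesis by simp
qed

lemma neumann_solve: "neumann_solve A b = b + A (neumann_solve A b)"
proof -
  have "dist (b + A x) (b + A y) \<le> 1/2 * dist x y" for x y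
    using half_contraction[of "x - y"] by (simp add: dist_norm blinfun.diff_right)
  then have "\<exists>!z. z \<in> UNIV \<and> b + A z = z"
    by (intro Banach_fix[of _ "1/2"]) (auto simp: complete_UNIV)
  then obtain z where "b + A z = z" by blast
  then have z: "z = b + A z" by (rule sym)
  show ?thesis unfolding neumann_solve_def
    by (rule theI[of "\<lambda>z. z = b + A z", OF z]) (rule neumann_solve_unique[OF _ z])
qed

lemma neumann_solve_eqI: "z = b + A z \<Longrightarrow> neumann_solve A b = z"
  by (rule neumann_solve_unique[OF neumann_solve])

lemma bounded_linear_neumann_solve: "bounded_linear (neumann_solve A)"
proof
  show "neumann_solve A (x + y) = neumann_solve A x + neumann_solve A y" for x y
  proof (rule neumann_solve_eqI)
    have "neumann_solve A x + neumann_solve A y = (x + A (neumann_solve A x)) + (y + A (neumann_solve A y))"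
      by (rule arg_cong2[of _ _ _ _ "(+)", OF neumann_solve neumann_solve])
    also have "\<dots> = x + y + A (neumann_solve A x + neumann_solve A y)"
      by (simp add: blinfun.add_right)
    finally show "neumann_solve A x + neumann_solve A y = x + y + A (neumann_solve A x + neumann_solve A y)" .
  qed
  show "neumann_solve A (r *\<^sub>R x) = r *\<^sub>R neumann_solve A x" for r x
    by (rule neumann_solve_eqI)
      (use neumann_solve[of x] in \<open>metis blinfun.scaleR_right scaleR_add_right\<close>)
  show "\<exists>K. \<forall>x. norm (neumann_solve A x) \<le> norm x * K"
    using neumann_solve_bound[OF neumann_solve] by (intro exI[of _ 2]) (simp add: mult.commute)
qed

end

text \<open>Differentiating z = b + A z shows that the derivative of z solves the same equation with
  right-hand side Db + DA z. The operator is unchanged, so induction on n with \<open>b\<close>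
  arbitrary closes.\<close>

lemma k_smooth_on_neumann_solve:
  fixes A :: "'a::euclidean_space \<Rightarrow> ('e::banach \<Rightarrow>\<^sub>L 'e)"
  assumes U: "open U" and A: "\<And>l. l \<in> U \<Longrightarrow> norm (A l) \<le> 1/2"
    and "k_smooth_on n U A" "k_smooth_on n U b"
  shows "k_smooth_on n U (\<lambda>l. neumann_solve (A l) (b l))"
  using assms(3,4)
proof (induction n arbitrary: b)
  case 0
  let ?z = "\<lambda>l. neumann_solve (A l) (b l)"
  have "isCont ?z l" if l: "l \<in> U" for l
  proof -
    have Ab: "isCont A l" "isCont b l"
      using 0 U l by (auto simp: continuous_on_eq_continuous_at)
    have "((\<lambda>m. 2 * (norm (b m - b l) + norm (A m - A l) * norm (?z l))) \<longlongrightarrow>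
        2 * (norm (b l - b l) + norm (A l - A l) * norm (?z l))) (at l)"
      using Ab unfolding isCont_def by (intro tendsto_intros)
    then have lim: "((\<lambda>m. 2 * (norm (b m - b l) + norm (A m - A l) * norm (?z l))) \<longlongrightarrow> 0) (at l)"
      by simp
    have "\<forall>\<^sub>F m in at l. norm (?z m - ?z l) \<le> 2 * (norm (b m - b l) + norm (A m - A l) * norm (?z l))"
      using eventually_at_in_open'[OF U l]
    proof eventually_elim
      case (elim m)
      \<comment> \<open>The difference solves the equation for \<open>A m\<close> with a right-hand
        side that tends to 0; the a priori bound then gives continuity.\<close>
      have "?z m - ?z l = (b m - b l + (A m - A l) (?z l)) + A m (?z m - ?z l)"
      proof -
        have "?z m - ?z l = (b m + A m (?z m)) - (b l + A l (?z l))"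
          by (rule arg_cong2[of _ _ _ _ "(-)", OF neumann_solve[OF A[OF elim]] neumann_solve[OF A[OF l]]])
        also have "\<dots> = (b m - b l + (A m - A l) (?z l)) + A m (?z m - ?z l)"
          by (simp add: blinfun.diff_left blinfun.diff_right)
        finally show ?thesis .
      qed
      from neumann_solve_bound[OF A[OF elim] this]
      have "norm (?z m - ?z l) \<le> 2 * norm (b m - b l + (A m - A l) (?z l))" .
      also have "\<dots> \<le> 2 * (norm (b m - b l) + norm (A m - A l) * norm (?z l))"
        by (intro mult_left_mono order_trans[OF norm_triangle_ineq add_left_mono[OF norm_blinfun]]) simp
      finally show ?case .
    qed
    then have "((\<lambda>m. ?z m - ?z l) \<longlongrightarrow> 0) (at l)"
      by (rule Lim_null_comparison[OF _ lim])
    then show ?thesis unfolding isCont_def by (rule LIM_zero_cancel)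
  qed
  then show ?case by (simp add: continuous_at_imp_continuous_on)
next
  case (Suc n)
  let ?z = "\<lambda>l. neumann_solve (A l) (b l)"
  obtain DA where DA: "\<And>x. x \<in> U \<Longrightarrow> (A has_derivative DA x) (at x)" "\<And>v. k_smooth_on n U (\<lambda>x. DA x v)"
    using k_smooth_on_SucE[OF Suc.prems(1)] by blast
  obtain Db where Db: "\<And>x. x \<in> U \<Longrightarrow> (b has_derivative Db x) (at x)" "\<And>v. k_smooth_on n U (\<lambda>x. Db x v)"
    using k_smooth_on_SucE[OF Suc.prems(2)] by blast
  have z: "k_smooth_on n U ?z"
    by (rule Suc.IH) (use Suc.prems k_smooth_on_SucD in auto)
  show ?case
  proof (rule k_smooth_on_SucI[OF U])
    fix l assume l: "l \<in> U"
    have bl: "bounded_linear (\<lambda>h. Db l h + DA l h (?z l))"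
      using has_derivative_bounded_linear[OF DA(1)[OF l]] has_derivative_bounded_linear[OF Db(1)[OF l]]
      by (intro bounded_linear_add bounded_linear_compose[OF blinfun.bounded_linear_left])
    show "(?z has_derivative (\<lambda>h. neumann_solve (A l) (Db l h + DA l h (?z l)))) (at l)"
    proof (rule implicit_has_derivative[where N = "\<lambda>(m, x). b m + A m x" and A = "blinfun_apply (A l)"])
      have 1: "((\<lambda>p. b (fst p)) has_derivative (\<lambda>h. Db l (fst h))) (at (l, ?z l))"
        by (rule has_derivative_compose[of fst fst _ _ b "Db l"])
          (use Db(1)[OF l] has_derivative_fst[OF has_derivative_ident] in auto)
      have 2: "((\<lambda>p. A (fst p)) has_derivative (\<lambda>h. DA l (fst h))) (at (l, ?z l))"
        by (rule has_derivative_compose[of fst fst _ _ A "DA l"])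
          (use DA(1)[OF l] has_derivative_fst[OF has_derivative_ident] in auto)
      have 3: "((\<lambda>p. blinfun_apply (A (fst p)) (snd p)) has_derivative
          (\<lambda>h. A l (snd h) + DA l (fst h) (?z l))) (at (l, ?z l))"
        using blinfun.FDERIV[OF 2 has_derivative_snd[OF has_derivative_ident]] by simp
      show "((\<lambda>(m, x). b m + A m x) has_derivative
          (\<lambda>(h, k). (Db l h + DA l h (?z l)) + A l k)) (at (l, ?z l))"
        using has_derivative_add[OF 1 3] by (simp add: split_beta' algebra_simps)
      show "\<forall>\<^sub>F m in nhds l. ?z m = (\<lambda>(m, x). b m + A m x) (m, ?z m)"
        using eventually_nhds_in_open[OF U l] by eventually_elim (simp add: neumann_solve[OF A, symmetric])
      show "isCont ?z l"
        using k_smooth_on_imp_continuous[OF z] U l by (simp add: continuous_on_eq_continuous_at)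
      show "linear (blinfun_apply (A l))"
        by (rule bounded_linear.linear[OF blinfun.bounded_linear_right])
      show "norm (A l k) \<le> norm k / 2" for k by (rule half_contraction[OF A[OF l]])
      show "bounded_linear (\<lambda>h. neumann_solve (A l) (Db l h + DA l h (?z l)))"
        by (rule bounded_linear_compose[OF bounded_linear_neumann_solve[OF A[OF l]] bl])
      show "neumann_solve (A l) (Db l h + DA l h (?z l)) = (Db l h + DA l h (?z l)) +
          A l (neumann_solve (A l) (Db l h + DA l h (?z l)))" for h
        by (rule neumann_solve[OF A[OF l]])
    qed
  next
    fix v
    have "k_smooth_on n U (\<lambda>l. Db l v + DA l v (?z l))"
      by (intro k_smooth_on_add[OF U Db(2)] k_smooth_on_bilinear[OF U bounded_bilinear_blinfun_apply DA(2) z])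
    then show "k_smooth_on n U (\<lambda>l. neumann_solve (A l) (Db l v + DA l v (?z l)))"
      by (rule Suc.IH[OF k_smooth_on_SucD[OF Suc.prems(1)]])
  qed
qed

text \<open>Bootstrapping: the derivative of X is (1 - A)^(-1) B with coefficients evaluated along
  X, hence as smooth as X itself. This is why the last two hypotheses may presuppose smoothness of X
  of the same order.\<close>

theorem fixed_point_smooth:
  fixes X :: "'a::euclidean_space \<Rightarrow> 'e::banach" and A :: "'a \<Rightarrow> ('e \<Rightarrow>\<^sub>L 'e)"
  assumes U: "open U" and fixed: "\<And>l. l \<in> U \<Longrightarrow> X l = N (l, X l)"
    and cont: "continuous_on U X"
    and N: "\<And>l. l \<in> U \<Longrightarrow> (N has_derivative (\<lambda>(h, k). B l h + A l k)) (at (l, X l))"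
    and A: "\<And>l. l \<in> U \<Longrightarrow> norm (A l) \<le> 1/2"
    and kA: "\<And>n. k_smooth_on n U X \<Longrightarrow> k_smooth_on n U A"
    and kB: "\<And>n v. k_smooth_on n U X \<Longrightarrow> k_smooth_on n U (\<lambda>l. B l v)"
  shows "Cinf_on U X"
proof -
  have D: "(X has_derivative (\<lambda>h. neumann_solve (A l) (B l h))) (at l)" if l: "l \<in> U" for l
  proof (rule implicit_has_derivative[where N = N and B = "B l" and A = "blinfun_apply (A l)"])
    show "(N has_derivative (\<lambda>(h, k). B l h + A l k)) (at (l, X l))" by (rule N[OF l])
    have "bounded_linear (\<lambda>h. (\<lambda>(h, k). B l h + A l k) (h, 0))"
      by (rule bounded_linear_compose[OF has_derivative_bounded_linear[OF N[OF l]]])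
        (intro bounded_linear_Pair bounded_linear_ident bounded_linear_zero)
    then have "bounded_linear (B l)" by (simp add: blinfun.zero_right)
    then show "bounded_linear (\<lambda>h. neumann_solve (A l) (B l h))"
      by (rule bounded_linear_compose[OF bounded_linear_neumann_solve[OF A[OF l]]])
    show "\<forall>\<^sub>F m in nhds l. X m = N (m, X m)"
      using eventually_nhds_in_open[OF U l] by eventually_elim (rule fixed)
    show "isCont X l" using cont U l by (simp add: continuous_on_eq_continuous_at)
    show "linear (blinfun_apply (A l))"
      by (rule bounded_linear.linear[OF blinfun.bounded_linear_right])
    show "norm (A l k) \<le> norm k / 2" for k by (rule half_contraction[OF A[OF l]])
    show "neumann_solve (A l) (B l h) = B l h + A l (neumann_solve (A l) (B l h))" for h
      by (rule neumann_solve[OF A[OF l]])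
  qed
  have "k_smooth_on n U X" for n
  proof (induction n)
    case (Suc n)
    show ?case
      by (rule k_smooth_on_SucI[OF U D], assumption)
        (rule k_smooth_on_neumann_solve[OF U A kA[OF Suc] kB[OF Suc]])
  qed (simp add: cont)
  then show ?thesis by (simp add: Cinf_on_def)
qed

section \<open>Bounded continuous functions as a Banach algebra\<close>

lemma bcontfun_mult:
  fixes f g :: "'a::topological_space \<Rightarrow>\<^sub>C 'b::real_normed_algebra"
  shows "(\<lambda>x. f x * g x) \<in> bcontfun"
proof (rule bcontfun_normI)
  show "continuous_on UNIV (\<lambda>x. f x * g x)" by (intro continuous_intros) simp_all
  show "norm (f x * g x) \<le> norm f * norm g" for x
    by (rule order_trans[OF norm_mult_ineq]) (intro mult_mono norm_bounded norm_ge_zero)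
qed

text \<open>The algebra structure makes the integral operator below a polynomial in the unknown, the
  coefficients, two averages and one reciprocal, so bilinearity handles everything but the
  reciprocal.\<close>

instantiation bcontfun :: (topological_space, real_normed_algebra_1) real_normed_algebra_1
begin

definition one_bcontfun :: "'a \<Rightarrow>\<^sub>C 'b" where "one_bcontfun = const_bcontfun 1"

definition times_bcontfun :: "'a \<Rightarrow>\<^sub>C 'b \<Rightarrow> 'a \<Rightarrow>\<^sub>C 'b \<Rightarrow> 'a \<Rightarrow>\<^sub>C 'b" where
  "times_bcontfun f g = Bcontfun (\<lambda>x. f x * g x)"

lemma apply_bcontfun_times [simp]: "apply_bcontfun (f * g) x = f x * g x"
  by (simp add: times_bcontfun_def Bcontfun_inverse bcontfun_mult)

lemma apply_bcontfun_one [simp]: "apply_bcontfun 1 x = 1"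
  by (simp add: one_bcontfun_def)

instance
proof
  fix f g h :: "'a \<Rightarrow>\<^sub>C 'b" and r :: real
  show "f * g * h = f * (g * h)" "(f + g) * h = f * h + g * h" "f * (g + h) = f * g + f * h"
    "r *\<^sub>R f * g = r *\<^sub>R (f * g)" "f * r *\<^sub>R g = r *\<^sub>R (f * g)" "1 * f = f" "f * 1 = f"
    by (auto intro!: bcontfun_eqI simp: algebra_simps)
  show "norm (f * g) \<le> norm f * norm g"
    by (rule norm_bound, simp, rule order_trans[OF norm_mult_ineq])
      (intro mult_mono norm_bounded norm_ge_zero)
  have "apply_bcontfun (0 :: 'a \<Rightarrow>\<^sub>C 'b) undefined \<noteq> apply_bcontfun 1 undefined" by simp
  then show "0 \<noteq> (1 :: 'a \<Rightarrow>\<^sub>C 'b)" by metis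
  have "norm (1 :: 'a \<Rightarrow>\<^sub>C 'b) \<le> 1" by (rule norm_bound) simp
  moreover have "1 \<le> norm (1 :: 'a \<Rightarrow>\<^sub>C 'b)"
    using norm_bounded[of "1 :: 'a \<Rightarrow>\<^sub>C 'b" undefined] by simp
  ultimately show "norm (1 :: 'a \<Rightarrow>\<^sub>C 'b) = 1" by simp
qed

end

lemma apply_bcontfun_power [simp]:
  fixes f :: "'a::topological_space \<Rightarrow>\<^sub>C 'b::real_normed_algebra_1"
  shows "apply_bcontfun (f ^ n) x = f x ^ n"
  by (induction n) auto

instance bcontfun :: (topological_space, real_normed_field) comm_ring_1
  by standard (auto intro!: bcontfun_eqI simp: algebra_simps)

lemma bounded_linear_apply_bcontfun:
  "bounded_linear (\<lambda>f :: 'a::topological_space \<Rightarrow>\<^sub>C 'b::real_normed_vector. f x)"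
  by (rule bounded_linear_intro[of _ 1]) (auto simp: norm_bounded)

subsection \<open>Superposition operators\<close>

text \<open>\<open>Bcontfun\<close> is meaningful for bounded continuous functions only; the results
  below therefore ask that the range of x lie in a compact subset of the domain of F.\<close>

definition superpose :: "(real \<Rightarrow> real) \<Rightarrow> ('a::topological_space \<Rightarrow>\<^sub>C real) \<Rightarrow> 'a \<Rightarrow>\<^sub>C real" where
  "superpose F x = Bcontfun (\<lambda>t. F (x t))"

lemma apply_superpose:
  fixes x :: "'a::topological_space \<Rightarrow>\<^sub>C real"
  assumes "continuous_on K F" "compact K" "range x \<subseteq> K"
  shows "apply_bcontfun (superpose F x) t = F (x t)"
proof -
  have "(\<lambda>t. F (x t)) \<in> bcontfun"
    unfolding bcontfun_def
  proof (intro CollectI conjI)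
    show "continuous_on UNIV (\<lambda>t. F (x t))"
      by (rule continuous_on_compose2[OF assms(1)]) (use assms(3) in auto)
    show "bounded (range (\<lambda>t. F (x t)))"
      by (rule bounded_subset[OF compact_imp_bounded[OF compact_continuous_image[OF assms(1,2)]]])
        (use assms(3) in auto)
  qed
  then show ?thesis by (simp add: superpose_def Bcontfun_inverse)
qed

text \<open>The remainder at t is controlled by the oscillation of F' between x t and y t. The
  closed r-neighbourhood \<open>K'\<close> of K is compact and still inside U, so F' is uniformly
  continuous on it and the estimate is uniform in t.\<close>

lemma superpose_has_derivative:
  fixes x :: "'a::topological_space \<Rightarrow>\<^sub>C real"
  assumes U: "open U" and F: "\<And>u. u \<in> U \<Longrightarrow> (F has_real_derivative F' u) (at u)"
    and F': "continuous_on U F'" and K: "compact K" "K \<subseteq> U" "range x \<subseteq> K"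
  shows "(superpose F has_derivative (\<lambda>h. superpose F' x * h)) (at x)"
  unfolding has_derivative_at_alt
proof (intro conjI allI impI)
  show "bounded_linear (\<lambda>h. superpose F' x * h)" by (rule bounded_linear_mult_right)
  fix e :: real assume e: "e > 0"
  obtain r where r: "r > 0" "(\<Union>k\<in>K. cball k r) \<subseteq> U"
    using compact_subset_open_imp_cball_epsilon_subset[OF K(1) U K(2)] by auto
  define K' where "K' = {k + b | k b. k \<in> K \<and> b \<in> cball 0 r}"
  have K': "compact K'" unfolding K'_def by (rule compact_sums[OF K(1) compact_cball])
  have K'U: "K' \<subseteq> U"
  proof
    fix u assume "u \<in> K'"
    then obtain k b where "u = k + b" "k \<in> K" "b \<in> cball 0 r" by (auto simp: K'_def)
    then have "u \<in> cball k r" by (simp add: dist_norm)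
    with \<open>k \<in> K\<close> have "u \<in> (\<Union>k\<in>K. cball k r)" by blast
    with r(2) show "u \<in> U" by blast
  qed
  have KK': "K \<subseteq> K'" unfolding K'_def
  proof
    fix k assume "k \<in> K"
    then show "k \<in> {k + b | k b. k \<in> K \<and> b \<in> cball 0 r}"
      using r(1) by (intro CollectI exI[of _ k] exI[of _ 0]) auto
  qed
  have cF: "continuous_on U F" by (intro continuous_at_imp_continuous_on ballI DERIV_isCont[OF F])
  have "uniformly_continuous_on K' F'"
    by (rule compact_uniformly_continuous[OF continuous_on_subset[OF F' K'U] K'])
  then obtain d where d: "d > 0" "\<And>u u'. u \<in> K' \<Longrightarrow> u' \<in> K' \<Longrightarrow> dist u' u < d \<Longrightarrow> dist (F' u') (F' u) < e"
    unfolding uniformly_continuous_on_def using e by meson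
  show "\<exists>d>0. \<forall>y. norm (y - x) < d \<longrightarrow>
      norm (superpose F y - superpose F x - superpose F' x * (y - x)) \<le> e * norm (y - x)"
  proof (intro exI[of _ "min r d"] conjI allI impI)
    show "min r d > 0" using r d by simp
    fix y :: "'a \<Rightarrow>\<^sub>C real" assume y: "norm (y - x) < min r d"
    have near: "\<bar>y t - x t\<bar> \<le> norm (y - x)" for t
      using norm_bounded[of "y - x" t] by simp
    have ball: "u \<in> K'" if "u \<in> cball (x t) (norm (y - x))" for u t
    proof -
      have "u = x t + (u - x t)" "x t \<in> K" "u - x t \<in> cball 0 r"
        using that y K(3) by (auto simp: dist_norm norm_minus_commute)
      then show ?thesis unfolding K'_def by blast
    qed
    have ry: "range y \<subseteq> K'"
    proof
      fix v assume "v \<in> range y"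
      then obtain t where "v = y t" by blast
      then show "v \<in> K'" using ball[of v t] near[of t] by (simp add: dist_real_def abs_minus_commute)
    qed
    have rx: "range x \<subseteq> K'" using K(3) KK' by auto
    have ap: "superpose F y t = F (y t)" "superpose F x t = F (x t)" "superpose F' x t = F' (x t)" for t
      using apply_superpose[OF continuous_on_subset[OF cF K'U] K' ry]
        apply_superpose[OF continuous_on_subset[OF cF K'U] K' rx]
        apply_superpose[OF continuous_on_subset[OF F' K'U] K' rx] by auto
    show "norm (superpose F y - superpose F x - superpose F' x * (y - x)) \<le> e * norm (y - x)"
    proof (rule norm_bound)
      fix t
      let ?S = "cball (x t) (norm (y - x))"
      have "norm ((F (y t) - F' (x t) * y t) - (F (x t) - F' (x t) * x t)) \<le> e * norm (y t - x t)"
      proof (rule field_differentiable_bound[of ?S "\<lambda>u. F u - F' (x t) * u" "\<lambda>u. F' u - F' (x t)"])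
        show "convex ?S" by simp
        show "x t \<in> ?S" "y t \<in> ?S" using near[of t] by (simp_all add: dist_real_def abs_minus_commute)
        fix u assume u: "u \<in> ?S"
        have "u \<in> U" using ball[OF u] K'U by auto
        show "((\<lambda>u. F u - F' (x t) * u) has_field_derivative F' u - F' (x t)) (at u within ?S)"
          by (rule has_field_derivative_at_within) (auto intro!: derivative_eq_intros F[OF \<open>u \<in> U\<close>])
        have "dist u (x t) < d" using u y by (auto simp: dist_commute)
        then show "norm (F' u - F' (x t)) \<le> e"
          using d(2)[OF ball[of "x t" t] ball[OF u]] by (auto simp: dist_norm)
      qed
      also have "\<dots> \<le> e * norm (y - x)" using near e by (intro mult_left_mono) auto
      finally show "norm (apply_bcontfun (superpose F y - superpose F x - superpose F' x * (y - x)) t)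
          \<le> e * norm (y - x)"
        by (simp add: ap algebra_simps)
    qed
  qed
qed

lemma k_smooth_on_superpose:
  fixes X :: "'b::euclidean_space \<Rightarrow> 'a::topological_space \<Rightarrow>\<^sub>C real"
  assumes L: "open L" and U: "open U" and "Cinf_on U F" and X: "k_smooth_on n L X"
    and K: "\<And>l. l \<in> L \<Longrightarrow> \<exists>K. compact K \<and> K \<subseteq> U \<and> range (X l) \<subseteq> K"
  shows "k_smooth_on n L (\<lambda>l. superpose F (X l))"
  using assms(3) X
proof (induction n arbitrary: F)
  case 0
  let ?F' = "\<lambda>u. frechet_derivative F (at u) 1"
  have F: "(F has_real_derivative ?F' u) (at u)" if "u \<in> U" for u
  proof -
    have "(F has_derivative frechet_derivative F (at u)) (at u)"
      by (rule Cinf_on_has_derivative[OF 0(1) that])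
    moreover from this have "frechet_derivative F (at u) = (\<lambda>h. ?F' u * h)"
      using linear_scale[OF has_derivative_linear, of F _ "at u" _ 1] by (auto simp: fun_eq_iff mult.commute)
    ultimately show ?thesis by (simp add: has_field_derivative_def)
  qed
  have cF': "continuous_on U ?F'" by (rule Cinf_on_imp_continuous_on[OF Cinf_on_frechet_derivative[OF 0(1)]])
  have "isCont (\<lambda>l. superpose F (X l)) l" if l: "l \<in> L" for l
  proof -
    obtain K where K: "compact K" "K \<subseteq> U" "range (X l) \<subseteq> K" using K[OF l] by blast
    have "isCont (superpose F) (X l)"
      by (rule has_derivative_continuous[OF superpose_has_derivative[OF U F cF' K]])
    moreover have "isCont X l" using 0(2) L l by (simp add: continuous_on_eq_continuous_at)
    ultimately show ?thesis by (rule isCont_o2[rotated])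
  qed
  then show ?case by (simp add: continuous_at_imp_continuous_on)
next
  case (Suc n)
  let ?F' = "\<lambda>u. frechet_derivative F (at u) 1"
  have F: "(F has_real_derivative ?F' u) (at u)" if "u \<in> U" for u
  proof -
    have "(F has_derivative frechet_derivative F (at u)) (at u)"
      by (rule Cinf_on_has_derivative[OF Suc.prems(1) that])
    moreover from this have "frechet_derivative F (at u) = (\<lambda>h. ?F' u * h)"
      using linear_scale[OF has_derivative_linear, of F _ "at u" _ 1] by (auto simp: fun_eq_iff mult.commute)
    ultimately show ?thesis by (simp add: has_field_derivative_def)
  qed
  have cF': "continuous_on U ?F'" by (rule Cinf_on_imp_continuous_on[OF Cinf_on_frechet_derivative[OF Suc.prems(1)]])
  obtain D where D: "\<And>x. x \<in> L \<Longrightarrow> (X has_derivative D x) (at x)" "\<And>v. k_smooth_on n L (\<lambda>x. D x v)"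
    using k_smooth_on_SucE[OF Suc.prems(2)] by blast
  show ?case
  proof (rule k_smooth_on_SucI[OF L])
    fix l assume l: "l \<in> L"
    obtain K where K: "compact K" "K \<subseteq> U" "range (X l) \<subseteq> K" using K[OF l] by blast
    show "((\<lambda>l. superpose F (X l)) has_derivative (\<lambda>v. superpose ?F' (X l) * D l v)) (at l)"
      by (rule has_derivative_compose[OF D(1)[OF l] superpose_has_derivative[OF U F cF' K]])
  next
    fix v
    show "k_smooth_on n L (\<lambda>l. superpose ?F' (X l) * D l v)"
      by (rule k_smooth_on_bilinear[OF L bounded_bilinear_mult
            Suc.IH[OF Cinf_on_frechet_derivative[OF Suc.prems(1)] k_smooth_on_SucD[OF Suc.prems(2)]] D(2)])
  qed
qed

subsection \<open>Averaging along rays\<close>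

text \<open>Only [0,1] matters for a profile, but the Banach space consists of functions on the
  whole line. Clamping keeps the coefficients bounded and makes averages depend on values in [0,1]
  alone.\<close>

definition unit_clamp :: "real \<Rightarrow> real" where "unit_clamp t = max 0 (min 1 t)"

lemma unit_clamp: "0 \<le> unit_clamp t" "unit_clamp t \<le> 1" "0 \<le> t \<Longrightarrow> t \<le> 1 \<Longrightarrow> unit_clamp t = t"
  by (auto simp: unit_clamp_def)

lemma continuous_on_unit_clamp [continuous_intros]:
  "continuous_on S f \<Longrightarrow> continuous_on S (\<lambda>x. unit_clamp (f x))"
  unfolding unit_clamp_def by (intro continuous_intros)

text \<open>For t in (0,1] this is 1/t times the integral of \<kappa> (x / t) u x over [0,t]. In
  this form the division by the distance to the pole is harmless at t = 0.\<close>

definition ray_avg :: "(real \<Rightarrow> real) \<Rightarrow> (real \<Rightarrow>\<^sub>C real) \<Rightarrow> real \<Rightarrow>\<^sub>C real" where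
  "ray_avg \<kappa> u = Bcontfun (\<lambda>t. integral {0..1} (\<lambda>\<tau>. \<kappa> \<tau> * u (unit_clamp t * \<tau>)))"

context
  fixes \<kappa> :: "real \<Rightarrow> real"
  assumes \<kappa>: "continuous_on {0..1} \<kappa>" "\<And>\<tau>. \<tau> \<in> {0..1} \<Longrightarrow> \<bar>\<kappa> \<tau>\<bar> \<le> 1"
begin

lemma ray_avg_integrable: "(\<lambda>\<tau>. \<kappa> \<tau> * apply_bcontfun u (c * \<tau>)) integrable_on {0..1}"
  by (intro integrable_continuous_real continuous_intros \<kappa>(1) continuous_on_compose2[OF continuous_on_apply_bcontfun[of UNIV u]])
    auto

lemma ray_avg_bound: "\<bar>integral {0..1} (\<lambda>\<tau>. \<kappa> \<tau> * apply_bcontfun u (c * \<tau>))\<bar> \<le> norm u"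
proof -
  have "norm (integral (cbox 0 1) (\<lambda>\<tau>. \<kappa> \<tau> * apply_bcontfun u (c * \<tau>))) \<le> norm u * measure lborel (cbox 0 (1::real))"
  proof (rule integrable_bound)
    show "0 \<le> norm u" by simp
    show "(\<lambda>\<tau>. \<kappa> \<tau> * apply_bcontfun u (c * \<tau>)) integrable_on cbox 0 1" using ray_avg_integrable by simp
    show "norm (\<kappa> \<tau> * apply_bcontfun u (c * \<tau>)) \<le> norm u" if "\<tau> \<in> cbox 0 1" for \<tau>
    proof -
      have "\<bar>\<kappa> \<tau>\<bar> * \<bar>u (c * \<tau>)\<bar> \<le> 1 * norm u"
        using \<kappa>(2)[of \<tau>] that norm_bounded[of u "c * \<tau>"] by (intro mult_mono) auto
      then show ?thesis by (simp add: abs_mult)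
    qed
  qed
  then show ?thesis by simp
qed

lemma apply_ray_avg: "ray_avg \<kappa> u t = integral {0..1} (\<lambda>\<tau>. \<kappa> \<tau> * u (unit_clamp t * \<tau>))"
proof -
  have "continuous_on UNIV (\<lambda>t. integral (cbox 0 1) (\<lambda>\<tau>. \<kappa> \<tau> * u (unit_clamp t * \<tau>)))"
  proof (rule integral_continuous_on_param)
    have "continuous_on (UNIV \<times> cbox 0 1) (\<lambda>p. \<kappa> (snd p) * u (unit_clamp (fst p) * snd p))"
      by (intro continuous_intros continuous_on_compose2[OF \<kappa>(1)]
          continuous_on_compose2[OF continuous_on_apply_bcontfun[of UNIV u]]) auto
    then show "continuous_on (UNIV \<times> cbox 0 1) (\<lambda>(t, \<tau>). \<kappa> \<tau> * u (unit_clamp t * \<tau>))"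
      by (simp add: split_beta')
  qed
  then have "(\<lambda>t. integral {0..1} (\<lambda>\<tau>. \<kappa> \<tau> * u (unit_clamp t * \<tau>))) \<in> bcontfun"
    by (intro bcontfun_normI[of _ "norm u"]) (use ray_avg_bound in auto)
  then show ?thesis by (simp add: ray_avg_def Bcontfun_inverse)
qed

lemma norm_ray_avg: "norm (ray_avg \<kappa> u) \<le> norm u"
  by (rule norm_bound) (simp add: apply_ray_avg ray_avg_bound)

lemma bounded_linear_ray_avg: "bounded_linear (ray_avg \<kappa>)"
proof (rule bounded_linear_intro[of _ 1])
  show "ray_avg \<kappa> (x + y) = ray_avg \<kappa> x + ray_avg \<kappa> y" for x y
    by (rule bcontfun_eqI) (simp add: apply_ray_avg distrib_left integral_add ray_avg_integrable)
  show "ray_avg \<kappa> (r *\<^sub>R x) = r *\<^sub>R ray_avg \<kappa> x" for r x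
    by (rule bcontfun_eqI) (simp add: apply_ray_avg mult.left_commute[of _ r])
  show "norm (ray_avg \<kappa> x) \<le> norm x * 1" for x using norm_ray_avg by simp
qed

end

lemma k_smooth_on_mult:
  fixes f :: "'a::euclidean_space \<Rightarrow> 'b::real_normed_algebra"
  shows "open U \<Longrightarrow> k_smooth_on n U f \<Longrightarrow> k_smooth_on n U g \<Longrightarrow> k_smooth_on n U (\<lambda>x. f x * g x)"
  using k_smooth_on_bilinear[OF _ bounded_bilinear_mult] .

lemma k_smooth_on_minus: "open U \<Longrightarrow> k_smooth_on n U f \<Longrightarrow> k_smooth_on n U (\<lambda>x. - f x)"
  by (rule k_smooth_on_bounded_linear_compose[OF _ bounded_linear_minus[OF bounded_linear_ident]])

lemma k_smooth_on_diff:
  "open U \<Longrightarrow> k_smooth_on n U f \<Longrightarrow> k_smooth_on n U g \<Longrightarrow> k_smooth_on n U (\<lambda>x. f x - g x)"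
  using k_smooth_on_add[of U n f "\<lambda>x. - g x"] k_smooth_on_minus[of U n g] by simp

lemma k_smooth_on_power:
  fixes f :: "'a::euclidean_space \<Rightarrow> 'b::real_normed_algebra_1"
  assumes "open U" "k_smooth_on n U f"
  shows "k_smooth_on n U (\<lambda>x. f x ^ k)"
  by (induction k) (simp_all add: k_smooth_on_const k_smooth_on_mult assms)

lemma k_smooth_on_scaleR_const:
  "open U \<Longrightarrow> k_smooth_on n U f \<Longrightarrow> k_smooth_on n U (\<lambda>x. r *\<^sub>R f x)"
  by (rule k_smooth_on_bounded_linear_compose[OF _ bounded_linear_scaleR_right])

lemma k_smooth_on_Pair:
  assumes "open U" "k_smooth_on n U f" "k_smooth_on n U g"
  shows "k_smooth_on n U (\<lambda>x. (f x, g x))"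
proof -
  have L: "bounded_linear (\<lambda>x. (x, 0))" "bounded_linear (\<lambda>y. (0, y))"
    by (auto intro: bounded_linear_Pair bounded_linear_ident bounded_linear_zero)
  have "k_smooth_on n U (\<lambda>x. (f x, 0) + (0, g x))"
    by (rule k_smooth_on_add[OF assms(1) k_smooth_on_bounded_linear_compose[OF assms(1) L(1) assms(2)]
          k_smooth_on_bounded_linear_compose[OF assms(1) L(2) assms(3)]])
  then show ?thesis by simp
qed

section \<open>Partial derivatives and implicit functions\<close>

definition pd1 :: "(real \<times> 'b::euclidean_space \<Rightarrow> 'c::real_normed_vector) \<Rightarrow> real \<times> 'b \<Rightarrow> 'c" where
  "pd1 f p = frechet_derivative f (at p) (1, 0)"

definition pd2 :: "('a::euclidean_space \<times> real \<Rightarrow> 'c::real_normed_vector) \<Rightarrow> 'a \<times> real \<Rightarrow> 'c" where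
  "pd2 f p = frechet_derivative f (at p) (0, 1)"

lemma Cinf_on_pd1: "Cinf_on U f \<Longrightarrow> Cinf_on U (pd1 f)"
  unfolding pd1_def by (rule Cinf_on_frechet_derivative)

lemma Cinf_on_pd2: "Cinf_on U f \<Longrightarrow> Cinf_on U (pd2 f)"
  unfolding pd2_def by (rule Cinf_on_frechet_derivative)

lemma pd1_vector:
  assumes "Cinf_on U f" "(x, y) \<in> U"
  shows "((\<lambda>x. f (x, y)) has_vector_derivative pd1 f (x, y)) (at x)"
proof -
  let ?D = "frechet_derivative f (at (x, y))"
  have D: "(f has_derivative ?D) (at (x, y))" by (rule Cinf_on_has_derivative[OF assms])
  have "((\<lambda>x. (x, y)) has_derivative (\<lambda>h. (h, 0))) (at x)"
    by (intro has_derivative_Pair has_derivative_ident has_derivative_const)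
  from has_derivative_compose[OF this D]
  have "((\<lambda>x. f (x, y)) has_derivative (\<lambda>h. ?D (h, 0))) (at x)" .
  moreover have "(\<lambda>h. ?D (h, 0)) = (\<lambda>h. h *\<^sub>R ?D (1, 0))"
  proof
    show "?D (h, 0) = h *\<^sub>R ?D (1, 0)" for h
      using linear_scale[OF has_derivative_linear[OF D], of h "(1, 0)"] by simp
  qed
  ultimately show ?thesis unfolding has_vector_derivative_def pd1_def by (simp only:)
qed

lemma pd2_vector:
  assumes "Cinf_on U f" "(x, y) \<in> U"
  shows "((\<lambda>y. f (x, y)) has_vector_derivative pd2 f (x, y)) (at y)"
proof -
  let ?D = "frechet_derivative f (at (x, y))"
  have D: "(f has_derivative ?D) (at (x, y))" by (rule Cinf_on_has_derivative[OF assms])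
  have "((\<lambda>y. (x, y)) has_derivative (\<lambda>h. (0, h))) (at y)"
    by (intro has_derivative_Pair has_derivative_ident has_derivative_const)
  from has_derivative_compose[OF this D]
  have "((\<lambda>y. f (x, y)) has_derivative (\<lambda>h. ?D (0, h))) (at y)" .
  moreover have "(\<lambda>h. ?D (0, h)) = (\<lambda>h. h *\<^sub>R ?D (0, 1))"
  proof
    show "?D (0, h) = h *\<^sub>R ?D (0, 1)" for h
      using linear_scale[OF has_derivative_linear[OF D], of h "(0, 1)"] by simp
  qed
  ultimately show ?thesis unfolding has_vector_derivative_def pd2_def by (simp only:)
qed

lemma pd1_real:
  fixes f :: "real \<times> 'b::euclidean_space \<Rightarrow> real"
  shows "Cinf_on U f \<Longrightarrow> (x, y) \<in> U \<Longrightarrow> ((\<lambda>x. f (x, y)) has_real_derivative pd1 f (x, y)) (at x)"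
  using pd1_vector has_real_derivative_iff_has_vector_derivative by blast

lemma pd2_real:
  fixes f :: "'a::euclidean_space \<times> real \<Rightarrow> real"
  shows "Cinf_on U f \<Longrightarrow> (x, y) \<in> U \<Longrightarrow> ((\<lambda>y. f (x, y)) has_real_derivative pd2 f (x, y)) (at y)"
  using pd2_vector has_real_derivative_iff_has_vector_derivative by blast

lemma pd2_eqI:
  fixes f :: "'a::euclidean_space \<times> real \<Rightarrow> real"
  assumes "Cinf_on U f" "(x, y) \<in> U" "((\<lambda>y. f (x, y)) has_real_derivative d) (at y)"
  shows "pd2 f (x, y) = d"
  by (rule DERIV_unique[OF pd2_real[OF assms(1,2)] assms(3)])

lemma open_prod_box:
  fixes a b :: real
  assumes "open U" "(a, b) \<in> U"
  obtains d where "d > 0" "\<And>x y. \<bar>x - a\<bar> \<le> d \<Longrightarrow> \<bar>y - b\<bar> \<le> d \<Longrightarrow> (x, y) \<in> U"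
proof -
  obtain A B where AB: "open A" "open B" "a \<in> A" "b \<in> B" "A \<times> B \<subseteq> U"
    using open_prod_elim[OF assms] by (metis mem_Sigma_iff)
  obtain r s where "r > 0" "cball a r \<subseteq> A" "s > 0" "cball b s \<subseteq> B"
    using AB open_contains_cball by meson
  then show ?thesis
    using AB(5) by (intro that[of "min r s"]) (force simp: subset_iff dist_real_def abs_minus_commute)+
qed

text \<open>Both mixed derivatives are limits of the same second difference quotient.\<close>

lemma pd_commute:
  fixes f :: "real \<times> real \<Rightarrow> real"
  assumes U: "open U" and f: "Cinf_on U f" and p: "(a, b) \<in> U"
  shows "pd1 (pd2 f) (a, b) = pd2 (pd1 f) (a, b)"
proof (rule ccontr)
  assume ne: "pd1 (pd2 f) (a, b) \<noteq> pd2 (pd1 f) (a, b)"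
  define e where "e = \<bar>pd1 (pd2 f) (a, b) - pd2 (pd1 f) (a, b)\<bar> / 2"
  have e: "e > 0" using ne by (simp add: e_def)
  have c1: "isCont (pd1 (pd2 f)) (a, b)" and c2: "isCont (pd2 (pd1 f)) (a, b)"
    using Cinf_on_imp_continuous_on[OF Cinf_on_pd1[OF Cinf_on_pd2[OF f]]]
      Cinf_on_imp_continuous_on[OF Cinf_on_pd2[OF Cinf_on_pd1[OF f]]] U p
    by (simp_all add: continuous_on_eq_continuous_at)
  define W where "W = {q \<in> U. dist (pd1 (pd2 f) q) (pd1 (pd2 f) (a, b)) < e \<and>
      dist (pd2 (pd1 f) q) (pd2 (pd1 f) (a, b)) < e}"
  have "open W"
  proof -
    have "W = U \<inter> pd1 (pd2 f) -` ball (pd1 (pd2 f) (a, b)) e \<inter> (U \<inter> pd2 (pd1 f) -` ball (pd2 (pd1 f) (a, b)) e)"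
      by (auto simp: W_def dist_commute)
    then show ?thesis
      by (metis continuous_on_open_vimage[OF U] open_Int open_ball Int_commute
          Cinf_on_imp_continuous_on[OF Cinf_on_pd1[OF Cinf_on_pd2[OF f]]]
          Cinf_on_imp_continuous_on[OF Cinf_on_pd2[OF Cinf_on_pd1[OF f]]])
  qed
  moreover have "(a, b) \<in> W" using p e by (simp add: W_def)
  ultimately obtain d where d: "d > 0" "\<And>x y. \<bar>x - a\<bar> \<le> d \<Longrightarrow> \<bar>y - b\<bar> \<le> d \<Longrightarrow> (x, y) \<in> W"
    using open_prod_box by blast
  have inU: "(x, y) \<in> U" if "\<bar>x - a\<bar> \<le> d" "\<bar>y - b\<bar> \<le> d" for x y using d(2)[OF that] by (simp add: W_def)
  have "\<exists>x. a < x \<and> x < a + d \<and> (f (a + d, b + d) - f (a + d, b)) - (f (a, b + d) - f (a, b))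
      = (a + d - a) * (pd1 f (x, b + d) - pd1 f (x, b))"
    by (rule MVT2[of a "a + d" "\<lambda>x. f (x, b + d) - f (x, b)" "\<lambda>x. pd1 f (x, b + d) - pd1 f (x, b)"])
      (use d(1) in \<open>auto intro!: DERIV_diff pd1_real[OF f] inU\<close>)
  then obtain x where x: "a < x" "x < a + d"
    "(f (a + d, b + d) - f (a + d, b)) - (f (a, b + d) - f (a, b)) = d * (pd1 f (x, b + d) - pd1 f (x, b))" by auto
  have "\<exists>y. b < y \<and> y < b + d \<and> pd1 f (x, b + d) - pd1 f (x, b) = (b + d - b) * pd2 (pd1 f) (x, y)"
    by (rule MVT2[of b "b + d" "\<lambda>y. pd1 f (x, y)" "\<lambda>y. pd2 (pd1 f) (x, y)"])
      (use d(1) x in \<open>auto intro!: pd2_real[OF Cinf_on_pd1[OF f]] inU\<close>)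
  then obtain y where y: "b < y" "y < b + d" "pd1 f (x, b + d) - pd1 f (x, b) = d * pd2 (pd1 f) (x, y)" by auto
  have "\<exists>y. b < y \<and> y < b + d \<and> (f (a + d, b + d) - f (a, b + d)) - (f (a + d, b) - f (a, b))
      = (b + d - b) * (pd2 f (a + d, y) - pd2 f (a, y))"
    by (rule MVT2[of b "b + d" "\<lambda>y. f (a + d, y) - f (a, y)" "\<lambda>y. pd2 f (a + d, y) - pd2 f (a, y)"])
      (use d(1) in \<open>auto intro!: DERIV_diff pd2_real[OF f] inU\<close>)
  then obtain y' where y': "b < y'" "y' < b + d"
    "(f (a + d, b + d) - f (a, b + d)) - (f (a + d, b) - f (a, b)) = d * (pd2 f (a + d, y') - pd2 f (a, y'))" by auto
  have "\<exists>x. a < x \<and> x < a + d \<and> pd2 f (a + d, y') - pd2 f (a, y') = (a + d - a) * pd1 (pd2 f) (x, y')"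
    by (rule MVT2[of a "a + d" "\<lambda>x. pd2 f (x, y')" "\<lambda>x. pd1 (pd2 f) (x, y')"])
      (use d(1) y' in \<open>auto intro!: pd1_real[OF Cinf_on_pd2[OF f]] inU\<close>)
  then obtain x' where x': "a < x'" "x' < a + d" "pd2 f (a + d, y') - pd2 f (a, y') = d * pd1 (pd2 f) (x', y')" by auto
  have "d * (d * pd2 (pd1 f) (x, y)) = d * (d * pd1 (pd2 f) (x', y'))"
    using x(3)[unfolded y(3)] y'(3)[unfolded x'(3)] by linarith
  then have eq: "pd2 (pd1 f) (x, y) = pd1 (pd2 f) (x', y')" using d(1) by simp
  have "(x, y) \<in> W" "(x', y') \<in> W" using d x y x' y' by auto
  then have "\<bar>pd2 (pd1 f) (x, y) - pd2 (pd1 f) (a, b)\<bar> < e" "\<bar>pd1 (pd2 f) (x', y') - pd1 (pd2 f) (a, b)\<bar> < e"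
    by (simp_all add: W_def dist_real_def)
  with eq have "\<bar>pd1 (pd2 f) (a, b) - pd2 (pd1 f) (a, b)\<bar> < 2 * e" by linarith
  then show False by (simp add: e_def)
qed

text \<open>Continuity suffices: with c the value of \<open>pd2 \<Psi>\<close> frozen at the point,
  t = t - \<Psi> (x, t) / c is a fixed point equation whose t-derivative vanishes there, so
  \<open>implicit_has_derivative\<close> applies with A = 0. The resulting formula for the
  derivative bootstraps.\<close>

lemma Cinf_on_implicit:
  fixes \<Psi> :: "'a::euclidean_space \<times> real \<Rightarrow> real"
  assumes S: "open S" and W: "open W" and \<Psi>: "Cinf_on W \<Psi>" and \<tau>: "continuous_on S \<tau>"
    and z: "\<And>x. x \<in> S \<Longrightarrow> (x, \<tau> x) \<in> W" "\<And>x. x \<in> S \<Longrightarrow> \<Psi> (x, \<tau> x) = 0"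
      "\<And>x. x \<in> S \<Longrightarrow> pd2 \<Psi> (x, \<tau> x) \<noteq> 0"
  shows "Cinf_on S \<tau>"
proof -
  define D where "D p = frechet_derivative \<Psi> (at p)" for p
  have D: "(\<Psi> has_derivative D p) (at p)" if "p \<in> W" for p
    unfolding D_def by (rule Cinf_on_has_derivative[OF \<Psi> that])
  have D01: "pd2 \<Psi> p = D p (0, 1)" for p by (simp add: pd2_def D_def)
  have der: "(\<tau> has_derivative (\<lambda>h. - D (l, \<tau> l) (h, 0) / D (l, \<tau> l) (0, 1))) (at l)" if l: "l \<in> S" for l
  proof -
    define c where "c = D (l, \<tau> l) (0, 1)"
    have c: "c \<noteq> 0" using z(3)[OF l] by (simp add: c_def D01)
    have lin: "linear (D (l, \<tau> l))" using has_derivative_linear[OF D[OF z(1)[OF l]]] .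
    have spl: "D (l, \<tau> l) (h, k) = D (l, \<tau> l) (h, 0) + k * c" for h k
      using linear_add[OF lin, of "(h, 0)" "(0, k)"] linear_scale[OF lin, of k "(0, 1)"] by (simp add: c_def)
    have "((\<lambda>p. snd p - \<Psi> p / c) has_derivative (\<lambda>p. snd p - D (l, \<tau> l) p / c)) (at (l, \<tau> l))"
      by (intro has_derivative_diff has_derivative_snd has_derivative_ident
          bounded_linear.has_derivative[OF bounded_linear_divide] D z(1) l)
    moreover have "(\<lambda>p. snd p - D (l, \<tau> l) p / c) = (\<lambda>(h, k). - D (l, \<tau> l) (h, 0) / c + 0)"
    proof (rule ext, clarify)
      fix h k
      show "snd (h, k) - D (l, \<tau> l) (h, k) / c = - D (l, \<tau> l) (h, 0) / c + 0"
        using c spl[of h k] by (simp add: add_divide_distrib)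
    qed
    ultimately have N: "((\<lambda>p. snd p - \<Psi> p / c) has_derivative (\<lambda>(h, k). - D (l, \<tau> l) (h, 0) / c + 0)) (at (l, \<tau> l))"
      by simp
    have "(\<tau> has_derivative (\<lambda>h. - D (l, \<tau> l) (h, 0) / c)) (at l)"
    proof (rule implicit_has_derivative[where N = "\<lambda>p. snd p - \<Psi> p / c" and A = "\<lambda>_. 0"])
      show "((\<lambda>p. snd p - \<Psi> p / c) has_derivative (\<lambda>(h, k). - D (l, \<tau> l) (h, 0) / c + 0)) (at (l, \<tau> l))" by (rule N)
      show "\<forall>\<^sub>F m in nhds l. \<tau> m = snd (m, \<tau> m) - \<Psi> (m, \<tau> m) / c"
        using eventually_nhds_in_open[OF S l] by eventually_elim (simp add: z(2))
      show "isCont \<tau> l" using \<tau> S l by (simp add: continuous_on_eq_continuous_at)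
      have "bounded_linear (\<lambda>h. D (l, \<tau> l) (h, 0))"
        by (rule bounded_linear_compose[OF has_derivative_bounded_linear[OF D[OF z(1)[OF l]]]])
          (intro bounded_linear_Pair bounded_linear_ident bounded_linear_zero)
      then have "bounded_linear (\<lambda>h. (- D (l, \<tau> l) (h, 0)) / c)"
        by (intro bounded_linear_compose[OF bounded_linear_divide] bounded_linear_minus)
      then show "bounded_linear (\<lambda>h. - D (l, \<tau> l) (h, 0) / c)" by simp
    qed (simp_all add: linear_zero)
    then show ?thesis by (simp add: c_def)
  qed
  define W' where "W' = {p \<in> W. D p (0, 1) \<noteq> 0}"
  have cD: "continuous_on W (\<lambda>p. D p (0, 1))"
    unfolding D_def by (rule Cinf_on_imp_continuous_on[OF Cinf_on_frechet_derivative[OF \<Psi>]])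
  have "W' = W \<inter> (\<lambda>p. D p (0, 1)) -` (- {0})" by (auto simp: W'_def)
  then have W': "open W'" using continuous_open_preimage[OF cD W, of "- {0}"] by auto
  have cDv: "Cinf_on W' (\<lambda>p. D p v)" for v
    unfolding D_def by (rule Cinf_on_subset[OF Cinf_on_frechet_derivative[OF \<Psi>]]) (simp add: W'_def)
  have quot: "Cinf_on W' (\<lambda>p. - D p (v, 0) / D p (0, 1))" for v
    by (rule Cinf_on_divide[OF W' Cinf_on_minus[OF W' cDv] cDv]) (simp add: W'_def)
  have "k_smooth_on n S \<tau>" for n
  proof (induction n)
    case (Suc n)
    show ?case
    proof (rule k_smooth_on_SucI[OF S der], assumption)
      fix v
      show "k_smooth_on n S (\<lambda>x. - D (x, \<tau> x) (v, 0) / D (x, \<tau> x) (0, 1))"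
        by (rule k_smooth_on_compose[OF S W' _ k_smooth_on_Pair[OF S k_smooth_on_ident Suc]
              Cinf_on_k[OF quot[of v]]])
          (use z D01 in \<open>auto simp: W'_def\<close>)
    qed
  qed (simp add: \<tau>)
  then show ?thesis by (simp add: Cinf_on_def)
qed

text \<open>Positivity of the partial derivative makes \<Psi> (x, _) increasing on a short interval.
  The intermediate value theorem gives the zero, persistent signs on both sides of it give
  continuity, and smoothness is left to \<open>Cinf_on_implicit\<close>.\<close>

lemma implicit_function_pos:
  fixes \<Psi> :: "'a::euclidean_space \<times> real \<Rightarrow> real"
  assumes W: "open W" and \<Psi>: "Cinf_on W \<Psi>" and p: "(x0, t0) \<in> W" "\<Psi> (x0, t0) = 0" "pd2 \<Psi> (x0, t0) > 0"
  shows "\<exists>S \<tau>. open S \<and> x0 \<in> S \<and> Cinf_on S \<tau> \<and> \<tau> x0 = t0 \<and>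
    (\<forall>x\<in>S. (x, \<tau> x) \<in> W \<and> \<Psi> (x, \<tau> x) = 0)"
proof -
  have c\<Psi>: "continuous_on W \<Psi>" by (rule Cinf_on_imp_continuous_on[OF \<Psi>])
  have cpd: "continuous_on W (pd2 \<Psi>)" by (rule Cinf_on_imp_continuous_on[OF Cinf_on_pd2[OF \<Psi>]])
  define W' where "W' = W \<inter> pd2 \<Psi> -` {0<..}"
  have "open W'" unfolding W'_def by (rule continuous_open_preimage[OF cpd W open_greaterThan])
  moreover have "(x0, t0) \<in> W'" using p by (simp add: W'_def)
  ultimately obtain A B where AB: "open A" "open B" "x0 \<in> A" "t0 \<in> B" "A \<times> B \<subseteq> W'"
    using open_prod_elim by (metis mem_Sigma_iff)
  obtain r where r: "r > 0" "cball t0 r \<subseteq> B" using AB open_contains_cball by meson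
  have box: "(x, t) \<in> W" "pd2 \<Psi> (x, t) > 0" if "x \<in> A" "\<bar>t - t0\<bar> \<le> r" for x t
  proof -
    have "t \<in> B" using r(2) that by (auto simp: subset_iff dist_real_def abs_minus_commute)
    then show "(x, t) \<in> W" "pd2 \<Psi> (x, t) > 0" using AB(5) that by (auto simp: W'_def)
  qed
  have mono: "\<Psi> (x, s) < \<Psi> (x, t)" if "x \<in> A" "s < t" "\<bar>s - t0\<bar> \<le> r" "\<bar>t - t0\<bar> \<le> r" for x s t
  proof (rule DERIV_pos_imp_increasing[OF that(2)])
    fix u assume "s \<le> u" "u \<le> t"
    then have "\<bar>u - t0\<bar> \<le> r" using that by auto
    from box[OF that(1) this] show "\<exists>y. ((\<lambda>t. \<Psi> (x, t)) has_real_derivative y) (at u) \<and> 0 < y"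
      using pd2_real[OF \<Psi>] by blast
  qed
  have slice: "open {x \<in> A. P (\<Psi> (x, t))}" if "open (Collect P)" "\<bar>t - t0\<bar> \<le> r" for P t
  proof -
    have "continuous_on A (\<lambda>x. \<Psi> (x, t))"
      by (rule continuous_on_compose2[OF c\<Psi>]) (use box that in \<open>auto intro!: continuous_intros\<close>)
    moreover have "{x \<in> A. P (\<Psi> (x, t))} = A \<inter> (\<lambda>x. \<Psi> (x, t)) -` Collect P" by auto
    ultimately show ?thesis using continuous_open_preimage[OF _ AB(1) that(1)] by (simp only:)
  qed
  define S where "S = {x \<in> A. \<Psi> (x, t0 - r) < 0} \<inter> {x \<in> A. 0 < \<Psi> (x, t0 + r)}"
  have S: "open S"
    unfolding S_def using slice[of "\<lambda>y. y < 0" "t0 - r"] slice[of "\<lambda>y. 0 < y" "t0 + r"] r(1)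
    by (intro open_Int) (simp_all add: open_Collect_less)
  have x0: "x0 \<in> S"
    using mono[of x0 "t0 - r" t0] mono[of x0 t0 "t0 + r"] AB(3) r(1) p(2) by (simp add: S_def)
  have ex: "\<exists>t. \<bar>t - t0\<bar> < r \<and> \<Psi> (x, t) = 0" if x: "x \<in> S" for x
  proof -
    have "x \<in> A" using x by (simp add: S_def)
    have "continuous_on {t0 - r..t0 + r} (\<lambda>t. \<Psi> (x, t))"
      by (rule continuous_on_compose2[OF c\<Psi>]) (use box[OF \<open>x \<in> A\<close>] in \<open>auto intro!: continuous_intros\<close>)
    then obtain t where t: "t0 - r \<le> t" "t \<le> t0 + r" "\<Psi> (x, t) = 0"
      using IVT'[of "\<lambda>t. \<Psi> (x, t)" "t0 - r" 0 "t0 + r"] x r(1) by (auto simp: S_def)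
    moreover have "t \<noteq> t0 - r" "t \<noteq> t0 + r" using t(3) x by (auto simp: S_def)
    ultimately have "\<bar>t - t0\<bar> < r" by linarith
    with t(3) show ?thesis by blast
  qed
  define \<tau> where "\<tau> x = (SOME t. \<bar>t - t0\<bar> < r \<and> \<Psi> (x, t) = 0)" for x
  have \<tau>: "\<bar>\<tau> x - t0\<bar> < r" "\<Psi> (x, \<tau> x) = 0" if "x \<in> S" for x
    using someI_ex[OF ex[OF that]] by (auto simp: \<tau>_def)
  have SA: "x \<in> A" if "x \<in> S" for x using that by (simp add: S_def)
  have cont: "continuous_on S \<tau>"
    unfolding continuous_on_iff
  proof (intro ballI allI impI)
    fix x1 and e :: real assume x1: "x1 \<in> S" and e: "e > 0"
    define d where "d = min (e / 2) (r - \<bar>\<tau> x1 - t0\<bar>)"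
    have d: "d > 0" "d < e" "\<bar>\<tau> x1 - d - t0\<bar> \<le> r" "\<bar>\<tau> x1 + d - t0\<bar> \<le> r"
    proof -
      have "d \<le> e / 2" "d \<le> r - \<bar>\<tau> x1 - t0\<bar>" unfolding d_def by (rule min.cobounded1, rule min.cobounded2)
      moreover show "d > 0" using e \<tau>(1)[OF x1] by (simp add: d_def)
      ultimately show "d < e" "\<bar>\<tau> x1 - d - t0\<bar> \<le> r" "\<bar>\<tau> x1 + d - t0\<bar> \<le> r"
        using e by linarith+
    qed
    define S1 where "S1 = {x \<in> A. \<Psi> (x, \<tau> x1 - d) < 0} \<inter> {x \<in> A. 0 < \<Psi> (x, \<tau> x1 + d)}"
    have "open S1"
      unfolding S1_def using slice[of "\<lambda>y. y < 0" "\<tau> x1 - d"] slice[of "\<lambda>y. 0 < y" "\<tau> x1 + d"] d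
      by (intro open_Int) (simp_all add: open_Collect_less)
    moreover have "x1 \<in> S1"
      using mono[OF SA[OF x1], of "\<tau> x1 - d" "\<tau> x1"] mono[OF SA[OF x1], of "\<tau> x1" "\<tau> x1 + d"] d \<tau>[OF x1] SA[OF x1]
      by (simp add: S1_def)
    ultimately obtain k where k: "k > 0" "ball x1 k \<subseteq> S1" using open_contains_ball by blast
    show "\<exists>k>0. \<forall>x'\<in>S. dist x' x1 < k \<longrightarrow> dist (\<tau> x') (\<tau> x1) < e"
    proof (intro exI[of _ k] conjI ballI impI k(1))
      fix x assume x: "x \<in> S" "dist x x1 < k"
      then have "x \<in> S1" using k(2) by (auto simp: dist_commute)
      then have s: "\<Psi> (x, \<tau> x1 - d) < 0" "0 < \<Psi> (x, \<tau> x1 + d)" by (auto simp: S1_def)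
      have "\<tau> x1 - d < \<tau> x"
      proof (rule ccontr)
        assume "\<not> \<tau> x1 - d < \<tau> x"
        then have "\<tau> x = \<tau> x1 - d \<or> \<tau> x < \<tau> x1 - d" by auto
        then have "\<Psi> (x, \<tau> x) \<le> \<Psi> (x, \<tau> x1 - d)"
          using mono[OF SA[OF x(1)], of "\<tau> x" "\<tau> x1 - d"] d(3) \<tau>(1)[OF x(1)] by auto
        with s \<tau>(2)[OF x(1)] show False by simp
      qed
      moreover have "\<tau> x < \<tau> x1 + d"
      proof (rule ccontr)
        assume "\<not> \<tau> x < \<tau> x1 + d"
        then have "\<tau> x = \<tau> x1 + d \<or> \<tau> x1 + d < \<tau> x" by auto
        then have "\<Psi> (x, \<tau> x1 + d) \<le> \<Psi> (x, \<tau> x)"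
          using mono[OF SA[OF x(1)], of "\<tau> x1 + d" "\<tau> x"] d(4) \<tau>(1)[OF x(1)] by auto
        with s \<tau>(2)[OF x(1)] show False by simp
      qed
      ultimately show "dist (\<tau> x) (\<tau> x1) < e" using d(2) by (simp add: dist_real_def abs_less_iff)
    qed
  qed
  have inW: "(x, \<tau> x) \<in> W" "pd2 \<Psi> (x, \<tau> x) > 0" if "x \<in> S" for x
    using box[OF SA[OF that]] \<tau>(1)[OF that] by auto
  have "Cinf_on S \<tau>"
    by (rule Cinf_on_implicit[OF S W \<Psi> cont]) (use inW \<tau> in force)+
  moreover have "\<tau> x0 = t0"
  proof (rule ccontr)
    assume "\<tau> x0 \<noteq> t0"
    then have "\<Psi> (x0, \<tau> x0) \<noteq> \<Psi> (x0, t0)"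
      using mono[OF AB(3), of "\<tau> x0" t0] mono[OF AB(3), of t0 "\<tau> x0"] \<tau>(1)[OF x0] r(1) by force
    then show False using p(2) \<tau>(2)[OF x0] by simp
  qed
  ultimately show ?thesis using S x0 inW \<tau> by blast
qed

lemma implicit_function:
  fixes \<Psi> :: "'a::euclidean_space \<times> real \<Rightarrow> real"
  assumes W: "open W" and \<Psi>: "Cinf_on W \<Psi>" and p: "(x0, t0) \<in> W" "\<Psi> (x0, t0) = 0" "pd2 \<Psi> (x0, t0) \<noteq> 0"
  obtains S \<tau> where "open S" "x0 \<in> S" "Cinf_on S \<tau>" "\<tau> x0 = t0"
    "\<And>x. x \<in> S \<Longrightarrow> (x, \<tau> x) \<in> W" "\<And>x. x \<in> S \<Longrightarrow> \<Psi> (x, \<tau> x) = 0"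
proof (cases "pd2 \<Psi> (x0, t0) > 0")
  case True
  then show ?thesis using implicit_function_pos[OF W \<Psi> p(1,2)] that by blast
next
  case False
  have \<Psi>': "Cinf_on W (\<lambda>p. - \<Psi> p)" by (rule Cinf_on_minus[OF W \<Psi>])
  have "pd2 (\<lambda>p. - \<Psi> p) (x0, t0) = - pd2 \<Psi> (x0, t0)"
    by (rule pd2_eqI[OF \<Psi>' p(1) DERIV_minus[OF pd2_real[OF \<Psi> p(1)]]])
  with False p have "pd2 (\<lambda>p. - \<Psi> p) (x0, t0) > 0" by simp
  from implicit_function_pos[OF W \<Psi>' p(1) _ this] p(2)
  obtain S \<tau> where "open S" "x0 \<in> S" "Cinf_on S \<tau>" "\<tau> x0 = t0"
    "\<forall>x\<in>S. (x, \<tau> x) \<in> W \<and> - \<Psi> (x, \<tau> x) = 0" by auto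
  then show ?thesis using that by simp
qed

text \<open>The implicit function theorem for p (x, t) - y = 0 gives smooth local inverses and
  openness of the image. Injectivity enters through the left inverse q, with which the local
  inverses must agree.\<close>

lemma parametric_inverse:
  fixes p :: "'a::euclidean_space \<times> real \<Rightarrow> real"
  assumes W: "open W" and p: "Cinf_on W p" and nz: "\<And>z. z \<in> W \<Longrightarrow> pd2 p z \<noteq> 0"
    and q: "\<And>x t. (x, t) \<in> W \<Longrightarrow> q (x, p (x, t)) = t"
  shows "open ((\<lambda>(x, t). (x, p (x, t))) ` W)" "Cinf_on ((\<lambda>(x, t). (x, p (x, t))) ` W) q"
proof -
  let ?V = "(\<lambda>(x, t). (x, p (x, t))) ` W"
  have *: "\<exists>S. open S \<and> z \<in> S \<and> S \<subseteq> ?V \<and> Cinf_on S q" if z: "z \<in> ?V" for z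
  proof -
    obtain x0 t0 where xt: "(x0, t0) \<in> W" "z = (x0, p (x0, t0))" using z by auto
    define pr where "pr = (\<lambda>u :: ('a \<times> real) \<times> real. (fst (fst u), snd u))"
    define \<Psi> where "\<Psi> = (\<lambda>u. p (pr u) - snd (fst u))"
    define W' where "W' = pr -` W"
    have cpr: "Cinf_on UNIV pr" unfolding pr_def by (intro smooth_intros open_UNIV)
    have W': "open W'"
      unfolding W'_def by (rule open_vimage[OF W Cinf_on_imp_continuous_on[OF cpr]])
    have cp: "Cinf_on W' (\<lambda>u. p (pr u))"
      by (rule Cinf_on_compose[OF W' W _ Cinf_on_subset[OF cpr subset_UNIV] p]) (auto simp: W'_def)
    have \<Psi>: "Cinf_on W' \<Psi>"
      unfolding \<Psi>_def by (intro Cinf_on_diff cp W' Cinf_on_snd Cinf_on_fst Cinf_on_ident)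
    have in': "(z, t0) \<in> W'" using xt by (simp add: W'_def pr_def)
    have "((\<lambda>t. \<Psi> (z, t)) has_real_derivative pd2 p (x0, t0) - 0) (at t0)"
      unfolding \<Psi>_def using xt(2) pd2_real[OF p xt(1)] by (intro DERIV_diff) (simp_all add: pr_def)
    from pd2_eqI[OF \<Psi> in' this] have "pd2 \<Psi> (z, t0) \<noteq> 0" using nz[OF xt(1)] by simp
    moreover have "\<Psi> (z, t0) = 0" using xt by (simp add: \<Psi>_def pr_def)
    ultimately obtain S \<tau> where S: "open S" "z \<in> S" "Cinf_on S \<tau>"
      "\<And>u. u \<in> S \<Longrightarrow> (u, \<tau> u) \<in> W'" "\<And>u. u \<in> S \<Longrightarrow> \<Psi> (u, \<tau> u) = 0"
      using implicit_function[OF W' \<Psi> in'] by metis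
    have sol: "(fst u, \<tau> u) \<in> W" "p (fst u, \<tau> u) = snd u" if "u \<in> S" for u
      using S(4,5)[OF that] by (auto simp: W'_def \<Psi>_def pr_def)
    have "S \<subseteq> ?V"
    proof
      fix u assume "u \<in> S"
      then have "u = (\<lambda>(x, t). (x, p (x, t))) (fst u, \<tau> u)" using sol(2) by simp
      then show "u \<in> ?V" using sol(1)[OF \<open>u \<in> S\<close>] by (rule image_eqI)
    qed
    moreover have "\<tau> u = q u" if "u \<in> S" for u
      using q[OF sol(1)[OF that]] sol(2)[OF that] by simp
    then have "Cinf_on S q" by (rule Cinf_on_cong[OF S(1) _ S(3)])
    ultimately show ?thesis using S(1,2) by blast
  qed
  show "open ?V" unfolding open_subopen[of ?V] using * by blast
  show "Cinf_on ?V q"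
  proof (rule Cinf_on_local)
    fix z assume "z \<in> ?V"
    from *[OF this] show "\<exists>V. open V \<and> z \<in> V \<and> Cinf_on V q" by blast
  qed
qed

section \<open>The integral equation for the profile near a pole\<close>

text \<open>For t in [0,1], t^2 times these averages are the integral of x u x and the twofold
  integral of u over [0,t].\<close>

definition avg1 :: "(real \<Rightarrow>\<^sub>C real) \<Rightarrow> real \<Rightarrow>\<^sub>C real" where "avg1 = ray_avg (\<lambda>\<tau>. \<tau>)"
definition avg2 :: "(real \<Rightarrow>\<^sub>C real) \<Rightarrow> real \<Rightarrow>\<^sub>C real" where "avg2 = ray_avg (\<lambda>\<tau>. 1 - \<tau>)"

lemma bounded_linear_avg: "bounded_linear avg1" "bounded_linear avg2"
  unfolding avg1_def avg2_def by (rule bounded_linear_ray_avg; auto intro!: continuous_intros)+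

lemma norm_avg: "norm (avg1 u) \<le> norm u" "norm (avg2 u) \<le> norm u"
  unfolding avg1_def avg2_def by (rule norm_ray_avg; auto intro!: continuous_intros)+

lemma apply_avg:
  "avg1 u t = integral {0..1} (\<lambda>\<tau>. \<tau> * u (unit_clamp t * \<tau>))"
  "avg2 u t = integral {0..1} (\<lambda>\<tau>. (1 - \<tau>) * u (unit_clamp t * \<tau>))"
  unfolding avg1_def avg2_def by (rule apply_ray_avg; auto intro!: continuous_intros)+

instance bcontfun :: (metric_space, banach) banach ..

lemma apply_bcontfun_numeral [simp]:
  "apply_bcontfun (numeral n :: 'a::topological_space \<Rightarrow>\<^sub>C 'b::real_normed_algebra_1) x = numeral n"
proof -
  have "(numeral n :: 'a \<Rightarrow>\<^sub>C 'b) = numeral n *\<^sub>R 1"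
    by (metis of_real_def of_real_numeral)
  then have "apply_bcontfun (numeral n :: 'a \<Rightarrow>\<^sub>C 'b) x = apply_bcontfun (numeral n *\<^sub>R 1 :: 'a \<Rightarrow>\<^sub>C 'b) x"
    by (rule arg_cong)
  also have "\<dots> = numeral n *\<^sub>R 1" unfolding scaleR_bcontfun.rep_eq apply_bcontfun_one ..
  finally have "apply_bcontfun (numeral n :: 'a \<Rightarrow>\<^sub>C 'b) x = numeral n *\<^sub>R 1" .
  then show ?thesis by (metis of_real_def of_real_numeral)
qed

lemma norm_mult_le:
  fixes x y :: "'a::real_normed_algebra"
  assumes "norm x \<le> a" "norm y \<le> b" shows "norm (x * y) \<le> a * b"
  by (rule order_trans[OF norm_mult_ineq mult_mono[OF assms order_trans[OF norm_ge_zero assms(1)] norm_ge_zero]])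

lemma norm_power_le:
  fixes x :: "'a::real_normed_algebra_1"
  assumes "norm x \<le> a" shows "norm (x ^ n) \<le> a ^ n"
  by (rule order_trans[OF norm_power_ineq power_mono[OF assms norm_ge_zero]])

text \<open>Without gravity the solution is 2 - s, between 3/4 and 9/4. In general P lies in
  [5/8, 19/8] and the integral term is at most 1/8, which gives the bounds of the box.\<close>

definition profile_box :: "(real \<Rightarrow>\<^sub>C real) set" where
  "profile_box = {V. \<forall>t. 1/2 \<le> apply_bcontfun V t \<and> apply_bcontfun V t \<le> 5/2}"

lemma profile_box_eq: "profile_box = (\<Inter>t. (\<lambda>V. apply_bcontfun V t) -` {1/2..5/2})"
  by (auto simp: profile_box_def)

lemma closed_profile_box: "closed profile_box"
  unfolding profile_box_eq
  by (intro closed_INT ballI closed_vimage closed_atLeastAtMost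
      linear_continuous_on bounded_linear_apply_bcontfun)

lemma convex_profile_box: "convex profile_box"
  unfolding profile_box_eq
  by (intro convex_INT convex_linear_vimage bounded_linear.linear[OF bounded_linear_apply_bcontfun]
      convex_real_interval)

lemma profile_box_norm: "V \<in> profile_box \<Longrightarrow> norm V \<le> 5/2"
proof (rule norm_bound)
  fix t assume "V \<in> profile_box"
  then have "1/2 \<le> V t \<and> V t \<le> 5/2" by (simp add: profile_box_def)
  then show "norm (V t) \<le> 5/2" by (simp add: abs_le_iff)
qed

text \<open>For a cap of length s, V t stands for W / (s t) at distance s t from the pole. Then the
  moment is (s t)^2 J, the denominator H W - g^2 I is s t Gq, and q = 1 / Gq, so W'' = - 2 - 16 g^2
  V J q^3 is regular at the pole. N is this equation integrated twice and divided by s t; T stands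
  for g^2 s t, P for the part without the integral, and C for the height times m.\<close>

locale profile_equation =
  fixes U :: "'a::euclidean_space set" and P T H C :: "'a \<Rightarrow> real \<Rightarrow>\<^sub>C real" and \<epsilon> c :: real
  assumes U: "open U" and smooth: "Cinf_on U P" "Cinf_on U T" "Cinf_on U H" "Cinf_on U C"
    and T: "\<And>l. l \<in> U \<Longrightarrow> norm (T l) \<le> \<epsilon>" and C: "\<And>l. l \<in> U \<Longrightarrow> norm (C l) \<le> c"
    and H: "\<And>l t. l \<in> U \<Longrightarrow> 1 \<le> H l t" "\<And>l. l \<in> U \<Longrightarrow> norm (H l) \<le> 3"
    and P: "\<And>l t. l \<in> U \<Longrightarrow> 5/8 \<le> P l t" "\<And>l t. l \<in> U \<Longrightarrow> P l t \<le> 19/8"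
    and small: "\<epsilon> * c \<le> 1 / 1000000" "0 \<le> \<epsilon>" "0 \<le> c"
begin

definition J where "J l V = avg1 (C l * V)"
definition Gq where "Gq l V = H l * V - T l * J l V"
definition q where "q l V = superpose inverse (Gq l V)"
definition M where "M l V = V * J l V * q l V ^ 3"
definition N where "N l V = P l - 16 *\<^sub>R (T l * avg2 (M l V))"

lemma norm_J: "l \<in> U \<Longrightarrow> V \<in> profile_box \<Longrightarrow> norm (J l V) \<le> c * (5/2)"
  unfolding J_def by (rule order_trans[OF norm_avg(1) norm_mult_le[OF C profile_box_norm]])

lemma norm_TJ: "l \<in> U \<Longrightarrow> V \<in> profile_box \<Longrightarrow> norm (T l * J l V) \<le> 1/4"
  using norm_mult_le[OF T norm_J, of l l V] small by simp

lemma Gq_bounds: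
  assumes "l \<in> U" "V \<in> profile_box"
  shows "1/4 \<le> Gq l V t" "Gq l V t \<le> 9"
proof -
  have a: "\<bar>T l t * J l V t\<bar> \<le> 1/4"
    using norm_bounded[of "T l * J l V" t] norm_TJ[OF assms] by (simp add: abs_mult)
  have v: "1/2 \<le> V t" "V t \<le> 5/2" using assms(2) by (auto simp: profile_box_def)
  have h: "1 \<le> H l t" "H l t \<le> 3"
    using H[OF assms(1)] norm_bounded[of "H l" t] order_trans by (auto simp: abs_le_iff intro: order_trans)
  have "1 * (1/2) \<le> H l t * V t" "H l t * V t \<le> 3 * (5/2)"
    using v h by (intro mult_mono; simp)+
  then show "1/4 \<le> Gq l V t" "Gq l V t \<le> 9"
    using a unfolding Gq_def by (simp_all add: abs_le_iff)
qed

lemma Gq_range: "l \<in> U \<Longrightarrow> V \<in> profile_box \<Longrightarrow> range (Gq l V) \<subseteq> {1/4..9}"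
  using Gq_bounds by auto

lemma q_apply:
  assumes "l \<in> U" "V \<in> profile_box" shows "q l V t = inverse (Gq l V t)"
  unfolding q_def by (rule apply_superpose[OF _ _ Gq_range[OF assms]]) (auto intro!: continuous_intros)

lemma norm_q:
  assumes "l \<in> U" "V \<in> profile_box" shows "norm (q l V) \<le> 4"
proof (rule norm_bound)
  show "norm (q l V t) \<le> 4" for t
    using Gq_bounds(1)[OF assms, of t] le_imp_inverse_le[of "1/4" "Gq l V t"] by (simp add: q_apply assms)
qed

lemma norm_M:
  assumes "l \<in> U" "V \<in> profile_box" shows "norm (M l V) \<le> 5/2 * (c * (5/2)) * 4 ^ 3"
  unfolding M_def by (intro norm_mult_le norm_power_le profile_box_norm norm_J norm_q assms)

lemma norm_N_diff:
  assumes "l \<in> U" "V \<in> profile_box" shows "norm (16 *\<^sub>R (T l * avg2 (M l V))) \<le> 1/8"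
proof -
  have "norm (T l * avg2 (M l V)) \<le> \<epsilon> * (5/2 * (c * (5/2)) * 4 ^ 3)"
    by (rule norm_mult_le[OF T[OF assms(1)] order_trans[OF norm_avg(2) norm_M[OF assms]]])
  also have "\<dots> = 400 * (\<epsilon> * c)" by simp
  finally show ?thesis using small(1) by simp
qed

lemma N_box: "l \<in> U \<Longrightarrow> V \<in> profile_box \<Longrightarrow> N l V \<in> profile_box"
proof -
  assume l: "l \<in> U" "V \<in> profile_box"
  have b: "\<bar>(16 *\<^sub>R (T l * avg2 (M l V))) t\<bar> \<le> 1/8" for t
    using norm_bounded[of "16 *\<^sub>R (T l * avg2 (M l V))" t] norm_N_diff[OF l] unfolding real_norm_def by linarith
  have "1/2 \<le> P l t - (16 *\<^sub>R (T l * avg2 (M l V))) t \<and> P l t - (16 *\<^sub>R (T l * avg2 (M l V))) t \<le> 5/2" for t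
    using P(1)[OF l(1), of t] P(2)[OF l(1), of t] abs_le_D1[OF b[of t]] abs_le_D2[OF b[of t]] by linarith
  then show "N l V \<in> profile_box" unfolding profile_box_def N_def by simp
qed

definition DP where "DP l = frechet_derivative P (at l)"
definition DT where "DT l = frechet_derivative T (at l)"
definition DH where "DH l = frechet_derivative H (at l)"
definition DC where "DC l = frechet_derivative C (at l)"

definition avg1L :: "(real \<Rightarrow>\<^sub>C real) \<Rightarrow>\<^sub>L (real \<Rightarrow>\<^sub>C real)" where "avg1L = Blinfun avg1"
definition avg2L :: "(real \<Rightarrow>\<^sub>C real) \<Rightarrow>\<^sub>L (real \<Rightarrow>\<^sub>C real)" where "avg2L = Blinfun avg2"

lemma avgL_apply [simp]: "avg1L u = avg1 u" "avg2L u = avg2 u"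
  by (simp_all add: avg1L_def avg2L_def bounded_linear_Blinfun_apply bounded_linear_avg)

text \<open>The partial derivative of N in V, written as a composition of bounded operators so that
  its smooth dependence on the parameters follows from bilinearity. The factor - 3 V J q^4 comes
  from differentiating the cube of q = 1 / Gq.\<close>

definition NV :: "'a \<Rightarrow> (real \<Rightarrow>\<^sub>C real) \<Rightarrow> (real \<Rightarrow>\<^sub>C real) \<Rightarrow>\<^sub>L (real \<Rightarrow>\<^sub>C real)" where
  "NV l V = (-16) *\<^sub>R (blinfun_mult_right (T l) o\<^sub>L avg2L o\<^sub>L
      (blinfun_mult_right (J l V * q l V ^ 3) + (blinfun_mult_right (V * q l V ^ 3) o\<^sub>L avg1L o\<^sub>L blinfun_mult_right (C l))
       + (blinfun_mult_right ((-3) *\<^sub>R (V * J l V * q l V ^ 4)) o\<^sub>L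
          (blinfun_mult_right (H l) - (blinfun_mult_right (T l) o\<^sub>L avg1L o\<^sub>L blinfun_mult_right (C l))))))"

definition Nl where
  "Nl l V h = DP l h - 16 *\<^sub>R (DT l h * avg2 (M l V) + T l * avg2 (V * avg1 (DC l h * V) * q l V ^ 3
      + (-3) *\<^sub>R (V * J l V * q l V ^ 4) * (DH l h * V - (DT l h * J l V + T l * avg1 (DC l h * V)))))"

lemma coeff_derivatives:
  assumes "l \<in> U"
  shows "(P has_derivative DP l) (at l)" "(T has_derivative DT l) (at l)"
    "(H has_derivative DH l) (at l)" "(C has_derivative DC l) (at l)"
  unfolding DP_def DT_def DH_def DC_def
  by (rule Cinf_on_has_derivative[OF smooth(1) assms], rule Cinf_on_has_derivative[OF smooth(2) assms],
      rule Cinf_on_has_derivative[OF smooth(3) assms], rule Cinf_on_has_derivative[OF smooth(4) assms])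

lemma fst_derivative:
  assumes "(f has_derivative D) (at l)"
  shows "((\<lambda>p. f (fst p)) has_derivative (\<lambda>p. D (fst p))) (at (l, V))"
  by (rule has_derivative_compose[OF has_derivative_fst[OF has_derivative_ident]]) (simp add: assms)

lemma J_derivative:
  assumes "l \<in> U"
  shows "((\<lambda>p. J (fst p) (snd p)) has_derivative (\<lambda>p. avg1 (C l * snd p) + avg1 (DC l (fst p) * V))) (at (l, V))"
proof -
  have "((\<lambda>p. C (fst p) * snd p) has_derivative (\<lambda>p. C l * snd p + DC l (fst p) * V)) (at (l, V))"
    using has_derivative_mult[OF fst_derivative[OF coeff_derivatives(4)[OF assms]] has_derivative_snd[OF has_derivative_ident], of V]
    by simp
  from bounded_linear.has_derivative[OF bounded_linear_avg(1) this]
  show ?thesis unfolding J_def by (simp add: linear_add[OF bounded_linear.linear[OF bounded_linear_avg(1)]])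
qed

lemma Gq_derivative:
  assumes "l \<in> U"
  shows "((\<lambda>p. Gq (fst p) (snd p)) has_derivative (\<lambda>p. (H l * snd p + DH l (fst p) * V) -
    (T l * (avg1 (C l * snd p) + avg1 (DC l (fst p) * V)) + DT l (fst p) * J l V))) (at (l, V))"
proof -
  have 1: "((\<lambda>p. H (fst p) * snd p) has_derivative (\<lambda>p. H l * snd p + DH l (fst p) * V)) (at (l, V))"
    using has_derivative_mult[OF fst_derivative[OF coeff_derivatives(3)[OF assms]] has_derivative_snd[OF has_derivative_ident], of V]
    by simp
  have 2: "((\<lambda>p. T (fst p) * J (fst p) (snd p)) has_derivative
      (\<lambda>p. T l * (avg1 (C l * snd p) + avg1 (DC l (fst p) * V)) + DT l (fst p) * J l V)) (at (l, V))"
    using has_derivative_mult[OF fst_derivative[OF coeff_derivatives(2)[OF assms]] J_derivative[OF assms], of V]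
    by simp
  show ?thesis unfolding Gq_def using has_derivative_diff[OF 1 2] by (simp add: Gq_def)
qed

lemma superpose_inverse_derivative:
  assumes "l \<in> U" "V \<in> profile_box"
  shows "superpose (\<lambda>u. - (inverse u ^ 2)) (Gq l V) = - (q l V ^ 2)"
proof (rule bcontfun_eqI)
  fix t
  have "superpose (\<lambda>u. - (inverse u ^ 2)) (Gq l V) t = - (inverse (Gq l V t) ^ 2)"
    by (rule apply_superpose[OF _ _ Gq_range[OF assms]]) (auto intro!: continuous_intros)
  then show "superpose (\<lambda>u. - (inverse u ^ 2)) (Gq l V) t = (- (q l V ^ 2)) t" by (simp add: q_apply assms)
qed

lemma q_derivative:
  assumes "l \<in> U" "V \<in> profile_box" "((\<lambda>p. Gq (fst p) (snd p)) has_derivative D) (at (l, V))"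
  shows "((\<lambda>p. q (fst p) (snd p)) has_derivative (\<lambda>p. - (q l V ^ 2) * D p)) (at (l, V))"
proof -
  have "(superpose inverse has_derivative (\<lambda>h. superpose (\<lambda>u. - (inverse u ^ 2)) (Gq l V) * h)) (at (Gq l V))"
  proof (rule superpose_has_derivative[of "- {0}"])
    show "(inverse has_real_derivative - (inverse u ^ 2)) (at u)" if "u \<in> - {0}" for u :: real
      using DERIV_inverse[of u] that by (simp add: power2_eq_square)
    show "range (Gq l V) \<subseteq> {1/4..9}" by (rule Gq_range[OF assms(1,2)])
  qed (auto intro!: continuous_intros)
  then have "(superpose inverse has_derivative (\<lambda>h. - (q l V ^ 2) * h)) (at (Gq (fst (l, V)) (snd (l, V))))"
    by (simp add: superpose_inverse_derivative assms)
  from has_derivative_compose[OF assms(3) this] show ?thesis unfolding q_def .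
qed

lemma N_derivative:
  assumes l: "l \<in> U" and V: "V \<in> profile_box"
  shows "((\<lambda>p. N (fst p) (snd p)) has_derivative (\<lambda>(h, k). Nl l V h + NV l V k)) (at (l, V))"
proof -
  let ?J' = "\<lambda>p. avg1 (C l * snd p) + avg1 (DC l (fst p) * V)"
  let ?G' = "\<lambda>p. (H l * snd p + DH l (fst p) * V) - (T l * ?J' p + DT l (fst p) * J l V)"
  let ?q' = "\<lambda>p. - (q l V ^ 2) * ?G' p"
  let ?q3' = "\<lambda>p. q l V * q l V * ?q' p + (q l V * ?q' p + ?q' p * q l V) * q l V"
  note qd = q_derivative[OF l V Gq_derivative[OF l]]
  have q3: "((\<lambda>p. q (fst p) (snd p) ^ 3) has_derivative ?q3') (at (l, V))"
    unfolding power3_eq_cube using has_derivative_mult[OF has_derivative_mult[OF qd qd] qd] by simp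
  let ?M' = "\<lambda>p. V * J l V * ?q3' p + (V * ?J' p + snd p * J l V) * q l V ^ 3"
  have "((\<lambda>p. snd p * J (fst p) (snd p) * q (fst p) (snd p) ^ 3) has_derivative ?M') (at (l, V))"
    using has_derivative_mult[OF has_derivative_mult[OF has_derivative_snd[OF has_derivative_ident] J_derivative[OF l]] q3]
    by simp
  then have M': "((\<lambda>p. M (fst p) (snd p)) has_derivative ?M') (at (l, V))" unfolding M_def .
  define M' where "M' = ?M'"
  from bounded_linear.has_derivative[OF bounded_linear_avg(2) M'[folded M'_def]]
  have A: "((\<lambda>p. avg2 (M (fst p) (snd p))) has_derivative (\<lambda>p. avg2 (M' p))) (at (l, V))" .
  have "((\<lambda>p. P (fst p) - 16 *\<^sub>R (T (fst p) * avg2 (M (fst p) (snd p)))) has_derivative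
      (\<lambda>p. DP l (fst p) - 16 *\<^sub>R (T (fst (l, V)) * avg2 (M' p) + DT l (fst p) * avg2 (M (fst (l, V)) (snd (l, V)))))) (at (l, V))"
    by (rule has_derivative_diff[OF fst_derivative[OF coeff_derivatives(1)[OF l]]
        has_derivative_scaleR_right[OF has_derivative_mult[OF fst_derivative[OF coeff_derivatives(2)[OF l]] A]]])
  then have "((\<lambda>p. N (fst p) (snd p)) has_derivative
      (\<lambda>p. DP l (fst p) - 16 *\<^sub>R (T l * avg2 (M' p) + DT l (fst p) * avg2 (M l V)))) (at (l, V))"
    unfolding N_def fst_conv snd_conv .
  moreover have "DP l (fst p) - 16 *\<^sub>R (T l * avg2 (M' p) + DT l (fst p) * avg2 (M l V)) =
      (\<lambda>(h, k). Nl l V h + NV l V k) p" for p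
  proof -
    obtain h k where p: "p = (h, k)" by (cases p)
    define M1 where "M1 = V * avg1 (DC l h * V) * q l V ^ 3
      + (-3) *\<^sub>R (V * J l V * q l V ^ 4) * (DH l h * V - (DT l h * J l V + T l * avg1 (DC l h * V)))"
    define M2 where "M2 = J l V * q l V ^ 3 * k + V * q l V ^ 3 * avg1 (C l * k)
      + ((-3) *\<^sub>R (V * J l V * q l V ^ 4)) * (H l * k - T l * avg1 (C l * k))"
    have e: "M' p = M1 + M2"
      by (rule bcontfun_eqI) (simp add: p M'_def M1_def M2_def algebra_simps power2_eq_square power3_eq_cube power4_eq_xxxx)
    have 1: "Nl l V h = DP l h - 16 *\<^sub>R (DT l h * avg2 (M l V) + T l * avg2 M1)"
      by (simp add: Nl_def M1_def)
    have 2: "NV l V k = (-16) *\<^sub>R (T l * avg2 M2)"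
      by (simp add: NV_def M2_def blinfun.add_left blinfun.diff_left blinfun.scaleR_left blinfun.minus_left)
    have "avg2 (M' p) = avg2 M1 + avg2 M2"
      unfolding e by (rule linear_add[OF bounded_linear.linear[OF bounded_linear_avg(2)]])
    then show ?thesis unfolding p prod.case 1 2 by (simp add: p algebra_simps)
  qed
  ultimately show ?thesis by (simp only:)
qed

lemma norm_NV:
  assumes l: "l \<in> U" and V: "V \<in> profile_box"
  shows "norm (NV l V) \<le> 1/2"
proof (rule norm_blinfun_bound)
  fix k :: "real \<Rightarrow>\<^sub>C real"
  let ?n = "norm k"
  let ?M2 = "J l V * q l V ^ 3 * k + V * q l V ^ 3 * avg1 (C l * k)
      + ((-3) *\<^sub>R (V * J l V * q l V ^ 4)) * (H l * k - T l * avg1 (C l * k))"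
  have 2: "NV l V k = (-16) *\<^sub>R (T l * avg2 ?M2)"
    by (simp add: NV_def blinfun.add_left blinfun.diff_left blinfun.scaleR_left blinfun.minus_left)
  have C1: "norm (avg1 (C l * k)) \<le> c * ?n"
    by (rule order_trans[OF norm_avg(1) norm_mult_le[OF C[OF l] order_refl]])
  have a: "norm (J l V * q l V ^ 3 * k) \<le> c * (5/2) * 4 ^ 3 * ?n"
    by (intro norm_mult_le norm_power_le norm_J norm_q l V order_refl)
  have b: "norm (V * q l V ^ 3 * avg1 (C l * k)) \<le> 5/2 * 4 ^ 3 * (c * ?n)"
    by (intro norm_mult_le norm_power_le norm_q profile_box_norm l V C1)
  have d1: "norm (V * J l V * q l V ^ 4) \<le> 5/2 * (c * (5/2)) * 4 ^ 4"
    by (intro norm_mult_le norm_power_le norm_J norm_q profile_box_norm l V)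
  have d2: "norm (H l * k - T l * avg1 (C l * k)) \<le> 3 * ?n + \<epsilon> * (c * ?n)"
    by (rule order_trans[OF norm_triangle_ineq4 add_mono[OF norm_mult_le[OF H(2)[OF l] order_refl] norm_mult_le[OF T[OF l] C1]]])
  have "\<epsilon> * c * ?n \<le> 1 * ?n" using small by (intro mult_right_mono) auto
  with d2 have d2': "norm (H l * k - T l * avg1 (C l * k)) \<le> 4 * ?n" by (simp add: mult.assoc)
  have "norm ((-3) *\<^sub>R (V * J l V * q l V ^ 4)) \<le> 3 * (5/2 * (c * (5/2)) * 4 ^ 4)"
    using d1 by simp
  from norm_mult_le[OF this d2']
  have d: "norm (((-3) *\<^sub>R (V * J l V * q l V ^ 4)) * (H l * k - T l * avg1 (C l * k)))
      \<le> 3 * (5/2 * (c * (5/2)) * 4 ^ 4) * (4 * ?n)" .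
  have "norm ?M2 \<le> c * (5/2) * 4 ^ 3 * ?n + 5/2 * 4 ^ 3 * (c * ?n) + 3 * (5/2 * (c * (5/2)) * 4 ^ 4) * (4 * ?n)"
    by (rule order_trans[OF norm_triangle_ineq add_mono[OF order_trans[OF norm_triangle_ineq add_mono[OF a b]] d]])
  also have "\<dots> = 19520 * (c * ?n)" by (simp add: algebra_simps)
  finally have "norm (avg2 ?M2) \<le> 19520 * (c * ?n)" by (rule order_trans[OF norm_avg(2)])
  from norm_mult_le[OF T[OF l] this]
  have "norm (NV l V k) \<le> 16 * (\<epsilon> * (19520 * (c * ?n)))" unfolding 2 by simp
  also have "\<dots> = 312320 * (\<epsilon> * c) * ?n" by (simp add: algebra_simps)
  \<comment> \<open>This estimate is the one for which the constant in \<open>small\<close> is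
    chosen: 312320 / 1000000 is below 1/2. The self-map property gets by with far less.\<close>
  also have "\<dots> \<le> 1/2 * ?n" using small(1) by (intro mult_right_mono) auto
  finally show "norm (NV l V k) \<le> 1/2 * norm k" .
qed simp

lemma N_contraction:
  assumes l: "l \<in> U" and V: "V \<in> profile_box" "W \<in> profile_box"
  shows "norm (N l V - N l W) \<le> 1/2 * norm (V - W)"
proof (rule differentiable_bound[OF convex_profile_box _ _ V])
  fix V assume V: "V \<in> profile_box"
  have "((\<lambda>V. (l, V)) has_derivative (\<lambda>k. (0, k))) (at V)"
    by (intro has_derivative_Pair has_derivative_ident has_derivative_const)
  from has_derivative_compose[OF this N_derivative[OF l V]]
  have "(N l has_derivative (\<lambda>k. Nl l V 0 + NV l V k)) (at V)" by simp
  moreover have "Nl l V 0 = 0"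
    using linear_0[OF has_derivative_linear[OF coeff_derivatives(1)[OF l]]]
      linear_0[OF has_derivative_linear[OF coeff_derivatives(2)[OF l]]]
      linear_0[OF has_derivative_linear[OF coeff_derivatives(3)[OF l]]]
      linear_0[OF has_derivative_linear[OF coeff_derivatives(4)[OF l]]]
      linear_0[OF bounded_linear.linear[OF bounded_linear_avg(1)]]
      linear_0[OF bounded_linear.linear[OF bounded_linear_avg(2)]]
    by (simp add: Nl_def)
  ultimately show "(N l has_derivative blinfun_apply (NV l V)) (at V within profile_box)"
    by (simp add: has_derivative_at_withinI)
  show "onorm (blinfun_apply (NV l V)) \<le> 1/2"
    using norm_NV[OF l V] by (simp add: norm_blinfun.rep_eq)
qed

definition sol where "sol l = (THE V. V \<in> profile_box \<and> N l V = V)"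

lemma sol_ex1: "l \<in> U \<Longrightarrow> \<exists>!V. V \<in> profile_box \<and> N l V = V"
proof (rule Banach_fix[of _ "1/2"])
  show "complete profile_box" using closed_profile_box complete_eq_closed by blast
  have "1 *\<^sub>R (1 :: real \<Rightarrow>\<^sub>C real) \<in> profile_box" by (simp add: profile_box_def)
  then show "profile_box \<noteq> {}" by blast
qed (use N_box N_contraction in \<open>auto simp: dist_norm\<close>)

lemma sol: "l \<in> U \<Longrightarrow> sol l \<in> profile_box" "l \<in> U \<Longrightarrow> N l (sol l) = sol l"
  using theI'[OF sol_ex1] by (auto simp: sol_def)

lemma sol_unique: "l \<in> U \<Longrightarrow> V \<in> profile_box \<Longrightarrow> N l V = V \<Longrightarrow> V = sol l"
  using sol_ex1 sol by blast

lemma continuous_sol: "continuous_on U sol"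
proof (rule continuous_at_imp_continuous_on, rule ballI)
  fix l assume l: "l \<in> U"
  have "isCont (\<lambda>p. N (fst p) (snd p)) (l, sol l)"
    by (rule has_derivative_continuous[OF N_derivative[OF l sol(1)[OF l]]])
  then have "isCont (\<lambda>m. N m (sol l)) l"
    using isCont_o2[where f = "\<lambda>m. (m, sol l)" and a = l and g = "\<lambda>p. N (fst p) (snd p)"] by (simp add: continuous_intros)
  then have "((\<lambda>m. N m (sol l) - N l (sol l)) \<longlongrightarrow> 0) (at l)"
    unfolding isCont_def by (rule LIM_zero)
  from tendsto_mult_left[OF tendsto_norm_zero[OF this], of 2]
  have lim: "((\<lambda>m. 2 * norm (N m (sol l) - N l (sol l))) \<longlongrightarrow> 0) (at l)" by simp
  have "\<forall>\<^sub>F m in at l. norm (sol m - sol l) \<le> 2 * norm (N m (sol l) - N l (sol l))"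
    using eventually_at_in_open'[OF U l]
  proof eventually_elim
    case (elim m)
    \<comment> \<open>Both solutions are compared under the parameter m; the first bracket is at
      most half of the left-hand side by contraction and is absorbed.\<close>
    have "sol m - sol l = (N m (sol m) - N m (sol l)) + (N m (sol l) - N l (sol l))"
      using sol(2)[OF elim] sol(2)[OF l] by simp
    from norm_triangle_ineq[of "N m (sol m) - N m (sol l)" "N m (sol l) - N l (sol l)", folded this]
    show ?case using N_contraction[OF elim sol(1)[OF elim] sol(1)[OF l]] by linarith
  qed
  from LIM_zero_cancel[OF Lim_null_comparison[OF this lim]]
  show "isCont sol l" unfolding isCont_def .
qed

lemma k_smooth_J:
  "k_smooth_on n U X \<Longrightarrow> k_smooth_on n U (\<lambda>l. J l (X l))"
  unfolding J_def
  by (intro k_smooth_on_bounded_linear_compose[OF U bounded_linear_avg(1)] k_smooth_on_mult[OF U]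
      Cinf_on_k[OF smooth(4)])

lemma k_smooth_Gq:
  "k_smooth_on n U X \<Longrightarrow> k_smooth_on n U (\<lambda>l. Gq l (X l))"
  unfolding Gq_def
  by (intro k_smooth_on_diff[OF U] k_smooth_on_mult[OF U] k_smooth_J
      Cinf_on_k[OF smooth(2)] Cinf_on_k[OF smooth(3)])

lemma k_smooth_q:
  assumes "k_smooth_on n U X" "\<And>l. l \<in> U \<Longrightarrow> X l \<in> profile_box"
  shows "k_smooth_on n U (\<lambda>l. q l (X l))"
  unfolding q_def
proof (rule k_smooth_on_superpose[OF U _ Cinf_on_real_inverse k_smooth_Gq[OF assms(1)]])
  show "open (- {0::real})" by auto
  show "\<exists>K. compact K \<and> K \<subseteq> - {0} \<and> range (Gq l (X l)) \<subseteq> K" if "l \<in> U" for l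
    using Gq_range[OF that assms(2)[OF that]] by (intro exI[of _ "{1/4..9}"]) auto
qed

lemma k_smooth_M:
  assumes "k_smooth_on n U X" "\<And>l. l \<in> U \<Longrightarrow> X l \<in> profile_box"
  shows "k_smooth_on n U (\<lambda>l. M l (X l))"
  unfolding M_def
  by (intro k_smooth_on_mult[OF U] k_smooth_on_power[OF U] assms(1) k_smooth_J[OF assms(1)] k_smooth_q[OF assms])

lemma k_smooth_NV:
  assumes "k_smooth_on n U X" "\<And>l. l \<in> U \<Longrightarrow> X l \<in> profile_box"
  shows "k_smooth_on n U (\<lambda>l. NV l (X l))"
proof -
  note m = k_smooth_on_bounded_linear_compose[OF U bounded_linear_blinfun_mult_right]
  note o = k_smooth_on_bilinear[OF U bounded_bilinear_blinfun_compose]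
  note [intro] = k_smooth_J[OF assms(1)] k_smooth_q[OF assms]
  show ?thesis
    unfolding NV_def
    by (intro k_smooth_on_scaleR_const[OF U] o m k_smooth_on_add[OF U] k_smooth_on_diff[OF U]
        k_smooth_on_mult[OF U] k_smooth_on_power[OF U] k_smooth_on_const assms(1)
        Cinf_on_k[OF smooth(2)] Cinf_on_k[OF smooth(3)] Cinf_on_k[OF smooth(4)]
        k_smooth_J[OF assms(1)] k_smooth_q[OF assms])
qed

lemma k_smooth_Nl:
  assumes "k_smooth_on n U X" "\<And>l. l \<in> U \<Longrightarrow> X l \<in> profile_box"
  shows "k_smooth_on n U (\<lambda>l. Nl l (X l) v)"
  unfolding Nl_def DP_def DT_def DH_def DC_def
  by (intro k_smooth_on_scaleR_const[OF U] k_smooth_on_add[OF U] k_smooth_on_diff[OF U]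
        k_smooth_on_mult[OF U] k_smooth_on_power[OF U] k_smooth_on_const assms(1)
        k_smooth_on_bounded_linear_compose[OF U bounded_linear_avg(1)]
        k_smooth_on_bounded_linear_compose[OF U bounded_linear_avg(2)]
        Cinf_on_k[OF smooth(2)] Cinf_on_k[OF smooth(3)] Cinf_on_k[OF smooth(4)]
        Cinf_on_k[OF Cinf_on_frechet_derivative[OF smooth(1)]]
        Cinf_on_k[OF Cinf_on_frechet_derivative[OF smooth(2)]]
        Cinf_on_k[OF Cinf_on_frechet_derivative[OF smooth(3)]]
        Cinf_on_k[OF Cinf_on_frechet_derivative[OF smooth(4)]]
        k_smooth_J[OF assms(1)] k_smooth_M[OF assms] k_smooth_q[OF assms])

theorem smooth_sol: "Cinf_on U sol"
proof (rule fixed_point_smooth[where N = "\<lambda>p. N (fst p) (snd p)" and A = "\<lambda>l. NV l (sol l)" and B = "\<lambda>l. Nl l (sol l)"])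
  show "open U" by (rule U)
  show "sol l = N (fst (l, sol l)) (snd (l, sol l))" if "l \<in> U" for l using sol(2)[OF that] by simp
  show "continuous_on U sol" by (rule continuous_sol)
  show "((\<lambda>p. N (fst p) (snd p)) has_derivative (\<lambda>(h, k). Nl l (sol l) h + NV l (sol l) k)) (at (l, sol l))"
    if "l \<in> U" for l by (rule N_derivative[OF that sol(1)[OF that]])
  show "norm (NV l (sol l)) \<le> 1/2" if "l \<in> U" for l by (rule norm_NV[OF that sol(1)[OF that]])
qed (rule k_smooth_NV k_smooth_Nl; simp add: sol)+

lemma Cinf_on_J_sol: "Cinf_on U (\<lambda>l. J l (sol l))"
  and Cinf_on_q_sol: "Cinf_on U (\<lambda>l. q l (sol l))"
  using k_smooth_J[OF Cinf_on_k[OF smooth_sol]] k_smooth_q[OF Cinf_on_k[OF smooth_sol] sol(1)]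
  by (simp_all add: Cinf_on_def)

end

section \<open>Caps as functions of the gravity g, the depth a of the pole and the distance s from
  it\<close>

lemma abs_diff_mult_le:
  fixes s a c :: real
  assumes "\<bar>a - 1\<bar> < 1/8" "-1/4 < s" "s < 5/4" "0 \<le> c" "c \<le> 1"
  shows "\<bar>s * c - a\<bar> \<le> 5/2"
proof -
  have "\<bar>s * c\<bar> \<le> 5/4 * 1" unfolding abs_mult using assms by (intro mult_mono) auto
  with assms(1) show ?thesis by linarith
qed

definition unit_arg :: "real \<Rightarrow>\<^sub>C real" where "unit_arg = Bcontfun unit_clamp"

lemma apply_unit_arg [simp]: "unit_arg t = unit_clamp t"
proof -
  have "unit_clamp \<in> bcontfun"
    using unit_clamp continuous_on_unit_clamp[OF continuous_on_id, of UNIV] by (intro bcontfun_normI[of _ 1]) auto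
  then show ?thesis by (simp add: unit_arg_def Bcontfun_inverse)
qed

text \<open>The prescribed curvature at height \<open>z\<close> is \<open>F (g z)\<close>; its derivative in \<open>z\<close> is \<open>g\<^sup>2 z m (g z)\<close>.\<close>

locale curvature_law =
  fixes F m :: "real \<Rightarrow> real" and d M :: real
  assumes d: "0 < d" "d \<le> 1"
    and F_smooth: "Cinf_on {- (3 * d)<..<3 * d} F" and m_smooth: "Cinf_on {- (3 * d)<..<3 * d} m"
    and F0: "F 0 = 2" and m0: "m 0 > 0"
    and F': "\<And>y. \<bar>y\<bar> < 3 * d \<Longrightarrow> (F has_real_derivative y * m y) (at y)"
    and F_bounds: "\<And>y. \<bar>y\<bar> < 3 * d \<Longrightarrow> 19/10 \<le> F y" "\<And>y. \<bar>y\<bar> < 3 * d \<Longrightarrow> F y \<le> 21/10"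
    and m_bound: "\<And>y. \<bar>y\<bar> < 3 * d \<Longrightarrow> \<bar>m y\<bar> \<le> M" and small_d: "6 * d\<^sup>2 * M \<le> 1 / 1000000"
begin

lemma M0: "0 \<le> M"
  using m_bound[of 0] d by simp

text \<open>The distance s runs past both ends. Values s < 0 continue the profile through the pole,
  so that it is smooth in a neighbourhood of it; values up to 5/4 reach at least 1/8 beyond s = a,
  where the height is 0.\<close>

definition pars :: "((real \<times> real) \<times> real) set" where
  "pars = ({-d<..<d} \<times> {7/8<..<9/8}) \<times> {-1/4<..<5/4}"

lemma open_pars: "open pars"
  unfolding pars_def by (intro open_Times open_greaterThanLessThan)

lemma pars_iff: "((g, a), s) \<in> pars \<longleftrightarrow> \<bar>g\<bar> < d \<and> \<bar>a - 1\<bar> < 1/8 \<and> -1/4 < s \<and> s < 5/4"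
  unfolding pars_def mem_Times_iff fst_conv snd_conv greaterThanLessThan_iff abs_less_iff
  by (rule iffI; elim conjE; intro conjI; linarith)

text \<open>The pole lies at height - a, so distance s t from it means height s t - a, and
  \<open>Yc\<close> is g times the height.\<close>

definition Yc :: "(real \<times> real) \<times> real \<Rightarrow> real \<Rightarrow>\<^sub>C real" where
  "Yc = (\<lambda>((g, a), s). (- (g * a)) *\<^sub>R 1 + (g * s) *\<^sub>R unit_arg)"
definition Hc where "Hc l = superpose F (Yc l)"
definition Cc where "Cc = (\<lambda>l. ((- snd (fst l)) *\<^sub>R 1 + snd l *\<^sub>R unit_arg) * superpose m (Yc l))"
definition Tc where "Tc = (\<lambda>((g, a), s). (g\<^sup>2 * s) *\<^sub>R unit_arg)"
definition Pc :: "(real \<times> real) \<times> real \<Rightarrow> real \<Rightarrow>\<^sub>C real" where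
  "Pc = (\<lambda>((g, a), s). (4 / F (- (g * a))) *\<^sub>R 1 - s *\<^sub>R unit_arg)"

lemma Yc_apply: "Yc ((g, a), s) t = g * (s * unit_clamp t - a)"
  by (simp add: Yc_def algebra_simps)

lemma Yc_range: "l \<in> pars \<Longrightarrow> range (Yc l) \<subseteq> {- (5/2 * d)..5/2 * d}"
proof (cases l rule: prod.exhaust, rename_tac ga s, case_tac ga)
  fix ga s g a assume l: "l \<in> pars" "l = (ga, s)" "ga = (g, a)"
  show ?thesis
  proof
    fix y assume "y \<in> range (Yc l)"
    then obtain t where y: "y = g * (s * unit_clamp t - a)" using l by (auto simp: Yc_apply)
    have "\<bar>y\<bar> \<le> d * (5/2)"
      unfolding y abs_mult
      using l abs_diff_mult_le[of a s "unit_clamp t"] unit_clamp[of t] d(1)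
      by (intro mult_mono) (auto simp: pars_iff)
    then show "y \<in> {- (5/2 * d)..5/2 * d}" by auto
  qed
qed

lemma sub_interval: "{- (5/2 * d)..5/2 * d} \<subseteq> {- (3 * d)<..<3 * d}"
  using d by auto

lemma Yc_less: "l \<in> pars \<Longrightarrow> \<bar>Yc l t\<bar> < 3 * d"
proof -
  assume "l \<in> pars"
  then have "Yc l t \<in> {- (5/2 * d)..5/2 * d}" using Yc_range[of l] by blast
  then have "Yc l t \<in> {- (3 * d)<..<3 * d}" using sub_interval by blast
  then show "\<bar>Yc l t\<bar> < 3 * d" by auto
qed

lemma superpose_Yc:
  assumes "l \<in> pars" "Cinf_on {- (3 * d)<..<3 * d} f"
  shows "superpose f (Yc l) t = f (Yc l t)"
  by (rule apply_superpose[OF continuous_on_subset[OF Cinf_on_imp_continuous_on[OF assms(2)] sub_interval] _ Yc_range[OF assms(1)]])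
    simp

lemma Hc_apply: "((g, a), s) \<in> pars \<Longrightarrow> Hc ((g, a), s) t = F (g * (s * unit_clamp t - a))"
  by (simp add: Hc_def superpose_Yc F_smooth Yc_apply)

lemma Cc_apply: "((g, a), s) \<in> pars \<Longrightarrow>
    Cc ((g, a), s) t = (s * unit_clamp t - a) * m (g * (s * unit_clamp t - a))"
  by (simp add: Cc_def superpose_Yc m_smooth Yc_apply)

lemma Tc_apply: "Tc ((g, a), s) t = g\<^sup>2 * s * unit_clamp t"
  by (simp add: Tc_def)

lemma Pc_apply: "Pc ((g, a), s) t = 4 / F (- (g * a)) - s * unit_clamp t"
  by (simp add: Pc_def)

lemma ga_less: "((g, a), s) \<in> pars \<Longrightarrow> \<bar>g * a\<bar> < 3 * d"
proof -
  assume l: "((g, a), s) \<in> pars"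
  then have "\<bar>a - 1\<bar> < 1/8" by (simp only: pars_iff)
  then have "\<bar>a\<bar> \<le> 2" by linarith
  then have "\<bar>g\<bar> * \<bar>a\<bar> \<le> d * 2" using l by (intro mult_mono) (auto simp: pars_iff)
  then show ?thesis using d by (simp add: abs_mult)
qed

lemma smooth_coeffs: "Cinf_on pars Pc" "Cinf_on pars Tc" "Cinf_on pars Hc" "Cinf_on pars Cc"
proof -
  note o = open_pars
  have g: "Cinf_on pars (\<lambda>l. fst (fst l))" and a: "Cinf_on pars (\<lambda>l. snd (fst l))" and s: "Cinf_on pars (\<lambda>l. snd l)"
    by (intro Cinf_on_fst Cinf_on_snd Cinf_on_ident o)+
  have ga: "Cinf_on pars (\<lambda>l. - (fst (fst l) * snd (fst l)))"
    by (intro Cinf_on_minus Cinf_on_mult o g a)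
  have Y: "Cinf_on pars Yc"
    unfolding Yc_def split_beta'
    by (intro Cinf_on_add Cinf_on_scaleR Cinf_on_mult Cinf_on_const o g s ga)
  have sup: "Cinf_on pars (\<lambda>l. superpose f (Yc l))" if "Cinf_on {- (3 * d)<..<3 * d} f" for f
    unfolding Cinf_on_def
  proof (rule allI, rule k_smooth_on_superpose[OF o open_greaterThanLessThan that Cinf_on_k[OF Y]])
    fix l assume "l \<in> pars"
    then show "\<exists>K. compact K \<and> K \<subseteq> {- (3 * d)<..<3 * d} \<and> range (Yc l) \<subseteq> K"
      by (intro exI[of _ "{- (5/2 * d)..5/2 * d}"] conjI compact_Icc sub_interval Yc_range)
  qed
  show "Cinf_on pars Hc" unfolding Hc_def by (rule sup[OF F_smooth])
  show "Cinf_on pars Cc" unfolding Cc_def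
    by (intro Cinf_on_mult Cinf_on_add Cinf_on_scaleR Cinf_on_minus Cinf_on_const o a s sup[OF m_smooth])
  show "Cinf_on pars Tc" unfolding Tc_def split_beta'
    by (intro Cinf_on_scaleR Cinf_on_mult Cinf_on_power Cinf_on_const o g s)
  have Fga: "Cinf_on pars (\<lambda>l. F (- (fst (fst l) * snd (fst l))))"
    by (rule Cinf_on_compose[OF o _ _ ga F_smooth]) (use ga_less in \<open>force simp: abs_less_iff\<close>)+
  have "F (- (fst (fst l) * snd (fst l))) \<noteq> 0" if "l \<in> pars" for l
    using F_bounds(1)[of "- (fst (fst l) * snd (fst l))"] ga_less[of "fst (fst l)" "snd (fst l)" "snd l"] that by simp
  then show "Cinf_on pars Pc" unfolding Pc_def split_beta'
    by (intro Cinf_on_diff Cinf_on_scaleR Cinf_on_divide Cinf_on_const o s Fga) auto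
qed

lemma four_over_F:
  assumes "\<bar>y\<bar> < 3 * d" shows "15/8 \<le> 4 / F y" "4 / F y \<le> 17/8"
  using F_bounds[OF assms] by (simp_all add: field_simps)

sublocale pe: profile_equation pars Pc Tc Hc Cc "2 * d\<^sup>2" "3 * M"
proof
  show "open pars" by (rule open_pars)
  show "Cinf_on pars Pc" "Cinf_on pars Tc" "Cinf_on pars Hc" "Cinf_on pars Cc" by (rule smooth_coeffs)+
  show "2 * d\<^sup>2 * (3 * M) \<le> 1 / 1000000" using small_d by simp
  show "0 \<le> 2 * d\<^sup>2" "0 \<le> 3 * M" using M0 by auto
next
  fix l t assume "l \<in> pars"
  then obtain g a s where l: "l = ((g, a), s)" "((g, a), s) \<in> pars" by (metis surj_pair)
  have b: "\<bar>g\<bar> < d" "\<bar>a - 1\<bar> < 1/8" "-1/4 < s" "s < 5/4" using l by (auto simp: pars_iff)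
  have "g\<^sup>2 \<le> d\<^sup>2" using b(1) by (simp add: abs_le_square_iff[symmetric])
  show "norm (Tc l) \<le> 2 * d\<^sup>2"
  proof (rule norm_bound)
    fix t
    have "\<bar>g\<^sup>2 * s * unit_clamp t\<bar> \<le> d\<^sup>2 * 2 * 1"
      unfolding abs_mult using b unit_clamp[of t] \<open>g\<^sup>2 \<le> d\<^sup>2\<close> by (intro mult_mono) auto
    then show "norm (Tc l t) \<le> 2 * d\<^sup>2" by (simp add: l Tc_apply)
  qed
  show "norm (Cc l) \<le> 3 * M"
  proof (rule norm_bound)
    fix t
    have "\<bar>s * unit_clamp t - a\<bar> \<le> 3"
      using abs_diff_mult_le[of a s "unit_clamp t"] b unit_clamp[of t] by auto
    moreover have "\<bar>m (g * (s * unit_clamp t - a))\<bar> \<le> M"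
      using m_bound[OF Yc_less[OF l(2), of t]] by (simp add: Yc_apply)
    ultimately have "\<bar>s * unit_clamp t - a\<bar> * \<bar>m (g * (s * unit_clamp t - a))\<bar> \<le> 3 * M"
      by (intro mult_mono) auto
    then show "norm (Cc l t) \<le> 3 * M" using l by (simp add: Cc_apply abs_mult)
  qed
  have Hb: "19/10 \<le> Hc l t" "Hc l t \<le> 21/10" for t
    using F_bounds[OF Yc_less[OF l(2), of t]] l by (simp_all add: Hc_apply Yc_apply)
  show "1 \<le> Hc l t" using Hb(1)[of t] by simp
  show "norm (Hc l) \<le> 3" 
  proof (rule norm_bound)
    show "norm (Hc l t) \<le> 3" for t using Hb[of t] by (simp add: abs_le_iff)
  qed
  have "\<bar>- (g * a)\<bar> < 3 * d" using ga_less[OF l(2)] by simp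
  from four_over_F[OF this] have "15/8 \<le> 4 / F (- (g * a))" "4 / F (- (g * a)) \<le> 17/8" .
  moreover have "s * unit_clamp t \<le> 5/4" "-1/4 \<le> s * unit_clamp t"
  proof -
    have "s * unit_clamp t \<le> max s 0" using unit_clamp[of t]
      by (cases "s \<ge> 0") (auto simp: mult_left_le max_def mult_nonpos_nonneg)
    then show "s * unit_clamp t \<le> 5/4" using b by auto
    have "min s 0 \<le> s * unit_clamp t" using unit_clamp[of t] mult_left_le[of "unit_clamp t" "- s"]
      by (cases "s \<ge> 0") auto
    then show "-1/4 \<le> s * unit_clamp t" using b by auto
  qed
  \<comment> \<open>5/8 = 15/8 - 5/4 and 19/8 = 17/8 + 1/4.\<close>
  ultimately show "5/8 \<le> Pc l t" "Pc l t \<le> 19/8" by (simp_all add: l Pc_apply)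
qed

text \<open>Evaluation at t = 1 turns dependence on the position into dependence on the parameter s,
  where smoothness is already known.\<close>

definition v where "v l = apply_bcontfun (pe.sol l) 1"
definition j where "j l = apply_bcontfun (pe.J l (pe.sol l)) 1"
definition q where "q l = apply_bcontfun (pe.q l (pe.sol l)) 1"

lemma smooth_vjq: "Cinf_on pars v" "Cinf_on pars j" "Cinf_on pars q"
  unfolding v_def j_def q_def
  by (rule Cinf_on_bounded_linear_compose[OF open_pars bounded_linear_apply_bcontfun];
      rule pe.smooth_sol pe.Cinf_on_J_sol pe.Cinf_on_q_sol)+

text \<open>Uniqueness of the fixed point makes the solutions for different lengths \<open>s\<close> dilations of each other.\<close>

lemma dilation:
  assumes l: "((g, a), s) \<in> pars" and \<theta>: "0 \<le> \<theta>" "\<theta> \<le> 1"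
  shows "((g, a), s * \<theta>) \<in> pars"
    "pe.sol ((g, a), s) \<theta> = v ((g, a), s * \<theta>)"
    "pe.J ((g, a), s) (pe.sol ((g, a), s)) \<theta> = j ((g, a), s * \<theta>)"
    "pe.q ((g, a), s) (pe.sol ((g, a), s)) \<theta> = q ((g, a), s * \<theta>)"
proof -
  let ?l = "((g, a), s)" and ?l' = "((g, a), s * \<theta>)"
  have "-1/4 < s * \<theta>" "s * \<theta> < 5/4"
  proof -
    have "s * \<theta> \<le> max s 0" using \<theta>
      by (cases "s \<ge> 0") (auto simp: mult_left_le max_def mult_nonpos_nonneg)
    then show "s * \<theta> < 5/4" using l by (auto simp: pars_iff)
    have "min s 0 \<le> s * \<theta>" using \<theta> mult_left_le[of \<theta> "- s"]
      by (cases "s \<ge> 0") auto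
    then show "-1/4 < s * \<theta>" using l by (auto simp: pars_iff)
  qed
  then show l': "?l' \<in> pars" using l by (simp add: pars_iff)
  define W where "W = Bcontfun (\<lambda>t. pe.sol ?l (\<theta> * unit_clamp t))"
  have "(\<lambda>t. pe.sol ?l (\<theta> * unit_clamp t)) \<in> bcontfun"
    by (rule bcontfun_normI[of _ "norm (pe.sol ?l)"])
      (auto simp del: real_norm_def intro!: norm_bounded continuous_on_compose2[OF continuous_on_apply_bcontfun[of UNIV]] continuous_intros)
  then have W: "W t = pe.sol ?l (\<theta> * unit_clamp t)" for t
    by (simp add: W_def Bcontfun_inverse)
  have box: "W \<in> profile_box" using pe.sol(1)[OF l] by (simp add: profile_box_def W)
  have cl: "unit_clamp (\<theta> * unit_clamp t) = \<theta> * unit_clamp t" for t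
    using \<theta> unit_clamp[of t] by (intro unit_clamp(3)) (auto simp: mult_le_one)
  have cl2: "unit_clamp (unit_clamp t * \<tau>) = unit_clamp t * \<tau>" if "\<tau> \<in> {0..1}" for t \<tau>
    using that unit_clamp[of t] by (intro unit_clamp(3)) (auto simp: mult_le_one)
  \<comment> \<open>All coefficients depend on s and t only through the product s t. As the averages
    run along rays, N commutes with the dilation.\<close>
  have co: "Pc ?l' t = Pc ?l (\<theta> * unit_clamp t)" "Tc ?l' t = Tc ?l (\<theta> * unit_clamp t)"
     "Hc ?l' t = Hc ?l (\<theta> * unit_clamp t)" "Cc ?l' t = Cc ?l (\<theta> * unit_clamp t)" for t
    using l l' by (simp_all add: Pc_apply Tc_apply Hc_apply Cc_apply cl mult.assoc)
  have avg: "avg1 u' t = avg1 u (\<theta> * unit_clamp t)" "avg2 u' t = avg2 u (\<theta> * unit_clamp t)"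
    if "\<And>t. u' t = u (\<theta> * unit_clamp t)" for u u' :: "real \<Rightarrow>\<^sub>C real" and t
    unfolding apply_avg
    by (auto intro!: integral_cong simp: that cl cl2 mult.assoc)
  have J: "pe.J ?l' W t = pe.J ?l (pe.sol ?l) (\<theta> * unit_clamp t)" for t
    unfolding pe.J_def by (rule avg(1)) (simp add: co W)
  have Gq: "pe.Gq ?l' W t = pe.Gq ?l (pe.sol ?l) (\<theta> * unit_clamp t)" for t
    by (simp add: pe.Gq_def J co W)
  have q': "pe.q ?l' W t = pe.q ?l (pe.sol ?l) (\<theta> * unit_clamp t)" for t
    using pe.q_apply[OF l' box] pe.q_apply[OF l pe.sol(1)[OF l]] by (simp add: Gq)
  have M': "pe.M ?l' W t = pe.M ?l (pe.sol ?l) (\<theta> * unit_clamp t)" for t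
    by (simp add: pe.M_def J q' W)
  have "pe.N ?l' W t = pe.N ?l (pe.sol ?l) (\<theta> * unit_clamp t)" for t
    by (simp add: pe.N_def co avg(2)[OF M'])
  then have "pe.N ?l' W = W" by (intro bcontfun_eqI) (simp add: pe.sol(2)[OF l] W)
  from pe.sol_unique[OF l' box this] have Weq: "W = pe.sol ?l'" .
  have one: "unit_clamp 1 = 1" by (simp add: unit_clamp_def)
  show "pe.sol ?l \<theta> = v ?l'" using W[of 1] by (simp add: v_def Weq[symmetric] one)
  show "pe.J ?l (pe.sol ?l) \<theta> = j ?l'" using J[of 1] by (simp add: j_def Weq[symmetric] one)
  show "pe.q ?l (pe.sol ?l) \<theta> = q ?l'" using q'[of 1] by (simp add: q_def Weq[symmetric] one)
qed

lemma one_clamp: "unit_clamp 1 = 1"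
  by (simp add: unit_clamp_def)

lemma v_bounds: "l \<in> pars \<Longrightarrow> 1/2 \<le> v l \<and> v l \<le> 5/2"
  using pe.sol(1)[of l] by (simp add: profile_box_def v_def)

lemma q_eq:
  assumes "((g, a), s) \<in> pars"
  shows "1/4 \<le> F (g * (s - a)) * v ((g, a), s) - g\<^sup>2 * s * j ((g, a), s)"
    "q ((g, a), s) = inverse (F (g * (s - a)) * v ((g, a), s) - g\<^sup>2 * s * j ((g, a), s))"
proof -
  have "pe.Gq ((g, a), s) (pe.sol ((g, a), s)) 1 = F (g * (s - a)) * v ((g, a), s) - g\<^sup>2 * s * j ((g, a), s)"
    using assms by (simp add: pe.Gq_def v_def j_def Hc_apply Tc_apply one_clamp)
  then show "1/4 \<le> F (g * (s - a)) * v ((g, a), s) - g\<^sup>2 * s * j ((g, a), s)"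
    "q ((g, a), s) = inverse (F (g * (s - a)) * v ((g, a), s) - g\<^sup>2 * s * j ((g, a), s))"
    using pe.Gq_bounds(1)[OF assms pe.sol(1)[OF assms], of 1] pe.q_apply[OF assms pe.sol(1)[OF assms], of 1]
    by (simp_all add: q_def)
qed

lemma j_bound: "l \<in> pars \<Longrightarrow> \<bar>j l\<bar> \<le> 8 * M"
proof -
  assume l: "l \<in> pars"
  show "\<bar>j l\<bar> \<le> 8 * M"
    using norm_bounded[of "pe.J l (pe.sol l)" 1] pe.norm_J[OF l pe.sol(1)[OF l]] M0
    unfolding j_def real_norm_def by linarith
qed

lemma v_integral:
  assumes l: "((g, a), s) \<in> pars"
  shows "v ((g, a), s) = 4 / F (- (g * a)) - s - 16 * (g\<^sup>2 * s * integral {0..1}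
    (\<lambda>\<tau>. (1 - \<tau>) * (v ((g, a), s * \<tau>) * j ((g, a), s * \<tau>) * q ((g, a), s * \<tau>) ^ 3)))"
proof -
  have 1: "v ((g, a), s) = Pc ((g, a), s) 1 - 16 * (Tc ((g, a), s) 1 * avg2 (pe.M ((g, a), s) (pe.sol ((g, a), s))) 1)"
    using arg_cong[OF pe.sol(2)[OF l], of "\<lambda>V. apply_bcontfun V 1"] by (simp add: v_def pe.N_def)
  have 2: "avg2 (pe.M ((g, a), s) (pe.sol ((g, a), s))) 1 = integral {0..1}
    (\<lambda>\<tau>. (1 - \<tau>) * (v ((g, a), s * \<tau>) * j ((g, a), s * \<tau>) * q ((g, a), s * \<tau>) ^ 3))"
    unfolding apply_avg
    by (rule integral_cong) (simp add: one_clamp pe.M_def dilation[OF l])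
  show ?thesis unfolding 1 2 Pc_apply Tc_apply one_clamp by simp
qed

lemma j_integral:
  assumes l: "((g, a), s) \<in> pars"
  shows "j ((g, a), s) = integral {0..1} (\<lambda>\<tau>. \<tau> * ((s * \<tau> - a) * m (g * (s * \<tau> - a)) * v ((g, a), s * \<tau>)))"
  unfolding j_def pe.J_def apply_avg
  by (rule integral_cong) (simp add: one_clamp Cc_apply[OF l] unit_clamp dilation[OF l])

end

lemma antiderivative_on_interval:
  fixes f :: "real \<Rightarrow> real"
  assumes "a < 0" "0 < b" "continuous_on {a<..<b} f"
  obtains A where "A 0 = 0" "\<And>x. x \<in> {a<..<b} \<Longrightarrow> (A has_real_derivative f x) (at x)"
proof -
  have "isCont f x" if "ereal a < ereal x" "ereal x < ereal b" for x
    using assms(3) that by (simp add: continuous_on_eq_continuous_at)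
  then have "\<exists>A. \<forall>x. ereal a < ereal x \<longrightarrow> ereal x < ereal b \<longrightarrow> (A has_vector_derivative f x) (at x)"
    using assms(1,2) by (intro einterval_antiderivative) auto
  then obtain A where
    A: "\<forall>x. ereal a < ereal x \<longrightarrow> ereal x < ereal b \<longrightarrow> (A has_vector_derivative f x) (at x)" by blast
  show ?thesis
  proof (rule that[of "\<lambda>x. A x - A 0"])
    fix x assume "x \<in> {a<..<b}"
    then have "(A has_real_derivative f x) (at x)"
      using A by (simp add: has_real_derivative_iff_has_vector_derivative)
    from DERIV_diff[OF this DERIV_const[of "A 0"]]
    show "((\<lambda>x. A x - A 0) has_real_derivative f x) (at x)" by simp
  qed simp
qed

lemma scaled_in_interval:
  fixes a b x \<tau> :: real
  assumes "a < 0" "0 < b" "x \<in> {a<..<b}" "0 \<le> \<tau>" "\<tau> \<le> 1"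
  shows "x * \<tau> \<in> {a<..<b}"
proof -
  have "x * \<tau> \<le> max x 0" using assms
    by (cases "x \<ge> 0") (auto simp: mult_left_le max_def mult_nonpos_nonneg)
  moreover have "min x 0 \<le> x * \<tau>" using assms mult_left_le[of \<tau> "- x"]
    by (cases "x \<ge> 0") auto
  ultimately show ?thesis using assms by auto
qed

lemma DERIV_dilate:
  fixes A :: "real \<Rightarrow> real"
  assumes "(A has_real_derivative D) (at (x * \<tau>))"
  shows "((\<lambda>\<tau>. A (x * \<tau>)) has_real_derivative D * x) (at \<tau>)"
  by (rule DERIV_chain2[where g = "\<lambda>\<tau>. x * \<tau>", OF assms]) (auto intro!: derivative_eq_intros)

text \<open>Substitution y = x \<tau> turns the left side into the integral of y f y from 0 to x; A
  is the primitive of this integrand that vanishes at 0.\<close>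

lemma integral_ray_linear:
  fixes A :: "real \<Rightarrow> real"
  assumes ab: "a < 0" "0 < b" and A: "A 0 = 0" "\<And>x. x \<in> {a<..<b} \<Longrightarrow> (A has_real_derivative x * f x) (at x)"
    and x: "x \<in> {a<..<b}"
  shows "x\<^sup>2 * integral {0..1} (\<lambda>\<tau>. \<tau> * f (x * \<tau>)) = A x"
proof -
  have "((\<lambda>\<tau>. x\<^sup>2 * (\<tau> * f (x * \<tau>))) has_integral (A (x * 1) - A (x * 0))) {0..1}"
  proof (rule fundamental_theorem_of_calculus)
    fix \<tau> :: real assume "\<tau> \<in> {0..1}"
    then have "x * \<tau> \<in> {a<..<b}" using scaled_in_interval[OF ab x] by auto
    from DERIV_dilate[OF A(2)[OF this]]
    have "((\<lambda>\<tau>. A (x * \<tau>)) has_real_derivative (x * \<tau>) * f (x * \<tau>) * x) (at \<tau>)" .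
    moreover have "(x * \<tau>) * f (x * \<tau>) * x = x\<^sup>2 * (\<tau> * f (x * \<tau>))" by (simp add: power2_eq_square)
    ultimately show "((\<lambda>\<tau>. A (x * \<tau>)) has_vector_derivative x\<^sup>2 * (\<tau> * f (x * \<tau>))) (at \<tau> within {0..1})"
      unfolding has_real_derivative_iff_has_vector_derivative by (metis has_vector_derivative_at_within)
  qed simp
  from integral_unique[OF this] show ?thesis using A(1) by simp
qed

text \<open>Cauchy's formula for repeated integration, scaled to the unit interval.\<close>

lemma integral_ray_complement:
  fixes A B :: "real \<Rightarrow> real"
  assumes ab: "a < 0" "0 < b" and A: "A 0 = 0" "\<And>x. x \<in> {a<..<b} \<Longrightarrow> (A has_real_derivative f x) (at x)"
    and B: "B 0 = 0" "\<And>x. x \<in> {a<..<b} \<Longrightarrow> (B has_real_derivative A x) (at x)"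
    and x: "x \<in> {a<..<b}"
  shows "x\<^sup>2 * integral {0..1} (\<lambda>\<tau>. (1 - \<tau>) * f (x * \<tau>)) = B x"
proof -
  have "((\<lambda>\<tau>. x\<^sup>2 * ((1 - \<tau>) * f (x * \<tau>))) has_integral
      (((1 - 1) * x * A (x * 1) + B (x * 1)) - ((1 - 0) * x * A (x * 0) + B (x * 0)))) {0..1}"
  proof (rule fundamental_theorem_of_calculus)
    fix \<tau> :: real assume "\<tau> \<in> {0..1}"
    then have i: "x * \<tau> \<in> {a<..<b}" using scaled_in_interval[OF ab x] by auto
    have 1: "((\<lambda>\<tau>. A (x * \<tau>)) has_real_derivative f (x * \<tau>) * x) (at \<tau>)"
      by (rule DERIV_dilate[OF A(2)[OF i]])
    have 2: "((\<lambda>\<tau>. B (x * \<tau>)) has_real_derivative A (x * \<tau>) * x) (at \<tau>)"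
      by (rule DERIV_dilate[OF B(2)[OF i]])
    have "((\<lambda>\<tau>. (1 - \<tau>) * x * A (x * \<tau>) + B (x * \<tau>)) has_real_derivative x\<^sup>2 * ((1 - \<tau>) * f (x * \<tau>))) (at \<tau>)"
      by (rule derivative_eq_intros 1 2 refl | simp add: power2_eq_square algebra_simps)+
    then show "((\<lambda>\<tau>. (1 - \<tau>) * x * A (x * \<tau>) + B (x * \<tau>)) has_vector_derivative x\<^sup>2 * ((1 - \<tau>) * f (x * \<tau>)))
        (at \<tau> within {0..1})"
      unfolding has_real_derivative_iff_has_vector_derivative by (rule has_vector_derivative_at_within)
  qed simp
  from integral_unique[OF this] show ?thesis using A(1) B(1) by simp
qed

context curvature_law
begin

section \<open>The profile equation near a pole\<close>

definition w where "w l = snd l * v l"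
definition I where "I l = (snd l)\<^sup>2 * j l"

lemma smooth_w: "Cinf_on pars w"
  unfolding w_def by (intro Cinf_on_mult Cinf_on_snd Cinf_on_ident open_pars smooth_vjq)

lemma smooth_I: "Cinf_on pars I"
  unfolding I_def by (intro Cinf_on_mult Cinf_on_power Cinf_on_snd Cinf_on_ident open_pars smooth_vjq)

lemma pars_slice: "((g, a), s) \<in> pars \<Longrightarrow> ((g, a), x) \<in> pars \<longleftrightarrow> x \<in> {-1/4<..<5/4}"
  by (auto simp: pars_iff)

lemma slice_continuous:
  assumes "((g, a), s) \<in> pars" "Cinf_on pars f"
  shows "continuous_on {-1/4<..<5/4} (\<lambda>x. f ((g, a), x))"
proof (rule continuous_on_compose2[OF Cinf_on_imp_continuous_on[OF assms(2)]])
  show "continuous_on {-1/4<..<5/4} (\<lambda>x. ((g, a), x))" by (intro continuous_intros)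
  show "(\<lambda>x. ((g, a), x)) ` {-1/4<..<5/4} \<subseteq> pars"
    by (rule image_subsetI) (simp only: pars_slice[OF assms(1)])
qed

text \<open>The averages are s^(-2) times the primitives \<open>K\<close> and \<open>M2\<close>,
  which exist because the integrands are continuous in s. Multiplication by powers of s yields
  formulas for w and I that can be differentiated at s = 0 as well.\<close>

lemma profile_ode:
  assumes l: "((g, a), s) \<in> pars"
  shows "pd2 w ((g, a), 0) = 4 / F (- (g * a))"
    "((\<lambda>x. pd2 w ((g, a), x)) has_real_derivative
      - 2 - 16 * g\<^sup>2 * (v ((g, a), s) * j ((g, a), s) * q ((g, a), s) ^ 3)) (at s)"
    "((\<lambda>x. I ((g, a), x)) has_real_derivative (s - a) * m (g * (s - a)) * w ((g, a), s)) (at s)"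
proof -
  note sl = pars_slice[OF l]
  define f where "f x = v ((g, a), x) * j ((g, a), x) * q ((g, a), x) ^ 3" for x
  define k where "k x = (x - a) * m (g * (x - a)) * v ((g, a), x)" for x
  have ab: "-1/4 < (0::real)" "0 < (5/4::real)" by auto
  have "continuous_on {-1/4<..<5/4} f"
    unfolding f_def by (intro continuous_intros slice_continuous[OF l] smooth_vjq)
  then obtain M1 where M1: "M1 0 = 0" "\<And>x. x \<in> {-1/4<..<5/4} \<Longrightarrow> (M1 has_real_derivative f x) (at x)"
    using antiderivative_on_interval[OF ab] by blast
  have "continuous_on {-1/4<..<5/4} M1" by (intro continuous_at_imp_continuous_on ballI DERIV_isCont[OF M1(2)])
  then obtain M2 where M2: "M2 0 = 0" "\<And>x. x \<in> {-1/4<..<5/4} \<Longrightarrow> (M2 has_real_derivative M1 x) (at x)"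
    using antiderivative_on_interval[OF ab] by blast
  have gx: "\<bar>g * (x - a)\<bar> < 3 * d" if "x \<in> {-1/4<..<5/4}" for x
    using Yc_less[of "((g, a), x)" 1] that sl by (simp add: Yc_apply one_clamp)
  have "continuous_on {-1/4<..<5/4} (\<lambda>x. m (g * (x - a)))"
  proof (rule continuous_on_compose2[OF Cinf_on_imp_continuous_on[OF m_smooth]])
    show "continuous_on {-1/4<..<5/4} (\<lambda>x. g * (x - a))" by (intro continuous_intros)
    show "(\<lambda>x. g * (x - a)) ` {-1/4<..<5/4} \<subseteq> {- (3 * d)<..<3 * d}"
      using gx by (intro image_subsetI) (simp only: abs_less_iff greaterThanLessThan_iff minus_less_iff)
  qed
  then have "continuous_on {-1/4<..<5/4} (\<lambda>x. x * k x)"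
    unfolding k_def by (intro continuous_intros slice_continuous[OF l] smooth_vjq)
  then obtain K where K: "K 0 = 0" "\<And>x. x \<in> {-1/4<..<5/4} \<Longrightarrow> (K has_real_derivative x * k x) (at x)"
    using antiderivative_on_interval[OF ab] by blast
  have IK: "I ((g, a), x) = K x" if x: "x \<in> {-1/4<..<5/4}" for x
    using integral_ray_linear[OF ab K x] j_integral[of g a x] x sl by (simp add: I_def k_def)
  have wM: "w ((g, a), x) = 4 / F (- (g * a)) * x - x\<^sup>2 - 16 * g\<^sup>2 * M2 x" if x: "x \<in> {-1/4<..<5/4}" for x
  proof -
    have e: "M2 x = x\<^sup>2 * integral {0..1} (\<lambda>\<tau>. (1 - \<tau>) * (v ((g, a), x * \<tau>) * j ((g, a), x * \<tau>) * q ((g, a), x * \<tau>) ^ 3))"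
      using integral_ray_complement[OF ab M1 M2 x] by (simp add: f_def)
    have "v ((g, a), x) = 4 / F (- (g * a)) - x - 16 * (g\<^sup>2 * x * integral {0..1}
        (\<lambda>\<tau>. (1 - \<tau>) * (v ((g, a), x * \<tau>) * j ((g, a), x * \<tau>) * q ((g, a), x * \<tau>) ^ 3)))"
      by (rule v_integral) (use x sl in simp)
    then have "w ((g, a), x) = x * (4 / F (- (g * a)) - x - 16 * (g\<^sup>2 * x * integral {0..1}
        (\<lambda>\<tau>. (1 - \<tau>) * (v ((g, a), x * \<tau>) * j ((g, a), x * \<tau>) * q ((g, a), x * \<tau>) ^ 3))))"
      by (simp only: w_def snd_conv)
    then show ?thesis unfolding e by (simp only: algebra_simps power2_eq_square)
  qed
  have w1: "pd2 w ((g, a), x) = 4 / F (- (g * a)) - 2 * x - 16 * g\<^sup>2 * M1 x" if x: "x \<in> {-1/4<..<5/4}" for x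
  proof (rule pd2_eqI[OF smooth_w])
    show "((g, a), x) \<in> pars" using x sl by simp
    have "((\<lambda>x. 4 / F (- (g * a)) * x - x\<^sup>2 - 16 * g\<^sup>2 * M2 x) has_real_derivative
        4 / F (- (g * a)) - 2 * x - 16 * g\<^sup>2 * M1 x) (at x)"
      by (rule derivative_eq_intros M2(2)[OF x] refl | simp)+
    then show "((\<lambda>x. w ((g, a), x)) has_real_derivative 4 / F (- (g * a)) - 2 * x - 16 * g\<^sup>2 * M1 x) (at x)"
      by (rule has_field_derivative_transform_within_open[OF _ open_greaterThanLessThan x]) (simp only: wM)
  qed
  have s: "s \<in> {-1/4<..<5/4}" using l sl by simp
  show "pd2 w ((g, a), 0) = 4 / F (- (g * a))" using w1[of 0] M1(1) by simp
  have "((\<lambda>x. 4 / F (- (g * a)) - 2 * x - 16 * g\<^sup>2 * M1 x) has_real_derivative - 2 - 16 * g\<^sup>2 * f s) (at s)"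
    by (rule derivative_eq_intros M1(2)[OF s] refl | simp)+
  then have "((\<lambda>x. pd2 w ((g, a), x)) has_real_derivative - 2 - 16 * g\<^sup>2 * f s) (at s)"
    by (rule has_field_derivative_transform_within_open[OF _ open_greaterThanLessThan s]) (simp only: w1)
  then show "((\<lambda>x. pd2 w ((g, a), x)) has_real_derivative
      - 2 - 16 * g\<^sup>2 * (v ((g, a), s) * j ((g, a), s) * q ((g, a), s) ^ 3)) (at s)" unfolding f_def .
  have "((\<lambda>x. I ((g, a), x)) has_real_derivative s * k s) (at s)"
    by (rule has_field_derivative_transform_within_open[OF K(2)[OF s] open_greaterThanLessThan s]) (simp only: IK)
  then show "((\<lambda>x. I ((g, a), x)) has_real_derivative (s - a) * m (g * (s - a)) * w ((g, a), s)) (at s)"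
    by (simp add: k_def w_def mult_ac)
qed

lemma F_chain:
  assumes l: "((g, a), s) \<in> pars"
  shows "((\<lambda>x. F (g * (x - a))) has_real_derivative g\<^sup>2 * ((s - a) * m (g * (s - a)))) (at s)"
proof -
  have "\<bar>g * (s - a)\<bar> < 3 * d" using Yc_less[OF l, of 1] by (simp add: Yc_apply one_clamp)
  then have "(F has_real_derivative (g * (s - a)) * m (g * (s - a))) (at (g * (s - a)))" by (rule F')
  moreover have "((\<lambda>x. g * (x - a)) has_real_derivative g) (at s)" by (rule derivative_eq_intros refl | simp)+
  ultimately have "((\<lambda>x. F (g * (x - a))) has_real_derivative (g * (s - a)) * m (g * (s - a)) * g) (at s)"
    using DERIV_chain' by blast
  then show ?thesis by (simp add: power2_eq_square mult_ac)
qed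

lemma denominator:
  assumes l: "((g, a), s) \<in> pars"
  shows "F (g * (s - a)) * w ((g, a), s) - g\<^sup>2 * I ((g, a), s) =
    s * (F (g * (s - a)) * v ((g, a), s) - g\<^sup>2 * s * j ((g, a), s))"
    "q ((g, a), s) * (F (g * (s - a)) * v ((g, a), s) - g\<^sup>2 * s * j ((g, a), s)) = 1"
    "q ((g, a), s) > 0"
proof -
  let ?X = "F (g * (s - a)) * v ((g, a), s) - g\<^sup>2 * s * j ((g, a), s)"
  have "?X > 0" using q_eq(1)[OF l] by linarith
  then show "q ((g, a), s) * ?X = 1" "q ((g, a), s) > 0"
    unfolding q_eq(2)[OF l] by (simp_all only: left_inverse less_imp_neq[symmetric] not_False_eq_True positive_imp_inverse_positive)
  show "F (g * (s - a)) * w ((g, a), s) - g\<^sup>2 * I ((g, a), s) = s * ?X"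
    by (simp add: w_def I_def power2_eq_square algebra_simps)
qed

text \<open>Both sides have derivative \<open>- 8 g\<^sup>2 w' v j q\<^sup>3\<close> away from the pole.\<close>

lemma first_integral:
  assumes l: "((g, a), s) \<in> pars"
  shows "w ((g, a), s) + (pd2 w ((g, a), s))\<^sup>2 / 4 = 4 * (v ((g, a), s) * q ((g, a), s))\<^sup>2"
proof -
  note sl = pars_slice[OF l]
  define \<phi> where "\<phi> x = w ((g, a), x) + (pd2 w ((g, a), x))\<^sup>2 / 4 - 4 * (v ((g, a), x) * q ((g, a), x))\<^sup>2" for x
  have cont: "continuous_on {-1/4<..<5/4} \<phi>"
    unfolding \<phi>_def by (intro continuous_intros slice_continuous[OF l] smooth_vjq smooth_w Cinf_on_pd2) auto
  have "\<phi> 0 = 0"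
  proof -
    have l0: "((g, a), 0) \<in> pars" using sl by simp
    have v0: "v ((g, a), 0) = 4 / F (- (g * a))" using v_integral[OF l0] by simp
    have "F (- (g * a)) \<noteq> 0" using q_eq(1)[OF l0] by auto
    \<comment> \<open>At the pole v = 4 / F (- g a), so F v = 4; both sides of the identity become 4
      / F^2.\<close>
    then have q0: "q ((g, a), 0) = 1 / 4" using q_eq(2)[OF l0] v0 by simp
    show ?thesis unfolding \<phi>_def w_def q0 v0 profile_ode(1)[OF l0] by (simp add: power2_eq_square)
  qed
  moreover have "(\<phi> has_real_derivative 0) (at x)" if x: "x \<in> {-1/4<..<5/4} - {0}" for x
  proof -
    have lx: "((g, a), x) \<in> pars" using sl x by simp
    have x0: "x \<noteq> 0" using x by simp
    let ?w = "w ((g, a), x)" and ?u = "pd2 w ((g, a), x)" and ?v = "v ((g, a), x)" and ?j = "j ((g, a), x)"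
      and ?q = "q ((g, a), x)" and ?I = "I ((g, a), x)" and ?h = "F (g * (x - a))"
      and ?k = "(x - a) * m (g * (x - a))"
    let ?D = "?h * ?w - g\<^sup>2 * ?I"
    have vq: "v ((g, a), y) * q ((g, a), y) = w ((g, a), y) / (F (g * (y - a)) * w ((g, a), y) - g\<^sup>2 * I ((g, a), y))"
      if "y \<in> {-1/4<..<5/4} - {0}" for y
    proof -
      have ly: "((g, a), y) \<in> pars" using sl that by simp
      define X where "X = F (g * (y - a)) * v ((g, a), y) - g\<^sup>2 * y * j ((g, a), y)"
      have d: "F (g * (y - a)) * w ((g, a), y) - g\<^sup>2 * I ((g, a), y) = y * X"
        unfolding X_def by (rule denominator(1)[OF ly])
      have q: "q ((g, a), y) = inverse X" unfolding X_def by (rule q_eq(2)[OF ly])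
      have "y \<noteq> 0" using that by simp
      show ?thesis unfolding d q unfolding w_def snd_conv mult_divide_mult_cancel_left[OF \<open>y \<noteq> 0\<close>]
        by (rule divide_inverse[symmetric])
    qed
    have D0: "?D \<noteq> 0" using denominator[OF lx] x0 by auto
    have dw: "((\<lambda>x. w ((g, a), x)) has_real_derivative ?u) (at x)" by (rule pd2_real[OF smooth_w lx])
    \<comment> \<open>The reason for introducing the moment: the derivative of the factor F cancels
      against that of g^2 I, and only h w' is left.\<close>
    have dD: "((\<lambda>x. F (g * (x - a)) * w ((g, a), x) - g\<^sup>2 * I ((g, a), x)) has_real_derivative ?h * ?u) (at x)"
      by (rule derivative_eq_intros dw F_chain[OF lx] profile_ode(3)[OF lx] refl | simp add: algebra_simps)+
    have "((\<lambda>x. w ((g, a), x) / (F (g * (x - a)) * w ((g, a), x) - g\<^sup>2 * I ((g, a), x)))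
        has_real_derivative (?u * ?D - ?w * (?h * ?u)) / (?D * ?D)) (at x)"
      by (rule DERIV_divide[OF dw dD D0])
    moreover have "(?u * ?D - ?w * (?h * ?u)) / (?D * ?D) = - (g\<^sup>2 * ?u * ?j * ?q\<^sup>2)"
    proof -
      have Dq: "?D * ?q = x" using denominator(2)[OF lx] unfolding denominator(1)[OF lx] by (simp add: mult_ac)
      have "- (g\<^sup>2 * ?u * ?j * ?q\<^sup>2) * (?D * ?D) = - (g\<^sup>2 * ?u * ?j * ((?D * ?q) * (?D * ?q)))"
        by (simp add: power2_eq_square mult_ac)
      also have "\<dots> = ?u * ?D - ?w * (?h * ?u)"
        unfolding Dq by (simp add: I_def power2_eq_square algebra_simps)
      finally show ?thesis using D0 by (simp add: nonzero_divide_eq_eq)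
    qed
    ultimately have "((\<lambda>x. w ((g, a), x) / (F (g * (x - a)) * w ((g, a), x) - g\<^sup>2 * I ((g, a), x)))
        has_real_derivative - (g\<^sup>2 * ?u * ?j * ?q\<^sup>2)) (at x)" by (simp only:)
    then have dvq: "((\<lambda>x. v ((g, a), x) * q ((g, a), x)) has_real_derivative - (g\<^sup>2 * ?u * ?j * ?q\<^sup>2)) (at x)"
      by (rule has_field_derivative_transform_within_open[of _ _ _ "{-1/4<..<5/4} - {0}"])
        (use x in \<open>auto intro!: open_Diff simp: vq\<close>)
    have "(\<phi> has_real_derivative ?u + (2 * ?u * (- 2 - 16 * g\<^sup>2 * (?v * ?j * ?q ^ 3))) / 4
        - 4 * (2 * (?v * ?q) * (- (g\<^sup>2 * ?u * ?j * ?q\<^sup>2)))) (at x)"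
      unfolding \<phi>_def
      by (rule derivative_eq_intros dw dvq profile_ode(2)[OF lx] refl | simp)+
    moreover have "?u + (2 * ?u * (- 2 - 16 * g\<^sup>2 * (?v * ?j * ?q ^ 3))) / 4
        - 4 * (2 * (?v * ?q) * (- (g\<^sup>2 * ?u * ?j * ?q\<^sup>2))) = 0"
      by (simp add: field_simps power2_eq_square power3_eq_cube)
    ultimately show ?thesis by simp
  qed
  ultimately have \<phi>: "\<phi> 0 = 0" "\<And>x. x \<in> {-1/4<..<5/4} - {0} \<Longrightarrow> (\<phi> has_real_derivative 0) (at x)" .
  have "\<phi> s = 0"
  \<comment> \<open>The quotient of w by its denominator is 0/0 at the pole, so the derivative is
    computed only off 0; continuity bridges the single point.\<close>
  proof (rule has_derivative_zero_unique_strong_connected[OF connected_Ioo _ _ cont])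
    show "open {-1/4<..<5/4::real}" by (rule open_greaterThanLessThan)
    show "finite {0::real}" by simp
    show "0 \<in> {-1/4<..<5/4::real}" by simp
    show "\<phi> 0 = 0" by (rule \<phi>(1))
    show "s \<in> {-1/4<..<5/4}" using l by (simp only: sl)
    show "(\<phi> has_derivative (\<lambda>h. 0)) (at x within {-1/4<..<5/4})" if "x \<in> {-1/4<..<5/4} - {0}" for x
      using \<phi>(2)[OF that] unfolding has_field_derivative_def lambda_zero by (rule has_derivative_at_withinI)
  qed
  then show ?thesis by (simp add: \<phi>_def)
qed

text \<open>The first integral says sqrt E = 2 v q. With w'' from \<open>profile_ode\<close> and a
  factor 1 = q (F v - g^2 s j) inserted in one term, the left side becomes F (2 v q)^3. Divided by
  \<open>sqrt E ^ 3\<close> it is the total curvature of the surface of revolution.\<close>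

lemma curvature_equation:
  assumes l: "((g, a), s) \<in> pars"
  defines "E \<equiv> w ((g, a), s) + (pd2 w ((g, a), s))\<^sup>2 / 4"
  shows "E > 0"
    "2 * E - w ((g, a), s) * (1 + pd2 (pd2 w) ((g, a), s) / 2) = F (g * (s - a)) * sqrt E ^ 3"
proof -
  let ?v = "v ((g, a), s)" and ?j = "j ((g, a), s)" and ?q = "q ((g, a), s)" and ?h = "F (g * (s - a))"
  have pos: "?v > 0" "?q > 0" using v_bounds[OF l] denominator(3)[OF l] by auto
  have E: "E = (2 * (?v * ?q))\<^sup>2" using first_integral[OF l] by (simp add: E_def power_mult_distrib)
  then show "E > 0" using pos by simp
  have sq: "sqrt E = 2 * (?v * ?q)" unfolding E real_sqrt_abs using pos by (simp add: abs_of_pos)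
  have w2: "pd2 (pd2 w) ((g, a), s) = - 2 - 16 * g\<^sup>2 * (?v * ?j * ?q ^ 3)"
    by (rule pd2_eqI[OF Cinf_on_pd2[OF smooth_w] l profile_ode(2)[OF l]])
  have "2 * E - w ((g, a), s) * (1 + pd2 (pd2 w) ((g, a), s) / 2)
      = 8 * ?v\<^sup>2 * ?q\<^sup>2 + 8 * g\<^sup>2 * s * ?v\<^sup>2 * ?j * ?q ^ 3"
    unfolding E w2 by (simp add: w_def field_simps power2_eq_square power3_eq_cube)
  also have "\<dots> = 8 * ?v\<^sup>2 * ?q\<^sup>2 * (?q * (?h * ?v - g\<^sup>2 * s * ?j)) + 8 * g\<^sup>2 * s * ?v\<^sup>2 * ?j * ?q ^ 3"
    unfolding denominator(2)[OF l] by simp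
  also have "\<dots> = ?h * sqrt E ^ 3"
    unfolding sq by (simp add: algebra_simps power2_eq_square power3_eq_cube)
  finally show "2 * E - w ((g, a), s) * (1 + pd2 (pd2 w) ((g, a), s) / 2) = ?h * sqrt E ^ 3" .
qed

text \<open>The cap is then part of the unit sphere, w = 1 - (s - 1)^2, with centre at height 1 - a.
  These polynomials provide the nondegeneracy needed in the matching.\<close>

lemma zero_gravity:
  assumes l: "((0, a), s) \<in> pars"
  shows "w ((0, a), s) = 2 * s - s\<^sup>2" "pd2 w ((0, a), s) = 2 - 2 * s"
    "I ((0, a), s) = m 0 * (2 * s ^ 3 / 3 - s ^ 4 / 4 - a * s\<^sup>2 + a * s ^ 3 / 3)"
proof -
  note sl = pars_slice[OF l]
  have w: "w ((0, a), x) = 2 * x - x\<^sup>2" if "x \<in> {-1/4<..<5/4}" for x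
  proof -
    have vx: "v ((0, a), x) = 2 - x" using v_integral[of 0 a x] that sl F0 by simp
    show ?thesis unfolding w_def snd_conv vx by (simp add: algebra_simps power2_eq_square)
  qed
  have s: "s \<in> {-1/4<..<5/4}" using l sl by simp
  show "w ((0, a), s) = 2 * s - s\<^sup>2" by (rule w[OF s])
  have "((\<lambda>x. 2 * x - x\<^sup>2) has_real_derivative 2 - 2 * s) (at s)"
    by (rule derivative_eq_intros refl | simp)+
  then have "((\<lambda>x. w ((0, a), x)) has_real_derivative 2 - 2 * s) (at s)"
    by (rule has_field_derivative_transform_within_open[OF _ open_greaterThanLessThan s]) (simp only: w)
  then show "pd2 w ((0, a), s) = 2 - 2 * s" by (rule pd2_eqI[OF smooth_w l])
  define \<phi> where "\<phi> x = I ((0, a), x) - m 0 * (2 * x ^ 3 / 3 - x ^ 4 / 4 - a * x\<^sup>2 + a * x ^ 3 / 3)" for x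
  have "(\<phi> has_real_derivative 0) (at x)" if x: "x \<in> {-1/4<..<5/4}" for x
  proof -
    have lx: "((0, a), x) \<in> pars" using sl x by simp
    have "((\<lambda>x. m 0 * (2 * x ^ 3 / 3 - x ^ 4 / 4 - a * x\<^sup>2 + a * x ^ 3 / 3)) has_real_derivative
        m 0 * (2 * x\<^sup>2 - x ^ 3 - 2 * a * x + a * x\<^sup>2)) (at x)"
      by (rule derivative_eq_intros refl | simp)+
    from DERIV_diff[OF profile_ode(3)[OF lx] this]
    have "(\<phi> has_real_derivative (x - a) * m (0 * (x - a)) * w ((0, a), x) - m 0 * (2 * x\<^sup>2 - x ^ 3 - 2 * a * x + a * x\<^sup>2)) (at x)"
      unfolding \<phi>_def .
    moreover have "(x - a) * m (0 * (x - a)) * w ((0, a), x) - m 0 * (2 * x\<^sup>2 - x ^ 3 - 2 * a * x + a * x\<^sup>2) = 0"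
      unfolding w[OF x] by (simp add: algebra_simps power2_eq_square power3_eq_cube)
    ultimately show ?thesis by (simp only:)
  qed
  then have "\<phi> s = \<phi> 0"
    by (intro DERIV_isconst3[of "-1/4" "5/4"]) (use s in auto)
  then show "I ((0, a), s) = m 0 * (2 * s ^ 3 / 3 - s ^ 4 / 4 - a * s\<^sup>2 + a * s ^ 3 / 3)"
    by (simp add: \<phi>_def I_def)
qed

end

lemma frechet_derivative_cong_open:
  assumes "open U" "x \<in> U" "\<And>y. y \<in> U \<Longrightarrow> f y = g y" "Cinf_on U f"
  shows "frechet_derivative f (at x) = frechet_derivative g (at x)"
  by (rule frechet_derivative_at[OF has_derivative_transform_within_open[OF Cinf_on_has_derivative[OF assms(4,2)] assms(1,2,3)]])

lemma pd2_cong: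
  assumes "open U" "x \<in> U" "\<And>y. y \<in> U \<Longrightarrow> f y = g y" "Cinf_on U f"
  shows "pd2 f x = pd2 g x"
  unfolding pd2_def by (simp only: frechet_derivative_cong_open[OF assms])

section \<open>Uniqueness for the profile equation away from the poles\<close>

lemma nonneg_zero_of_gronwall:
  fixes E :: "real \<Rightarrow> real"
  assumes E: "\<And>z. z \<in> {-r<..<r} \<Longrightarrow> (E has_real_derivative E' z) (at z)"
    and nn: "\<And>z. 0 \<le> E z" and N: "\<And>z. z \<in> {-r<..<r} \<Longrightarrow> \<bar>E' z\<bar> \<le> N * E z"
    and E0: "E 0 = 0" and z: "z \<in> {-r<..<r}"
  shows "E z = 0"
proof (cases "0 \<le> z")
  case True
  have "E z * exp (- N * z) \<le> E 0 * exp (- N * 0)"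
  proof (rule DERIV_nonpos_imp_nonincreasing[where f = "\<lambda>x. E x * exp (- N * x)", OF True])
    fix x assume "0 \<le> x" "x \<le> z"
    then have x: "x \<in> {-r<..<r}" using z by auto
    have "((\<lambda>x. E x * exp (- N * x)) has_real_derivative (E' x - N * E x) * exp (- N * x)) (at x)"
      by (rule derivative_eq_intros E[OF x] refl | simp add: algebra_simps)+
    moreover have "(E' x - N * E x) * exp (- N * x) \<le> 0"
      using N[OF x] by (intro mult_nonpos_nonneg) auto
    ultimately show "\<exists>y. ((\<lambda>x. E x * exp (- N * x)) has_real_derivative y) (at x) \<and> y \<le> 0" by blast
  qed
  then have "E z \<le> 0" using E0 by (simp add: mult_le_0_iff)
  then show ?thesis using nn[of z] by simp
next
  case False
  have "E z * exp (N * z) \<le> E 0 * exp (N * 0)"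
  proof (rule DERIV_nonneg_imp_nondecreasing[where f = "\<lambda>x. E x * exp (N * x)"])
    show "z \<le> 0" using False by simp
    fix x assume "z \<le> x" "x \<le> 0"
    then have x: "x \<in> {-r<..<r}" using z by auto
    have "((\<lambda>x. E x * exp (N * x)) has_real_derivative (E' x + N * E x) * exp (N * x)) (at x)"
      by (rule derivative_eq_intros E[OF x] refl | simp add: algebra_simps)+
    moreover have "0 \<le> (E' x + N * E x) * exp (N * x)"
      using N[OF x] by (intro mult_nonneg_nonneg) auto
    ultimately show "\<exists>y. ((\<lambda>x. E x * exp (N * x)) has_real_derivative y) (at x) \<and> 0 \<le> y" by blast
  qed
  then have "E z \<le> 0" using E0 by (simp add: mult_le_0_iff)
  then show ?thesis using nn[of z] by simp
qed

text \<open>Telescoping over the factors w, I and the inverse cube of the denominator, whose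
  reciprocal is at most 8. The constants are crude; only their finiteness matters.\<close>

lemma profile_rhs_lipschitz:
  fixes w1 w2 I1 I2 h e B :: real
  assumes w: "\<bar>w2\<bar> \<le> 4" and I: "\<bar>I1\<bar> \<le> B" "\<bar>I2\<bar> \<le> B"
    and D: "1/8 \<le> h * w1 - e * I1" "1/8 \<le> h * w2 - e * I2"
    and he: "\<bar>h\<bar> \<le> 3" "\<bar>e\<bar> \<le> 1"
  shows "\<bar>w1 * I1 / (h * w1 - e * I1) ^ 3 - w2 * I2 / (h * w2 - e * I2) ^ 3\<bar>
    \<le> (150000 * B + 2048) * (\<bar>w1 - w2\<bar> + \<bar>I1 - I2\<bar>)"
proof -
  define r1 r2 where "r1 = inverse (h * w1 - e * I1)" and "r2 = inverse (h * w2 - e * I2)"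
  define A C where "A = \<bar>w1 - w2\<bar>" and "C = \<bar>I1 - I2\<bar>"
  have AC: "0 \<le> A" "0 \<le> C" "0 \<le> B" using I(1) by (auto simp: A_def C_def)
  have r: "0 < r1" "r1 \<le> 8" "0 < r2" "r2 \<le> 8"
    using D le_imp_inverse_le[OF D(1)] le_imp_inverse_le[OF D(2)] by (auto simp: r1_def r2_def)
  have "r1 - r2 = (h * (w2 - w1) - e * (I2 - I1)) * (r1 * r2)"
    using D by (simp add: r1_def r2_def field_simps)
  then have "\<bar>r1 - r2\<bar> = \<bar>h * (w2 - w1) - e * (I2 - I1)\<bar> * (r1 * r2)"
    using r by (simp add: abs_mult)
  also have "\<dots> \<le> (3 * A + 1 * C) * (8 * 8)"
  proof (intro mult_mono)
    have "\<bar>h * (w2 - w1)\<bar> \<le> 3 * A" "\<bar>e * (I2 - I1)\<bar> \<le> 1 * C"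
      unfolding abs_mult A_def C_def abs_minus_commute[of w2] abs_minus_commute[of I2]
      by (rule mult_right_mono[OF he(1) abs_ge_zero], rule mult_right_mono[OF he(2) abs_ge_zero])
    then show "\<bar>h * (w2 - w1) - e * (I2 - I1)\<bar> \<le> 3 * A + 1 * C" by linarith
  qed (use r AC in auto)
  finally have r12: "\<bar>r1 - r2\<bar> \<le> 64 * (3 * A + C)" by simp
  have cube: "\<bar>r1 ^ 3\<bar> \<le> 512" using power_mono[of r1 8 3] r by simp
  have "\<bar>r1 ^ 3 - r2 ^ 3\<bar> = \<bar>r1 - r2\<bar> * (r1 * r1 + r1 * r2 + r2 * r2)"
  proof -
    have "r1 ^ 3 - r2 ^ 3 = (r1 - r2) * (r1 * r1 + r1 * r2 + r2 * r2)" by (simp add: power3_eq_cube algebra_simps)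
    moreover have "0 \<le> r1 * r1 + r1 * r2 + r2 * r2" using r by simp
    ultimately show ?thesis by (simp add: abs_mult)
  qed
  also have "\<dots> \<le> (64 * (3 * A + C)) * (8 * 8 + 8 * 8 + 8 * 8)"
    using r r12 AC by (intro mult_mono add_mono) auto
  finally have r3: "\<bar>r1 ^ 3 - r2 ^ 3\<bar> \<le> 12288 * (3 * A + C)" by simp
  have eq: "w1 * I1 / (h * w1 - e * I1) ^ 3 - w2 * I2 / (h * w2 - e * I2) ^ 3 =
      (w1 - w2) * I1 * r1 ^ 3 + w2 * (I1 - I2) * r1 ^ 3 + w2 * I2 * (r1 ^ 3 - r2 ^ 3)"
    by (simp add: r1_def r2_def divide_inverse power_inverse algebra_simps)
  have "\<bar>(w1 - w2) * I1 * r1 ^ 3\<bar> \<le> A * B * 512"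
    unfolding abs_mult A_def
    by (rule mult_mono[OF mult_mono[OF order_refl I(1)] cube]) (use AC in simp_all)
  moreover have "\<bar>w2 * (I1 - I2) * r1 ^ 3\<bar> \<le> 4 * C * 512"
    unfolding abs_mult C_def
    by (rule mult_mono[OF mult_mono[OF w order_refl] cube]) simp_all
  moreover have "\<bar>w2 * I2 * (r1 ^ 3 - r2 ^ 3)\<bar> \<le> 4 * B * (12288 * (3 * A + C))"
    unfolding abs_mult
    by (rule mult_mono[OF mult_mono[OF w I(2)] r3]) (use AC in simp_all)
  ultimately have "\<bar>w1 * I1 / (h * w1 - e * I1) ^ 3 - w2 * I2 / (h * w2 - e * I2) ^ 3\<bar>
      \<le> A * B * 512 + 4 * C * 512 + 4 * B * (12288 * (3 * A + C))"
    unfolding eq by linarith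
  also have "\<dots> = 147968 * (B * A) + 2048 * C + 49152 * (B * C)" by (simp add: algebra_simps)
  also have "\<dots> \<le> (150000 * B + 2048) * (A + C)"
    using AC mult_nonneg_nonneg[OF AC(3,1)] mult_nonneg_nonneg[OF AC(3,2)] by (simp add: algebra_simps)
  finally show ?thesis unfolding A_def C_def .
qed

text \<open>The equation is read as a first-order system for (W, W', I). Where the denominator is
  bounded away from 0 the system is Lipschitz, and Gronwall's inequality applies to the squared
  distance of two solutions.\<close>

lemma profile_unique:
  fixes w1 w2 u1 u2 I1 I2 h k :: "real \<Rightarrow> real" and e B K r :: real
  defines "\<Theta> \<equiv> \<lambda>z w I. w * I / (h z * w - e * I) ^ 3"
  assumes d1: "\<And>z. z \<in> {-r<..<r} \<Longrightarrow> (w1 has_real_derivative u1 z) (at z)"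
      "\<And>z. z \<in> {-r<..<r} \<Longrightarrow> (u1 has_real_derivative - 2 - 16 * e * \<Theta> z (w1 z) (I1 z)) (at z)"
      "\<And>z. z \<in> {-r<..<r} \<Longrightarrow> (I1 has_real_derivative k z * w1 z) (at z)"
    and d2: "\<And>z. z \<in> {-r<..<r} \<Longrightarrow> (w2 has_real_derivative u2 z) (at z)"
      "\<And>z. z \<in> {-r<..<r} \<Longrightarrow> (u2 has_real_derivative - 2 - 16 * e * \<Theta> z (w2 z) (I2 z)) (at z)"
      "\<And>z. z \<in> {-r<..<r} \<Longrightarrow> (I2 has_real_derivative k z * w2 z) (at z)"
    and w: "\<And>z. z \<in> {-r<..<r} \<Longrightarrow> \<bar>w2 z\<bar> \<le> 4"
    and I: "\<And>z. z \<in> {-r<..<r} \<Longrightarrow> \<bar>I1 z\<bar> \<le> B" "\<And>z. z \<in> {-r<..<r} \<Longrightarrow> \<bar>I2 z\<bar> \<le> B"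
    and D: "\<And>z. z \<in> {-r<..<r} \<Longrightarrow> 1/8 \<le> h z * w1 z - e * I1 z"
      "\<And>z. z \<in> {-r<..<r} \<Longrightarrow> 1/8 \<le> h z * w2 z - e * I2 z"
    and h: "\<And>z. z \<in> {-r<..<r} \<Longrightarrow> \<bar>h z\<bar> \<le> 3" and k: "\<And>z. z \<in> {-r<..<r} \<Longrightarrow> \<bar>k z\<bar> \<le> K"
    and e: "0 \<le> e" "e \<le> 1"
    and init: "w1 0 = w2 0" "u1 0 = u2 0" "I1 0 = I2 0"
    and z: "z \<in> {-r<..<r}"
  shows "w1 z = w2 z"
proof -
  define E where "E z = (w1 z - w2 z)\<^sup>2 + (u1 z - u2 z)\<^sup>2 + (I1 z - I2 z)\<^sup>2" for z
  define du where "du z = (- 2 - 16 * e * \<Theta> z (w1 z) (I1 z)) - (- 2 - 16 * e * \<Theta> z (w2 z) (I2 z))" for z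
  define E' where "E' z = 2 * (w1 z - w2 z) * (u1 z - u2 z) + 2 * (u1 z - u2 z) * du z
    + 2 * (I1 z - I2 z) * (k z * w1 z - k z * w2 z)" for z
  define L where "L = 16 * (150000 * B + 2048)"
  have "E z = 0"
  proof (rule nonneg_zero_of_gronwall[where E = E and z = z and E' = E' and N = "1 + 2 * L + K" and r = r])
    show "E 0 = 0" by (simp add: E_def init)
    show "0 \<le> E z" for z by (simp add: E_def)
    show "z \<in> {-r<..<r}" by (rule z)
    fix z assume z: "z \<in> {-r<..<r}"
    show "(E has_real_derivative E' z) (at z)"
      unfolding E_def E'_def du_def
      by (rule derivative_eq_intros d1[OF z] d2[OF z] refl | simp add: algebra_simps)+
    define A b C where "A = \<bar>w1 z - w2 z\<bar>" and "b = \<bar>u1 z - u2 z\<bar>" and "C = \<bar>I1 z - I2 z\<bar>"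
    have AC: "0 \<le> A" "0 \<le> b" "0 \<le> C" by (auto simp: A_def b_def C_def)
    have B: "0 \<le> B" "0 \<le> K" using I(1)[OF z] k[OF z] by auto
    have L: "0 \<le> L" using B by (simp add: L_def)
    have "du z = - (16 * e * (\<Theta> z (w1 z) (I1 z) - \<Theta> z (w2 z) (I2 z)))" by (simp add: du_def algebra_simps)
    then have "\<bar>du z\<bar> = 16 * e * \<bar>\<Theta> z (w1 z) (I1 z) - \<Theta> z (w2 z) (I2 z)\<bar>" using e by (simp add: abs_mult)
    also have "\<dots> \<le> 16 * 1 * ((150000 * B + 2048) * (A + C))"
      unfolding A_def C_def \<Theta>_def using e
      by (intro mult_mono profile_rhs_lipschitz w I D h z) auto
    finally have du: "\<bar>du z\<bar> \<le> L * (A + C)" by (simp only: L_def mult_1_right mult.assoc)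
    have "\<bar>E' z\<bar> \<le> 2 * (A * b) + 2 * (b * (L * (A + C))) + 2 * (C * (K * A))"
    proof -
      have "\<bar>(u1 z - u2 z) * du z\<bar> \<le> b * (L * (A + C))"
        unfolding abs_mult b_def using du by (intro mult_mono) auto
      moreover have "\<bar>(I1 z - I2 z) * (k z * w1 z - k z * w2 z)\<bar> \<le> C * (K * A)"
      proof -
        have "k z * w1 z - k z * w2 z = k z * (w1 z - w2 z)" by (simp add: algebra_simps)
        then have "\<bar>k z * w1 z - k z * w2 z\<bar> \<le> K * A"
          using k[OF z] by (simp add: abs_mult A_def mult_right_mono)
        then show ?thesis unfolding abs_mult C_def by (intro mult_left_mono) auto
      qed
      moreover have "\<bar>(w1 z - w2 z) * (u1 z - u2 z)\<bar> = A * b" by (simp add: A_def b_def abs_mult)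
      ultimately show ?thesis unfolding E'_def by linarith
    qed
    also have "\<dots> = 2 * (A * b) + L * (2 * (A * b)) + L * (2 * (b * C)) + K * (2 * (A * C))"
      by (simp add: algebra_simps)
    also have "\<dots> \<le> E z + L * E z + L * E z + K * E z"
    proof -
      have Ez: "E z = A\<^sup>2 + b\<^sup>2 + C\<^sup>2" by (simp add: E_def A_def b_def C_def)
      have "2 * (A * b) \<le> E z" "2 * (b * C) \<le> E z" "2 * (A * C) \<le> E z"
        using zero_le_power2[of "A - b"] zero_le_power2[of "b - C"] zero_le_power2[of "A - C"]
          zero_le_power2[of A] zero_le_power2[of b] zero_le_power2[of C]
        unfolding Ez power2_diff by linarith+
      then show ?thesis using L B by (intro add_mono mult_left_mono) auto
    qed
    also have "\<dots> = (1 + 2 * L + K) * E z" by (simp add: algebra_simps)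
    finally show "\<bar>E' z\<bar> \<le> (1 + 2 * L + K) * E z" .
  qed
  then have "(w1 z - w2 z)\<^sup>2 = 0"
    unfolding E_def using zero_le_power2[of "u1 z - u2 z"] zero_le_power2[of "I1 z - I2 z"] zero_le_power2[of "w1 z - w2 z"] by linarith
  then show ?thesis by simp
qed

text \<open>The first integral determines the radius at the matching height.\<close>

lemma first_integral_injective:
  fixes w1 w2 c e :: real
  assumes w: "7/16 \<le> w1" "7/16 \<le> w2" and e: "\<bar>e\<bar> \<le> 1/1000" "0 \<le> c"
    and eq: "w1 + c = (2 * w1 / (2 * w1 - e))\<^sup>2" "w2 + c = (2 * w2 / (2 * w2 - e))\<^sup>2"
  shows "w1 = w2"
proof -
  define x1 x2 where "x1 = inverse (2 * w1 - e)" and "x2 = inverse (2 * w2 - e)"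
  have D: "1/2 \<le> 2 * w1 - e" "1/2 \<le> 2 * w2 - e" using w e by auto
  have x: "0 < x1" "x1 \<le> 2" "0 < x2" "x2 \<le> 2"
    using D le_imp_inverse_le[OF D(1)] le_imp_inverse_le[OF D(2)] by (auto simp: x1_def x2_def)
  \<comment> \<open>The right-hand sides are (1 + e x)^2 and vary with w at a rate proportional to
    the small e, whereas the left-hand sides vary at rate 1.\<close>
  have r: "2 * w1 / (2 * w1 - e) = 1 + e * x1" "2 * w2 / (2 * w2 - e) = 1 + e * x2"
    using D by (simp_all add: x1_def x2_def field_simps)
  have xd: "x1 - x2 = 2 * (w2 - w1) * (x1 * x2)"
    using D by (simp add: x1_def x2_def field_simps)
  have "w1 - w2 = (1 + e * x1)\<^sup>2 - (1 + e * x2)\<^sup>2" using eq unfolding r by simp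
  also have "\<dots> = e * (x1 - x2) * (2 + e * (x1 + x2))" by (simp add: power2_eq_square algebra_simps)
  finally have "w1 - w2 = e * (2 * (w2 - w1) * (x1 * x2)) * (2 + e * (x1 + x2))" unfolding xd .
  then have "\<bar>w1 - w2\<bar> = \<bar>e * (2 * (w2 - w1) * (x1 * x2)) * (2 + e * (x1 + x2))\<bar>" by (rule arg_cong)
  also have "\<dots> = \<bar>e\<bar> * (2 * \<bar>w1 - w2\<bar> * (x1 * x2)) * \<bar>2 + e * (x1 + x2)\<bar>"
    unfolding abs_mult abs_minus_commute[of w2] using x by simp
  also have "\<dots> \<le> 1/1000 * (2 * \<bar>w1 - w2\<bar> * (2 * 2)) * 3"
  proof (intro mult_mono)
    have "\<bar>e * (x1 + x2)\<bar> \<le> 1/1000 * 4" unfolding abs_mult using e x by (intro mult_mono) auto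
    then show "\<bar>2 + e * (x1 + x2)\<bar> \<le> 3" by linarith
  qed (use e x in \<open>auto intro!: mult_nonneg_nonneg\<close>)
  finally show ?thesis by simp
qed

section \<open>Choosing the two poles so that slope and moment agree at height 0\<close>

context curvature_law
begin

definition matching_box where "matching_box = {-d<..<d} \<times> {7/8<..<(9/8::real)}"
text \<open>s = a is the distance from the pole at which height 0 is reached.\<close>

definition slope0 where "slope0 ga = pd2 w (ga, snd ga)"
definition moment0 where "moment0 ga = I (ga, snd ga)"

lemma open_matching_box: "open matching_box"
  unfolding matching_box_def by (intro open_Times open_greaterThanLessThan)

lemma matching_box_pars: "ga \<in> matching_box \<Longrightarrow> (ga, snd ga) \<in> pars"
  by (auto simp: matching_box_def pars_def)

lemma smooth_matching: "Cinf_on matching_box slope0" "Cinf_on matching_box moment0"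
proof -
  have 1: "Cinf_on matching_box (\<lambda>ga :: real \<times> real. (ga, snd ga))"
    by (intro Cinf_on_Pair Cinf_on_snd Cinf_on_ident open_matching_box)
  have 2: "(\<lambda>ga. (ga, snd ga)) ` matching_box \<subseteq> pars" using matching_box_pars by blast
  show "Cinf_on matching_box slope0" unfolding slope0_def
    by (rule Cinf_on_compose[OF open_matching_box open_pars 2 1 Cinf_on_pd2[OF smooth_w]])
  show "Cinf_on matching_box moment0" unfolding moment0_def
    by (rule Cinf_on_compose[OF open_matching_box open_pars 2 1 smooth_I])
qed

lemma matching_zero_gravity:
  assumes "(0, a) \<in> matching_box"
  shows "slope0 (0, a) = 2 - 2 * a" "moment0 (0, a) = m 0 * (a ^ 4 / 12 - a ^ 3 / 3)"
  using zero_gravity[OF matching_box_pars[OF assms, simplified]]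
  by (simp_all add: slope0_def moment0_def power2_eq_square power3_eq_cube power4_eq_xxxx algebra_simps)

text \<open>The reflection z -> - z turns the north cap into a south cap for - g with the opposite
  slope. Hence one function \<alpha>, the depth of the pole for gravity g and slope p at height 0,
  serves both caps: a = \<alpha> (g, p) and b = \<alpha> (- g, - p). Only p is left to be found from
  the moments.\<close>

lemma matching:
  obtains \<delta> a b where "0 < \<delta>" "\<delta> \<le> d" "Cinf_on {-\<delta><..<\<delta>} a" "Cinf_on {-\<delta><..<\<delta>} b" "a 0 = 1" "b 0 = 1"
    "\<And>g. g \<in> {-\<delta><..<\<delta>} \<Longrightarrow> (g, a g) \<in> matching_box"
    "\<And>g. g \<in> {-\<delta><..<\<delta>} \<Longrightarrow> (- g, b g) \<in> matching_box"
    "\<And>g. g \<in> {-\<delta><..<\<delta>} \<Longrightarrow> slope0 (g, a g) = - slope0 (- g, b g)"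
    "\<And>g. g \<in> {-\<delta><..<\<delta>} \<Longrightarrow> moment0 (g, a g) = moment0 (- g, b g)"
proof -
  define pr where "pr = (\<lambda>u :: (real \<times> real) \<times> real. (fst (fst u), snd u))"
  define W1 where "W1 = pr -` matching_box"
  define \<Psi>1 where "\<Psi>1 = (\<lambda>u. slope0 (pr u) - snd (fst u))"
  have cpr: "Cinf_on UNIV pr" unfolding pr_def by (intro Cinf_on_Pair Cinf_on_fst Cinf_on_snd Cinf_on_ident open_UNIV)
  have W1: "open W1" unfolding W1_def by (rule open_vimage[OF open_matching_box Cinf_on_imp_continuous_on[OF cpr]])
  have prW: "pr ` W1 \<subseteq> matching_box" by (auto simp: W1_def)
  have c\<Psi>1: "Cinf_on W1 \<Psi>1" unfolding \<Psi>1_def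
    by (intro Cinf_on_diff W1 Cinf_on_compose[OF W1 open_matching_box prW Cinf_on_subset[OF cpr subset_UNIV] smooth_matching(1)]
        Cinf_on_snd Cinf_on_fst Cinf_on_ident)
  have box0: "(0, a) \<in> matching_box" if "a \<in> {7/8<..<9/8}" for a using that d by (simp add: matching_box_def)
  have in1: "((0, 0), 1) \<in> W1" by (simp add: W1_def pr_def box0)
  have z1: "\<Psi>1 ((0, 0), 1) = 0" using matching_zero_gravity(1)[OF box0[of 1]] by (simp add: \<Psi>1_def pr_def)
  have "((\<lambda>a. \<Psi>1 ((0, 0), a)) has_real_derivative - 2) (at 1)"
  proof (rule has_field_derivative_transform_within_open[of "\<lambda>a. 2 - 2 * a" _ _ "{7/8<..<9/8}"])
    show "((\<lambda>a::real. 2 - 2 * a) has_real_derivative - 2) (at 1)" by (rule derivative_eq_intros refl | simp)+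
    show "2 - 2 * a = \<Psi>1 ((0, 0), a)" if "a \<in> {7/8<..<9/8}" for a
      using matching_zero_gravity(1)[OF box0[OF that]] by (simp add: \<Psi>1_def pr_def)
  qed auto
  from pd2_eqI[OF c\<Psi>1 in1 this] have "pd2 \<Psi>1 ((0, 0), 1) \<noteq> 0" by simp
  from implicit_function[OF W1 c\<Psi>1 in1 z1 this] obtain S1 \<alpha> where S1: "open S1" "(0, 0) \<in> S1" "Cinf_on S1 \<alpha>" "\<alpha> (0, 0) = 1"
    "\<And>x. x \<in> S1 \<Longrightarrow> (x, \<alpha> x) \<in> W1" "\<And>x. x \<in> S1 \<Longrightarrow> \<Psi>1 (x, \<alpha> x) = 0" by metis
  have \<alpha>: "(fst x, \<alpha> x) \<in> matching_box" "slope0 (fst x, \<alpha> x) = snd x" if "x \<in> S1" for x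
    using S1(5,6)[OF that] by (auto simp: W1_def \<Psi>1_def pr_def)
  define S1' where "S1' = S1 \<inter> uminus -` S1"
  have cneg: "Cinf_on UNIV (uminus :: real \<times> real \<Rightarrow> _)" by (intro Cinf_on_minus Cinf_on_ident open_UNIV)
  have S1': "open S1'" unfolding S1'_def
    by (intro open_Int S1(1) open_vimage Cinf_on_imp_continuous_on cneg)
  have sub: "S1' \<subseteq> S1" "uminus ` S1' \<subseteq> S1" by (auto simp: S1'_def)
  have c\<alpha>: "Cinf_on S1' \<alpha>" "Cinf_on S1' (\<lambda>x. \<alpha> (- x))"
    by (rule Cinf_on_subset[OF S1(3) sub(1)])
      (rule Cinf_on_compose[OF S1' S1(1) sub(2) Cinf_on_subset[OF cneg subset_UNIV] S1(3)])
  define \<Psi>2 where "\<Psi>2 = (\<lambda>x. moment0 (fst x, \<alpha> x) - moment0 (- fst x, \<alpha> (- x)))"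
  have im: "(\<lambda>x. (fst x, \<alpha> x)) ` S1' \<subseteq> matching_box" "(\<lambda>x. (- fst x, \<alpha> (- x))) ` S1' \<subseteq> matching_box"
    using \<alpha>(1) by (auto simp: S1'_def)
  have c\<Psi>2: "Cinf_on S1' \<Psi>2" unfolding \<Psi>2_def
    by (intro Cinf_on_diff S1' Cinf_on_compose[OF S1' open_matching_box im(1) _ smooth_matching(2)]
        Cinf_on_compose[OF S1' open_matching_box im(2) _ smooth_matching(2)] Cinf_on_Pair Cinf_on_minus Cinf_on_fst Cinf_on_ident c\<alpha>)
  have in2: "(0, 0) \<in> S1'" using S1(2) by (simp add: S1'_def)
  have z2: "\<Psi>2 (0, 0) = 0" by (simp add: \<Psi>2_def)
  define T where "T = {p. (0::real, p) \<in> S1'}"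
  have T: "open T" unfolding T_def
  proof -
    have "open ((\<lambda>p::real. (0::real, p)) -` S1')" by (rule open_vimage[OF S1']) (intro continuous_intros)
    then show "open {p. (0::real, p) \<in> S1'}" by (simp add: vimage_def)
  qed
  have \<alpha>0: "\<alpha> (0, p) = 1 - p / 2" "(0, \<alpha> (0, p)) \<in> matching_box" if "(0, p) \<in> S1" for p
    using \<alpha>[OF that] matching_zero_gravity(1)[of "\<alpha> (0, p)"] by auto
  \<comment> \<open>\<alpha> has p-derivative - 1/2, and a^4 / 12 - a^3 / 3 has derivative - 2/3 at
    a = 1; each of the two caps contributes m 0 / 3.\<close>
  have "((\<lambda>p. \<Psi>2 (0, p)) has_real_derivative m 0 * (2 / 3)) (at 0)"
  proof (rule has_field_derivative_transform_within_open[OF _ T])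
    show "0 \<in> T" using in2 by (simp add: T_def)
    show "((\<lambda>p. m 0 * ((1 - p / 2) ^ 4 / 12 - (1 - p / 2) ^ 3 / 3) - m 0 * ((1 + p / 2) ^ 4 / 12 - (1 + p / 2) ^ 3 / 3))
        has_real_derivative m 0 * (2 / 3)) (at 0)"
      by (rule derivative_eq_intros refl | simp)+
    fix p assume "p \<in> T"
    then have p: "(0, p) \<in> S1" "(0, - p) \<in> S1" by (auto simp: T_def S1'_def)
    show "m 0 * ((1 - p / 2) ^ 4 / 12 - (1 - p / 2) ^ 3 / 3) - m 0 * ((1 + p / 2) ^ 4 / 12 - (1 + p / 2) ^ 3 / 3) = \<Psi>2 (0, p)"
      using matching_zero_gravity(2)[OF \<alpha>0(2)[OF p(1)]] matching_zero_gravity(2)[OF \<alpha>0(2)[OF p(2)]]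
        \<alpha>0(1)[OF p(1)] \<alpha>0(1)[OF p(2)] by (simp add: \<Psi>2_def)
  qed
  from pd2_eqI[OF c\<Psi>2 in2 this] have "pd2 \<Psi>2 (0, 0) \<noteq> 0" using m0 by simp
  from implicit_function[OF S1' c\<Psi>2 in2 z2 this] obtain S2 \<pi> where S2: "open S2" "0 \<in> S2" "Cinf_on S2 \<pi>" "\<pi> 0 = 0"
    "\<And>g. g \<in> S2 \<Longrightarrow> (g, \<pi> g) \<in> S1'" "\<And>g. g \<in> S2 \<Longrightarrow> \<Psi>2 (g, \<pi> g) = 0" by metis
  obtain r where r: "r > 0" "ball 0 r \<subseteq> S2" using S2(1,2) open_contains_ball by blast
  define \<delta> where "\<delta> = min r d"
  have \<delta>: "0 < \<delta>" "\<delta> \<le> d" using r d by (auto simp: \<delta>_def)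
  have in_S2: "{-\<delta><..<\<delta>} \<subseteq> S2"
  proof
    fix g assume "g \<in> {-\<delta><..<\<delta>}"
    then have "\<bar>g\<bar> < r" by (auto simp: \<delta>_def)
    then have "g \<in> ball 0 r" by (simp add: dist_real_def)
    then show "g \<in> S2" using r(2) by blast
  qed
  have c2: "Cinf_on {-\<delta><..<\<delta>} (\<lambda>g. (g, \<pi> g))"
    by (intro Cinf_on_Pair Cinf_on_ident open_greaterThanLessThan Cinf_on_subset[OF S2(3) in_S2])
  have im2: "(\<lambda>g. (g, \<pi> g)) ` {-\<delta><..<\<delta>} \<subseteq> S1'" using S2(5) in_S2 by blast
  show thesis
  proof (rule that[of \<delta> "\<lambda>g. \<alpha> (g, \<pi> g)" "\<lambda>g. \<alpha> (- (g, \<pi> g))"])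
    show "0 < \<delta>" "\<delta> \<le> d" by (rule \<delta>)+
    show "Cinf_on {-\<delta><..<\<delta>} (\<lambda>g. \<alpha> (g, \<pi> g))"
      by (rule Cinf_on_compose[OF open_greaterThanLessThan S1' im2 c2 c\<alpha>(1)])
    show "Cinf_on {-\<delta><..<\<delta>} (\<lambda>g. \<alpha> (- (g, \<pi> g)))"
      by (rule Cinf_on_compose[OF open_greaterThanLessThan S1' im2 c2 c\<alpha>(2)])
    show "\<alpha> (0, \<pi> 0) = 1" "\<alpha> (- (0, \<pi> 0)) = 1" by (simp_all add: S2(4) S1(4))
    fix g assume "g \<in> {-\<delta><..<\<delta>}"
    then have g: "(g, \<pi> g) \<in> S1'" "\<Psi>2 (g, \<pi> g) = 0" using S2(5,6) in_S2 by blast+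
    have g1: "(g, \<pi> g) \<in> S1" "- (g, \<pi> g) \<in> S1" using g(1) by (auto simp: S1'_def)
    show "(g, \<alpha> (g, \<pi> g)) \<in> matching_box" "(- g, \<alpha> (- (g, \<pi> g))) \<in> matching_box"
      using \<alpha>(1)[OF g1(1)] \<alpha>(1)[OF g1(2)] by simp_all
    show "slope0 (g, \<alpha> (g, \<pi> g)) = - slope0 (- g, \<alpha> (- (g, \<pi> g)))"
      using \<alpha>(2)[OF g1(1)] \<alpha>(2)[OF g1(2)] by simp
    show "moment0 (g, \<alpha> (g, \<pi> g)) = moment0 (- g, \<alpha> (- (g, \<pi> g)))"
      using g(2) by (simp add: \<Psi>2_def)
  qed
qed

end

section \<open>Gluing the caps to one profile\<close>

context curvature_law
begin

lemma vjq_eq: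
  assumes l: "((g, a), s) \<in> pars" and s: "s > 0"
  shows "v ((g, a), s) * j ((g, a), s) * q ((g, a), s) ^ 3 =
    w ((g, a), s) * I ((g, a), s) / (F (g * (s - a)) * w ((g, a), s) - g\<^sup>2 * I ((g, a), s)) ^ 3"
    "v ((g, a), s) * q ((g, a), s) = w ((g, a), s) / (F (g * (s - a)) * w ((g, a), s) - g\<^sup>2 * I ((g, a), s))"
    "s / 4 \<le> F (g * (s - a)) * w ((g, a), s) - g\<^sup>2 * I ((g, a), s)"
proof -
  define X where "X = F (g * (s - a)) * v ((g, a), s) - g\<^sup>2 * s * j ((g, a), s)"
  have d: "F (g * (s - a)) * w ((g, a), s) - g\<^sup>2 * I ((g, a), s) = s * X"
    unfolding X_def by (rule denominator(1)[OF l])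
  have q: "q ((g, a), s) = inverse X" unfolding X_def by (rule q_eq(2)[OF l])
  have X: "1/4 \<le> X" unfolding X_def by (rule q_eq(1)[OF l])
  show "s / 4 \<le> F (g * (s - a)) * w ((g, a), s) - g\<^sup>2 * I ((g, a), s)"
    unfolding d using mult_left_mono[OF X, of s] s by simp
  show "v ((g, a), s) * q ((g, a), s) = w ((g, a), s) / (F (g * (s - a)) * w ((g, a), s) - g\<^sup>2 * I ((g, a), s))"
    unfolding d q using s by (simp add: w_def field_simps)
  show "v ((g, a), s) * j ((g, a), s) * q ((g, a), s) ^ 3 =
    w ((g, a), s) * I ((g, a), s) / (F (g * (s - a)) * w ((g, a), s) - g\<^sup>2 * I ((g, a), s)) ^ 3"
    unfolding d q using s X by (simp add: w_def I_def field_simps power2_eq_square power3_eq_cube)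
qed

text \<open>The bounds required by \<open>profile_unique\<close>: within 1/8 of height 0 the
  distance to the pole is at least 3/4, so the denominator is at least 3/16.\<close>

lemma middle_facts:
  assumes ga: "(g, a) \<in> matching_box" and s: "s - a \<in> {-1/8<..<1/8}"
  shows "((g, a), s) \<in> pars" "3/4 \<le> s" "\<bar>w ((g, a), s)\<bar> \<le> 4" "\<bar>I ((g, a), s)\<bar> \<le> 16 * M"
    "1/8 \<le> F (g * (s - a)) * w ((g, a), s) - g\<^sup>2 * I ((g, a), s)"
    "((\<lambda>x. w ((g, a), x)) has_real_derivative pd2 w ((g, a), s)) (at s)"
    "((\<lambda>x. pd2 w ((g, a), x)) has_real_derivative
      - 2 - 16 * g\<^sup>2 * (w ((g, a), s) * I ((g, a), s) / (F (g * (s - a)) * w ((g, a), s) - g\<^sup>2 * I ((g, a), s)) ^ 3)) (at s)"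
    "((\<lambda>x. I ((g, a), x)) has_real_derivative (s - a) * m (g * (s - a)) * w ((g, a), s)) (at s)"
proof -
  have s': "3/4 < s" "s < 5/4" using ga s by (auto simp: matching_box_def)
  have g: "\<bar>g\<bar> < d" "\<bar>a - 1\<bar> < 1/8" using ga by (auto simp: matching_box_def abs_if)
  show l: "((g, a), s) \<in> pars" using s' g by (auto simp: pars_iff)
  show "3/4 \<le> s" using s' by simp
  show "\<bar>w ((g, a), s)\<bar> \<le> 4"
  proof -
    have "\<bar>s\<bar> * \<bar>v ((g, a), s)\<bar> \<le> 5/4 * (5/2)" using s' v_bounds[OF l] by (intro mult_mono) auto
    then show ?thesis by (simp add: w_def abs_mult)
  qed
  show "\<bar>I ((g, a), s)\<bar> \<le> 16 * M"
  proof -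
    have "s\<^sup>2 \<le> (5/4)\<^sup>2" using s' by (intro power_mono) auto
    then have "s\<^sup>2 * \<bar>j ((g, a), s)\<bar> \<le> 2 * (8 * M)"
      using j_bound[OF l] by (intro mult_mono) (auto simp: power2_eq_square)
    then show ?thesis by (simp add: I_def abs_mult)
  qed
  show "1/8 \<le> F (g * (s - a)) * w ((g, a), s) - g\<^sup>2 * I ((g, a), s)"
    using vjq_eq(3)[OF l] s' by linarith
  show "((\<lambda>x. w ((g, a), x)) has_real_derivative pd2 w ((g, a), s)) (at s)" by (rule pd2_real[OF smooth_w l])
  have "s > 0" using s' by simp
  from profile_ode(2)[OF l, unfolded vjq_eq(1)[OF l this]]
  show "((\<lambda>x. pd2 w ((g, a), x)) has_real_derivative
      - 2 - 16 * g\<^sup>2 * (w ((g, a), s) * I ((g, a), s) / (F (g * (s - a)) * w ((g, a), s) - g\<^sup>2 * I ((g, a), s)) ^ 3)) (at s)" .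
  show "((\<lambda>x. I ((g, a), x)) has_real_derivative (s - a) * m (g * (s - a)) * w ((g, a), s)) (at s)"
    by (rule profile_ode(3)[OF l])
qed

lemma DERIV_shift_real:
  fixes f :: "real \<Rightarrow> real"
  assumes "(f has_real_derivative D) (at (z + a))"
  shows "((\<lambda>z. f (z + a)) has_real_derivative D) (at z)"
proof -
  have "((\<lambda>z. z + a) has_real_derivative 1) (at z)" by (rule derivative_eq_intros refl | simp)+
  from DERIV_chain2[where g = "\<lambda>z. z + a", OF assms this] show ?thesis by simp
qed

lemma DERIV_reflect_real:
  fixes f :: "real \<Rightarrow> real"
  assumes "(f has_real_derivative D) (at (b - z))"
  shows "((\<lambda>z. f (b - z)) has_real_derivative - D) (at z)"
proof -
  have "((\<lambda>z. b - z) has_real_derivative - 1) (at z)" by (rule derivative_eq_intros refl | simp)+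
  from DERIV_chain2[where g = "\<lambda>z. b - z", OF assms this] show ?thesis by simp
qed

lemma sq_le_d: "\<bar>g\<bar> < d \<Longrightarrow> g\<^sup>2 \<le> d\<^sup>2" "\<bar>g\<bar> < d \<Longrightarrow> g\<^sup>2 \<le> 1"
proof -
  assume g: "\<bar>g\<bar> < d"
  then show a: "g\<^sup>2 \<le> d\<^sup>2" by (simp add: abs_le_square_iff[symmetric])
  have "d\<^sup>2 \<le> 1" using d by (simp add: power_le_one)
  with a show "g\<^sup>2 \<le> 1" by linarith
qed

text \<open>At height 0 the prescribed curvature is F 0 = 2 whatever g is, so the first integral
  involves only the squared radius, the slope and the moment. Both caps then satisfy one and the
  same equation for the squared radius.\<close>

lemma equator_value:
  assumes ga: "(g, a) \<in> matching_box"
  shows "7/16 \<le> w ((g, a), a)" "\<bar>g\<^sup>2 * moment0 (g, a)\<bar> \<le> 1/1000"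
    "w ((g, a), a) + (slope0 (g, a))\<^sup>2 / 4 = (2 * w ((g, a), a) / (2 * w ((g, a), a) - g\<^sup>2 * moment0 (g, a)))\<^sup>2"
proof -
  have in0: "a - a \<in> {-1/8<..<1/8}" by simp
  note f = middle_facts[OF ga in0]
  have a: "7/8 < a" "\<bar>g\<bar> < d" using ga by (auto simp: matching_box_def abs_if)
  have "7/8 * (1/2) \<le> a * v ((g, a), a)" using a v_bounds[OF f(1)] by (intro mult_mono) auto
  then show "7/16 \<le> w ((g, a), a)" by (simp add: w_def)
  have "\<bar>g\<^sup>2\<bar> * \<bar>moment0 (g, a)\<bar> \<le> d\<^sup>2 * (16 * M)"
    using f(4) sq_le_d(1)[OF a(2)] by (intro mult_mono) (auto simp: moment0_def)
  then show "\<bar>g\<^sup>2 * moment0 (g, a)\<bar> \<le> 1/1000"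
    using small_d unfolding abs_mult by linarith
  have "a > 0" using a by simp
  have "w ((g, a), a) + (slope0 (g, a))\<^sup>2 / 4 = 4 * (v ((g, a), a) * q ((g, a), a))\<^sup>2"
    using first_integral[OF f(1)] by (simp add: slope0_def)
  also have "\<dots> = 4 * (w ((g, a), a) / (2 * w ((g, a), a) - g\<^sup>2 * moment0 (g, a)))\<^sup>2"
    unfolding vjq_eq(2)[OF f(1) \<open>a > 0\<close>] by (simp add: moment0_def F0)
  also have "\<dots> = (2 * w ((g, a), a) / (2 * w ((g, a), a) - g\<^sup>2 * moment0 (g, a)))\<^sup>2"
    by (simp add: power_divide power_mult_distrib)
  finally show "w ((g, a), a) + (slope0 (g, a))\<^sup>2 / 4 = (2 * w ((g, a), a) / (2 * w ((g, a), a) - g\<^sup>2 * moment0 (g, a)))\<^sup>2" .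
qed

text \<open>Both sides solve the same initial value problem at height 0. Under the reflection of the
  north cap the slope changes sign, but the moment does not: its integrand is odd in the height, and
  the orientation is reversed too.\<close>

lemma glue:
  assumes ga: "(g, a) \<in> matching_box" and gb: "(- g, b) \<in> matching_box"
    and slope: "slope0 (g, a) = - slope0 (- g, b)" and moment: "moment0 (g, a) = moment0 (- g, b)"
    and z: "z \<in> {-(1/8)<..<1/8}"
  shows "w ((g, a), z + a) = w ((- g, b), b - z)"
proof (rule profile_unique[where r = "1/8" and e = "g\<^sup>2" and B = "16 * M" and K = M
      and h = "\<lambda>z. F (g * z)" and k = "\<lambda>z. z * m (g * z)" and z = z
      and ?w1.0 = "\<lambda>z. w ((g, a), z + a)" and ?w2.0 = "\<lambda>z. w ((- g, b), b - z)"
      and ?u1.0 = "\<lambda>z. pd2 w ((g, a), z + a)" and ?u2.0 = "\<lambda>z. - pd2 w ((- g, b), b - z)"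
      and ?I1.0 = "\<lambda>z. I ((g, a), z + a)" and ?I2.0 = "\<lambda>z. I ((- g, b), b - z)"])
  have gd: "\<bar>g\<bar> < d" using ga by (auto simp: matching_box_def abs_if)
  show "z \<in> {-(1/8)<..<1/8}" by (rule z)
  show "0 \<le> g\<^sup>2" "g\<^sup>2 \<le> 1" using sq_le_d(2)[OF gd] by auto
  show "pd2 w ((g, a), 0 + a) = - pd2 w ((- g, b), b - 0)" using slope by (simp add: slope0_def)
  show "I ((g, a), 0 + a) = I ((- g, b), b - 0)" using moment by (simp add: moment0_def)
  show "w ((g, a), 0 + a) = w ((- g, b), b - 0)"
  proof -
    have "w ((g, a), a) = w ((- g, b), b)"
      by (rule first_integral_injective[of _ _ "g\<^sup>2 * moment0 (g, a)" "(slope0 (g, a))\<^sup>2 / 4"])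
        (use equator_value[OF ga] equator_value[OF gb] slope moment in auto)
    then show ?thesis by simp
  qed
  fix z :: real assume z: "z \<in> {-(1/8)<..<1/8}"
  have za: "z + a - a \<in> {-1/8<..<1/8}" and zb: "b - z - b \<in> {-1/8<..<1/8}" using z by auto
  note fa = middle_facts[OF ga za] and fb = middle_facts[OF gb zb]
  have sa: "g * (z + a - a) = g * z" and sb: "- g * (b - z - b) = g * z" by (simp_all add: algebra_simps)
  have gz: "\<bar>g * z\<bar> < 3 * d" using Yc_less[OF fa(1), of 1] by (simp add: Yc_apply one_clamp)
  show "\<bar>F (g * z)\<bar> \<le> 3" using F_bounds[OF gz] by auto
  show "\<bar>z * m (g * z)\<bar> \<le> M"
  proof -
    have "\<bar>z\<bar> * \<bar>m (g * z)\<bar> \<le> 1 * M" using z m_bound[OF gz] by (intro mult_mono) auto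
    then show ?thesis by (simp add: abs_mult)
  qed
  show "\<bar>w ((- g, b), b - z)\<bar> \<le> 4" by (rule fb(3))
  show "\<bar>I ((g, a), z + a)\<bar> \<le> 16 * M" by (rule fa(4))
  show "\<bar>I ((- g, b), b - z)\<bar> \<le> 16 * M" by (rule fb(4))
  show "1/8 \<le> F (g * z) * w ((g, a), z + a) - g\<^sup>2 * I ((g, a), z + a)" using fa(5) unfolding sa .
  show "1/8 \<le> F (g * z) * w ((- g, b), b - z) - g\<^sup>2 * I ((- g, b), b - z)" using fb(5) unfolding sb power2_minus .
  show "((\<lambda>z. w ((g, a), z + a)) has_real_derivative pd2 w ((g, a), z + a)) (at z)"
    by (rule DERIV_shift_real[OF fa(6)])
  show "((\<lambda>z. w ((- g, b), b - z)) has_real_derivative - pd2 w ((- g, b), b - z)) (at z)"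
    by (rule DERIV_reflect_real[OF fb(6)])
  show "((\<lambda>z. pd2 w ((g, a), z + a)) has_real_derivative - 2 - 16 * g\<^sup>2 *
      (w ((g, a), z + a) * I ((g, a), z + a) / (F (g * z) * w ((g, a), z + a) - g\<^sup>2 * I ((g, a), z + a)) ^ 3)) (at z)"
    using DERIV_shift_real[OF fa(7)] unfolding sa .
  show "((\<lambda>z. - pd2 w ((- g, b), b - z)) has_real_derivative - 2 - 16 * g\<^sup>2 *
      (w ((- g, b), b - z) * I ((- g, b), b - z) / (F (g * z) * w ((- g, b), b - z) - g\<^sup>2 * I ((- g, b), b - z)) ^ 3)) (at z)"
    using DERIV_minus[OF DERIV_reflect_real[OF fb(7)]] unfolding sb power2_minus minus_minus .
  show "((\<lambda>z. I ((g, a), z + a)) has_real_derivative z * m (g * z) * w ((g, a), z + a)) (at z)"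
    using DERIV_shift_real[OF fa(8)] unfolding sa by simp
  show "((\<lambda>z. I ((- g, b), b - z)) has_real_derivative z * m (g * z) * w ((- g, b), b - z)) (at z)"
    using DERIV_reflect_real[OF fb(8)] unfolding sb by simp
qed

theorem profile_exists:
  obtains \<delta> W where "0 < \<delta>" "\<delta> \<le> d" "Cinf_on ({-\<delta><..<\<delta>} \<times> {-(11/10)<..<11/10}) W"
    "\<And>z. z \<in> {-(11/10)<..<11/10} \<Longrightarrow> W (0, z) = 1 - z\<^sup>2"
    "\<And>g z. (g, z) \<in> {-\<delta><..<\<delta>} \<times> {-(11/10)<..<11/10} \<Longrightarrow> 0 < W (g, z) + (pd2 W (g, z))\<^sup>2 / 4"
    "\<And>g z. (g, z) \<in> {-\<delta><..<\<delta>} \<times> {-(11/10)<..<11/10} \<Longrightarrow>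
      2 * (W (g, z) + (pd2 W (g, z))\<^sup>2 / 4) - W (g, z) * (1 + pd2 (pd2 W) (g, z) / 2)
        = F (g * z) * sqrt (W (g, z) + (pd2 W (g, z))\<^sup>2 / 4) ^ 3"
proof -
  obtain \<delta> a b where \<delta>: "0 < \<delta>" "\<delta> \<le> d" and ab: "Cinf_on {-\<delta><..<\<delta>} a" "Cinf_on {-\<delta><..<\<delta>} b" "a 0 = 1" "b 0 = 1"
    and box: "\<And>g. g \<in> {-\<delta><..<\<delta>} \<Longrightarrow> (g, a g) \<in> matching_box"
    "\<And>g. g \<in> {-\<delta><..<\<delta>} \<Longrightarrow> (- g, b g) \<in> matching_box"
    and slope: "\<And>g. g \<in> {-\<delta><..<\<delta>} \<Longrightarrow> slope0 (g, a g) = - slope0 (- g, b g)"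
    and moment: "\<And>g. g \<in> {-\<delta><..<\<delta>} \<Longrightarrow> moment0 (g, a g) = moment0 (- g, b g)"
    using matching by metis
  let ?Om = "{-\<delta><..<\<delta>} \<times> {-(11/10)<..<11/10::real}"
  \<comment> \<open>As a lies in (7/8, 9/8), heights above - 11/10 keep s = z + a above - 1/4, and
    heights below 1/8 keep it below 5/4; likewise for the north cap. The caps overlap for |z| < 1/8,
    where \<open>glue\<close> identifies them.\<close>
  define L where "L = {-\<delta><..<\<delta>} \<times> {-(11/10)<..<1/8::real}"
  define R where "R = {-\<delta><..<\<delta>} \<times> {-(1/8)<..<11/10::real}"
  have LR: "open L" "open R" "L \<subseteq> ?Om" "R \<subseteq> ?Om" "?Om \<subseteq> L \<union> R"
    by (auto simp: L_def R_def intro: open_Times)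
  define pl where "pl = (\<lambda>p. ((fst p, a (fst p)), snd p + a (fst p)))"
  define pr where "pr = (\<lambda>p. ((- fst p, b (fst p)), b (fst p) - snd p))"
  have pl: "pl p \<in> pars" if "p \<in> L" for p
    using box(1)[of "fst p"] that by (auto simp: L_def pl_def matching_box_def pars_def)
  have pr: "pr p \<in> pars" if "p \<in> R" for p
    using box(2)[of "fst p"] that by (auto simp: R_def pr_def matching_box_def pars_def)
  have fstL: "fst ` L \<subseteq> {-\<delta><..<\<delta>}" "fst ` R \<subseteq> {-\<delta><..<\<delta>}" by (auto simp: L_def R_def)
  have cf: "Cinf_on X (fst :: real \<times> real \<Rightarrow> real)" "Cinf_on X (snd :: real \<times> real \<Rightarrow> real)" if "open X" for X
    using Cinf_on_fst[OF that Cinf_on_ident] Cinf_on_snd[OF that Cinf_on_ident] by auto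
  have ca: "Cinf_on L (\<lambda>p. a (fst p))" and cb: "Cinf_on R (\<lambda>p. b (fst p))"
    by (rule Cinf_on_compose[OF LR(1) open_greaterThanLessThan fstL(1) cf(1)[OF LR(1)] ab(1)])
      (rule Cinf_on_compose[OF LR(2) open_greaterThanLessThan fstL(2) cf(1)[OF LR(2)] ab(2)])
  have cpl: "Cinf_on L pl" and cpr: "Cinf_on R pr"
    unfolding pl_def pr_def
    by (intro Cinf_on_Pair Cinf_on_add Cinf_on_diff Cinf_on_minus ca cb cf LR)+
  have imL: "pl ` L \<subseteq> pars" and imR: "pr ` R \<subseteq> pars" using pl pr by auto
  have cl: "Cinf_on L (\<lambda>p. f (pl p))" and cr: "Cinf_on R (\<lambda>p. f (pr p))" if "Cinf_on pars f" for f :: "_ \<Rightarrow> real"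
    by (rule Cinf_on_compose[OF LR(1) open_pars imL cpl that], rule Cinf_on_compose[OF LR(2) open_pars imR cpr that])
  have pdl: "pd2 (\<lambda>p. f (pl p)) p = pd2 f (pl p)" if f: "Cinf_on pars f" and p: "p \<in> L" for f :: "(real \<times> real) \<times> real \<Rightarrow> real" and p
  proof -
    obtain g z where gz: "p = (g, z)" by (cases p)
    have "((\<lambda>x. f ((g, a g), x)) has_real_derivative pd2 f ((g, a g), z + a g)) (at (z + a g))"
      by (rule pd2_real[OF f]) (use pl[OF p] in \<open>simp add: pl_def gz\<close>)
    from DERIV_shift_real[OF this] show ?thesis
      using pd2_eqI[OF cl[OF f], of g z] p by (simp add: pl_def gz)
  qed
  have pdr: "pd2 (\<lambda>p. f (pr p)) p = - pd2 f (pr p)" if f: "Cinf_on pars f" and p: "p \<in> R" for f :: "(real \<times> real) \<times> real \<Rightarrow> real" and p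
  proof -
    obtain g z where gz: "p = (g, z)" by (cases p)
    have "((\<lambda>x. f ((- g, b g), x)) has_real_derivative pd2 f ((- g, b g), b g - z)) (at (b g - z))"
      by (rule pd2_real[OF f]) (use pr[OF p] in \<open>simp add: pr_def gz\<close>)
    from DERIV_reflect_real[OF this] show ?thesis
      using pd2_eqI[OF cr[OF f], of g z] p by (simp add: pr_def gz)
  qed
  define W where "W = (\<lambda>p. if snd p < 0 then w (pl p) else w (pr p))"
  have eq: "w (pl p) = w (pr p)" if "p \<in> L" "p \<in> R" for p
    using glue[OF box(1)[of "fst p"] box(2)[of "fst p"] slope moment, of "snd p"] that
    by (auto simp: L_def R_def pl_def pr_def)
  have WL: "W p = w (pl p)" if "p \<in> L" for p
    using eq[of p] that by (auto simp: W_def L_def R_def)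
  have WR: "W p = w (pr p)" if "p \<in> R" for p
    using eq[of p] that by (auto simp: W_def L_def R_def)
  have cWL: "Cinf_on L W" by (rule Cinf_on_cong[OF LR(1) WL[symmetric] cl[OF smooth_w]])
  have cWR: "Cinf_on R W" by (rule Cinf_on_cong[OF LR(2) WR[symmetric] cr[OF smooth_w]])
  have cW: "Cinf_on ?Om W"
  proof (rule Cinf_on_local)
    fix p assume "p \<in> ?Om"
    then have "p \<in> L \<or> p \<in> R" using LR(5) by blast
    then show "\<exists>V. open V \<and> p \<in> V \<and> Cinf_on V W" using LR(1,2) cWL cWR by blast
  qed
  have pdW_L: "pd2 W p = pd2 w (pl p)" if "p \<in> L" for p
    using pd2_cong[OF LR(1) that WL cWL] pdl[OF smooth_w that] by simp
  have pdW_R: "pd2 W p = - pd2 w (pr p)" if "p \<in> R" for p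
    using pd2_cong[OF LR(2) that WR cWR] pdr[OF smooth_w that] by simp
  have pd2W_L: "pd2 (pd2 W) p = pd2 (pd2 w) (pl p)" if "p \<in> L" for p
    using pd2_cong[OF LR(1) that pdW_L Cinf_on_pd2[OF cWL]] pdl[OF Cinf_on_pd2[OF smooth_w] that] by simp
  have cmw: "Cinf_on pars (\<lambda>l. - pd2 w l)" by (rule Cinf_on_minus[OF open_pars Cinf_on_pd2[OF smooth_w]])
  have pdm: "pd2 (\<lambda>l. - pd2 w l) l = - pd2 (pd2 w) l" if "l \<in> pars" for l
  proof -
    obtain ga s where l: "l = (ga, s)" by (cases l)
    show ?thesis unfolding l
      by (rule pd2_eqI[OF cmw _ DERIV_minus[OF pd2_real[OF Cinf_on_pd2[OF smooth_w]]]]) (use that l in auto)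
  qed
  have pd2W_R: "pd2 (pd2 W) p = pd2 (pd2 w) (pr p)" if "p \<in> R" for p
    using pd2_cong[OF LR(2) that pdW_R Cinf_on_pd2[OF cWR]] pdr[OF cmw that] pdm[OF pr[OF that]] by simp
  have conc: "0 < W (g, z) + (pd2 W (g, z))\<^sup>2 / 4 \<and>
     2 * (W (g, z) + (pd2 W (g, z))\<^sup>2 / 4) - W (g, z) * (1 + pd2 (pd2 W) (g, z) / 2)
        = F (g * z) * sqrt (W (g, z) + (pd2 W (g, z))\<^sup>2 / 4) ^ 3" if gz: "(g, z) \<in> ?Om" for g z
  proof (cases "(g, z) \<in> L")
    case True
    have l: "((g, a g), z + a g) \<in> pars" using pl[OF True] by (simp add: pl_def)
    show ?thesis
      unfolding WL[OF True] pdW_L[OF True] pd2W_L[OF True]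
      using curvature_equation[OF l] by (simp add: pl_def)
  next
    case False
    then have R: "(g, z) \<in> R" using gz LR(5) by blast
    have l: "((- g, b g), b g - z) \<in> pars" using pr[OF R] by (simp add: pr_def)
    show ?thesis
      unfolding WR[OF R] pdW_R[OF R] pd2W_R[OF R] power2_minus
      using curvature_equation[OF l] by (simp add: pr_def)
  qed
  have W0: "W (0, z) = 1 - z\<^sup>2" if z: "z \<in> {-(11/10)<..<11/10}" for z
  proof (cases "z < 0")
    case True
    then have L: "(0, z) \<in> L" using z \<delta> by (auto simp: L_def)
    show ?thesis unfolding WL[OF L] using zero_gravity(1)[of 1 "z + 1"] pl[OF L] ab
      by (simp add: pl_def power2_eq_square algebra_simps)
  next
    case False
    then have R: "(0, z) \<in> R" using z \<delta> by (auto simp: R_def)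
    show ?thesis unfolding WR[OF R] using zero_gravity(1)[of 1 "1 - z"] pr[OF R] ab
      by (simp add: pr_def power2_eq_square algebra_simps)
  qed
  show thesis by (rule that[OF \<delta> cW W0]) (use conc in blast)+
qed

end

section \<open>Diffeomorphisms and charts of the ball\<close>

lemma smooth_onE:
  assumes "smooth_on S f" "x \<in> S"
  obtains U F where "open U" "x \<in> U" "Cinf_on U F" "\<And>y. y \<in> S \<Longrightarrow> y \<in> U \<Longrightarrow> F y = f y"
proof -
  have "\<exists>U F. open U \<and> x \<in> U \<and> Cinf_on U F \<and> (\<forall>y\<in>S \<inter> U. F y = f y)"
    using assms(1) unfolding smooth_on_def Cinf_on_def[symmetric] by (rule bspec) (rule assms(2))
  then obtain U F where U: "open U" "x \<in> U" "Cinf_on U F" "\<forall>y\<in>S \<inter> U. F y = f y"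
    by (elim exE conjE) (rule that)
  show ?thesis by (rule that[OF U(1-3)]) (rule bspec[OF U(4)], rule IntI)
qed

lemma smooth_onI:
  assumes "\<And>x. x \<in> S \<Longrightarrow> \<exists>U F. open U \<and> x \<in> U \<and> Cinf_on U F \<and> (\<forall>y\<in>S \<inter> U. F y = f y)"
  shows "smooth_on S f"
  unfolding smooth_on_def Cinf_on_def[symmetric] by (rule ballI) (rule assms)

lemma smooth_on_cong:
  assumes "\<And>x. x \<in> S \<Longrightarrow> f x = g x" "smooth_on S f"
  shows "smooth_on S g"
proof (rule smooth_onI)
  fix x assume x: "x \<in> S"
  obtain U F where U: "open U" "x \<in> U" "Cinf_on U F" "\<And>y. y \<in> S \<Longrightarrow> y \<in> U \<Longrightarrow> F y = f y"
    by (rule smooth_onE[OF assms(2) x]) (rule that)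
  have "\<forall>y\<in>S \<inter> U. F y = g y" using U(4) assms(1) by simp
  with U(1-3) show "\<exists>U F. open U \<and> x \<in> U \<and> Cinf_on U F \<and> (\<forall>y\<in>S \<inter> U. F y = g y)"
    by (intro exI[of _ U] exI[of _ F] conjI)
qed

lemma smooth_on_compose:
  fixes g :: "'a::euclidean_space \<Rightarrow> 'b::euclidean_space"
  assumes g: "smooth_on T g" and f: "smooth_on S f" and im: "g ` T \<subseteq> S"
  shows "smooth_on T (\<lambda>x. f (g x))"
proof (rule smooth_onI)
  fix x assume x: "x \<in> T"
  obtain U G where U: "open U" "x \<in> U" "Cinf_on U G" "\<And>y. y \<in> T \<Longrightarrow> y \<in> U \<Longrightarrow> G y = g y"
    by (rule smooth_onE[OF g x]) (rule that)
  have gx: "g x \<in> S" using im x by blast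
  obtain V F where V: "open V" "g x \<in> V" "Cinf_on V F" "\<And>y. y \<in> S \<Longrightarrow> y \<in> V \<Longrightarrow> F y = f y"
    by (rule smooth_onE[OF f gx]) (rule that)
  define U' where "U' = U \<inter> G -` V"
  have U': "open U'" unfolding U'_def
    by (rule continuous_open_preimage[OF Cinf_on_imp_continuous_on[OF U(3)] U(1) V(1)])
  have xU': "x \<in> U'" using U(2,4) V(2) x by (simp add: U'_def)
  have "Cinf_on U' (\<lambda>x. F (G x))"
    by (rule Cinf_on_compose[OF U' V(1) _ Cinf_on_subset[OF U(3)] V(3)]) (auto simp: U'_def)
  moreover have "\<forall>y\<in>T \<inter> U'. F (G y) = f (g y)"
  proof
    fix y assume y: "y \<in> T \<inter> U'"
    then have "G y = g y" "g y \<in> S" "G y \<in> V" using U(4) im by (auto simp: U'_def)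
    then show "F (G y) = f (g y)" using V(4) by simp
  qed
  ultimately show "\<exists>U F. open U \<and> x \<in> U \<and> Cinf_on U F \<and> (\<forall>y\<in>T \<inter> U. F y = f (g y))"
    using U' xU' by (intro exI[of _ U'] exI[of _ "\<lambda>x. F (G x)"] conjI)
qed

lemma smooth_diffeoI:
  fixes f :: "'a::euclidean_space \<Rightarrow> 'b::euclidean_space"
  assumes f: "smooth_on A f" and g: "smooth_on B g"
    and im: "f ` A \<subseteq> B" "g ` B \<subseteq> A" and inv: "\<And>a. a \<in> A \<Longrightarrow> g (f a) = a" "\<And>b. b \<in> B \<Longrightarrow> f (g b) = b"
  shows "smooth_diffeo A B f"
  unfolding smooth_diffeo_def
proof (intro conjI f)
  show b: "bij_betw f A B" by (rule bij_betw_byWitness[where f' = g]) (use im inv in auto)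
  show "smooth_on B (inv_into A f)"
  proof (rule smooth_on_cong[OF _ g])
    fix y assume "y \<in> B"
    then have "g y \<in> A" "f (g y) = y" using im(2) inv(2) by auto
    then show "g y = inv_into A f y" using inv_into_f_eq[OF bij_betw_imp_inj_on[OF b]] by simp
  qed
qed

lemma smooth_diffeo_compose:
  fixes f :: "'a::euclidean_space \<Rightarrow> 'b::euclidean_space" and g :: "'b \<Rightarrow> 'c::euclidean_space"
  assumes f: "smooth_diffeo A B f" and g: "smooth_diffeo B C g"
  shows "smooth_diffeo A C (\<lambda>x. g (f x))"
proof -
  have b: "bij_betw f A B" "bij_betw g B C" using f g by (auto simp: smooth_diffeo_def)
  have s: "smooth_on A f" "smooth_on B (inv_into A f)" "smooth_on B g" "smooth_on C (inv_into B g)"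
    using f g by (auto simp: smooth_diffeo_def)
  have im: "f ` A = B" "g ` B = C" using b by (auto simp: bij_betw_def)
  have im': "inv_into B g ` C \<subseteq> B" "inv_into A f ` B \<subseteq> A"
    using im inv_into_into[of _ g B] inv_into_into[of _ f A] by blast+
  show ?thesis
  proof (rule smooth_diffeoI[where g = "\<lambda>y. inv_into A f (inv_into B g y)"])
    show "smooth_on A (\<lambda>x. g (f x))" by (rule smooth_on_compose[OF s(1) s(3)]) (simp add: im)
    show "smooth_on C (\<lambda>y. inv_into A f (inv_into B g y))" by (rule smooth_on_compose[OF s(4) s(2) im'(1)])
    show "(\<lambda>x. g (f x)) ` A \<subseteq> C" using im by blast
    show "(\<lambda>y. inv_into A f (inv_into B g y)) ` C \<subseteq> A" using im' by blast
    show "inv_into A f (inv_into B g (g (f a))) = a" if "a \<in> A" for a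
    proof -
      have "f a \<in> B" using im(1) that by blast
      then show ?thesis using bij_betw_inv_into_left[OF b(2)] bij_betw_inv_into_left[OF b(1) that] by simp
    qed
    show "g (f (inv_into A f (inv_into B g y))) = y" if "y \<in> C" for y
    proof -
      have "inv_into B g y \<in> B" using im'(1) that by blast
      then show ?thesis using bij_betw_inv_into_right[OF b(1)] bij_betw_inv_into_right[OF b(2) that] by simp
    qed
  qed
qed

text \<open>A diffeomorphism between open sets carries charts of any subset to charts of its image.
  This covers the sphere and the closed ball, including its boundary charts, without computations on
  the deformed surface.\<close>

locale ambient_diffeo =
  fixes U0 :: "'a::euclidean_space set" and V0 :: "'b::euclidean_space set" and L Li
  assumes open_dom: "open U0" "open V0" and smooth_L: "Cinf_on U0 L" and smooth_Li: "Cinf_on V0 Li"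
    and L_in: "\<And>x. x \<in> U0 \<Longrightarrow> L x \<in> V0" and Li_in: "\<And>y. y \<in> V0 \<Longrightarrow> Li y \<in> U0"
    and Li_L: "\<And>x. x \<in> U0 \<Longrightarrow> Li (L x) = x" and L_Li: "\<And>y. y \<in> V0 \<Longrightarrow> L (Li y) = y"
begin

lemma image_eq: "M \<subseteq> U0 \<Longrightarrow> L ` M = {y \<in> V0. Li y \<in> M}"
  using L_in Li_L L_Li by force

lemma diffeo_image:
  assumes "M \<subseteq> U0"
  shows "smooth_diffeo M (L ` M) L" "smooth_diffeo (L ` M) M Li"
proof -
  have s: "smooth_on M L" by (rule Cinf_on_imp_smooth_on[OF smooth_L open_dom(1) assms])
  have s': "smooth_on (L ` M) Li"
    by (rule Cinf_on_imp_smooth_on[OF smooth_Li open_dom(2)]) (use assms L_in in blast)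
  show "smooth_diffeo M (L ` M) L" by (rule smooth_diffeoI[OF s s']) (use assms Li_L in auto)
  show "smooth_diffeo (L ` M) M Li" by (rule smooth_diffeoI[OF s' s]) (use assms Li_L in auto)
qed

lemma image_Int_open:
  assumes "M \<subseteq> U0" "open U"
  shows "open {y \<in> V0. Li y \<in> U}" "L ` M \<inter> {y \<in> V0. Li y \<in> U} = L ` (M \<inter> U)"
proof -
  have "{y \<in> V0. Li y \<in> U} = V0 \<inter> Li -` U" by auto
  then show "open {y \<in> V0. Li y \<in> U}"
    using continuous_open_preimage[OF Cinf_on_imp_continuous_on[OF smooth_Li] open_dom(2) assms(2)] by simp
  show "L ` M \<inter> {y \<in> V0. Li y \<in> U} = L ` (M \<inter> U)"
    using assms(1) image_eq[OF assms(1)] image_eq[of "M \<inter> U"] by blast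
qed

lemma chart_image:
  assumes M: "M \<subseteq> U0" and x: "x \<in> M" and c: "half_space_chart M x b f"
  shows "half_space_chart (L ` M) (L x) b (\<lambda>y. f (Li y))"
proof -
  obtain U V where b: "b \<in> Basis" and UV: "open U" "x \<in> U" "open V" "smooth_diffeo (M \<inter> U) (V \<inter> {y. 0 \<le> y \<bullet> b}) f"
    using c unfolding half_space_chart_def by blast
  have "M \<inter> U \<subseteq> U0" using M by blast
  from smooth_diffeo_compose[OF diffeo_image(2)[OF this] UV(4)]
  have "smooth_diffeo (L ` M \<inter> {y \<in> V0. Li y \<in> U}) (V \<inter> {y. 0 \<le> y \<bullet> b}) (\<lambda>y. f (Li y))"
    unfolding image_Int_open(2)[OF M UV(1)] .
  moreover have "L x \<in> {y \<in> V0. Li y \<in> U}" using x M UV(2) L_in Li_L by auto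
  ultimately show ?thesis
    unfolding half_space_chart_def using b UV(3) image_Int_open(1)[OF M UV(1)] by blast
qed

lemma manifold_image:
  assumes M: "M \<subseteq> U0" and m: "smooth_manifold TYPE('m::euclidean_space) M"
  shows "smooth_manifold TYPE('m) (L ` M)"
  unfolding smooth_manifold_def
proof
  fix y assume "y \<in> L ` M"
  then obtain x where x: "x \<in> M" "y = L x" by blast
  obtain U V and f :: "'a \<Rightarrow> 'm" where UV: "open U" "x \<in> U" "open V" "smooth_diffeo (M \<inter> U) V f"
    using m x(1) unfolding smooth_manifold_def by meson
  have "M \<inter> U \<subseteq> U0" using M by blast
  from smooth_diffeo_compose[OF diffeo_image(2)[OF this] UV(4)]
  have "smooth_diffeo (L ` M \<inter> {y \<in> V0. Li y \<in> U}) V (\<lambda>y. f (Li y))"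
    unfolding image_Int_open(2)[OF M UV(1)] .
  moreover have "y \<in> {y \<in> V0. Li y \<in> U}" using x M UV(2) L_in Li_L by auto
  ultimately show "\<exists>U V (f :: 'b \<Rightarrow> 'm). open U \<and> y \<in> U \<and> open V \<and> smooth_diffeo (L ` M \<inter> U) V f"
    using UV(3) image_Int_open(1)[OF M UV(1)] by blast
qed

lemma homeomorphic_image: "M \<subseteq> U0 \<Longrightarrow> M homeomorphic (L ` M)"
  unfolding homeomorphic_minimal
  by (intro exI[of _ L] exI[of _ Li] conjI ballI continuous_on_subset[OF Cinf_on_imp_continuous_on[OF smooth_L]]
      continuous_on_subset[OF Cinf_on_imp_continuous_on[OF smooth_Li]]) (use L_in Li_L in auto)

lemma compact_image: "M \<subseteq> U0 \<Longrightarrow> compact M \<Longrightarrow> compact (L ` M)"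
  by (rule compact_continuous_image[OF continuous_on_subset[OF Cinf_on_imp_continuous_on[OF smooth_L]]])

lemma open_image: "M \<subseteq> U0 \<Longrightarrow> open M \<Longrightarrow> open (L ` M)"
  using image_Int_open(1)[of M M] image_eq by simp

lemma inverse_derivatives:
  assumes y: "y \<in> V0"
  shows "frechet_derivative L (at (Li y)) (frechet_derivative Li (at y) v) = v"
proof -
  have "(L has_derivative frechet_derivative L (at (Li y))) (at (Li y))"
    by (rule Cinf_on_has_derivative[OF smooth_L Li_in[OF y]])
  from has_derivative_compose[OF Cinf_on_has_derivative[OF smooth_Li y] this]
  have 1: "((\<lambda>y. L (Li y)) has_derivative (\<lambda>v. frechet_derivative L (at (Li y)) (frechet_derivative Li (at y) v))) (at y)" .
  have "((\<lambda>y. L (Li y)) has_derivative (\<lambda>v. v)) (at y)"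
    by (rule has_derivative_transform_within_open[OF has_derivative_ident open_dom(2) y]) (simp add: L_Li)
  from fun_cong[OF has_derivative_unique[OF 1 this]] show ?thesis .
qed

end

text \<open>At an interior point a boundary chart would have a component with a local minimum, hence a singular derivative.\<close>

lemma interior_not_boundary:
  fixes M :: "'a::euclidean_space set" and f :: "'a \<Rightarrow> 'a"
  assumes x: "x \<in> interior M" and c: "half_space_chart M x b f"
  shows "f x \<bullet> b \<noteq> 0"
proof
  assume fx: "f x \<bullet> b = 0"
  obtain U V where b: "b \<in> Basis" and UV: "open U" "x \<in> U" "open V" "smooth_diffeo (M \<inter> U) (V \<inter> {y. 0 \<le> y \<bullet> b}) f"
    using c unfolding half_space_chart_def by blast
  let ?A = "M \<inter> U" and ?B = "V \<inter> {y. 0 \<le> y \<bullet> b}"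
  have bij: "bij_betw f ?A ?B" and sf: "smooth_on ?A f" and sg: "smooth_on ?B (inv_into ?A f)"
    using UV(4) by (auto simp: smooth_diffeo_def)
  have xA: "x \<in> ?A" using x UV(2) interior_subset by blast
  have fxB: "f x \<in> ?B" using bij xA by (auto simp: bij_betw_def)
  obtain U1 F where F: "open U1" "x \<in> U1" "Cinf_on U1 F" "\<And>y. y \<in> ?A \<Longrightarrow> y \<in> U1 \<Longrightarrow> F y = f y"
    by (rule smooth_onE[OF sf xA]) (rule that)
  obtain V1 G where G: "open V1" "f x \<in> V1" "Cinf_on V1 G" "\<And>y. y \<in> ?B \<Longrightarrow> y \<in> V1 \<Longrightarrow> G y = inv_into ?A f y"
    by (rule smooth_onE[OF sg fxB]) (rule that)
  have Fx: "F x = f x" by (rule F(4)[OF xA F(2)])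
  \<comment> \<open>\<open>Q\<close> is a full neighbourhood of x in space because x is interior. On
    it G F = id, so the derivative of F at x is bijective, while the component of F along b is
    minimal at x.\<close>
  define Q where "Q = (interior M \<inter> U \<inter> U1) \<inter> F -` V1"
  have cF: "continuous_on (interior M \<inter> U \<inter> U1) F"
    by (rule continuous_on_subset[OF Cinf_on_imp_continuous_on[OF F(3)]]) blast
  have oQ: "open Q" unfolding Q_def
    by (rule continuous_open_preimage[OF cF _ G(1)]) (use UV(1) F(1) in auto)
  have xQ: "x \<in> Q" using x UV(2) F(2) G(2) Fx by (simp add: Q_def)
  have QA: "y \<in> ?A" "y \<in> U1" "F y \<in> V1" if "y \<in> Q" for y
    using that interior_subset by (auto simp: Q_def)
  have QF: "F y = f y" "F y \<in> ?B" if "y \<in> Q" for y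
    using F(4)[OF QA(1,2)[OF that]] QA(1)[OF that] bij by (auto simp: bij_betw_def)
  have GF: "G (F y) = y" if "y \<in> Q" for y
    using G(4)[OF QF(2)[OF that] QA(3)[OF that]] QF(1)[OF that] bij_betw_inv_into_left[OF bij QA(1)[OF that]] by simp
  let ?DF = "frechet_derivative F (at x)" and ?DG = "frechet_derivative G (at (F x))"
  have DF: "(F has_derivative ?DF) (at x)" by (rule Cinf_on_has_derivative[OF F(3,2)])
  have DG: "(G has_derivative ?DG) (at (F x))" by (rule Cinf_on_has_derivative[OF G(3)]) (simp add: Fx G(2))
  have "((\<lambda>y. G (F y)) has_derivative (\<lambda>v. v)) (at x)"
    by (rule has_derivative_transform_within_open[OF has_derivative_ident oQ xQ]) (simp add: GF)
  from fun_cong[OF has_derivative_unique[OF has_derivative_compose[OF DF DG] this]]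
  have inv: "?DG (?DF v) = v" for v .
  have "inj ?DF" by (rule inj_on_inverseI[of _ ?DG]) (rule inv)
  then have "surj ?DF"
    by (rule linear_injective_imp_surjective[OF has_derivative_linear[OF DF]]) (rule refl)
  then obtain v where v: "?DF v = b" by (metis surjD)
  have D1: "((\<lambda>y. F y \<bullet> b) has_derivative (\<lambda>v. ?DF v \<bullet> b)) (at x)"
    by (rule has_derivative_inner_left[OF DF])
  obtain e where e: "e > 0" "ball x e \<subseteq> Q" using oQ xQ open_contains_ball by blast
  have "(\<lambda>v. ?DF v \<bullet> b) = (\<lambda>v. 0)"
  proof (rule differential_zero_maxmin[OF _ open_ball D1])
    show "x \<in> ball x e" using e(1) by simp
    have "F x \<bullet> b \<le> F y \<bullet> b" if "y \<in> ball x e" for y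
      using QF(2)[of y] that e(2) Fx fx by auto
    then show "(\<forall>y\<in>ball x e. F y \<bullet> b \<le> F x \<bullet> b) \<or> (\<forall>y\<in>ball x e. F x \<bullet> b \<le> F y \<bullet> b)" by blast
  qed
  from fun_cong[OF this, of v] v b show False by simp
qed

section \<open>Cayley charts of the ball and stereographic charts of the sphere\<close>

definition inversion :: "'a::euclidean_space \<Rightarrow> 'a" where "inversion u = inverse (u \<bullet> u) *\<^sub>R u"

lemma inversion_inversion: "u \<noteq> 0 \<Longrightarrow> inversion (inversion u) = u"
  by (simp add: inversion_def)

lemma inversion_nonzero: "u \<noteq> 0 \<Longrightarrow> inversion u \<noteq> 0"
  by (simp add: inversion_def)

lemma Cinf_on_inversion: "Cinf_on (- {0}) inversion"
  unfolding inversion_def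
  by (intro Cinf_on_scaleR Cinf_on_inverse Cinf_on_inner Cinf_on_ident) auto

text \<open>Inversion at the antipode \<open>- x\<close> maps the unit ball to the half-space \<open>1/2 \<le> u \<bullet> x\<close>.\<close>

locale cayley_chart =
  fixes x b :: "'a::euclidean_space" and T Ti :: "'a \<Rightarrow> 'a"
  assumes x: "norm x = 1" and T: "orthogonal_transformation T" "T x = b"
    and Ti: "linear Ti" "\<And>u. Ti (T u) = u" "\<And>u. T (Ti u) = u"
begin

definition chart where "chart y = T (inversion (y + x)) - (1/2) *\<^sub>R b"
definition param where "param p = inversion (Ti (p + (1/2) *\<^sub>R b)) - x"

lemma bb: "b \<bullet> b = 1" "x \<bullet> x = 1"
proof -
  have "norm b = 1" using x orthogonal_transformation_norm[OF T(1), of x] T(2) by simp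
  then show "b \<bullet> b = 1" unfolding norm_eq_1 .
  show "x \<bullet> x = 1" using x unfolding norm_eq_1 .
qed

lemma Tb: "T u \<bullet> b = u \<bullet> x"
  using T by (metis orthogonal_transformation_def)

lemma lin: "linear T" using T(1) orthogonal_transformation_linear by blast

text \<open>T carries x to b and preserves inner products, so the height is the component of
  \<open>inversion (y + x)\<close> along x, minus 1/2. The numerator 1 - |y|^2 shows that the ball
  corresponds to the half-space and the sphere to its boundary.\<close>

lemma chart_height:
  assumes "y \<noteq> - x"
  shows "chart y \<bullet> b = (1 - y \<bullet> y) / (2 * ((y + x) \<bullet> (y + x)))"
proof -
  have 0: "(y + x) \<bullet> (y + x) \<noteq> 0" using assms by (simp add: add_eq_0_iff2)
  have e: "(y + x) \<bullet> (y + x) = y \<bullet> y + 2 * (y \<bullet> x) + 1"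
    using bb(2) by (simp add: inner_add_left inner_add_right inner_commute)
  have "chart y \<bullet> b = inverse ((y + x) \<bullet> (y + x)) * ((y + x) \<bullet> x) - 1/2"
    unfolding chart_def inner_diff_left Tb by (simp add: inversion_def bb)
  also have "(y + x) \<bullet> x = y \<bullet> x + 1" using bb(2) by (simp add: inner_add_left)
  finally have "chart y \<bullet> b = (y \<bullet> x + 1) / ((y + x) \<bullet> (y + x)) - 1/2" by (simp only: divide_inverse_commute)
  also have "\<dots> = (2 * (y \<bullet> x + 1) - (y + x) \<bullet> (y + x)) / (2 * ((y + x) \<bullet> (y + x)))"
    using 0 by (simp add: field_simps)
  also have "2 * (y \<bullet> x + 1) - (y + x) \<bullet> (y + x) = 1 - y \<bullet> y" unfolding e by simp
  finally show ?thesis .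
qed

lemma param_chart: "y \<noteq> - x \<Longrightarrow> param (chart y) = y"
  by (simp add: param_def chart_def Ti(2) inversion_inversion add_eq_0_iff2)

lemma chart_param:
  assumes "p + (1/2) *\<^sub>R b \<noteq> 0"
  shows "chart (param p) = p" "param p \<noteq> - x"
proof -
  have "Ti (p + (1/2) *\<^sub>R b) \<noteq> 0"
    using assms Ti(3) linear_0[OF lin] by metis
  then show "chart (param p) = p" "param p \<noteq> - x"
    using inversion_nonzero[of "Ti (p + (1/2) *\<^sub>R b)"]
    by (simp_all add: param_def chart_def inversion_inversion Ti(3) add_eq_0_iff2 del: inversion_nonzero)
qed

lemma nonneg_height: "0 \<le> p \<bullet> b \<Longrightarrow> p + (1/2) *\<^sub>R b \<noteq> 0"
proof
  assume "0 \<le> p \<bullet> b" "p + (1/2) *\<^sub>R b = 0"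
  then have "(p + (1/2) *\<^sub>R b) \<bullet> b = 0" by simp
  then show False using \<open>0 \<le> p \<bullet> b\<close> bb by (simp add: inner_add_left)
qed

lemma smooth_chart: "Cinf_on (- {- x}) chart"
proof -
  have "Cinf_on (- {- x}) (\<lambda>y. inversion (y + x))"
    by (rule Cinf_on_compose[OF _ _ _ _ Cinf_on_inversion]) (auto intro!: Cinf_on_add Cinf_on_ident Cinf_on_const simp: add_eq_0_iff2)
  then show ?thesis unfolding chart_def
    by (intro Cinf_on_diff Cinf_on_const Cinf_on_bounded_linear_compose[OF _ linear_conv_bounded_linear[THEN iffD1, OF lin]]) auto
qed

lemma smooth_param: "Cinf_on (- {- ((1/2) *\<^sub>R b)}) param"
proof -
  have "Cinf_on (- {- ((1/2) *\<^sub>R b)}) (\<lambda>p. Ti (p + (1/2) *\<^sub>R b))"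
    by (intro Cinf_on_bounded_linear_compose[OF _ linear_conv_bounded_linear[THEN iffD1, OF Ti(1)]] Cinf_on_add Cinf_on_ident Cinf_on_const) auto
  moreover have nz: "Ti (p + (1/2) *\<^sub>R b) \<noteq> 0" if "p \<in> - {- ((1/2) *\<^sub>R b)}" for p
  proof
    assume "Ti (p + (1/2) *\<^sub>R b) = 0"
    then have "p + (1/2) *\<^sub>R b = 0" using Ti(3) linear_0[OF lin] by metis
    then have "p = - ((1/2) *\<^sub>R b)" by (simp add: add_eq_0_iff2)
    then show False using that by simp
  qed
  ultimately have "Cinf_on (- {- ((1/2) *\<^sub>R b)}) (\<lambda>p. inversion (Ti (p + (1/2) *\<^sub>R b)))"
    by (intro Cinf_on_compose[OF _ _ _ _ Cinf_on_inversion] image_subsetI) (auto simp del: Compl_iff intro: nz simp: Compl_iff[of _ "{0}"])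
  then show ?thesis unfolding param_def by (intro Cinf_on_diff Cinf_on_const) auto
qed

lemma chart_sign:
  assumes "y \<noteq> - x"
  shows "0 \<le> chart y \<bullet> b \<longleftrightarrow> norm y \<le> 1" "chart y \<bullet> b = 0 \<longleftrightarrow> norm y = 1"
proof -
  have 0: "0 < 2 * ((y + x) \<bullet> (y + x))" using assms by (simp add: add_eq_0_iff2)
  have n: "y \<bullet> y = (norm y)\<^sup>2" by (simp add: power2_norm_eq_inner)
  have "0 \<le> chart y \<bullet> b \<longleftrightarrow> 0 \<le> 1 - y \<bullet> y"
    unfolding chart_height[OF assms] using pos_le_divide_eq[OF 0, of 0] by simp
  then show "0 \<le> chart y \<bullet> b \<longleftrightarrow> norm y \<le> 1" unfolding n by (simp add: abs_square_le_1)
  have "chart y \<bullet> b = 0 \<longleftrightarrow> 1 - y \<bullet> y = 0"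
    unfolding chart_height[OF assms] using less_imp_neq[OF 0] unfolding divide_eq_0_iff by simp
  then show "chart y \<bullet> b = 0 \<longleftrightarrow> norm y = 1" unfolding n using abs_square_eq_1[of "norm y"] by auto
qed

lemma diffeo_half_space: "smooth_diffeo (cball 0 1 \<inter> - {- x}) (UNIV \<inter> {y. 0 \<le> y \<bullet> b}) chart"
proof (rule smooth_diffeoI[where g = param])
  show "smooth_on (cball 0 1 \<inter> - {- x}) chart" by (rule Cinf_on_imp_smooth_on[OF smooth_chart]) auto
  show "smooth_on (UNIV \<inter> {y. 0 \<le> y \<bullet> b}) param"
    by (rule Cinf_on_imp_smooth_on[OF smooth_param]) (use bb in auto)
  show "chart ` (cball 0 1 \<inter> - {- x}) \<subseteq> UNIV \<inter> {y. 0 \<le> y \<bullet> b}" using chart_sign(1) by auto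
  show "param ` (UNIV \<inter> {y. 0 \<le> y \<bullet> b}) \<subseteq> cball 0 1 \<inter> - {- x}"
  proof
    fix y assume "y \<in> param ` (UNIV \<inter> {y. 0 \<le> y \<bullet> b})"
    then obtain p where p: "0 \<le> p \<bullet> b" "y = param p" by blast
    note cp = chart_param[OF nonneg_height[OF p(1)]]
    show "y \<in> cball 0 1 \<inter> - {- x}" using chart_sign(1)[OF cp(2)] cp p by simp
  qed
  show "param (chart a) = a" if "a \<in> cball 0 1 \<inter> - {- x}" for a using param_chart that by simp
  show "chart (param p) = p" if "p \<in> UNIV \<inter> {y. 0 \<le> y \<bullet> b}" for p using chart_param(1)[OF nonneg_height] that by simp
qed

lemma chart_center: "chart x = 0"
proof -
  have "(x + x) \<bullet> (x + x) = 4" using bb by (simp add: inner_add_left inner_add_right)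
  then have "inversion (x + x) = (1/4) *\<^sub>R (x + x)" by (simp add: inversion_def)
  also have "\<dots> = (1/2) *\<^sub>R x" by (simp add: scaleR_2[symmetric])
  finally show ?thesis by (simp add: chart_def linear_scale[OF lin] T(2))
qed

end

lemma cayley_chart_exists:
  fixes x b :: "real^'n"
  assumes "norm x = 1" "norm b = 1"
  obtains T Ti where "cayley_chart x b T Ti"
proof -
  obtain T where T: "orthogonal_transformation T" "T x = b"
    using orthogonal_transformation_exists[of x b] assms by metis
  have bij: "bij T" by (rule orthogonal_transformation_bij[OF T(1)])
  have lin: "linear (inv T)"
    using orthogonal_transformation_linear[OF orthogonal_transformation_inv[OF T(1)]] .
  have "cayley_chart x b T (inv T)"
    by (rule cayley_chart.intro) (use assms T bij lin in \<open>simp_all add: bij_is_inj bij_is_surj surj_f_inv_f\<close>)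
  then show ?thesis by (rule that)
qed

lemma unit_neq_minus:
  fixes x :: "'a::real_normed_vector"
  assumes "norm x = 1" shows "x \<noteq> - x"
proof
  assume "x = - x"
  then have "x + x = 0" by (metis add.right_inverse)
  then have "2 *\<^sub>R x = 0" by (simp add: scaleR_2)
  then show False using assms by simp
qed

lemma half_space_chart_sphere:
  fixes x :: "real^3"
  assumes "norm x = 1"
  shows "\<exists>(b :: real^3) f. half_space_chart (cball 0 1) x b f \<and> f x \<bullet> b = 0"
proof -
  obtain T Ti where "cayley_chart x (axis 3 1) T Ti"
    using cayley_chart_exists[OF assms, of "axis 3 1"] by auto
  then interpret cayley_chart x "axis 3 1" T Ti .
  have "x \<noteq> - x" by (rule unit_neq_minus[OF assms])
  then have "half_space_chart (cball 0 1) x (axis 3 1) chart"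
    unfolding half_space_chart_def using diffeo_half_space
    by (intro conjI exI[of _ "- {- x}"] exI[of _ UNIV]) (auto simp: axis_in_Basis_iff)
  then show ?thesis using chart_center by (intro exI[of _ "axis 3 1"] exI[of _ chart]) simp
qed

text \<open>Translation by 2 b moves the open ball into the open half-space, where intersecting with
  the half-space changes nothing.\<close>

lemma half_space_chart_ball:
  fixes x :: "real^3"
  assumes "norm x < 1"
  shows "\<exists>(b :: real^3) f. half_space_chart (cball 0 1) x b f"
proof -
  let ?b = "axis 3 1 :: real^3"
  have bb: "?b \<bullet> ?b = 1" "norm ?b = 1" by (simp_all add: inner_axis_axis norm_axis_1)
  have pos: "0 \<le> y \<bullet> ?b" if "y \<in> ball (2 *\<^sub>R ?b) 1" for y
  proof -
    have "\<bar>(y - 2 *\<^sub>R ?b) \<bullet> ?b\<bar> \<le> 1"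
      using Cauchy_Schwarz_ineq2[of "y - 2 *\<^sub>R ?b" ?b] that bb by (simp add: dist_norm norm_minus_commute)
    then show ?thesis using bb by (simp add: inner_diff_left)
  qed
  have "smooth_diffeo (cball 0 1 \<inter> ball 0 1) (ball (2 *\<^sub>R ?b) 1 \<inter> {y. 0 \<le> y \<bullet> ?b}) (\<lambda>y. y + 2 *\<^sub>R ?b)"
  proof (rule smooth_diffeoI[where g = "\<lambda>y. y - 2 *\<^sub>R ?b"])
    show "smooth_on (cball 0 1 \<inter> ball 0 1) (\<lambda>y. y + 2 *\<^sub>R ?b)"
      by (rule Cinf_on_imp_smooth_on[of UNIV]) (auto intro: Cinf_on_add Cinf_on_ident Cinf_on_const)
    show "smooth_on (ball (2 *\<^sub>R ?b) 1 \<inter> {y. 0 \<le> y \<bullet> ?b}) (\<lambda>y. y - 2 *\<^sub>R ?b)"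
      by (rule Cinf_on_imp_smooth_on[of UNIV]) (auto intro: Cinf_on_diff Cinf_on_ident Cinf_on_const)
    show "(\<lambda>y. y + 2 *\<^sub>R ?b) ` (cball 0 1 \<inter> ball 0 1) \<subseteq> ball (2 *\<^sub>R ?b) 1 \<inter> {y. 0 \<le> y \<bullet> ?b}"
    proof
      fix z assume "z \<in> (\<lambda>y. y + 2 *\<^sub>R ?b) ` (cball 0 1 \<inter> ball 0 1)"
      then have "z \<in> ball (2 *\<^sub>R ?b) 1" by (auto simp: dist_norm)
      then show "z \<in> ball (2 *\<^sub>R ?b) 1 \<inter> {y. 0 \<le> y \<bullet> ?b}" using pos by blast
    qed
    show "(\<lambda>y. y - 2 *\<^sub>R ?b) ` (ball (2 *\<^sub>R ?b) 1 \<inter> {y. 0 \<le> y \<bullet> ?b}) \<subseteq> cball 0 1 \<inter> ball 0 1"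
      by (auto simp: dist_norm norm_minus_commute)
  qed simp_all
  then have "half_space_chart (cball 0 1) x ?b (\<lambda>y. y + 2 *\<^sub>R ?b)"
    unfolding half_space_chart_def using assms
    by (intro conjI exI[of _ "ball 0 1"] exI[of _ "ball (2 *\<^sub>R ?b) 1"]) (auto simp: axis_in_Basis_iff)
  then show ?thesis by blast
qed

text \<open>The Cayley chart sends the sphere minus - x to height 0; dropping the third coordinate
  leaves the stereographic projection from - x, up to scale and rotation.\<close>

lemma smooth_manifold_sphere: "smooth_manifold TYPE(real^2) (sphere 0 1 :: (real^3) set)"
  unfolding smooth_manifold_def
proof
  fix x :: "real^3" assume "x \<in> sphere 0 1"
  then have x: "norm x = 1" by simp
  obtain T Ti where "cayley_chart x (axis 3 1) T Ti"
    using cayley_chart_exists[OF x, of "axis 3 1"] by auto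
  then interpret cayley_chart x "axis 3 1" T Ti .
  define \<pi> :: "real^3 \<Rightarrow> real^2" where "\<pi> v = v $ 1 *\<^sub>R axis 1 1 + v $ 2 *\<^sub>R axis 2 1" for v
  define \<sigma> :: "real^2 \<Rightarrow> real^3" where "\<sigma> p = p $ 1 *\<^sub>R axis 1 1 + p $ 2 *\<^sub>R axis 2 1" for p
  have c\<pi>: "Cinf_on U \<pi>" if "open U" for U
    unfolding \<pi>_def by (intro Cinf_on_add Cinf_on_scaleR Cinf_on_vec_nth Cinf_on_ident Cinf_on_const that)
  have c\<sigma>: "Cinf_on UNIV \<sigma>"
    unfolding \<sigma>_def by (intro Cinf_on_add Cinf_on_scaleR Cinf_on_vec_nth Cinf_on_ident Cinf_on_const open_UNIV)
  have \<pi>\<sigma>: "\<pi> (\<sigma> p) = p" for p by (simp add: \<pi>_def \<sigma>_def vec_eq_iff forall_2 axis_def)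
  have \<sigma>\<pi>: "\<sigma> (\<pi> v) = v" if "v $ 3 = 0" for v using that by (simp add: \<pi>_def \<sigma>_def vec_eq_iff forall_3 axis_def)
  have \<sigma>3: "\<sigma> p \<bullet> axis 3 1 = 0" for p by (simp add: \<sigma>_def inner_vec_def sum_3 axis_def)
  have cs: "chart y $ 3 = 0 \<longleftrightarrow> norm y = 1" if "y \<noteq> - x" for y
    using chart_sign(2)[OF that] by (simp add: inner_axis)
  have ne: "x \<noteq> - x" by (rule unit_neq_minus[OF x])
  have "smooth_diffeo (sphere 0 1 \<inter> - {- x}) UNIV (\<lambda>y. \<pi> (chart y))"
  proof (rule smooth_diffeoI[where g = "\<lambda>p. param (\<sigma> p)"])
    have "Cinf_on (- {- x}) (\<lambda>y. \<pi> (chart y))"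
      by (rule Cinf_on_compose[OF _ open_UNIV _ smooth_chart c\<pi>]) auto
    then show "smooth_on (sphere 0 1 \<inter> - {- x}) (\<lambda>y. \<pi> (chart y))"
      by (rule Cinf_on_imp_smooth_on) auto
    have "Cinf_on UNIV (\<lambda>p. param (\<sigma> p))"
    proof (rule Cinf_on_compose[OF open_UNIV _ _ c\<sigma> smooth_param])
      show "range \<sigma> \<subseteq> - {- ((1/2) *\<^sub>R axis 3 1)}"
      proof (rule image_subsetI, rule ComplI)
        fix p assume "\<sigma> p \<in> {- ((1/2) *\<^sub>R axis 3 1)}"
        then have "\<sigma> p + (1/2) *\<^sub>R axis 3 1 = 0" by simp
        then show False using nonneg_height[of "\<sigma> p"] \<sigma>3[of p] by simp
      qed
    qed auto
    then show "smooth_on UNIV (\<lambda>p. param (\<sigma> p))" by (rule Cinf_on_imp_smooth_on) auto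
    have cp: "chart (param (\<sigma> p)) = \<sigma> p" "param (\<sigma> p) \<noteq> - x" for p
      using chart_param[OF nonneg_height[of "\<sigma> p"]] \<sigma>3 by simp_all
    show "(\<lambda>p. param (\<sigma> p)) ` UNIV \<subseteq> sphere 0 1 \<inter> - {- x}"
    proof (rule image_subsetI)
      fix p
      show "param (\<sigma> p) \<in> sphere 0 1 \<inter> - {- x}"
        using chart_sign(2)[OF cp(2)[of p]] cp[of p] \<sigma>3[of p] by simp
    qed
    show "param (\<sigma> (\<pi> (chart a))) = a" if "a \<in> sphere 0 1 \<inter> - {- x}" for a
      using \<sigma>\<pi>[of "chart a"] cs[of a] param_chart[of a] that by simp
    show "\<pi> (chart (param (\<sigma> p))) = p" for p by (simp add: cp \<pi>\<sigma>)
  qed simp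
  then show "\<exists>U V (f :: real^3 \<Rightarrow> real^2). open U \<and> x \<in> U \<and> open V \<and> smooth_diffeo (sphere 0 1 \<inter> U) V f"
    using ne by (intro exI[of _ "- {- x}"] exI[of _ UNIV] exI[of _ "\<lambda>y. \<pi> (chart y)"]) auto
qed

section \<open>Topology and boundary of diffeomorphic images of the ball\<close>

locale ball_diffeo = ambient_diffeo U0 V0 L Li
  for U0 V0 :: "(real^3) set" and L Li + assumes ball_in: "cball 0 1 \<subseteq> U0"
begin

lemma subs: "ball 0 1 \<subseteq> U0" "sphere 0 1 \<subseteq> U0"
  using ball_in by (force simp: subset_iff)+

lemma closure_image: "closure (L ` ball 0 1) = L ` cball 0 1"
proof
  have "closed (L ` cball 0 1)" by (rule compact_imp_closed[OF compact_image[OF ball_in compact_cball]])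
  then show "closure (L ` ball 0 1) \<subseteq> L ` cball 0 1" by (intro closure_minimal image_mono) auto
  have "L ` closure (ball 0 1) \<subseteq> closure (L ` ball 0 1)"
    by (rule image_closure_subset[OF _ closed_closure closure_subset])
      (use continuous_on_subset[OF Cinf_on_imp_continuous_on[OF smooth_L] ball_in] in simp)
  then show "L ` cball 0 1 \<subseteq> closure (L ` ball 0 1)" by simp
qed

lemma geometry:
  "smooth_diffeo (cball 0 1) (L ` cball 0 1) L"
  "smooth_manifold_with_boundary TYPE(real^3) (closure (L ` ball 0 1))"
  "compact (closure (L ` ball 0 1))" "simply_connected (closure (L ` ball 0 1))"
  "L ` sphere 0 1 = manifold_boundary TYPE(real^3) (closure (L ` ball 0 1))"
  "smooth_manifold TYPE(real^2) (L ` sphere 0 1)" "compact (L ` sphere 0 1)" "simply_connected (L ` sphere 0 1)"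
proof -
  show "smooth_diffeo (cball 0 1) (L ` cball 0 1) L" by (rule diffeo_image(1)[OF ball_in])
  show "compact (closure (L ` ball 0 1))" unfolding closure_image by (rule compact_image[OF ball_in compact_cball])
  show "compact (L ` sphere 0 1)" by (rule compact_image[OF subs(2) compact_sphere])
  show "smooth_manifold TYPE(real^2) (L ` sphere 0 1)" by (rule manifold_image[OF subs(2) smooth_manifold_sphere])
  show "simply_connected (closure (L ` ball 0 1))"
    unfolding closure_image using homeomorphic_simply_connected_eq[OF homeomorphic_image[OF ball_in]]
      convex_imp_simply_connected[OF convex_cball] by blast
  show "simply_connected (L ` sphere 0 1)"
    using homeomorphic_simply_connected_eq[OF homeomorphic_image[OF subs(2)]]
      simply_connected_sphere[of "0 :: real^3" 1] by simp
  have chart: "\<exists>(b :: real^3) f. half_space_chart (L ` cball 0 1) (L x) b f" if "x \<in> cball 0 1" for x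
  proof (cases "norm x < 1")
    case True
    from half_space_chart_ball[OF this] show ?thesis using chart_image[OF ball_in that] by blast
  next
    case False
    then have "norm x = 1" using that by simp
    from half_space_chart_sphere[OF this] show ?thesis using chart_image[OF ball_in that] by blast
  qed
  then show "smooth_manifold_with_boundary TYPE(real^3) (closure (L ` ball 0 1))"
    unfolding closure_image smooth_manifold_with_boundary_def by blast
  show "L ` sphere 0 1 = manifold_boundary TYPE(real^3) (closure (L ` ball 0 1))"
    unfolding closure_image
  proof
    show "L ` sphere 0 1 \<subseteq> manifold_boundary TYPE(real^3) (L ` cball 0 1)"
    proof
      fix y assume "y \<in> L ` sphere 0 1"
      then obtain x where x: "norm x = 1" "y = L x" "x \<in> cball 0 1" by auto
      obtain b :: "real^3" and f where bf: "half_space_chart (cball 0 1) x b f" "f x \<bullet> b = 0"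
        using half_space_chart_sphere[OF x(1)] by blast
      have "half_space_chart (L ` cball 0 1) y b (\<lambda>y. f (Li y)) \<and> f (Li y) \<bullet> b = 0"
        using chart_image[OF ball_in x(3) bf(1)] bf(2) Li_L[of x] x(2,3) ball_in by auto
      then show "y \<in> manifold_boundary TYPE(real^3) (L ` cball 0 1)"
        unfolding manifold_boundary_def using x(2,3) by (intro CollectI conjI exI[of _ b] exI[of _ "\<lambda>y. f (Li y)"]) auto
    qed
    show "manifold_boundary TYPE(real^3) (L ` cball 0 1) \<subseteq> L ` sphere 0 1"
    proof
      fix y assume "y \<in> manifold_boundary TYPE(real^3) (L ` cball 0 1)"
      then obtain b :: "real^3" and f where y: "y \<in> L ` cball 0 1" "half_space_chart (L ` cball 0 1) y b f" "f y \<bullet> b = 0"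
        unfolding manifold_boundary_def by blast
      \<comment> \<open>The image of the open ball is open in space, and no boundary chart sends an
        interior point to height 0.\<close>
      have "y \<notin> interior (L ` cball 0 1)" using interior_not_boundary[OF _ y(2)] y(3) by blast
      moreover have "L ` ball 0 1 \<subseteq> interior (L ` cball 0 1)"
        by (rule interior_maximal[OF image_mono open_image[OF subs(1) open_ball]]) auto
      ultimately have "y \<notin> L ` ball 0 1" by blast
      then show "y \<in> L ` sphere 0 1" using y(1) by (force simp: order_le_less)
    qed
  qed
qed

end

section \<open>Curvature of rotationally symmetric radial graphs\<close>

lemma inner3: "x \<bullet> y = x $ 1 * y $ 1 + x $ 2 * y $ 2 + x $ 3 * y $ 3" for x y :: "real^3"
  by (simp add: inner_vec_def sum_3)

definition vec3 :: "real \<Rightarrow> real \<Rightarrow> real \<Rightarrow> real^3" where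
  "vec3 a b c = a *\<^sub>R axis 1 1 + b *\<^sub>R axis 2 1 + c *\<^sub>R axis 3 1"

lemma vec3_nth [simp]: "vec3 a b c $ 1 = a" "vec3 a b c $ 2 = b" "vec3 a b c $ 3 = c"
  by (simp_all add: vec3_def axis_def)

lemma vec_nth_has_derivative [derivative_intros]:
  "(f has_derivative f') F \<Longrightarrow> ((\<lambda>x. f x $ i) has_derivative (\<lambda>h. f' h $ i)) F"
  by (rule bounded_linear.has_derivative[OF bounded_linear_vec_nth])

lemma vec3_has_derivative [derivative_intros]:
  assumes "(a has_derivative a') F" "(b has_derivative b') F" "(c has_derivative c') F"
  shows "((\<lambda>x. vec3 (a x) (b x) (c x)) has_derivative (\<lambda>h. vec3 (a' h) (b' h) (c' h))) F"
  unfolding vec3_def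
  by (intro has_derivative_add has_derivative_scaleR_left assms)

text \<open>Parseval's identity; it removes the dependence on the orthonormal basis in
  \<open>total_curvature\<close>.\<close>

lemma sum_inner_squares:
  fixes B :: "'a::euclidean_space set"
  assumes "pairwise orthogonal B" "\<And>b. b \<in> B \<Longrightarrow> norm b = 1" "x \<in> span B"
  shows "(\<Sum>b\<in>B. (x \<bullet> b)\<^sup>2) = x \<bullet> x"
proof -
  have "0 \<notin> B" using assms(2) by force
  then have "finite B" using pairwise_orthogonal_independent[OF assms(1)] independent_imp_finite by blast
  from orthonormal_basis_expand[OF assms this] have "x \<bullet> x = x \<bullet> (\<Sum>b\<in>B. (x \<bullet> b) *\<^sub>R b)" by simp
  also have "\<dots> = (\<Sum>b\<in>B. (x \<bullet> b)\<^sup>2)" by (simp add: inner_sum_right power2_eq_square)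
  finally show ?thesis by simp
qed

text \<open>Curves inside S determine a derivative within S on tangent vectors, though not
  elsewhere. So the outward normal may be replaced by any smooth extension of it to space.\<close>

lemma derivative_within_on_tangent:
  fixes N :: "'a::euclidean_space \<Rightarrow> 'b::real_normed_vector"
  assumes W: "(N has_derivative W) (at x within S)" and W0: "(N0 has_derivative W0) (at x)"
    and eq: "\<And>y. y \<in> S \<Longrightarrow> N y = N0 y" and v: "v \<in> tangent_space S x"
  shows "W v = W0 v"
proof -
  obtain \<epsilon> \<gamma> where e: "\<epsilon>>0" "\<gamma> ` {-\<epsilon><..<\<epsilon>} \<subseteq> S" "\<gamma> (0::real) = x" "(\<gamma> has_vector_derivative v) (at 0)"
    using v unfolding tangent_space_def by blast
  have g0: "(\<gamma> has_derivative (\<lambda>h. h *\<^sub>R v)) (at 0)"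
    using e(4) unfolding has_vector_derivative_def .
  have W': "(N has_derivative W) (at (\<gamma> 0) within \<gamma> ` {-\<epsilon><..<\<epsilon>})"
    using has_derivative_subset[OF W e(2)] e(3) by simp
  have i: "at 0 within {-\<epsilon><..<\<epsilon>} = at 0" using e(1) by (intro at_within_open) auto
  have 1: "((\<lambda>t. N (\<gamma> t)) has_derivative (\<lambda>h. W (h *\<^sub>R v))) (at 0)"
    using diff_chain_within[OF has_derivative_at_withinI[OF g0] W'] unfolding i by (simp add: o_def)
  have W0': "(N0 has_derivative W0) (at (\<gamma> 0))" using W0 e(3) by simp
  have "((\<lambda>t. N (\<gamma> t)) has_derivative (\<lambda>h. W0 (h *\<^sub>R v))) (at 0)"
    by (rule has_derivative_transform_within_open[OF has_derivative_compose[OF g0 W0'], of "{-\<epsilon><..<\<epsilon>}"])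
      (use e eq in \<open>auto simp: image_subset_iff\<close>)
  from fun_cong[OF has_derivative_unique[OF 1 this], of 1] show ?thesis by simp
qed

text \<open>The surface is \<open>y\<^sub>1\<^sup>2 + y\<^sub>2\<^sup>2 = w y\<^sub>3\<close>; its distance to the origin in the direction of a unit vector
  with third component \<open>\<zeta>\<close> is \<open>f \<zeta>\<close>.\<close>

locale radial_graph =
  fixes Jz Ic :: "real set" and w f dw ddw :: "real \<Rightarrow> real"
  assumes open_JI: "open Jz" "open Ic" and smooth_w: "Cinf_on Jz w" and smooth_f: "Cinf_on Ic f"
    and dw: "\<And>z. z \<in> Jz \<Longrightarrow> (w has_real_derivative dw z) (at z)"
    and ddw: "\<And>z. z \<in> Jz \<Longrightarrow> (dw has_real_derivative ddw z) (at z)"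
    and pos: "\<And>z. z \<in> Jz \<Longrightarrow> 0 < w z + z\<^sup>2" and energy: "\<And>z. z \<in> Jz \<Longrightarrow> 0 < w z + (dw z)\<^sup>2 / 4"
    and f_pos: "\<And>\<zeta>. \<zeta> \<in> Ic \<Longrightarrow> 0 < f \<zeta>"
    and f_w: "\<And>\<zeta>. \<zeta> \<in> Ic \<Longrightarrow> f \<zeta> * \<zeta> \<in> Jz" "\<And>\<zeta>. \<zeta> \<in> Ic \<Longrightarrow> sqrt (w (f \<zeta> * \<zeta>) + (f \<zeta> * \<zeta>)\<^sup>2) = f \<zeta>"
    and w_f: "\<And>z. z \<in> Jz \<Longrightarrow> z / sqrt (w z + z\<^sup>2) \<in> Ic" "\<And>z. z \<in> Jz \<Longrightarrow> f (z / sqrt (w z + z\<^sup>2)) = sqrt (w z + z\<^sup>2)"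
    and unit_in: "{-1..1} \<subseteq> Ic"
begin

definition U0 :: "(real^3) set" where "U0 = {x. x $ 3 \<in> Ic}"
definition V0 :: "(real^3) set" where "V0 = {y. y $ 3 \<in> Jz}"
definition L :: "real^3 \<Rightarrow> real^3" where "L x = f (x $ 3) *\<^sub>R x"
definition Li :: "real^3 \<Rightarrow> real^3" where "Li y = inverse (sqrt (w (y $ 3) + (y $ 3)\<^sup>2)) *\<^sub>R y"

lemma open_UV: "open U0" "open V0"
proof -
  have "open ((\<lambda>x :: real^3. x $ 3) -` Ic)" "open ((\<lambda>x :: real^3. x $ 3) -` Jz)"
    by (intro open_vimage open_JI continuous_on_component continuous_on_id)+
  then show "open U0" "open V0" by (simp_all add: U0_def V0_def vimage_def)
qed

lemma third_smooth: "Cinf_on X (\<lambda>x :: real^3. x $ 3)"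
  unfolding Cinf_on_def
  by (intro allI k_smooth_on_subset[OF k_smooth_on_bounded_linear[OF open_UNIV bounded_linear_vec_nth]] subset_UNIV)

sublocale ball_diffeo U0 V0 L Li
proof
  show "open U0" "open V0" by (rule open_UV)+
  have "Cinf_on U0 (\<lambda>x. f (x $ 3))"
    by (rule Cinf_on_compose[OF open_UV(1) open_JI(2) _ third_smooth smooth_f]) (auto simp: U0_def)
  then show "Cinf_on U0 L" unfolding L_def by (intro Cinf_on_scaleR Cinf_on_ident open_UV)
  have "Cinf_on V0 (\<lambda>y. w (y $ 3))"
    by (rule Cinf_on_compose[OF open_UV(2) open_JI(1) _ third_smooth smooth_w]) (auto simp: V0_def)
  then have "Cinf_on V0 (\<lambda>y. sqrt (w (y $ 3) + (y $ 3)\<^sup>2))"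
    by (intro Cinf_on_sqrt Cinf_on_add Cinf_on_power third_smooth open_UV) (auto simp: V0_def pos)
  moreover have "sqrt (w (y $ 3) + (y $ 3)\<^sup>2) \<noteq> 0" if "y \<in> V0" for y using that pos[of "y $ 3"] by (simp add: V0_def)
  ultimately show "Cinf_on V0 Li" unfolding Li_def by (intro Cinf_on_scaleR Cinf_on_inverse Cinf_on_ident open_UV)
  show "L x \<in> V0" if "x \<in> U0" for x using that f_w(1) by (simp add: U0_def V0_def L_def)
  show "Li y \<in> U0" if "y \<in> V0" for y
    using that w_f(1)[of "y $ 3"] by (simp add: U0_def V0_def Li_def divide_inverse mult.commute)
  show "Li (L x) = x" if "x \<in> U0" for x
    using that f_w(2)[of "x $ 3"] f_pos[of "x $ 3"] by (simp add: U0_def L_def Li_def)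
  show "L (Li y) = y" if "y \<in> V0" for y
  proof -
    have "Li y $ 3 = y $ 3 / sqrt (w (y $ 3) + (y $ 3)\<^sup>2)" by (simp add: Li_def divide_inverse mult.commute)
    then have "f (Li y $ 3) = sqrt (w (y $ 3) + (y $ 3)\<^sup>2)" using w_f(2)[of "y $ 3"] that by (simp add: V0_def)
    then show ?thesis unfolding L_def using pos[of "y $ 3"] that by (simp add: Li_def V0_def)
  qed
  show "cball 0 1 \<subseteq> U0"
  proof
    fix x :: "real^3" assume "x \<in> cball 0 1"
    then have "\<bar>x $ 3\<bar> \<le> 1" using component_le_norm_cart[of x 3] by simp
    then show "x \<in> U0" using unit_in by (auto simp: U0_def abs_le_iff)
  qed
qed

definition level :: "real^3 \<Rightarrow> real" where "level y = (y $ 1)\<^sup>2 + (y $ 2)\<^sup>2 - w (y $ 3)"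
text \<open>Half of the gradient of \<open>level\<close>.\<close>

definition nn :: "real^3 \<Rightarrow> real^3" where "nn y = vec3 (y $ 1) (y $ 2) (- dw (y $ 3) / 2)"

text \<open>\<open>Li\<close> divides by the radius of the graph, so the squared norm is |y|^2 over
  w + y3^2, and |y|^2 exceeds this denominator by \<open>level y\<close>. This ties the level set to
  the image of the sphere and also yields the derivative of |Li|^2.\<close>

lemma norm_Li: "y \<in> V0 \<Longrightarrow> Li y \<bullet> Li y = 1 + level y * inverse (w (y $ 3) + (y $ 3)\<^sup>2)"
proof -
  assume y: "y \<in> V0"
  define e where "e = w (y $ 3) + (y $ 3)\<^sup>2"
  have e: "e > 0" using y pos by (simp add: e_def V0_def)
  have "Li y \<bullet> Li y = inverse (sqrt e) * inverse (sqrt e) * (y \<bullet> y)"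
    unfolding Li_def e_def[symmetric] by simp
  also have "inverse (sqrt e) * inverse (sqrt e) = inverse e"
    using e by (simp add: inverse_mult_distrib[symmetric] del: inverse_mult_distrib)
  also have "y \<bullet> y = e + level y" by (simp add: inner3 e_def level_def power2_eq_square)
  also have "inverse e * (e + level y) = 1 + level y * inverse e" using e by (simp add: field_simps)
  finally show "Li y \<bullet> Li y = 1 + level y * inverse (w (y $ 3) + (y $ 3)\<^sup>2)" unfolding e_def .
qed

lemma image_level:
  "L ` sphere 0 1 = {y \<in> V0. level y = 0}" "L ` cball 0 1 = {y \<in> V0. level y \<le> 0}"
proof -
  have "norm (Li y) = 1 \<longleftrightarrow> level y = 0" "norm (Li y) \<le> 1 \<longleftrightarrow> level y \<le> 0" if y: "y \<in> V0" for y
  proof -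
    have e: "0 < inverse (w (y $ 3) + (y $ 3)\<^sup>2)" using y pos by (simp add: V0_def)
    have n: "(norm (Li y))\<^sup>2 = 1 + level y * inverse (w (y $ 3) + (y $ 3)\<^sup>2)"
      using norm_Li[OF y] by (simp add: power2_norm_eq_inner)
    have "norm (Li y) = 1 \<longleftrightarrow> (norm (Li y))\<^sup>2 = 1" using abs_square_eq_1[of "norm (Li y)"] by simp
    then show "norm (Li y) = 1 \<longleftrightarrow> level y = 0" unfolding n using e by simp
    have "norm (Li y) \<le> 1 \<longleftrightarrow> (norm (Li y))\<^sup>2 \<le> 1" using abs_square_le_1[of "norm (Li y)"] by simp
    also have "\<dots> \<longleftrightarrow> level y * inverse (w (y $ 3) + (y $ 3)\<^sup>2) \<le> 0" unfolding n by simp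
    also have "\<dots> \<longleftrightarrow> level y \<le> 0" using e by (simp only: mult_le_0_iff) auto
    finally show "norm (Li y) \<le> 1 \<longleftrightarrow> level y \<le> 0" .
  qed
  then show "L ` sphere 0 1 = {y \<in> V0. level y = 0}" "L ` cball 0 1 = {y \<in> V0. level y \<le> 0}"
    unfolding image_eq[OF subs(2)] image_eq[OF ball_in] by auto
qed

lemma compose_third:
  assumes "y \<in> V0" "\<And>z. z \<in> Jz \<Longrightarrow> (h has_real_derivative h' z) (at z)"
  shows "((\<lambda>y. h (y $ 3)) has_derivative (\<lambda>v. h' (y $ 3) * v $ 3)) (at y)"
  using has_derivative_compose[OF vec_nth_has_derivative[OF has_derivative_ident]
      assms(2)[of "y $ 3", unfolded has_field_derivative_def]] assms(1)
  by (simp add: V0_def)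

lemma level_derivative:
  assumes "y \<in> V0"
  shows "(level has_derivative (\<lambda>v. 2 * (nn y \<bullet> v))) (at y)"
proof -
  have "(level has_derivative (\<lambda>v. 2 * v $ 1 * y $ 1 + 2 * v $ 2 * y $ 2 - dw (y $ 3) * v $ 3)) (at y)"
    unfolding level_def
    by (rule derivative_eq_intros compose_third[OF assms dw] refl | simp)+
  then show ?thesis by (simp add: inner3 nn_def algebra_simps)
qed

lemma nn_norm: "y \<in> V0 \<Longrightarrow> level y = 0 \<Longrightarrow> nn y \<bullet> nn y = w (y $ 3) + (dw (y $ 3))\<^sup>2 / 4"
  by (simp add: inner3 nn_def level_def power2_eq_square)

text \<open>For the inclusion from right to left, the derivative of |Li|^2 on the surface is a
  positive multiple of nn . v. Hence nn . v = 0 makes D Li v tangent to the sphere, and L maps a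
  curve on the sphere in that direction to a curve on the surface with velocity v.\<close>

lemma tangent_surface:
  assumes y: "y \<in> L ` sphere 0 1"
  shows "tangent_space (L ` sphere 0 1) y = {v. nn y \<bullet> v = 0}"
proof (intro set_eqI iffI)
  have yV: "y \<in> V0" and y0: "level y = 0" using y unfolding image_level(1) by auto
  fix v assume "v \<in> tangent_space (L ` sphere 0 1) y"
  then obtain \<epsilon> \<gamma> where e: "\<epsilon>>0" "\<gamma> ` {-\<epsilon><..<\<epsilon>} \<subseteq> L ` sphere 0 1" "\<gamma> (0::real) = y" "(\<gamma> has_vector_derivative v) (at 0)"
    unfolding tangent_space_def by blast
  have ld: "(level has_derivative (\<lambda>v. 2 * (nn y \<bullet> v))) (at (\<gamma> 0))" using level_derivative[OF yV] e(3) by simp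
  have 1: "((\<lambda>t. level (\<gamma> t)) has_derivative (\<lambda>h. 2 * (nn y \<bullet> (h *\<^sub>R v)))) (at 0)"
    by (rule has_derivative_compose[OF e(4)[unfolded has_vector_derivative_def] ld])
  have 2: "((\<lambda>t. level (\<gamma> t)) has_derivative (\<lambda>h. 0)) (at 0)"
    by (rule has_derivative_transform_within_open[OF has_derivative_const[of 0], of "{-\<epsilon><..<\<epsilon>}"])
      (use e(1,2) in \<open>auto simp: image_level(1) image_subset_iff\<close>)
  from fun_cong[OF has_derivative_unique[OF 1 2], of 1] show "v \<in> {v. nn y \<bullet> v = 0}" by simp
next
  have yV: "y \<in> V0" and y0: "level y = 0" using y unfolding image_level(1) by auto
  fix v assume v: "v \<in> {v. nn y \<bullet> v = 0}"
  let ?u = "frechet_derivative Li (at y) v"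
  have DLi: "(Li has_derivative frechet_derivative Li (at y)) (at y)" by (rule Cinf_on_has_derivative[OF smooth_Li yV])
  have unit: "norm (Li y) = 1" using y Li_L subs(2) by auto
  have 1: "((\<lambda>y. Li y \<bullet> Li y) has_derivative (\<lambda>h. Li y \<bullet> frechet_derivative Li (at y) h + frechet_derivative Li (at y) h \<bullet> Li y)) (at y)"
    by (rule has_derivative_inner[OF DLi DLi])
  obtain ie where ie: "((\<lambda>y. inverse (w (y $ 3) + (y $ 3)\<^sup>2)) has_derivative ie) (at y)"
  proof -
    have "w (y $ 3) + (y $ 3)\<^sup>2 \<noteq> 0" using pos[of "y $ 3"] yV by (simp add: V0_def)
    then have "(\<lambda>y. inverse (w (y $ 3) + (y $ 3)\<^sup>2)) differentiable (at y)"
      using compose_third[OF yV dw] vec_nth_has_derivative[OF has_derivative_ident, of 3 "at y"]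
      by (intro differentiable_inverse differentiable_add differentiable_power) (auto simp: differentiable_def)
    then show ?thesis using that unfolding differentiable_def by blast
  qed
  have "((\<lambda>y. 1 + level y * inverse (w (y $ 3) + (y $ 3)\<^sup>2)) has_derivative
      (\<lambda>h. 0 + (level y * ie h + 2 * (nn y \<bullet> h) * inverse (w (y $ 3) + (y $ 3)\<^sup>2)))) (at y)"
    by (intro has_derivative_add has_derivative_const has_derivative_mult level_derivative yV ie)
  then have 2: "((\<lambda>y. Li y \<bullet> Li y) has_derivative
      (\<lambda>h. 0 + (level y * ie h + 2 * (nn y \<bullet> h) * inverse (w (y $ 3) + (y $ 3)\<^sup>2)))) (at y)"
    by (rule has_derivative_transform_within_open[OF _ open_UV(2) yV]) (simp add: norm_Li)
  from fun_cong[OF has_derivative_unique[OF 1 2], of v]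
  have "Li y \<bullet> ?u = 0" using v y0 by (simp add: inner_commute)
  then have "?u \<in> tangent_space (sphere 0 1) (Li y)" unfolding tangent_sphere[OF unit] by simp
  then obtain \<epsilon> \<gamma> where e: "\<epsilon>>0" "smooth_on {-\<epsilon><..<\<epsilon>} \<gamma>" "\<gamma> ` {-\<epsilon><..<\<epsilon>} \<subseteq> sphere 0 1" "\<gamma> (0::real) = Li y"
    "(\<gamma> has_vector_derivative ?u) (at 0)"
    unfolding tangent_space_def by blast
  have sL: "smooth_on (sphere 0 1) L" by (rule Cinf_on_imp_smooth_on[OF smooth_L open_UV(1) subs(2)])
  have DL: "(L has_derivative frechet_derivative L (at (Li y))) (at (\<gamma> 0))"
    unfolding e(4) by (rule Cinf_on_has_derivative[OF smooth_L Li_in[OF yV]])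
  have d: "((\<lambda>t. L (\<gamma> t)) has_derivative (\<lambda>h. frechet_derivative L (at (Li y)) (h *\<^sub>R ?u))) (at 0)"
    by (rule has_derivative_compose[OF e(5)[unfolded has_vector_derivative_def] DL])
  have "frechet_derivative L (at (Li y)) (h *\<^sub>R ?u) = h *\<^sub>R v" for h
    using linear_scale[OF has_derivative_linear[OF DL]] inverse_derivatives[OF yV, of v] by simp
  with d have "((\<lambda>t. L (\<gamma> t)) has_vector_derivative v) (at 0)" unfolding has_vector_derivative_def by simp
  moreover have "L (\<gamma> 0) = y" using e(4) L_Li[OF yV] by simp
  moreover have "(\<lambda>t. L (\<gamma> t)) ` {-\<epsilon><..<\<epsilon>} \<subseteq> L ` sphere 0 1" using e(3) by blast
  ultimately show "v \<in> tangent_space (L ` sphere 0 1) y"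
    unfolding tangent_space_def using e(1) smooth_on_compose[OF e(2) sL e(3)]
    by (intro CollectI exI[of _ \<epsilon>] conjI exI[of _ "\<lambda>t. L (\<gamma> t)"])
qed

definition unit_normal where "unit_normal y = inverse (sqrt (w (y $ 3) + (dw (y $ 3))\<^sup>2 / 4)) *\<^sub>R nn y"

lemma unit_normal_norm:
  assumes "y \<in> V0" "level y = 0"
  shows "norm (unit_normal y) = 1" "0 < nn y \<bullet> unit_normal y"
proof -
  define e where "e = w (y $ 3) + (dw (y $ 3))\<^sup>2 / 4"
  have e: "e > 0" using energy[of "y $ 3"] assms(1) by (simp add: e_def V0_def)
  have nn: "nn y \<bullet> nn y = e" unfolding e_def by (rule nn_norm[OF assms])
  then have "norm (nn y) = sqrt e" by (simp add: norm_eq_sqrt_inner)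
  then show "norm (unit_normal y) = 1" using e unfolding unit_normal_def e_def[symmetric] by simp
  show "0 < nn y \<bullet> unit_normal y" using e nn unfolding unit_normal_def e_def[symmetric] by simp
qed

lemma level_along:
  assumes "y \<in> V0" "level y = 0" "0 < nn y \<bullet> v"
  shows "\<forall>\<^sub>F t in at_right 0. y + t *\<^sub>R v \<in> V0 \<and> 0 < level (y + t *\<^sub>R v)"
    "\<forall>\<^sub>F t in at_right 0. y - t *\<^sub>R v \<in> V0 \<and> level (y - t *\<^sub>R v) < 0"
proof -
  have "((\<lambda>t. y + t *\<^sub>R v) has_derivative (\<lambda>h. h *\<^sub>R v)) (at 0)"
    by (rule derivative_eq_intros refl | simp)+
  from has_derivative_compose[OF this, of level "\<lambda>v. 2 * (nn y \<bullet> v)"] level_derivative[OF assms(1)]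
  have "((\<lambda>t. level (y + t *\<^sub>R v)) has_derivative (\<lambda>h. 2 * (nn y \<bullet> (h *\<^sub>R v)))) (at 0)" by simp
  then have D: "((\<lambda>t. level (y + t *\<^sub>R v)) has_real_derivative 2 * (nn y \<bullet> v)) (at 0)"
    unfolding has_field_derivative_def by (rule has_derivative_eq_rhs) (simp add: fun_eq_iff)
  have V: "\<forall>\<^sub>F t in nhds 0. y + t *\<^sub>R v \<in> V0"
  proof -
    have o: "open ((\<lambda>t::real. y + t *\<^sub>R v) -` V0)" by (intro open_vimage open_UV continuous_intros)
    have i: "0 \<in> (\<lambda>t::real. y + t *\<^sub>R v) -` V0" using assms(1) by simp
    show ?thesis using eventually_nhds_in_open[OF o i] by simp
  qed
  obtain e where e: "e > 0" "\<And>t. dist t 0 < e \<Longrightarrow> y + t *\<^sub>R v \<in> V0" using V unfolding eventually_nhds_metric by blast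
  obtain d1 where d1: "d1 > 0" "\<And>h. 0 < h \<Longrightarrow> h < d1 \<Longrightarrow> level (y + 0 *\<^sub>R v) < level (y + (0 + h) *\<^sub>R v)"
    using DERIV_pos_inc_right[OF D] assms(3) by auto
  obtain d2 where d2: "d2 > 0" "\<And>h. 0 < h \<Longrightarrow> h < d2 \<Longrightarrow> level (y + (0 - h) *\<^sub>R v) < level (y + 0 *\<^sub>R v)"
    using DERIV_pos_inc_left[OF D] assms(3) by auto
  show "\<forall>\<^sub>F t in at_right 0. y + t *\<^sub>R v \<in> V0 \<and> 0 < level (y + t *\<^sub>R v)"
    unfolding eventually_at_right_field
    using e d1 assms(2) by (intro exI[of _ "min e d1"]) (auto simp: dist_real_def)
  show "\<forall>\<^sub>F t in at_right 0. y - t *\<^sub>R v \<in> V0 \<and> level (y - t *\<^sub>R v) < 0"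
    unfolding eventually_at_right_field
  proof (intro exI[of _ "min e d2"] conjI allI impI)
    show "0 < min e d2" using e d2 by simp
    fix t assume t: "0 < t" "t < min e d2"
    show "y - t *\<^sub>R v \<in> V0" using e(2)[of "- t"] t by (simp add: dist_real_def)
    show "level (y - t *\<^sub>R v) < 0" using d2(2)[of t] t assms(2) by simp
  qed
qed

lemma outward_normal_surface:
  assumes y: "y \<in> L ` sphere 0 1"
  shows "outward_normal (L ` ball 0 1) (L ` sphere 0 1) y = unit_normal y"
proof -
  have yV: "y \<in> V0" and y0: "level y = 0" using y unfolding image_level(1) by auto
  define \<nu> where "\<nu> = unit_normal y"
  have \<nu>: "norm \<nu> = 1" "0 < nn y \<bullet> \<nu>" unfolding \<nu>_def by (rule unit_normal_norm[OF yV y0])+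
  define c where "c = sqrt (w (y $ 3) + (dw (y $ 3))\<^sup>2 / 4)"
  have c: "c > 0" using energy[of "y $ 3"] yV by (simp add: c_def V0_def)
  have nc: "nn y = c *\<^sub>R \<nu>" using c unfolding \<nu>_def unit_normal_def c_def[symmetric] by simp
  have cl: "closure (L ` ball 0 1) = {y \<in> V0. level y \<le> 0}" using closure_image image_level(2) by simp
  show ?thesis
    unfolding outward_normal_def tangent_surface[OF y] cl \<nu>_def[symmetric]
  proof (rule the_equality, intro conjI)
    show "norm \<nu> = 1" by (rule \<nu>)
    show "\<forall>v\<in>{v. nn y \<bullet> v = 0}. \<nu> \<bullet> v = 0" using c by (simp add: nc)
    show "\<forall>\<^sub>F t in at_right 0. y + t *\<^sub>R \<nu> \<notin> {y \<in> V0. level y \<le> 0}"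
      using level_along(1)[OF yV y0 \<nu>(2)] by (rule eventually_mono) auto
    fix \<mu> assume \<mu>: "norm \<mu> = 1 \<and> (\<forall>v\<in>{v. nn y \<bullet> v = 0}. \<mu> \<bullet> v = 0) \<and>
      (\<forall>\<^sub>F t in at_right 0. y + t *\<^sub>R \<mu> \<notin> {y \<in> V0. level y \<le> 0})"
    define k where "k = \<mu> \<bullet> \<nu>"
    have \<nu>\<nu>: "\<nu> \<bullet> \<nu> = 1" using \<nu>(1) by (simp add: norm_eq_1)
    have "\<nu> \<bullet> (\<mu> - k *\<^sub>R \<nu>) = 0" by (simp add: inner_diff_right \<nu>\<nu> k_def inner_commute)
    moreover from this have "\<mu> \<bullet> (\<mu> - k *\<^sub>R \<nu>) = 0" using \<mu> by (simp add: nc)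
    ultimately have "(\<mu> - k *\<^sub>R \<nu>) \<bullet> (\<mu> - k *\<^sub>R \<nu>) = 0" by (simp add: inner_diff_left)
    then have mk: "\<mu> = k *\<^sub>R \<nu>" by simp
    then have "\<bar>k\<bar> = 1" using \<mu> \<nu>(1) by auto
    moreover have "k \<noteq> -1"
    proof
      assume "k = -1"
      then have "\<forall>\<^sub>F t in at_right 0. y - t *\<^sub>R \<nu> \<notin> {y \<in> V0. level y \<le> 0}" using \<mu> mk by simp
      with level_along(2)[OF yV y0 \<nu>(2)] have "\<forall>\<^sub>F t in at_right (0::real). False"
        by eventually_elim auto
      then show False by simp
    qed
    ultimately have "k = 1" by linarith
    then show "\<mu> = \<nu>" using mk by simp
  qed
qed

text \<open>\<open>W0\<close> differentiates the normal c nn; the term with c' points along nn and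
  drops out on tangent vectors. What remains depends on the basis B only through the sum of the
  squared third components, and this sum is W / E.\<close>

theorem total_curvature_surface:
  assumes y: "y \<in> L ` sphere 0 1"
  defines "E \<equiv> w (y $ 3) + (dw (y $ 3))\<^sup>2 / 4"
  shows "total_curvature (L ` ball 0 1) (L ` sphere 0 1) y = (2 * E - w (y $ 3) * (1 + ddw (y $ 3) / 2)) / sqrt E ^ 3"
proof -
  let ?S = "L ` sphere 0 1" and ?D = "L ` ball 0 1"
  have yV: "y \<in> V0" and y0: "level y = 0" using y unfolding image_level(1) by auto
  have E: "E > 0" using energy[of "y $ 3"] yV by (simp add: E_def V0_def)
  define c where "c = inverse (sqrt E)"
  have c2: "c\<^sup>2 = inverse E" "c > 0" using E by (simp_all add: c_def power_inverse)
  have nu: "unit_normal y = c *\<^sub>R nn y" by (simp add: unit_normal_def c_def E_def)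
  obtain c' where c': "((\<lambda>y. inverse (sqrt (w (y $ 3) + (dw (y $ 3))\<^sup>2 / 4))) has_derivative c') (at y)"
  proof -
    have D: "((\<lambda>z. inverse (sqrt (w z + (dw z)\<^sup>2 / 4))) has_real_derivative
        - (inverse (sqrt (w z + (dw z)\<^sup>2 / 4)) / 2 * (dw z + 2 * ddw z * dw z / 4) *
           inverse (sqrt (w z + (dw z)\<^sup>2 / 4) ^ Suc (Suc 0)))) (at z)"
      if z: "z \<in> Jz" for z
    proof -
      have "((\<lambda>z. (dw z)\<^sup>2) has_real_derivative 2 * ddw z * dw z) (at z)"
        using DERIV_power[OF ddw[OF z], of 2] by (simp add: mult.assoc)
      then have a: "((\<lambda>z. w z + (dw z)\<^sup>2 / 4) has_real_derivative dw z + 2 * ddw z * dw z / 4) (at z)"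
        by (intro DERIV_add dw[OF z] DERIV_cdivide)
      have "sqrt (w z + (dw z)\<^sup>2 / 4) \<noteq> 0" using energy[OF z] by simp
      from DERIV_inverse_fun[OF DERIV_chain2[OF DERIV_real_sqrt[OF energy[OF z]] a] this]
      show ?thesis .
    qed
    show ?thesis by (rule that[OF compose_third[OF yV D]])
  qed
  have nnd: "(nn has_derivative (\<lambda>v. vec3 (v $ 1) (v $ 2) (- (ddw (y $ 3) * v $ 3) / 2))) (at y)"
    unfolding nn_def
    by (rule derivative_eq_intros compose_third[OF yV ddw] refl | simp)+
  define W0 where "W0 v = c *\<^sub>R vec3 (v $ 1) (v $ 2) (- (ddw (y $ 3) * v $ 3) / 2) + c' v *\<^sub>R nn y" for v
  have W0: "(unit_normal has_derivative W0) (at y)"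
    unfolding unit_normal_def W0_def c_def E_def using has_derivative_scaleR[OF c' nnd] .
  have T: "tangent_space ?S y = {v. nn y \<bullet> v = 0}" by (rule tangent_surface[OF y])
  have nn0: "nn y \<noteq> 0" using nn_norm[OF yV y0] E by (auto simp: E_def)
  have dimT: "dim {v. nn y \<bullet> v = 0} = 2" using nn0 by (subst dim_hyperplane) auto
  have val: "(\<Sum>b\<in>B. W b \<bullet> b) = (2 * E - w (y $ 3) * (1 + ddw (y $ 3) / 2)) / sqrt E ^ 3"
    if W: "(outward_normal ?D ?S has_derivative W) (at y within ?S)" and orth: "pairwise orthogonal B"
      and unit: "\<forall>b\<in>B. norm b = 1" and span: "span B = tangent_space ?S y" for W B
  proof -
    have bT: "nn y \<bullet> b = 0" if "b \<in> B" for b using span_base[OF that] span T by simp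
    have Wb: "W b = W0 b" if "b \<in> B" for b
      by (rule derivative_within_on_tangent[OF W W0]) (use outward_normal_surface span_base[OF that] span in auto)
    have ind: "independent B" using orth unit by (intro pairwise_orthogonal_independent) auto
    then have "card B = dim (span B)" by (rule dim_span_eq_card_independent[symmetric])
    then have card: "card B = 2" using span T dimT by simp
    let ?e = "axis 3 1 :: real^3"
    \<comment> \<open>The projection of the axis to the tangent plane; its inner products with B are
      the third components.\<close>
    define p where "p = ?e - (inverse E * (?e \<bullet> nn y)) *\<^sub>R nn y"
    have EE: "nn y \<bullet> nn y = E" unfolding E_def by (rule nn_norm[OF yV y0])
    have "nn y \<bullet> p = 0" using E by (simp add: p_def inner_diff_right EE inner_commute)
    then have pB: "p \<in> span B" using span T by simp
    have pb: "p \<bullet> b = b $ 3" if "b \<in> B" for b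
      using bT[OF that] by (simp add: p_def inner_diff_left inner_axis')
    have en: "?e \<bullet> nn y = - dw (y $ 3) / 2" by (simp add: inner3 nn_def axis_def)
    have "p \<bullet> p = 1 - (?e \<bullet> nn y)\<^sup>2 * inverse E"
    proof -
      have "p \<bullet> p = p \<bullet> ?e - (inverse E * (?e \<bullet> nn y)) * (p \<bullet> nn y)"
        by (subst (2) p_def) (simp add: inner_diff_right)
      also have "p \<bullet> nn y = 0" using \<open>nn y \<bullet> p = 0\<close> by (simp add: inner_commute)
      also have "p \<bullet> ?e = 1 - (?e \<bullet> nn y)\<^sup>2 * inverse E"
      proof -
        have "?e \<bullet> ?e = 1" by (simp add: inner_axis_axis)
        then show ?thesis by (simp add: p_def inner_diff_left power2_eq_square inner_commute[of "nn y"])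
      qed
      finally show ?thesis by simp
    qed
    also have "\<dots> = w (y $ 3) * inverse E"
    proof -
      have "E - (?e \<bullet> nn y)\<^sup>2 = w (y $ 3)" unfolding en E_def by (simp add: power2_eq_square)
      then have "w (y $ 3) * inverse E = E * inverse E - (?e \<bullet> nn y)\<^sup>2 * inverse E" by (metis left_diff_distrib)
      then show ?thesis using E by simp
    qed
    finally have pp: "p \<bullet> p = w (y $ 3) * inverse E" .
    have s3: "(\<Sum>b\<in>B. (b $ 3)\<^sup>2) = w (y $ 3) * inverse E"
      using sum_inner_squares[OF orth _ pB] unit pb pp by simp
    have "W b \<bullet> b = c * (1 - (1 + ddw (y $ 3) / 2) * (b $ 3)\<^sup>2)" if "b \<in> B" for b
    proof -
      have "b \<bullet> b = 1" using unit that by (simp add: norm_eq_1)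
      then have b: "b $ 1 * b $ 1 + b $ 2 * b $ 2 = 1 - b $ 3 * b $ 3" by (simp add: inner3)
      have "W b \<bullet> b = c * (vec3 (b $ 1) (b $ 2) (- (ddw (y $ 3) * b $ 3) / 2) \<bullet> b)"
        unfolding Wb[OF that] W0_def using bT[OF that] by (simp add: inner_add_left)
      also have "vec3 (b $ 1) (b $ 2) (- (ddw (y $ 3) * b $ 3) / 2) \<bullet> b
          = (b $ 1 * b $ 1 + b $ 2 * b $ 2) - ddw (y $ 3) / 2 * (b $ 3 * b $ 3)" by (simp add: inner3)
      also have "\<dots> = 1 - (1 + ddw (y $ 3) / 2) * (b $ 3)\<^sup>2"
        unfolding b by (simp add: power2_eq_square algebra_simps)
      finally show ?thesis .
    qed
    then have "(\<Sum>b\<in>B. W b \<bullet> b) = (\<Sum>b\<in>B. c * (1 - (1 + ddw (y $ 3) / 2) * (b $ 3)\<^sup>2))" by simp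
    also have "\<dots> = c * (2 - (1 + ddw (y $ 3) / 2) * (\<Sum>b\<in>B. (b $ 3)\<^sup>2))"
      by (simp add: sum_distrib_left[symmetric] sum_subtractf card)
    also have "\<dots> = (2 * E - w (y $ 3) * (1 + ddw (y $ 3) / 2)) / sqrt E ^ 3"
    proof -
      define s where "s = sqrt E"
      have s: "s > 0" "E = s * s" using E by (simp_all add: s_def)
      show ?thesis unfolding s3 c_def s_def[symmetric] using s(1) unfolding s(2)
        by (simp add: field_simps power3_eq_cube)
    qed
    finally show ?thesis .
  qed
  have ex: "(outward_normal ?D ?S has_derivative W0) (at y within ?S)"
    by (rule has_derivative_transform[OF y _ has_derivative_at_withinI[OF W0]]) (rule outward_normal_surface)
  obtain B where "B \<subseteq> {v. nn y \<bullet> v = 0}" "pairwise orthogonal B" "\<And>b. b \<in> B \<Longrightarrow> norm b = 1" "span B = {v. nn y \<bullet> v = 0}"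
    using orthonormal_basis_subspace[OF subspace_hyperplane[of "nn y"]] by metis
  then have B: "pairwise orthogonal B" "\<forall>b\<in>B. norm b = 1" "span B = tangent_space ?S y" using T by auto
  show ?thesis
    unfolding total_curvature_def
  proof (rule the_equality)
    show "\<exists>W B. (outward_normal ?D ?S has_derivative W) (at y within ?S) \<and> pairwise orthogonal B \<and>
        (\<forall>b\<in>B. norm b = 1) \<and> span B = tangent_space ?S y \<and>
        (2 * E - w (y $ 3) * (1 + ddw (y $ 3) / 2)) / sqrt E ^ 3 = (\<Sum>b\<in>B. W b \<bullet> b)"
      using ex B val[OF ex B] by (intro exI[of _ W0] exI[of _ B] conjI) simp_all
    fix \<kappa> assume "\<exists>W B. (outward_normal ?D ?S has_derivative W) (at y within ?S) \<and> pairwise orthogonal B \<and>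
        (\<forall>b\<in>B. norm b = 1) \<and> span B = tangent_space ?S y \<and> \<kappa> = (\<Sum>b\<in>B. W b \<bullet> b)"
    then show "\<kappa> = (2 * E - w (y $ 3) * (1 + ddw (y $ 3) / 2)) / sqrt E ^ 3" using val by blast
  qed
qed

end

section \<open>The equation of state\<close>

lemma Cinf_on_deriv:
  fixes f :: "real \<Rightarrow> real"
  assumes "open U" "Cinf_on U f"
  shows "x \<in> U \<Longrightarrow> (f has_real_derivative deriv f x) (at x)" "Cinf_on U (deriv f)"
proof -
  have D: "(f has_real_derivative deriv f x) (at x)" if "x \<in> U" for x
  proof -
    have "f differentiable (at x)"
      using Cinf_on_has_derivative[OF assms(2) that] unfolding differentiable_def by blast
    then obtain d where "(f has_real_derivative d) (at x)" unfolding real_differentiable_def by blast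
    then show ?thesis using DERIV_imp_deriv by metis
  qed
  then show "x \<in> U \<Longrightarrow> (f has_real_derivative deriv f x) (at x)" .
  have "Cinf_on U (\<lambda>x. deriv f x * 1)"
    by (rule Cinf_on_derivative[OF assms]) (use D in \<open>simp add: has_field_derivative_def\<close>)
  then show "Cinf_on U (deriv f)" by simp
qed

lemma Cinf_on_real_SucI:
  fixes f :: "real \<Rightarrow> real"
  assumes "open U" "\<And>x. x \<in> U \<Longrightarrow> (f has_real_derivative f' x) (at x)" "Cinf_on U f'"
  shows "Cinf_on U f"
proof -
  have v: "(f has_vector_derivative f' x) (at x)" if "x \<in> U" for x
    using assms(2)[OF that] by (simp add: has_real_derivative_iff_has_vector_derivative)
  have "k_smooth_on n U f" for n
  proof (cases n)
    case 0
    have "continuous_on U f"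
      by (intro continuous_at_imp_continuous_on ballI) (rule has_vector_derivative_continuous[OF v])
    then show ?thesis using 0 by simp
  next
    case (Suc k)
    then show ?thesis using k_smooth_on_real_SucI[OF assms(1) v Cinf_on_k[OF assms(3)]] by blast
  qed
  then show ?thesis unfolding Cinf_on_def ..
qed

text \<open>Differentiation under the integral sign raises the weight from \<open>\<tau> ^ k\<close>
  to \<open>\<tau> ^ Suc k\<close> and replaces h by its derivative, so the family of such integrals
  is closed under derivatives.\<close>

lemma Cinf_on_segment_average:
  fixes h :: "real \<Rightarrow> real"
  assumes a: "a > 0" and h: "Cinf_on {-a<..<a} h"
  shows "Cinf_on {-a<..<a} (\<lambda>y. integral {0..1} (\<lambda>\<tau>. h (\<tau> * y)))"
proof -
  define I where "I = {-a<..<a}"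
  have I: "open I" "convex I" by (simp_all add: I_def)
  have sc: "\<tau> * y \<in> I" if "y \<in> I" "\<tau> \<in> {0..1}" for y \<tau>
  proof -
    have "\<bar>\<tau> * y\<bar> \<le> \<bar>y\<bar>" using that by (simp add: abs_mult mult_left_le_one_le)
    then show ?thesis using that by (auto simp: I_def)
  qed
  have main: "Cinf_on I (\<lambda>y. integral {0..1} (\<lambda>\<tau>. \<tau> ^ 0 * h (\<tau> * y)))"
  proof (rule Cinf_on_coinduct_real[OF I(1),
      where P = "\<lambda>f. \<exists>k h. Cinf_on I h \<and> f = (\<lambda>y. integral {0..1} (\<lambda>\<tau>. \<tau> ^ k * h (\<tau> * y)))"])
    show "\<exists>k ha. Cinf_on I ha \<and> (\<lambda>y. integral {0..1} (\<lambda>\<tau>. \<tau> ^ 0 * h (\<tau> * y)))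
        = (\<lambda>y. integral {0..1} (\<lambda>\<tau>. \<tau> ^ k * ha (\<tau> * y)))"
      using h unfolding I_def by (intro exI[of _ 0] exI[of _ h] conjI refl)
  next
    fix f :: "real \<Rightarrow> real"
    assume "\<exists>k h. Cinf_on I h \<and> f = (\<lambda>y. integral {0..1} (\<lambda>\<tau>. \<tau> ^ k * h (\<tau> * y)))"
    then obtain k h where h: "Cinf_on I h" and f: "f = (\<lambda>y. integral {0..1} (\<lambda>\<tau>. \<tau> ^ k * h (\<tau> * y)))"
      by (elim exE conjE) (rule that)
    have ch: "continuous_on I h" "continuous_on I (deriv h)"
      using Cinf_on_imp_continuous_on[OF h] Cinf_on_imp_continuous_on[OF Cinf_on_deriv(2)[OF I(1) h]] by simp_all
    have L: "((\<lambda>y. integral (cbox 0 1) (\<lambda>\<tau>. \<tau> ^ k * h (\<tau> * y))) has_field_derivative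
        integral (cbox 0 1) (\<lambda>\<tau>. \<tau> ^ Suc k * deriv h (\<tau> * y))) (at y within I)" if y: "y \<in> I" for y
    proof (rule leibniz_rule_field_derivative[OF _ _ _ y I(2)])
      fix x t :: real assume x: "x \<in> I" and "t \<in> cbox 0 1"
      then have "t * x \<in> I" using sc by simp
      have "((\<lambda>x. t * x) has_real_derivative t) (at x)" using DERIV_cmult_Id[of t x] by simp
      from DERIV_chain2[OF Cinf_on_deriv(1)[OF I(1) h \<open>t * x \<in> I\<close>] this]
      have "((\<lambda>x. h (t * x)) has_real_derivative deriv h (t * x) * t) (at x)" .
      from DERIV_cmult[OF this, of "t ^ k"]
      have "((\<lambda>x. t ^ k * h (t * x)) has_real_derivative t ^ Suc k * deriv h (t * x)) (at x)"
        by (simp add: mult.commute mult.left_commute)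
      then show "((\<lambda>x. t ^ k * h (t * x)) has_real_derivative t ^ Suc k * deriv h (t * x)) (at x within I)"
        by (rule has_field_derivative_at_within)
    next
      fix x assume x: "x \<in> I"
      have "continuous_on {0..1} (\<lambda>t. t ^ k * h (t * x))"
        by (intro continuous_intros continuous_on_compose2[OF ch(1)]) (use sc[OF x] in auto)
      then show "(\<lambda>\<tau>. \<tau> ^ k * h (\<tau> * x)) integrable_on cbox 0 1"
        by (simp add: integrable_continuous_real)
    next
      show "continuous_on (I \<times> cbox 0 1) (\<lambda>(x, t). t ^ Suc k * deriv h (t * x))"
        unfolding split_beta
        by (intro continuous_intros continuous_on_compose2[OF ch(2)]) (use sc in auto)
    qed
    have "(f has_vector_derivative integral {0..1} (\<lambda>\<tau>. \<tau> ^ Suc k * deriv h (\<tau> * y))) (at y)" if "y \<in> I" for y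
      unfolding f has_real_derivative_iff_has_vector_derivative[symmetric]
      using L[OF that] unfolding at_within_open[OF that I(1)] box_real .
    then show "\<exists>f'. (\<exists>k h. Cinf_on I h \<and> f' = (\<lambda>y. integral {0..1} (\<lambda>\<tau>. \<tau> ^ k * h (\<tau> * y)))) \<and>
        (\<forall>x\<in>I. (f has_vector_derivative f' x) (at x))"
      using Cinf_on_deriv(2)[OF I(1) h]
      by (intro exI[of _ "\<lambda>y. integral {0..1} (\<lambda>\<tau>. \<tau> ^ Suc k * deriv h (\<tau> * y))"] conjI
          exI[of _ "Suc k"] exI[of _ "deriv h"] refl ballI)
  qed
  then show ?thesis by (simp add: I_def)
qed

text \<open>h y is y times the mean of h' over the segment from 0 to y, and this mean is smooth
  through 0.\<close>

lemma hadamard_factor: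
  fixes h :: "real \<Rightarrow> real"
  assumes a: "a > 0" and h: "Cinf_on {-a<..<a} h" and h0: "h 0 = 0"
  obtains m where "Cinf_on {-a<..<a} m" "\<And>y. \<bar>y\<bar> < a \<Longrightarrow> h y = y * m y" "m 0 = deriv h 0"
proof
  let ?m = "\<lambda>y. integral {0..1} (\<lambda>\<tau>. deriv h (\<tau> * y))"
  show "Cinf_on {-a<..<a} ?m" by (rule Cinf_on_segment_average[OF a Cinf_on_deriv(2)[OF _ h]]) simp
  show "?m 0 = deriv h 0" by simp
  fix y :: real assume y: "\<bar>y\<bar> < a"
  have "((\<lambda>\<tau>. h (\<tau> * y)) has_vector_derivative deriv h (\<tau> * y) * y) (at \<tau> within {0..1})"
    if "\<tau> \<in> {0..1}" for \<tau>
  proof -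
    have "\<bar>\<tau> * y\<bar> \<le> \<bar>y\<bar>" using that by (simp add: abs_mult mult_left_le_one_le)
    then have "\<tau> * y \<in> {-a<..<a}" using y by auto
    from Cinf_on_deriv(1)[OF _ h this]
    have "(h has_real_derivative deriv h (\<tau> * y)) (at (\<tau> * y))" by simp
    moreover have "((\<lambda>\<tau>. \<tau> * y) has_real_derivative y) (at \<tau>)"
      using DERIV_cmult_right[OF DERIV_ident, of y \<tau>] by simp
    ultimately have "((\<lambda>\<tau>. h (\<tau> * y)) has_real_derivative deriv h (\<tau> * y) * y) (at \<tau>)"
      by (rule DERIV_chain2[where g = "\<lambda>\<tau>. \<tau> * y"])
    then show ?thesis unfolding has_real_derivative_iff_has_vector_derivative
      by (rule has_vector_derivative_at_within)
  qed
  from fundamental_theorem_of_calculus[OF _ this]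
  have "((\<lambda>\<tau>. deriv h (\<tau> * y) * y) has_integral h (1 * y) - h (0 * y)) {0..1}" by simp
  from integral_unique[OF this] show "h y = y * ?m y" by (simp add: h0 mult.commute)
qed

locale equation_of_state =
  fixes P :: "real \<Rightarrow> real" and \<rho> :: real
  assumes \<rho>: "0 < \<rho>" and P_smooth: "Cinf_on {0<..} P" and P_deriv: "\<And>t. 0 < t \<Longrightarrow> 0 < deriv P t"
begin

lemma P_derivative: "0 < t \<Longrightarrow> (P has_real_derivative deriv P t) (at t)"
  using Cinf_on_deriv(1)[OF _ P_smooth, of t] by simp

lemma P_less: assumes "0 < s" "s < t" shows "P s < P t"
  by (rule DERIV_pos_imp_increasing[OF assms(2)]) (use assms in \<open>auto intro!: exI[of _ "deriv P _"] P_derivative P_deriv\<close>)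

lemma density_smooth: "Cinf_on {0<..} (\<lambda>t. inverse t * deriv P t)"
  by (intro smooth_intros Cinf_on_inverse Cinf_on_deriv(2)[OF _ P_smooth]) auto

lemma eta_derivative:
  assumes z: "0 < z"
  shows "(eta P \<rho> has_real_derivative inverse z * deriv P z) (at z)"
proof -
  define a b where "a = min z \<rho> / 2" and "b = max z \<rho> + 1"
  have ab: "0 < a" "a < z" "z < b" "a \<le> \<rho>" "\<rho> \<le> b" using z \<rho> by (auto simp: a_def b_def)
  have "continuous_on {a..b} (\<lambda>t. inverse t * deriv P t)"
    by (rule continuous_on_subset[OF Cinf_on_imp_continuous_on[OF density_smooth]]) (use ab in auto)
  from interval_integral_FTC2[OF ab(4,5) this, of z] ab
  have "(eta P \<rho> has_vector_derivative inverse z * deriv P z) (at z within {a..b})"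
    unfolding eta_def[abs_def] by simp
  moreover have "at z within {a..b} = at z" by (rule at_within_interior) (use ab in simp)
  ultimately show ?thesis by (simp add: has_real_derivative_iff_has_vector_derivative)
qed

lemma eta_smooth: "Cinf_on {0<..} (eta P \<rho>)"
  by (rule Cinf_on_real_SucI[OF _ _ density_smooth]) (simp_all add: eta_derivative)

lemma eta_less: assumes "0 < s" "s < t" shows "eta P \<rho> s < eta P \<rho> t"
proof (rule DERIV_pos_imp_increasing[OF assms(2)])
  fix x assume "s \<le> x"
  then have "0 < x" using assms by simp
  then show "\<exists>y. (eta P \<rho> has_real_derivative y) (at x) \<and> 0 < y"
    using eta_derivative P_deriv by (intro exI[of _ "inverse x * deriv P x"]) simp
qed

lemma eta_inj: "inj_on (eta P \<rho>) {0<..}"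
  by (rule linorder_inj_onI) (use eta_less in \<open>auto dest: less_imp_neq\<close>)

lemma eta_base: "eta P \<rho> \<rho> = 0" by (simp add: eta_def)

lemma eta_inv_eta: "0 < t \<Longrightarrow> eta_inv P \<rho> (eta P \<rho> t) = t"
  unfolding eta_inv_def using inv_into_f_f[OF eta_inj, of t] by simp

lemma eta_inv_pos: "s \<in> eta P \<rho> ` {0<..} \<Longrightarrow> 0 < eta_inv P \<rho> s"
  using eta_inv_eta by auto

lemma eta_image:
  shows "open (eta P \<rho> ` {0<..})" "Cinf_on (eta P \<rho> ` {0<..}) (eta_inv P \<rho>)"
proof -
  \<comment> \<open>A dummy real parameter lets \<open>parametric_inverse\<close> act as the inverse
    function theorem in one variable.\<close>
  let ?W = "(UNIV :: real set) \<times> {0 :: real<..}" and ?p = "\<lambda>x :: real \<times> real. eta P \<rho> (snd x)"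
  have o: "open ?W" by (intro open_Times) auto
  have p: "Cinf_on ?W ?p"
    by (rule Cinf_on_compose[OF o open_greaterThan _ _ eta_smooth]) (auto intro!: smooth_intros o)
  have nz: "pd2 ?p z \<noteq> 0" if "z \<in> ?W" for z
  proof -
    obtain x t where z: "z = (x, t)" "0 < t" using \<open>z \<in> ?W\<close> by auto
    have "pd2 ?p (x, t) = inverse t * deriv P t"
      by (rule pd2_eqI[OF p]) (use z eta_derivative in auto)
    then show ?thesis using z P_deriv[of t] by simp
  qed
  have q: "(\<lambda>(x, s). eta_inv P \<rho> s) (x, ?p (x, t)) = t" if "(x, t) \<in> ?W" for x t
    using that eta_inv_eta by simp
  have im: "(\<lambda>(x, t). (x, ?p (x, t))) ` ?W = UNIV \<times> eta P \<rho> ` {0<..}" by (auto simp: image_iff)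
  note pi = parametric_inverse[OF o p nz q, unfolded im]
  then have "open (snd ` ((UNIV :: real set) \<times> eta P \<rho> ` {0<..}))" by (intro open_image_snd)
  moreover have "snd ` ((UNIV :: real set) \<times> eta P \<rho> ` {0<..}) = eta P \<rho> ` {0<..}" by force
  ultimately show J: "open (eta P \<rho> ` {0<..})" by simp
  have "Cinf_on (eta P \<rho> ` {0<..}) (\<lambda>s. (\<lambda>(x, s). eta_inv P \<rho> s) ((0::real), s))"
    by (rule Cinf_on_compose[OF J pi(1) _ _ pi(2)]) (auto intro!: smooth_intros J)
  then show "Cinf_on (eta P \<rho> ` {0<..}) (eta_inv P \<rho>)" by simp
qed

text \<open>As eta has derivative P' t / t, its inverse has derivative t / P' t, and composing with
  P leaves t. This is hydrostatic balance: for the density eta_inv (A - g x3) the gradient of the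
  pressure is - g times the density along the axis.\<close>

lemma frakP_derivative:
  assumes s: "s \<in> eta P \<rho> ` {0<..}"
  shows "(frakP P \<rho> has_real_derivative eta_inv P \<rho> s) (at s)"
    "(eta_inv P \<rho> has_real_derivative eta_inv P \<rho> s / deriv P (eta_inv P \<rho> s)) (at s)"
proof -
  obtain t where t: "0 < t" "s = eta P \<rho> t" using s by auto
  have ti: "eta_inv P \<rho> s = t" using eta_inv_eta t by simp
  note D = Cinf_on_deriv(1)[OF eta_image s]
  have "((\<lambda>s. eta P \<rho> (eta_inv P \<rho> s)) has_real_derivative
      inverse t * deriv P t * deriv (eta_inv P \<rho>) s) (at s)"
    by (rule DERIV_chain2[OF _ D]) (simp add: ti eta_derivative[OF t(1)])
  moreover have "((\<lambda>s. eta P \<rho> (eta_inv P \<rho> s)) has_real_derivative 1) (at s)"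
    by (rule has_field_derivative_transform_within_open[OF DERIV_ident eta_image(1) s])
      (use eta_inv_eta in auto)
  ultimately have e: "inverse t * deriv P t * deriv (eta_inv P \<rho>) s = 1" by (rule DERIV_unique)
  then have d: "deriv (eta_inv P \<rho>) s = t / deriv P t"
    using t P_deriv[OF t(1)] by (simp add: field_simps)
  show "(eta_inv P \<rho> has_real_derivative eta_inv P \<rho> s / deriv P (eta_inv P \<rho> s)) (at s)"
    using D unfolding d ti .
  have "((\<lambda>s. P (eta_inv P \<rho> s)) has_real_derivative deriv P t * deriv (eta_inv P \<rho>) s) (at s)"
    by (rule DERIV_chain2[OF _ D]) (simp add: ti P_derivative[OF t(1)])
  moreover have "deriv P t * deriv (eta_inv P \<rho>) s = t"
    unfolding d using P_deriv[OF t(1)] by simp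
  ultimately show "(frakP P \<rho> has_real_derivative eta_inv P \<rho> s) (at s)"
    unfolding frakP_def o_def ti by simp
qed

lemma frakP_eta: "0 < t \<Longrightarrow> frakP P \<rho> (eta P \<rho> t) = P t"
  by (simp add: frakP_def eta_inv_eta)

lemma frakP_zero: "frakP P \<rho> 0 = P \<rho>"
  using frakP_eta[OF \<rho>] eta_base by simp

lemma eta_inv_zero: "eta_inv P \<rho> 0 = \<rho>"
  using eta_inv_eta[OF \<rho>] eta_base by simp

lemma zero_in_eta: "0 \<in> eta P \<rho> ` {0<..}"
  using eta_base \<rho> by (auto simp: image_iff intro!: bexI[of _ \<rho>])

text \<open>For the lower bound on \<open>A = 0\<close>: the value of \<open>frakP\<close> at 0 is P
  \<rho>, so smaller pressures belong to negative arguments. The limit of P at 0 ensures that c is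
  attained.\<close>

lemma frakP_inv_negative:
  assumes P0: "(P \<longlongrightarrow> 0) (at_right 0)" and c: "0 < c" "c < P \<rho>"
  shows "frakP_inv P \<rho> c < 0"
proof -
  have "\<forall>\<^sub>F t in at_right 0. P t < c" using order_tendstoD(2)[OF P0 c(1)] .
  moreover have "\<forall>\<^sub>F t in at_right 0. t \<in> {0<..<\<rho>}" using \<rho> by (rule eventually_at_right_real)
  ultimately have "\<forall>\<^sub>F t in at_right 0. P t < c \<and> t \<in> {0<..<\<rho>}" by (rule eventually_conj)
  then obtain s where s: "P s < c" "0 < s" "s < \<rho>"
    using eventually_happens[of _ "at_right (0::real)"] by (auto simp: trivial_limit_at_right_real)
  have "continuous_on {s..\<rho>} P"
    by (rule continuous_on_subset[OF Cinf_on_imp_continuous_on[OF P_smooth]]) (use s in auto)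
  then obtain t where t: "s \<le> t" "t \<le> \<rho>" "P t = c" using IVT'[of P s c \<rho>] s c by auto
  then have t': "0 < t" "t < \<rho>" using s c by (auto simp: less_le)
  have inj: "inj_on (frakP P \<rho>) (eta P \<rho> ` {0<..})"
  proof (rule inj_onI)
    fix x y assume "x \<in> eta P \<rho> ` {0<..}" "y \<in> eta P \<rho> ` {0<..}" and e: "frakP P \<rho> x = frakP P \<rho> y"
    then obtain s t where st: "0 < s" "x = eta P \<rho> s" "0 < t" "y = eta P \<rho> t" by auto
    then have "P s = P t" using e by (simp add: frakP_eta)
    then have "s = t" using P_less[of s t] P_less[of t s] st by (cases s t rule: linorder_cases) auto
    then show "x = y" using st by simp
  qed
  have "frakP_inv P \<rho> (frakP P \<rho> (eta P \<rho> t)) = eta P \<rho> t"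
    unfolding frakP_inv_def by (rule inv_into_f_f[OF inj]) (use t' in auto)
  then have "frakP_inv P \<rho> c = eta P \<rho> t" using t t' by (simp add: frakP_eta)
  then show ?thesis using eta_less[OF t'] eta_base by simp
qed

text \<open>For the upper bound on \<open>A = 0\<close>: the integrand stays above a positive
  constant on (\<rho>, \<rho> + 1].\<close>

lemma eta_max_pos: "0 < eta_max P \<rho>"
proof -
  let ?e = "\<lambda>t. inverse t * deriv P t"
  have "continuous_on {\<rho>..\<rho> + 1} ?e"
    by (rule continuous_on_subset[OF Cinf_on_imp_continuous_on[OF density_smooth]]) (use \<rho> in auto)
  then obtain x where x: "x \<in> {\<rho>..\<rho> + 1}" "\<And>y. y \<in> {\<rho>..\<rho> + 1} \<Longrightarrow> ?e x \<le> ?e y"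
    using continuous_attains_inf[of "{\<rho>..\<rho> + 1}" ?e] by auto
  have x0: "0 < ?e x" using x(1) \<rho> P_deriv[of x] by simp
  have "(\<integral>\<^sup>+t. ennreal (?e x) * indicator {\<rho><..\<rho> + 1} t \<partial>lborel)
      \<le> (\<integral>\<^sup>+t\<in>{\<rho><..}. ennreal (?e t) \<partial>lborel)"
    by (rule nn_integral_mono) (use x(2) in \<open>auto simp: indicator_def intro!: ennreal_leI\<close>)
  also have "(\<integral>\<^sup>+t. ennreal (?e x) * indicator {\<rho><..\<rho> + 1} t \<partial>lborel) = ennreal (?e x)"
    by (simp add: nn_integral_cmult_indicator)
  finally have "ennreal (?e x) \<le> (\<integral>\<^sup>+t\<in>{\<rho><..}. ennreal (?e t) \<partial>lborel)" .
  moreover have "0 < ennreal (?e x)" using x0 by simp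
  ultimately have "0 < (\<integral>\<^sup>+t\<in>{\<rho><..}. ennreal (?e t) \<partial>lborel)" by (rule less_le_trans[rotated])
  then show ?thesis unfolding eta_max_def less_ennreal.rep_eq zero_ennreal.rep_eq .
qed

text \<open>Dividing the pressure jump by half its value at height 0 gives F 0 = 2, the unit sphere.
  F' is proportional to \<rho> minus the density and vanishes at 0, so the Hadamard factor provides
  m; m 0 is proportional to \<rho> / P' \<rho>, positive because the gas is compressible. Shrinking
  d achieves the remaining bounds.\<close>

lemma curvature_law_exists:
  assumes \<sigma>: "0 < \<sigma>" and p: "p < P \<rho>"
  obtains F m d M where "curvature_law F m d M"
    "\<And>y. \<bar>y\<bar> < 3 * d \<Longrightarrow> -y \<in> eta P \<rho> ` {0<..}"
    "\<And>y. \<bar>y\<bar> < 3 * d \<Longrightarrow> F y = 2 * (frakP P \<rho> (-y) + \<rho> * y - p) / (P \<rho> - p)"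
proof -
  let ?J = "eta P \<rho> ` {0<..}"
  obtain a where a: "a > 0" "ball 0 a \<subseteq> ?J" using openE[OF eta_image(1) zero_in_eta] .
  have aJ: "-y \<in> ?J" if "\<bar>y\<bar> < a" for y using a(2) that by (auto simp: subset_iff dist_real_def)
  define I where "I = {-a<..<a}"
  have oI: "open I" by (simp add: I_def)
  have abs: "y \<in> I \<longleftrightarrow> \<bar>y\<bar> < a" for y by (auto simp: I_def)
  define c where "c = 2 / (P \<rho> - p)"
  have c: "c > 0" using p by (simp add: c_def)
  define F where "F y = c * (frakP P \<rho> (-y) + \<rho> * y - p)" for y
  define h where "h y = c * (\<rho> - eta_inv P \<rho> (-y))" for y
  have neg: "((\<lambda>y. -y) has_real_derivative -1) (at y)" for y :: real
    using DERIV_minus[OF DERIV_ident, of y] .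
  have dF: "(F has_real_derivative h y) (at y)" if y: "y \<in> I" for y
  proof -
    have J: "-y \<in> ?J" using aJ y abs by simp
    have "(F has_real_derivative c * (eta_inv P \<rho> (-y) * -1 + \<rho> - 0)) (at y)"
      unfolding F_def
      by (intro DERIV_cmult DERIV_diff DERIV_add DERIV_chain2[OF frakP_derivative(1)[OF J] neg]
          DERIV_cmult_Id DERIV_const)
    then show ?thesis unfolding h_def by (simp add: algebra_simps)
  qed
  have hs: "Cinf_on I h"
    unfolding h_def
    by (intro smooth_intros oI Cinf_on_compose[OF oI eta_image(1) _ _ eta_image(2)])
      (use aJ abs in auto)
  have h0: "h 0 = 0" by (simp add: h_def eta_inv_zero)
  have dh: "deriv h 0 = c * (\<rho> / deriv P \<rho>)"
  proof (rule DERIV_imp_deriv)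
    have "(h has_real_derivative c * (0 - \<rho> / deriv P \<rho> * -1)) (at 0)"
      unfolding h_def
      by (intro DERIV_cmult DERIV_diff DERIV_const DERIV_chain2[OF _ neg])
        (use frakP_derivative(2)[OF zero_in_eta] in \<open>simp add: eta_inv_zero\<close>)
    then show "(h has_real_derivative c * (\<rho> / deriv P \<rho>)) (at 0)" by simp
  qed
  obtain m where m: "Cinf_on I m" "\<And>y. \<bar>y\<bar> < a \<Longrightarrow> h y = y * m y" "m 0 = deriv h 0"
    by (rule hadamard_factor[OF a(1) hs[unfolded I_def] h0, folded I_def]) (rule that; assumption)
  have Fs: "Cinf_on I F" by (rule Cinf_on_real_SucI[OF oI dF hs])
  have F0: "F 0 = 2" using p by (simp add: F_def c_def frakP_zero field_simps)
  have "isCont F 0" using DERIV_isCont[OF dF] abs a by simp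
  then obtain e where e: "e > 0" "\<And>y. \<bar>y\<bar> < e \<Longrightarrow> \<bar>F y - 2\<bar> < 1/10"
    using F0 unfolding continuous_at_eps_delta[of 0 F] dist_real_def
    by (metis diff_zero zero_less_divide_1_iff zero_less_numeral)
  have "continuous_on {-(a/2)..a/2} m"
    by (rule continuous_on_subset[OF Cinf_on_imp_continuous_on[OF m(1)]]) (use a in \<open>auto simp: I_def\<close>)
  then have "bounded (m ` {-(a/2)..a/2})" by (intro compact_imp_bounded compact_continuous_image) auto
  then obtain M where M: "M > 0" "\<And>y. y \<in> {-(a/2)..a/2} \<Longrightarrow> \<bar>m y\<bar> \<le> M"
    unfolding bounded_pos by auto
  \<comment> \<open>From d <= 1 / K follow d <= 1 and 6000000 d M <= 1, hence 6 d^2 M <= 1 /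
    1000000.\<close>
  define K where "K = 6000000 * M + 1"
  have K: "K \<ge> 1" using M by (simp add: K_def)
  define d where "d = min (1 / K) (min (a / 6) (e / 3))"
  have d: "d > 0" "d \<le> 1 / K" "3 * d \<le> a / 2" "3 * d \<le> e" using a e K by (simp_all add: d_def)
  have dK: "d * K \<le> 1" using d(2) K by (simp add: field_simps)
  have d1: "d \<le> 1" using dK mult_left_mono[OF K, of d] d(1) by linarith
  have d2: "6 * d\<^sup>2 * M \<le> 1 / 1000000"
  proof -
    have "d * (6000000 * M) \<le> 1" using dK d(1) by (simp add: K_def algebra_simps)
    then have "d * (d * (6000000 * M)) \<le> d * 1" using d(1) by (intro mult_left_mono) auto
    then show ?thesis using d1 by (simp add: power2_eq_square algebra_simps)
  qed
  have in_a: "\<bar>y\<bar> < a" if "\<bar>y\<bar> < 3 * d" for y using that d(3) a by simp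
  have sub: "{-(3*d)<..<3*d} \<subseteq> I" using d(3) a by (auto simp: I_def)
  show ?thesis
  proof (rule that)
    show "curvature_law F m d M"
    proof
      show "0 < d" "d \<le> 1" by fact+
      show "Cinf_on {-(3*d)<..<3*d} F" "Cinf_on {-(3*d)<..<3*d} m"
        using Cinf_on_subset[OF Fs sub] Cinf_on_subset[OF m(1) sub] by simp_all
      show "F 0 = 2" by fact
      show "0 < m 0" unfolding m(3) dh using c \<rho> P_deriv[OF \<rho>] by simp
      fix y assume y: "\<bar>y\<bar> < 3 * d"
      show "(F has_real_derivative y * m y) (at y)"
        using dF[of y] in_a[OF y] abs m(2)[OF in_a[OF y]] by simp
      have "\<bar>F y - 2\<bar> < 1/10" using e(2) y d(4) by simp
      then show "19/10 \<le> F y" "F y \<le> 21/10" by linarith+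
      have "y \<in> {-(a/2)..a/2}" using y d(3) by auto
      then show "\<bar>m y\<bar> \<le> M" by (rule M(2))
    qed (rule d2)
    show "-y \<in> ?J" if "\<bar>y\<bar> < 3 * d" for y using aJ[OF in_a[OF that]] .
    show "F y = 2 * (frakP P \<rho> (-y) + \<rho> * y - p) / (P \<rho> - p)" for y by (simp add: F_def c_def)
  qed
qed

end

section \<open>Curves of smooth functions on a compact interval\<close>

text \<open>The functions \<open>F k\<close> have two-sided derivatives also at the end points;
  derivatives within a nondegenerate interval are unique, so they agree with the one-sided ones in
  \<open>deriv_I\<close>.\<close>

lemma deriv_I_eqI:
  assumes 0: "\<And>\<zeta>. \<zeta> \<in> {-1..1} \<Longrightarrow> f \<zeta> = F 0 \<zeta>"
    and S: "\<And>k \<zeta>. \<zeta> \<in> {-1..1} \<Longrightarrow> (F k has_real_derivative F (Suc k) \<zeta>) (at \<zeta>)"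
  shows "\<zeta> \<in> {-1..1} \<Longrightarrow> deriv_I k f \<zeta> = F k \<zeta>"
proof (induction k arbitrary: \<zeta>)
  case 0
  then show ?case using assms(1) by (simp add: deriv_I_def)
next
  case (Suc k)
  have "(F k has_vector_derivative F (Suc k) \<zeta>) (at \<zeta> within {-1..1})"
    using S[OF Suc.prems, of k] unfolding has_real_derivative_iff_has_vector_derivative
    by (rule has_vector_derivative_at_within)
  then have "(deriv_I k f has_vector_derivative F (Suc k) \<zeta>) (at \<zeta> within {-1..1})"
    by (rule has_vector_derivative_transform[rotated 2]) (use Suc in auto)
  then have "vector_derivative (deriv_I k f) (at \<zeta> within {-1..1}) = F (Suc k) \<zeta>"
    using vector_derivative_within_cbox[of "-1" 1 \<zeta>] Suc.prems by simp
  then show ?case by (simp add: deriv_I_def)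
qed

lemma Cm_I_I:
  assumes "\<And>\<zeta>. \<zeta> \<in> {-1..1} \<Longrightarrow> f \<zeta> = F 0 \<zeta>"
    and S: "\<And>k \<zeta>. \<zeta> \<in> {-1..1} \<Longrightarrow> (F k has_real_derivative F (Suc k) \<zeta>) (at \<zeta>)"
  shows "f \<in> Cm_I m"
proof -
  have "deriv_I k f differentiable_on {-1..1}" for k
    unfolding differentiable_on_def
  proof
    fix \<zeta> :: real assume \<zeta>: "\<zeta> \<in> {-1..1}"
    have D: "(F k has_derivative (*) (F (Suc k) \<zeta>)) (at \<zeta> within {-1..1})"
      using S[OF \<zeta>, of k] unfolding has_field_derivative_def by (rule has_derivative_at_withinI)
    have "(deriv_I k f has_derivative (*) (F (Suc k) \<zeta>)) (at \<zeta> within {-1..1})"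
      by (rule has_derivative_transform[OF \<zeta> _ D]) (rule deriv_I_eqI[where F = F, OF assms])
    then show "deriv_I k f differentiable at \<zeta> within {-1..1}" unfolding differentiable_def by blast
  qed
  then show ?thesis unfolding Cm_I_def using differentiable_imp_continuous_on by blast
qed

lemma Cm_norm_bound:
  assumes "\<And>k \<zeta>. k \<le> m \<Longrightarrow> \<zeta> \<in> {-1..1} \<Longrightarrow> \<bar>deriv_I k f \<zeta>\<bar> \<le> B"
  shows "\<bar>Cm_norm m f\<bar> \<le> B"
proof -
  let ?s = "\<lambda>k. SUP \<zeta>\<in>{-1..1}. \<bar>deriv_I k f \<zeta>\<bar>"
  have le: "?s k \<le> B" if "k \<le> m" for k
    by (rule cSUP_least) (use assms that in auto)
  have "Cm_norm m f \<le> B" unfolding Cm_norm_def using le by (subst Max_le_iff) auto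
  moreover have "0 \<le> Cm_norm m f"
  proof -
    have "\<bar>deriv_I 0 f 0\<bar> \<le> ?s 0"
      by (rule cSUP_upper) (use assms[of 0] in \<open>auto intro!: bdd_aboveI2[of _ _ B]\<close>)
    also have "\<dots> \<le> Cm_norm m f" unfolding Cm_norm_def by (rule Max_ge) auto
    finally show ?thesis by simp
  qed
  ultimately show ?thesis by simp
qed

lemma Cm_norm_tendsto_0:
  assumes "\<And>k e. e > 0 \<Longrightarrow> \<forall>\<^sub>F h in at g. \<forall>\<zeta>\<in>{-1..1}. \<bar>deriv_I k (f h) \<zeta>\<bar> \<le> e"
  shows "((\<lambda>h. Cm_norm m (f h)) \<longlongrightarrow> 0) (at g)"
proof (rule tendstoI)
  fix e :: real assume e: "0 < e"
  have "\<forall>\<^sub>F h in at g. \<forall>k\<in>{..m}. \<forall>\<zeta>\<in>{-1..1}. \<bar>deriv_I k (f h) \<zeta>\<bar> \<le> e / 2"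
    by (rule eventually_ball_finite) (use assms[of "e / 2"] e in auto)
  then show "\<forall>\<^sub>F h in at g. dist (Cm_norm m (f h)) 0 < e"
  proof (rule eventually_mono)
    fix h assume "\<forall>k\<in>{..m}. \<forall>\<zeta>\<in>{-1..1}. \<bar>deriv_I k (f h) \<zeta>\<bar> \<le> e / 2"
    then have "\<bar>Cm_norm m (f h)\<bar> \<le> e / 2" by (intro Cm_norm_bound) auto
    then show "dist (Cm_norm m (f h)) 0 < e" using e by (simp add: dist_real_def)
  qed
qed

lemma slices_continuous:
  fixes \<psi> :: "real \<times> real \<Rightarrow> real"
  assumes G: "open G" "g \<in> G" and sub: "G \<times> {-1..1} \<subseteq> U" and \<psi>: "continuous_on U \<psi>" and e: "e > 0"
  obtains d where "d > 0" "ball g d \<subseteq> G"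
    "\<And>h \<zeta>. h \<in> ball g d \<Longrightarrow> \<zeta> \<in> {-1..1} \<Longrightarrow> \<bar>\<psi> (h, \<zeta>) - \<psi> (g, \<zeta>)\<bar> \<le> e"
proof -
  obtain r where r: "r > 0" "cball g r \<subseteq> G" using open_contains_cball G by blast
  have "uniformly_continuous_on (cball g r \<times> {-1..1}) \<psi>"
    by (intro compact_uniformly_continuous continuous_on_subset[OF \<psi>] compact_Times) (use r sub in auto)
  then obtain d where d: "d > 0" "\<And>p q. p \<in> cball g r \<times> {-1..1} \<Longrightarrow> q \<in> cball g r \<times> {-1..1} \<Longrightarrow>
      dist q p < d \<Longrightarrow> dist (\<psi> q) (\<psi> p) < e"
    unfolding uniformly_continuous_on_def using e by meson
  show ?thesis
  proof
    show "min d r > 0" using d r by simp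
    show "ball g (min d r) \<subseteq> G" using r(2) by auto
    fix h \<zeta> :: real assume "h \<in> ball g (min d r)" "\<zeta> \<in> {-1..1}"
    then show "\<bar>\<psi> (h, \<zeta>) - \<psi> (g, \<zeta>)\<bar> \<le> e"
      using d(2)[of "(g, \<zeta>)" "(h, \<zeta>)"] r(1)
      by (auto simp: dist_real_def dist_Pair_Pair abs_minus_commute)
  qed
qed

text \<open>The mean value inequality for \<psi> (x, \<zeta>) - c x, with c the derivative at g,
  reduces the claim to continuity of \<open>pd1 \<psi>\<close>, which compactness of [-1,1] makes
  uniform in \<zeta>.\<close>

lemma slices_differentiable:
  fixes \<psi> :: "real \<times> real \<Rightarrow> real"
  assumes G: "open G" "g \<in> G" and sub: "G \<times> {-1..1} \<subseteq> U" and \<psi>: "Cinf_on U \<psi>" and e: "e > 0"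
  shows "\<forall>\<^sub>F h in at g. \<forall>\<zeta>\<in>{-1..1}. \<bar>(\<psi> (h, \<zeta>) - \<psi> (g, \<zeta>)) / (h - g) - pd1 \<psi> (g, \<zeta>)\<bar> \<le> e"
proof -
  obtain d where d: "d > 0" "ball g d \<subseteq> G"
    "\<And>h \<zeta>. h \<in> ball g d \<Longrightarrow> \<zeta> \<in> {-1..1} \<Longrightarrow> \<bar>pd1 \<psi> (h, \<zeta>) - pd1 \<psi> (g, \<zeta>)\<bar> \<le> e"
    by (rule slices_continuous[OF G sub Cinf_on_imp_continuous_on[OF Cinf_on_pd1[OF \<psi>]] e]) (rule that; assumption)
  have main: "\<bar>(\<psi> (h, \<zeta>) - \<psi> (g, \<zeta>)) / (h - g) - pd1 \<psi> (g, \<zeta>)\<bar> \<le> e"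
    if h: "h \<in> ball g d" "h \<noteq> g" and \<zeta>: "\<zeta> \<in> {-1..1}" for h \<zeta>
  proof -
    define c where "c = pd1 \<psi> (g, \<zeta>)"
    let ?f = "\<lambda>x. \<psi> (x, \<zeta>) - c * x"
    have "norm (?f h - ?f g) \<le> e * norm (h - g)"
    proof (rule field_differentiable_bound[of "ball g d" ?f "\<lambda>x. pd1 \<psi> (x, \<zeta>) - c"])
      show "convex (ball g d)" by simp
      fix x assume x: "x \<in> ball g d"
      have "x \<in> G" using x d(2) by (rule subsetD[rotated])
      then have "(x, \<zeta>) \<in> U" using \<zeta> by (intro subsetD[OF sub]) simp
      then have "(?f has_real_derivative pd1 \<psi> (x, \<zeta>) - c) (at x)"
        by (intro DERIV_diff pd1_real[OF \<psi>] DERIV_cmult_Id)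
      then show "(?f has_real_derivative pd1 \<psi> (x, \<zeta>) - c) (at x within ball g d)"
        by (rule has_field_derivative_at_within)
      show "norm (pd1 \<psi> (x, \<zeta>) - c) \<le> e" using d(3)[OF x \<zeta>] by (simp add: c_def)
    qed (use h d in auto)
    moreover have "(\<psi> (h, \<zeta>) - \<psi> (g, \<zeta>)) / (h - g) - c = (?f h - ?f g) / (h - g)"
      using h(2) by (simp add: field_simps)
    ultimately show ?thesis
      using h(2) unfolding c_def[symmetric] by (simp add: pos_divide_le_eq)
  qed
  show ?thesis unfolding eventually_at
    by (rule exI[of _ d]) (use main d in \<open>auto simp: dist_commute\<close>)
qed

lemma Cinf_on_pd2_iter: "Cinf_on U f \<Longrightarrow> Cinf_on U ((pd2 ^^ k) f)"
  by (induction k) (auto intro: Cinf_on_pd2)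

text \<open>Convergence of difference quotients in the norm of C^m compares their
  \<zeta>-derivatives with those of \<open>pd1 f\<close>; for this the parameter derivative has to
  commute with all derivatives in \<zeta>.\<close>

lemma pd1_pd2_iter:
  fixes f :: "real \<times> real \<Rightarrow> real"
  assumes U: "open U" and f: "Cinf_on U f"
  shows "p \<in> U \<Longrightarrow> pd1 ((pd2 ^^ k) f) p = (pd2 ^^ k) (pd1 f) p"
proof (induction k arbitrary: p)
  case (Suc k)
  obtain a b where p: "p = (a, b)" by fastforce
  have "pd1 (pd2 ((pd2 ^^ k) f)) p = pd2 (pd1 ((pd2 ^^ k) f)) p"
    using pd_commute[OF U Cinf_on_pd2_iter[OF f, of k], of a b] Suc.prems unfolding p .
  also have "\<dots> = pd2 ((pd2 ^^ k) (pd1 f)) p"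
    by (rule pd2_cong[OF U Suc.prems Suc.IH Cinf_on_pd1[OF Cinf_on_pd2_iter[OF f]]])
  finally show ?case by simp
qed simp

text \<open>The derivative of the curve is given by \<open>pd1 \<Phi>\<close>, again a smooth
  function on U, so induction over the order applies to all \<Phi> at once. The k-th
  \<zeta>-derivative of a difference quotient is the difference quotient of the k-th
  \<zeta>-derivative.\<close>

theorem smooth_family_Cm_curve:
  fixes \<Phi> :: "real \<times> real \<Rightarrow> real"
  assumes U: "open U" and G: "open G" and sub: "G \<times> {-1..1} \<subseteq> U" and \<Phi>: "Cinf_on U \<Phi>"
  shows "g \<in> G \<Longrightarrow> (\<lambda>\<zeta>. \<Phi> (g, \<zeta>)) \<in> Cinf_I" "smooth_Cm_curve m G (\<lambda>g \<zeta>. \<Phi> (g, \<zeta>))"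
proof -
  have step: "((\<lambda>\<zeta>. (pd2 ^^ k) \<Phi> (g, \<zeta>)) has_real_derivative (pd2 ^^ Suc k) \<Phi> (g, \<zeta>)) (at \<zeta>)"
    if "Cinf_on U \<Phi>" "g \<in> G" "\<zeta> \<in> {-1..1}" for \<Phi> :: "real \<times> real \<Rightarrow> real" and g \<zeta> k
  proof -
    have "(g, \<zeta>) \<in> U" using sub that by auto
    then show ?thesis using pd2_real[OF Cinf_on_pd2_iter[OF that(1)]] by simp
  qed
  have mem: "(\<lambda>\<zeta>. \<Phi> (g, \<zeta>)) \<in> Cm_I m" if "Cinf_on U \<Phi>" "g \<in> G" for \<Phi> :: "real \<times> real \<Rightarrow> real" and g m
    by (rule Cm_I_I[where F = "\<lambda>k \<zeta>. (pd2 ^^ k) \<Phi> (g, \<zeta>)", OF _ step[OF that]]) simp_all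
  then show "(\<lambda>\<zeta>. \<Phi> (g, \<zeta>)) \<in> Cinf_I" if "g \<in> G" using \<Phi> that unfolding Cinf_I_def by blast
  have "Cm_curve m n G (\<lambda>g \<zeta>. \<Phi> (g, \<zeta>))" if "Cinf_on U \<Phi>" for n and \<Phi> :: "real \<times> real \<Rightarrow> real"
    using that
  proof (induction n arbitrary: \<Phi>)
    case 0
    have "((\<lambda>h. Cm_norm m (\<lambda>\<zeta>. \<Phi> (h, \<zeta>) - \<Phi> (g, \<zeta>))) \<longlongrightarrow> 0) (at g)" if g: "g \<in> G" for g
    proof (rule Cm_norm_tendsto_0)
      fix k and e :: real assume e: "e > 0"
      obtain d where d: "d > 0" "ball g d \<subseteq> G"
        "\<And>h \<zeta>. h \<in> ball g d \<Longrightarrow> \<zeta> \<in> {-1..1} \<Longrightarrow> \<bar>(pd2 ^^ k) \<Phi> (h, \<zeta>) - (pd2 ^^ k) \<Phi> (g, \<zeta>)\<bar> \<le> e"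
        by (rule slices_continuous[OF G g sub Cinf_on_imp_continuous_on[OF Cinf_on_pd2_iter[OF 0, of k]] e])
          (rule that; assumption)
      have "deriv_I k (\<lambda>\<zeta>. \<Phi> (h, \<zeta>) - \<Phi> (g, \<zeta>)) \<zeta> = (pd2 ^^ k) \<Phi> (h, \<zeta>) - (pd2 ^^ k) \<Phi> (g, \<zeta>)"
        if "h \<in> ball g d" "\<zeta> \<in> {-1..1}" for h \<zeta>
        by (rule deriv_I_eqI[where F = "\<lambda>k \<zeta>. (pd2 ^^ k) \<Phi> (h, \<zeta>) - (pd2 ^^ k) \<Phi> (g, \<zeta>)",
              OF _ DERIV_diff[OF step[OF 0] step[OF 0]]]) (use that d(2) g in auto)
      then show "\<forall>\<^sub>F h in at g. \<forall>\<zeta>\<in>{-1..1}. \<bar>deriv_I k (\<lambda>\<zeta>. \<Phi> (h, \<zeta>) - \<Phi> (g, \<zeta>)) \<zeta>\<bar> \<le> e"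
        unfolding eventually_at
        by (intro exI[of _ d]) (use d in \<open>auto simp: dist_commute\<close>)
    qed
    then show ?case using mem[OF 0] by auto
  next
    case (Suc n)
    note c = Suc.prems
    have "((\<lambda>h. Cm_norm m (\<lambda>\<zeta>. (\<Phi> (h, \<zeta>) - \<Phi> (g, \<zeta>)) / (h - g) - pd1 \<Phi> (g, \<zeta>))) \<longlongrightarrow> 0) (at g)"
      if g: "g \<in> G" for g
    proof (rule Cm_norm_tendsto_0)
      fix k and e :: real assume e: "e > 0"
      let ?F = "\<lambda>h k \<zeta>. ((pd2 ^^ k) \<Phi> (h, \<zeta>) - (pd2 ^^ k) \<Phi> (g, \<zeta>)) / (h - g) - (pd2 ^^ k) (pd1 \<Phi>) (g, \<zeta>)"
      have dI: "deriv_I k (\<lambda>\<zeta>. (\<Phi> (h, \<zeta>) - \<Phi> (g, \<zeta>)) / (h - g) - pd1 \<Phi> (g, \<zeta>)) \<zeta> = ?F h k \<zeta>"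
        if "h \<in> G" "\<zeta> \<in> {-1..1}" for h \<zeta>
        by (rule deriv_I_eqI[where F = "?F h",
              OF _ DERIV_diff[OF DERIV_cdivide[OF DERIV_diff[OF step[OF c] step[OF c]]] step[OF Cinf_on_pd1[OF c]]]])
          (use that g in auto)
      have comm: "pd1 ((pd2 ^^ k) \<Phi>) (g, \<zeta>) = (pd2 ^^ k) (pd1 \<Phi>) (g, \<zeta>)" if "\<zeta> \<in> {-1..1}" for \<zeta>
        by (rule pd1_pd2_iter[OF U c]) (use g that sub in auto)
      have "\<forall>\<^sub>F h in at g. h \<in> G" using G g by (rule eventually_at_in_open')
      moreover have "\<forall>\<^sub>F h in at g. \<forall>\<zeta>\<in>{-1..1}. \<bar>((pd2 ^^ k) \<Phi> (h, \<zeta>) - (pd2 ^^ k) \<Phi> (g, \<zeta>)) / (h - g)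
          - pd1 ((pd2 ^^ k) \<Phi>) (g, \<zeta>)\<bar> \<le> e"
        by (rule slices_differentiable[OF G g sub Cinf_on_pd2_iter[OF c] e])
      ultimately show "\<forall>\<^sub>F h in at g. \<forall>\<zeta>\<in>{-1..1}.
          \<bar>deriv_I k (\<lambda>\<zeta>. (\<Phi> (h, \<zeta>) - \<Phi> (g, \<zeta>)) / (h - g) - pd1 \<Phi> (g, \<zeta>)) \<zeta>\<bar> \<le> e"
      proof eventually_elim
        case (elim h)
        show ?case
        proof
          fix \<zeta> :: real assume \<zeta>: "\<zeta> \<in> {-1..1}"
          show "\<bar>deriv_I k (\<lambda>\<zeta>. (\<Phi> (h, \<zeta>) - \<Phi> (g, \<zeta>)) / (h - g) - pd1 \<Phi> (g, \<zeta>)) \<zeta>\<bar> \<le> e"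
            using bspec[OF elim(2) \<zeta>] unfolding dI[OF elim(1) \<zeta>] comm[OF \<zeta>] .
        qed
      qed
    qed
    then show ?case
      using mem[OF c] Suc.IH[OF Cinf_on_pd1[OF c]]
      by (auto intro!: exI[of _ "\<lambda>g \<zeta>. pd1 \<Phi> (g, \<zeta>)"])
  qed
  then show "smooth_Cm_curve m G (\<lambda>g \<zeta>. \<Phi> (g, \<zeta>))" using \<Phi> unfolding smooth_Cm_curve_def by blast
qed

section \<open>The family of bubbles\<close>

lemma Cinf_on_affine_pair:
  assumes U: "open U" and f: "Cinf_on V f" "open V" and sub: "\<And>x y. (x, y) \<in> U \<Longrightarrow> (a * x, b * y) \<in> V"
  shows "Cinf_on U (\<lambda>p :: real \<times> real. f (a * fst p :: real, b * snd p :: real))"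
  by (rule Cinf_on_compose[OF U f(2) _ _ f(1)]) (use sub in \<open>auto intro!: smooth_intros U\<close>)

lemma pd2_rescale:
  fixes f :: "real \<times> real \<Rightarrow> real"
  assumes f: "Cinf_on V f" and U: "open U" "Cinf_on U h"
    and sub: "\<And>x y. (x, y) \<in> U \<Longrightarrow> (a * x, b * y) \<in> V"
    and h: "\<And>x y. (x, y) \<in> U \<Longrightarrow> h (x, y) = c * f (a * x, b * y)" and p: "(x, y) \<in> U"
  shows "pd2 h (x, y) = c * b * pd2 f (a * x, b * y)"
proof (rule pd2_eqI[OF U(2) p])
  have D: "(f has_derivative frechet_derivative f (at (a * x, b * y))) (at (a * x, b * y))"
    by (rule Cinf_on_has_derivative[OF f sub[OF p]])
  have "((\<lambda>y. f (a * x, y)) has_real_derivative pd2 f (a * x, b * y)) (at (b * y))"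
    by (rule pd2_real[OF f sub[OF p]])
  then have "((\<lambda>y. c * f (a * x, b * y)) has_real_derivative c * (pd2 f (a * x, b * y) * b)) (at y)"
    by (intro DERIV_cmult DERIV_chain2[where g = "\<lambda>y. b * y"] DERIV_cmult_Id)
  then have "((\<lambda>y. c * f (a * x, b * y)) has_real_derivative c * b * pd2 f (a * x, b * y)) (at y)"
    by (simp add: mult_ac)
  moreover have "open ((\<lambda>y. (x, y)) -` U)" by (intro open_vimage U(1) continuous_intros)
  moreover have "y \<in> (\<lambda>y. (x, y)) -` U" using p by simp
  ultimately show "((\<lambda>y. h (x, y)) has_real_derivative c * b * pd2 f (a * x, b * y)) (at y)"
    by (rule has_field_derivative_transform_within_open) (simp add: h)
qed

text \<open>Undoes the normalization by W (g, z) = R^2 w (R g, z / R): lengths are multiplied by R,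
  and the gravity for w is R g, so that the product of gravity and height is unchanged. Curvature is
  divided by R, and \<sigma> F is R times the pressure jump.\<close>

lemma (in equation_of_state) scaled_profile_exists:
  assumes \<sigma>: "0 < \<sigma>" and p: "p < P \<rho>" and R: "R = 2 * \<sigma> / (P \<rho> - p)"
  obtains \<delta> W where "0 < \<delta>" "Cinf_on ({-\<delta><..<\<delta>} \<times> {-(11/10*R)<..<11/10*R}) W"
    "\<And>z. z \<in> {-(11/10*R)<..<11/10*R} \<Longrightarrow> W (0, z) = R\<^sup>2 - z\<^sup>2"
    "\<And>g z. (g, z) \<in> {-\<delta><..<\<delta>} \<times> {-(11/10*R)<..<11/10*R} \<Longrightarrow>
      0 < W (g, z) + (pd2 W (g, z))\<^sup>2 / 4 \<and>
      \<sigma> * (2 * (W (g, z) + (pd2 W (g, z))\<^sup>2 / 4) - W (g, z) * (1 + pd2 (pd2 W) (g, z) / 2))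
        = (frakP P \<rho> (- (g * z)) + \<rho> * (g * z) - p) * sqrt (W (g, z) + (pd2 W (g, z))\<^sup>2 / 4) ^ 3"
proof -
  have R0: "0 < R" using \<sigma> p R by simp
  obtain F m d M where law: "curvature_law F m d M"
    and F: "\<And>y. \<bar>y\<bar> < 3 * d \<Longrightarrow> F y = 2 * (frakP P \<rho> (-y) + \<rho> * y - p) / (P \<rho> - p)"
    by (rule curvature_law_exists[OF \<sigma> p]) (rule that; assumption)
  interpret curvature_law F m d M by (rule law)
  obtain \<delta> w where \<delta>: "0 < \<delta>" "\<delta> \<le> d" and w: "Cinf_on ({-\<delta><..<\<delta>} \<times> {-(11/10)<..<11/10}) w"
    and w0: "\<And>z. z \<in> {-(11/10)<..<11/10} \<Longrightarrow> w (0, z) = 1 - z\<^sup>2"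
    and wE: "\<And>g z. (g, z) \<in> {-\<delta><..<\<delta>} \<times> {-(11/10)<..<11/10} \<Longrightarrow> 0 < w (g, z) + (pd2 w (g, z))\<^sup>2 / 4"
    and ode: "\<And>g z. (g, z) \<in> {-\<delta><..<\<delta>} \<times> {-(11/10)<..<11/10} \<Longrightarrow>
      2 * (w (g, z) + (pd2 w (g, z))\<^sup>2 / 4) - w (g, z) * (1 + pd2 (pd2 w) (g, z) / 2)
        = F (g * z) * sqrt (w (g, z) + (pd2 w (g, z))\<^sup>2 / 4) ^ 3"
    by (rule profile_exists) (rule that; assumption)
  let ?V = "{-\<delta><..<\<delta>} \<times> {-(11/10)<..<11/10::real}"
  let ?U = "{-(\<delta>/R)<..<\<delta>/R} \<times> {-(11/10*R)<..<11/10*R}"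
  define W where "W q = R\<^sup>2 * w (R * fst q, inverse R * snd q)" for q
  have oU: "open ?U" and oV: "open ?V" by (intro open_Times; simp)+
  have UV: "(R * x, inverse R * y) \<in> ?V" if "(x, y) \<in> ?U" for x y
    using that R0 by (auto simp: field_simps)
  have W: "Cinf_on ?U W"
    unfolding W_def by (intro Cinf_on_mult Cinf_on_const Cinf_on_affine_pair[OF oU w oV UV] oU)
  have Weq: "W (x, y) = R\<^sup>2 * w (R * x, inverse R * y)" if "(x, y) \<in> ?U" for x y
    by (simp add: W_def)
  have W1: "pd2 W (g, z) = R * pd2 w (R * g, inverse R * z)" if gz: "(g, z) \<in> ?U" for g z
  proof -
    have "pd2 W (g, z) = R\<^sup>2 * inverse R * pd2 w (R * g, inverse R * z)"
      by (rule pd2_rescale[OF w oU W UV Weq gz])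
    then show ?thesis using R0 by (simp add: power2_eq_square)
  qed
  have W2: "pd2 (pd2 W) (g, z) = pd2 (pd2 w) (R * g, inverse R * z)" if gz: "(g, z) \<in> ?U" for g z
  proof -
    have "pd2 (pd2 W) (g, z) = R * inverse R * pd2 (pd2 w) (R * g, inverse R * z)"
      by (rule pd2_rescale[OF Cinf_on_pd2[OF w] oU Cinf_on_pd2[OF W] UV W1 gz])
    then show ?thesis using R0 by simp
  qed
  show ?thesis
  proof (rule that[of "\<delta> / R" W])
    show "0 < \<delta> / R" using \<delta> R0 by simp
    show "Cinf_on ?U W" by (rule W)
    show "W (0, z) = R\<^sup>2 - z\<^sup>2" if "z \<in> {-(11/10*R)<..<11/10*R}" for z
    proof -
      have "inverse R * z \<in> {-(11/10)<..<11/10}" using that R0 by (auto simp: field_simps)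
      from w0[OF this] show ?thesis using R0 by (simp add: W_def field_simps)
    qed
    fix g z assume gz: "(g, z) \<in> ?U"
    define a b c s where "a = w (R * g, inverse R * z)" and "b = pd2 w (R * g, inverse R * z)"
      and "c = pd2 (pd2 w) (R * g, inverse R * z)" and "s = sqrt (a + b\<^sup>2 / 4)"
    have Wa: "W (g, z) = R\<^sup>2 * a" by (simp add: W_def a_def)
    have Wb: "pd2 W (g, z) = R * b" by (simp add: W1[OF gz] b_def)
    have Wc: "pd2 (pd2 W) (g, z) = c" by (simp add: W2[OF gz] c_def)
    have e: "0 < a + b\<^sup>2 / 4" using wE[OF UV[OF gz]] by (simp add: a_def b_def)
    have E: "W (g, z) + (pd2 W (g, z))\<^sup>2 / 4 = R\<^sup>2 * (a + b\<^sup>2 / 4)"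
      unfolding Wa Wb by (simp add: power_mult_distrib algebra_simps)
    have sE: "sqrt (W (g, z) + (pd2 W (g, z))\<^sup>2 / 4) = R * s"
      unfolding E s_def real_sqrt_mult using R0 by simp
    have small: "\<bar>g * z\<bar> < 3 * d"
    proof -
      have "\<bar>R * g\<bar> * \<bar>inverse R * z\<bar> \<le> \<delta> * (11/10)"
        using UV[OF gz] by (intro mult_mono) auto
      moreover have "\<bar>R * g\<bar> * \<bar>inverse R * z\<bar> = \<bar>g * z\<bar>" using R0 by (simp add: abs_mult)
      ultimately show ?thesis using \<delta> by linarith
    qed
    define X where "X = frakP P \<rho> (- (g * z)) + \<rho> * (g * z) - p"
    have gz': "R * g * (inverse R * z) = g * z" using R0 by simp
    have "\<sigma> * F (g * z) = R * X" unfolding F[OF small] X_def R using p by (simp add: field_simps)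
    then have "\<sigma> * (2 * (a + b\<^sup>2 / 4) - a * (1 + c / 2)) = R * X * s ^ 3"
      using ode[OF UV[OF gz]] unfolding a_def[symmetric] b_def[symmetric] c_def[symmetric] s_def[symmetric] gz'
      by (simp add: mult.assoc[symmetric])
    then have e1: "R\<^sup>2 * (\<sigma> * (2 * (a + b\<^sup>2 / 4) - a * (1 + c / 2))) = R\<^sup>2 * (R * X * s ^ 3)" by simp
    have e2: "R\<^sup>2 * (\<sigma> * (2 * (a + b\<^sup>2 / 4) - a * (1 + c / 2)))
        = \<sigma> * (2 * (R\<^sup>2 * (a + b\<^sup>2 / 4)) - R\<^sup>2 * a * (1 + c / 2))"
      by (simp only: right_diff_distrib mult_ac)
    have e3: "R\<^sup>2 * (R * X * s ^ 3) = X * (R * s) ^ 3"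
      by (simp add: power2_eq_square power3_eq_cube mult_ac)
    have "\<sigma> * (2 * (W (g, z) + (pd2 W (g, z))\<^sup>2 / 4) - W (g, z) * (1 + pd2 (pd2 W) (g, z) / 2))
        = X * sqrt (W (g, z) + (pd2 W (g, z))\<^sup>2 / 4) ^ 3"
      unfolding sE unfolding E Wc unfolding Wa by (rule trans[OF e2[symmetric] trans[OF e1 e3]])
    moreover have "0 < W (g, z) + (pd2 W (g, z))\<^sup>2 / 4" unfolding E using R0 e by simp
    ultimately show "0 < W (g, z) + (pd2 W (g, z))\<^sup>2 / 4 \<and>
      \<sigma> * (2 * (W (g, z) + (pd2 W (g, z))\<^sup>2 / 4) - W (g, z) * (1 + pd2 (pd2 W) (g, z) / 2))
        = (frakP P \<rho> (- (g * z)) + \<rho> * (g * z) - p) * sqrt (W (g, z) + (pd2 W (g, z))\<^sup>2 / 4) ^ 3"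
      unfolding X_def by (rule conjI[rotated])
  qed
qed

text \<open>A point of the surface at height z has direction with third component p = z / sqrt S,
  where S is its squared distance to the origin. If p increases with z it can be inverted, and f is
  sqrt S at the inverse. At g = 0 this is the sphere of radius R, and for small g the inequalities
  persist.\<close>

theorem radial_family:
  fixes W :: "real \<times> real \<Rightarrow> real"
  assumes R: "0 < R" "R < r" and \<delta>: "0 < \<delta>"
    and W: "Cinf_on ({-\<delta><..<\<delta>} \<times> {-(11/10*R)<..<11/10*R}) W"
    and W0: "\<And>z. z \<in> {-(11/10*R)<..<11/10*R} \<Longrightarrow> W (0, z) = R\<^sup>2 - z\<^sup>2"
    and E: "\<And>g z. (g, z) \<in> {-\<delta><..<\<delta>} \<times> {-(11/10*R)<..<11/10*R} \<Longrightarrow> 0 < W (g, z) + (pd2 W (g, z))\<^sup>2 / 4"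
  obtains a b V f where "0 < a" "a \<le> \<delta>" "b < 11/10*R" "open V" "Cinf_on V f" "{-a<..<a} \<times> {-1..1} \<subseteq> V"
    "\<And>\<zeta>. \<zeta> \<in> {-1..1} \<Longrightarrow> f (0, \<zeta>) = R"
    "\<And>g \<zeta>. \<bar>g\<bar> < a \<Longrightarrow> \<zeta> \<in> {-1..1} \<Longrightarrow> f (g, \<zeta>) \<le> r"
    "\<And>g. \<bar>g\<bar> < a \<Longrightarrow> radial_graph {-b<..<b} {\<zeta>. (g, \<zeta>) \<in> V} (\<lambda>z. W (g, z)) (\<lambda>\<zeta>. f (g, \<zeta>))
        (\<lambda>z. pd2 W (g, z)) (\<lambda>z. pd2 (pd2 W) (g, z))"
proof -
  define U where "U = {-\<delta><..<\<delta>} \<times> {-(11/10*R)<..<11/10*R}"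
  have oU: "open U" unfolding U_def by (intro open_Times) auto
  note W = W[folded U_def] and E = E[folded U_def]
  \<comment> \<open>Slightly more than R, to include neighbourhoods of the perturbed poles, but
    still inside the domain of W.\<close>
  define b where "b = 21/20 * R"
  have b: "0 < b" "b < 11/10*R" using R by (simp_all add: b_def)
  define c where "c = min (r\<^sup>2) ((103/100 * R)\<^sup>2)" \<comment> \<open>\<open>S < c < b\<^sup>2\<close> makes \<open>b / sqrt S\<close> exceed 1, so that heights in \<open>(-b, b)\<close> cover all directions\<close>
  have c: "R\<^sup>2 < c" "c \<le> r\<^sup>2" "c < b\<^sup>2"
  proof -
    have "(103/100 * R)\<^sup>2 < b\<^sup>2" unfolding b_def using R by (intro power_strict_mono) auto
    then show "c < b\<^sup>2" by (simp add: c_def)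
    have "R\<^sup>2 < (103/100 * R)\<^sup>2" "R\<^sup>2 < r\<^sup>2" using R by (intro power_strict_mono; simp)+
    then show "R\<^sup>2 < c" by (simp add: c_def)
  qed (simp add: c_def)
  define S where "S q = W q + (snd q)\<^sup>2" for q
  \<comment> \<open>T / S^(3/2) is the z-derivative of z / sqrt S, so T > 0 makes the direction
    strictly increasing with the height.\<close>
  define T where "T q = W q - snd q * pd2 W q / 2" for q
  have S: "Cinf_on U S" unfolding S_def by (intro smooth_intros oU W)
  have T: "continuous_on U T"
    unfolding T_def by (intro continuous_intros Cinf_on_imp_continuous_on[OF W] Cinf_on_imp_continuous_on[OF Cinf_on_pd2[OF W]]) auto
  define A where "A = {q \<in> U. 0 < S q \<and> S q < c \<and> 0 < T q}"
  have "open (U \<inter> S -` {0<..<c})" "open (U \<inter> T -` {0<..})"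
    by (intro continuous_open_preimage oU T Cinf_on_imp_continuous_on[OF S]; simp)+
  then have "open ((U \<inter> S -` {0<..<c}) \<inter> (U \<inter> T -` {0<..}))" by (rule open_Int)
  moreover have "(U \<inter> S -` {0<..<c}) \<inter> (U \<inter> T -` {0<..}) = A" by (auto simp: A_def)
  ultimately have oA: "open A" by simp
  have in0: "(0, z) \<in> U" if "z \<in> {-b..b}" for z using that b \<delta> by (auto simp: U_def)
  have S0: "S (0, z) = R\<^sup>2" if "z \<in> {-b..b}" for z
    using W0[of z] that b by (simp add: S_def)
  have T0: "T (0, z) = R\<^sup>2" if "z \<in> {-b..b}" for z
  proof -
    have d1: "((\<lambda>z. R\<^sup>2 - z\<^sup>2) has_real_derivative - 2 * z) (at z)" by (auto intro!: derivative_eq_intros)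
    have d2: "R\<^sup>2 - y\<^sup>2 = W (0, y)" if "y \<in> {-(11/10*R)<..<11/10*R}" for y using W0[OF that] by simp
    have "((\<lambda>z. W (0, z)) has_real_derivative - 2 * z) (at z)"
      by (rule has_field_derivative_transform_within_open[where S = "{-(11/10*R)<..<11/10*R}", OF d1 _ _ d2]) (use that b in auto)
    from pd2_eqI[OF W in0[OF that] this] have "pd2 W (0, z) = - 2 * z" .
    then show ?thesis using W0[of z] that b by (simp add: T_def power2_eq_square)
  qed
  have "{0} \<times> {-b..b} \<subseteq> A" using in0 S0 T0 c R by (auto simp: A_def)
  \<comment> \<open>The tube lemma: compactness of the range of heights gives one interval of g on
    which all inequalities hold.\<close>
  then obtain B C where BC: "open B" "open C" "0 \<in> B" "{-b..b} \<subseteq> C" "B \<times> C \<subseteq> A"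
    using Wallace_theorem_prod_topology[of euclidean "{0}" euclidean "{-b..b}" A] oA
    by (auto simp: euclidean_product_topology)
  obtain a where a: "0 < a" "ball 0 a \<subseteq> B" using openE[OF BC(1,3)] .
  have inA: "(g, z) \<in> A" if "\<bar>g\<bar> < a" "z \<in> {-b..b}" for g z
  proof -
    have "g \<in> B" using a(2) that(1) by (auto simp: subset_iff)
    then show ?thesis using BC(4,5) that(2) by blast
  qed
  have inU: "(g, z) \<in> U" and Sp: "0 < S (g, z)" and Sc: "S (g, z) < c" and Tp: "0 < T (g, z)"
    if "\<bar>g\<bar> < a" "z \<in> {-b..b}" for g z using inA[OF that] by (simp_all add: A_def)
  have a\<delta>: "a \<le> \<delta>"
  proof (rule ccontr)
    assume "\<not> a \<le> \<delta>"
    then have "(\<delta>, 0) \<in> U" using \<delta> b by (intro inU) auto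
    then show False by (simp add: U_def)
  qed
  define p where "p q = snd q / sqrt (S q)" for q
  have pd: "((\<lambda>z. p (g, z)) has_real_derivative T (g, z) / (sqrt (S (g, z)) * S (g, z))) (at z)"
    if gz: "\<bar>g\<bar> < a" "z \<in> {-b..b}" for g z
  proof -
    define s where "s = sqrt (S (g, z))"
    have s: "0 < s" "S (g, z) = s\<^sup>2" using Sp[OF gz] by (simp_all add: s_def)
    have "((\<lambda>z. z\<^sup>2) has_real_derivative 2 * z) (at z)" by (auto intro!: derivative_eq_intros)
    then have dS: "((\<lambda>z. S (g, z)) has_real_derivative pd2 W (g, z) + 2 * z) (at z)"
      unfolding S_def snd_conv by (intro DERIV_add pd2_real[OF W inU[OF gz]])
    have "((\<lambda>z. z / sqrt (S (g, z))) has_real_derivative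
        (1 * s - z * (inverse s / 2 * (pd2 W (g, z) + 2 * z))) / (s * s)) (at z)"
      unfolding s_def
      by (intro DERIV_divide DERIV_ident DERIV_chain2[OF DERIV_real_sqrt[OF Sp[OF gz]] dS])
        (use Sp[OF gz] in simp)
    moreover have "(1 * s - z * (inverse s / 2 * (pd2 W (g, z) + 2 * z))) / (s * s) = T (g, z) / (s * s\<^sup>2)"
    proof -
      have Ts: "T (g, z) = s\<^sup>2 - z\<^sup>2 - z * pd2 W (g, z) / 2" using s(2) by (simp add: T_def S_def)
      show ?thesis unfolding Ts using s(1) by (simp add: field_simps power2_eq_square)
    qed
    ultimately show ?thesis unfolding p_def snd_conv s_def[symmetric] unfolding s(2) by simp
  qed
  have pd_pos: "0 < T (g, z) / (sqrt (S (g, z)) * S (g, z))" if "\<bar>g\<bar> < a" "z \<in> {-b..b}" for g z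
    using Tp[OF that] Sp[OF that] by simp
  have mono: "p (g, x) < p (g, y)" if g: "\<bar>g\<bar> < a" and xy: "x \<in> {-b..b}" "y \<in> {-b..b}" "x < y" for g x y
  proof (rule DERIV_pos_imp_increasing[OF xy(3)])
    fix z assume "x \<le> z" "z \<le> y"
    then have "z \<in> {-b..b}" using xy by simp
    from pd[OF g this] pd_pos[OF g this] show "\<exists>D. ((\<lambda>z. p (g, z)) has_real_derivative D) (at z) \<and> 0 < D" by (intro exI conjI)
  qed
  define D where "D = {-a<..<a} \<times> {-b<..<b}"
  have D: "(g, z) \<in> D \<longleftrightarrow> \<bar>g\<bar> < a \<and> z \<in> {-b<..<b}" for g z by (auto simp: D_def)
  have oD: "open D" unfolding D_def by (intro open_Times) auto
  have DU: "D \<subseteq> U" using inU by (auto simp: D_def)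
  have SD: "0 < S q" if "q \<in> D" for q
  proof -
    obtain g z where q: "q = (g, z)" by fastforce
    show ?thesis unfolding q by (rule Sp) (use that in \<open>auto simp: q D_def\<close>)
  qed
  have SD': "sqrt (S q) \<noteq> 0" if "q \<in> D" for q using SD[OF that] by simp
  have pC: "Cinf_on D p"
    unfolding p_def by (intro Cinf_on_divide Cinf_on_snd Cinf_on_ident Cinf_on_sqrt oD Cinf_on_subset[OF S DU] SD SD')
  have pnz: "pd2 p q \<noteq> 0" if "q \<in> D" for q
  proof -
    obtain g z where q: "q = (g, z)" by fastforce
    have gz: "\<bar>g\<bar> < a" "z \<in> {-b..b}" using that by (auto simp: q D_def)
    from pd2_eqI[OF pC that[unfolded q] pd[OF gz]] Tp[OF gz] Sp[OF gz] show ?thesis unfolding q by simp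
  qed
  define h where "h = (\<lambda>(g, \<zeta>). inv_into {-b<..<b} (\<lambda>z. p (g, z)) \<zeta>)"
  have hp: "h (g, p (g, z)) = z" if "(g, z) \<in> D" for g z
  proof -
    have inj: "inj_on (\<lambda>z. p (g, z)) {-b<..<b}"
    proof (rule linorder_inj_onI)
      fix x y assume "x < y" "x \<in> {-b<..<b}" "y \<in> {-b<..<b}"
      then have "p (g, x) < p (g, y)" using that by (intro mono) (auto simp: D)
      then show "p (g, x) \<noteq> p (g, y)" by simp
    qed auto
    have "z \<in> {-b<..<b}" using that by (simp add: D)
    from inv_into_f_f[OF inj this] show ?thesis by (simp add: h_def)
  qed
  define V where "V = (\<lambda>(g, z). (g, p (g, z))) ` D"
  have V: "open V" "Cinf_on V h"
    using parametric_inverse[OF oD pC pnz hp] by (simp_all add: V_def)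
  have Vi: "\<exists>z. (g, z) \<in> D \<and> \<zeta> = p (g, z)" if "(g, \<zeta>) \<in> V" for g \<zeta> using that by (auto simp: V_def)
  have pV: "(g, p (g, z)) \<in> V" if "(g, z) \<in> D" for g z using that by (force simp: V_def)
  define f where "f q = sqrt (S (fst q, h q))" for q
  have hD: "(fst q, h q) \<in> D" if qV: "q \<in> V" for q
  proof -
    obtain g \<zeta> where q: "q = (g, \<zeta>)" by fastforce
    obtain z where z: "(g, z) \<in> D" "\<zeta> = p (g, z)" using Vi[OF qV[unfolded q]] by blast
    show ?thesis using z(1) hp[OF z(1)] by (simp add: q z(2))
  qed
  have fC: "Cinf_on V f"
  proof -
    have "Cinf_on V (\<lambda>q. S (fst q, h q))"
      by (rule Cinf_on_compose[OF V(1) oD _ _ Cinf_on_subset[OF S DU]])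
        (use hD in \<open>auto intro!: Cinf_on_Pair Cinf_on_fst Cinf_on_ident V\<close>)
    then show ?thesis unfolding f_def
      by (rule Cinf_on_sqrt[OF V(1)]) (rule SD[OF hD])
  qed
  have fp: "f (g, p (g, z)) = sqrt (S (g, z))" if "(g, z) \<in> D" for g z
    using hp[OF that] by (simp add: f_def)
  have ends: "1 < p (g, b)" "p (g, -b) < -1" if g: "\<bar>g\<bar> < a" for g
  proof -
    have "sqrt (S (g, z)) < b" if "z \<in> {-b..b}" for z
      using Sc[OF g that] c(3) b by (intro real_less_lsqrt) auto
    from this[of b] this[of "-b"] show "1 < p (g, b)" "p (g, -b) < -1"
      using b Sp[OF g, of b] Sp[OF g, of "-b"] by (simp_all add: p_def)
  qed
  have unit: "(g, \<zeta>) \<in> V" if g: "\<bar>g\<bar> < a" and \<zeta>: "\<zeta> \<in> {-1..1}" for g \<zeta>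
  proof -
    have "continuous_on {-b..b} (\<lambda>z. p (g, z))"
      by (intro continuous_at_imp_continuous_on ballI) (rule DERIV_isCont[OF pd[OF g]])
    then obtain z where z: "-b \<le> z" "z \<le> b" "p (g, z) = \<zeta>"
      using IVT'[of "\<lambda>z. p (g, z)" "-b" \<zeta> b] ends[OF g] \<zeta> b by auto
    moreover have "z \<noteq> -b" "z \<noteq> b" using z ends[OF g] \<zeta> by auto
    ultimately have "(g, z) \<in> D" using g D by auto
    from pV[OF this] z(3) show ?thesis by simp
  qed
  show ?thesis
  proof (rule that[of a b V f])
    show "{-a<..<a} \<times> {-1..1} \<subseteq> V" using unit by auto
    show "f (0, \<zeta>) = R" if \<zeta>: "\<zeta> \<in> {-1..1}" for \<zeta>
    proof -
      have "(0, \<zeta>) \<in> V" by (rule unit[OF _ \<zeta>]) (simp add: a)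
      from Vi[OF this] obtain z where z: "(0, z) \<in> D" "\<zeta> = p (0, z)" by blast
      have zb: "z \<in> {-b..b}" using z(1) unfolding D by simp
      show ?thesis unfolding z(2) fp[OF z(1)] S0[OF zb] using R by simp
    qed
    show "f (g, \<zeta>) \<le> r" if g: "\<bar>g\<bar> < a" and \<zeta>: "\<zeta> \<in> {-1..1}" for g \<zeta>
    proof -
      from Vi[OF unit[OF g \<zeta>]] obtain z where z: "(g, z) \<in> D" "\<zeta> = p (g, z)" by blast
      have zb: "z \<in> {-b..b}" using z(1) unfolding D by simp
      have "S (g, z) \<le> r\<^sup>2" using Sc[OF g zb] c(2) by simp
      then have "sqrt (S (g, z)) \<le> r" using R by (intro real_le_lsqrt) auto
      then show ?thesis unfolding z(2) fp[OF z(1)] .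
    qed
    fix g :: real assume g: "\<bar>g\<bar> < a"
    have gD: "(g, z) \<in> D" if "z \<in> {-b<..<b}" for z using that g D by simp
    have oI: "open {\<zeta>. (g, \<zeta>) \<in> V}"
      using open_vimage[OF V(1), of "\<lambda>\<zeta>. (g, \<zeta>)"] by (simp add: continuous_on_Pair vimage_def)
    have inv: "\<exists>z\<in>{-b<..<b}. \<zeta> = p (g, z) \<and> f (g, \<zeta>) = sqrt (S (g, z)) \<and> 0 < S (g, z) \<and> f (g, \<zeta>) * \<zeta> = z"
      if gV: "(g, \<zeta>) \<in> V" for \<zeta>
    proof -
      from Vi[OF gV] obtain z where z: "(g, z) \<in> D" "\<zeta> = p (g, z)" by blast
      moreover have s: "0 < S (g, z)" by (rule SD[OF z(1)])
      moreover have "f (g, \<zeta>) * \<zeta> = z" using s fp[OF z(1)] z(2) by (simp add: p_def)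
      ultimately show ?thesis using fp[OF z(1)] D by blast
    qed
    show "radial_graph {-b<..<b} {\<zeta>. (g, \<zeta>) \<in> V} (\<lambda>z. W (g, z)) (\<lambda>\<zeta>. f (g, \<zeta>))
        (\<lambda>z. pd2 W (g, z)) (\<lambda>z. pd2 (pd2 W) (g, z))"
    proof
      show "open {-b<..<b}" by simp
      show "open {\<zeta>. (g, \<zeta>) \<in> V}" by (rule oI)
      show "Cinf_on {-b<..<b} (\<lambda>z. W (g, z))"
        by (rule Cinf_on_compose[OF _ oU _ _ W]) (use gD DU in \<open>auto intro!: smooth_intros\<close>)
      show "Cinf_on {\<zeta>. (g, \<zeta>) \<in> V} (\<lambda>\<zeta>. f (g, \<zeta>))"
        by (rule Cinf_on_compose[OF oI V(1) _ _ fC]) (auto intro!: smooth_intros oI)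
      show "{-1..1} \<subseteq> {\<zeta>. (g, \<zeta>) \<in> V}" using unit[OF g] by auto
      fix \<zeta> assume "\<zeta> \<in> {\<zeta>. (g, \<zeta>) \<in> V}"
      then obtain z where z: "z \<in> {-b<..<b}" "\<zeta> = p (g, z)" "f (g, \<zeta>) = sqrt (S (g, z))" "0 < S (g, z)"
        "f (g, \<zeta>) * \<zeta> = z" using inv by blast
      show "0 < f (g, \<zeta>)" using z(3,4) by simp
      show "f (g, \<zeta>) * \<zeta> \<in> {-b<..<b}" using z(1) z(5) by simp
      show "sqrt (W (g, f (g, \<zeta>) * \<zeta>) + (f (g, \<zeta>) * \<zeta>)\<^sup>2) = f (g, \<zeta>)"
        unfolding z(5) unfolding z(3) by (simp add: S_def)
    next
      fix z assume z: "z \<in> {-b<..<b}"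
      then have z': "z \<in> {-b..b}" by simp
      have gU: "(g, z) \<in> U" using gD[OF z] DU by blast
      show "((\<lambda>z. W (g, z)) has_real_derivative pd2 W (g, z)) (at z)" by (rule pd2_real[OF W gU])
      show "((\<lambda>z. pd2 W (g, z)) has_real_derivative pd2 (pd2 W) (g, z)) (at z)"
        by (rule pd2_real[OF Cinf_on_pd2[OF W] gU])
      show "0 < W (g, z) + z\<^sup>2" using Sp[OF g z'] by (simp add: S_def)
      show "0 < W (g, z) + (pd2 W (g, z))\<^sup>2 / 4" by (rule E[OF gU])
      have pe: "z / sqrt (W (g, z) + z\<^sup>2) = p (g, z)" by (simp add: p_def S_def)
      show "z / sqrt (W (g, z) + z\<^sup>2) \<in> {\<zeta>. (g, \<zeta>) \<in> V}" unfolding pe using pV[OF gD[OF z]] by simp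
      show "f (g, z / sqrt (W (g, z) + z\<^sup>2)) = sqrt (W (g, z) + z\<^sup>2)"
        unfolding pe using fp[OF gD[OF z]] by (simp add: S_def)
    qed
  qed (use a a\<delta> b V fC in auto)
qed

section \<open>Assembly of the family\<close>

text \<open>For finite q = Rmax the hypothesis 2 \<sigma> / q + p < c rearranges to 2 \<sigma> / (c
  - p) < q, which leaves room for r. For infinite Rmax the jump is 0 and any larger r will do; a
  smaller ball around 0 lies inside one of those in the supremum.\<close>

lemma radius_bounds:
  fixes \<Omega> :: "(real^3) set"
  assumes "open \<Omega>" "0 \<in> \<Omega>" and \<sigma>: "0 < \<sigma>"
    and less: "ereal (2 * \<sigma>) / Rmax \<Omega> + ereal p < ereal c"
  obtains r where "p < c" "2 * \<sigma> / (c - p) < r" "ereal r < Rmax \<Omega>" "cball 0 r \<subseteq> \<Omega>"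
    "0 \<le> min_pressure_jump \<sigma> \<Omega>" "min_pressure_jump \<sigma> \<Omega> + p < c"
proof -
  obtain s where s: "0 < s" "ball 0 s \<subseteq> \<Omega>" using openE[OF assms(1,2)] .
  have "ereal s \<le> Rmax \<Omega>" unfolding Rmax_def by (rule Sup_upper) (use s in auto)
  then have pos: "0 < Rmax \<Omega>" using s(1) by (meson ereal_less(2) less_le_trans)
  have ball: "cball 0 r \<subseteq> \<Omega>" if r: "ereal r < Rmax \<Omega>" for r
  proof -
    obtain t where t: "r < t" "ball 0 t \<subseteq> \<Omega>" using r unfolding Rmax_def less_Sup_iff by auto
    then have "cball 0 r \<subseteq> ball (0 :: real^3) t" by auto
    then show ?thesis using t(2) by (rule subset_trans)
  qed
  show ?thesis
  proof (cases "Rmax \<Omega>")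
    case PInf
    then have j: "min_pressure_jump \<sigma> \<Omega> = 0" by (simp add: min_pressure_jump_def)
    have pc: "p < c" using less PInf by (simp add: zero_ereal_def)
    show ?thesis
      by (rule that[OF pc _ _ ball, of "2 * \<sigma> / (c - p) + 1"]) (use PInf j pc in auto)
  next
    case (real q)
    then have q: "0 < q" using pos by simp
    have e: "ereal (2 * \<sigma>) / Rmax \<Omega> = ereal (2 * \<sigma> / q)" unfolding real using q by simp
    have j: "min_pressure_jump \<sigma> \<Omega> = 2 * \<sigma> / q" unfolding min_pressure_jump_def e by simp
    have l: "2 * \<sigma> / q + p < c" using less unfolding e by simp
    have "0 < 2 * \<sigma> / q" using q \<sigma> by simp
    then have pc: "p < c" using l by linarith
    have "2 * \<sigma> / (c - p) < q" using l q pc by (simp add: field_simps)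
    from dense[OF this] obtain r where r: "2 * \<sigma> / (c - p) < r" "r < q" by blast
    show ?thesis
      by (rule that[OF pc r(1) _ ball]) (use real r j l q \<sigma> in auto)
  next
    case MInf
    then show ?thesis using pos by simp
  qed
qed

lemma gderiv_affine_third: "GDERIV (\<lambda>x :: real^3. c - k * x $ 3) x :> (- k) *\<^sub>R axis 3 1"
proof -
  have "((\<lambda>x :: real^3. c - k * x $ 3) has_derivative (\<lambda>h. 0 - k * h $ 3)) (at x)"
    by (intro has_derivative_diff has_derivative_const has_derivative_mult_right
        bounded_linear_imp_has_derivative bounded_linear_vec_nth)
  moreover have "(\<lambda>h :: real^3. 0 - k * h $ 3) = (\<lambda>h. h \<bullet> ((- k) *\<^sub>R axis 3 1))"
    by (simp add: fun_eq_iff inner_axis)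
  ultimately show ?thesis unfolding gderiv_def by simp
qed

theorem theorem1p1:
  fixes \<Omega>tot :: "(real^3) set"
    and \<sigma> \<rho>ext Pext_star :: real
    and Pint :: "real \<Rightarrow> real"
  assumes "open \<Omega>tot" and "0 \<in> \<Omega>tot"
    and "\<sigma> > 0" and "\<rho>ext > 0" and "Pext_star > 0"
    and "\<And>t. t > 0 \<Longrightarrow> Pint t > 0"
    and "smooth_on {0<..} Pint"
    and "\<And>t. t > 0 \<Longrightarrow> deriv Pint t > 0"
    and "(Pint \<longlongrightarrow> 0) (at_right 0)"
    and "ereal (2 * \<sigma>) / Rmax \<Omega>tot + ereal Pext_star < ereal (Pint \<rho>ext)"
  shows "\<exists>(G :: real set) (A :: real \<Rightarrow> real) (\<phi> :: real \<Rightarrow> real \<Rightarrow> real).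
    let R = bubble_radius \<sigma> \<rho>ext Pext_star Pint;
        R\<^sub>0 = 2 * \<sigma> / (Pint \<rho>ext - Pext_star);
        Lam = (\<lambda>g (x :: real^3). (R (A g) + \<phi> g (x $ 3)) *\<^sub>R x);
        \<Omega>int = (\<lambda>g. Lam g ` ball 0 1);
        Surf = (\<lambda>g. Lam g ` sphere 0 1);
        \<Omega>ext = (\<lambda>g. \<Omega>tot - closure (\<Omega>int g));
        \<rho>int = (\<lambda>g (x :: real^3). eta_inv Pint \<rho>ext (A g - g * x $ 3));
        Pext = (\<lambda>g (x :: real^3). Pext_star - g * \<rho>ext * x $ 3);
        e\<^sub>3 = (axis 3 1 :: real^3)
    in
      open G \<and> is_interval G \<and> 0 \<in> G \<and>
      \<comment> \<open>(1)\<close>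
      A 0 = 0 \<and>
      (\<forall>g\<in>G. frakP_inv Pint \<rho>ext (min_pressure_jump \<sigma> \<Omega>tot + Pext_star) < A g \<and>
              ereal (A g) < eta_max Pint \<rho>ext) \<and>
      smooth_on G A \<and>
      \<comment> \<open>(2)\<close>
      (\<forall>g\<in>G. \<phi> g \<in> Cinf_I) \<and>
      (\<forall>\<zeta>\<in>{-1..1}. \<phi> 0 \<zeta> = 0) \<and>
      (\<forall>m. smooth_Cm_curve m G \<phi>) \<and>
      \<comment> \<open>(3)\<close>
      (\<forall>g\<in>G.
         smooth_diffeo (cball 0 1) (Lam g ` cball 0 1) (Lam g) \<and>
         smooth_manifold_with_boundary TYPE(real^3) (closure (\<Omega>int g)) \<and>
         compact (closure (\<Omega>int g)) \<and> simply_connected (closure (\<Omega>int g)) \<and>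
         Surf g = manifold_boundary TYPE(real^3) (closure (\<Omega>int g)) \<and>
         smooth_manifold TYPE(real^2) (Surf g) \<and>
         compact (Surf g) \<and> simply_connected (Surf g) \<and>
         closure (\<Omega>int g) \<subseteq> \<Omega>tot \<and> open (\<Omega>ext g)) \<and>
      \<Omega>int 0 = ball 0 R\<^sub>0 \<and> Surf 0 = sphere 0 R\<^sub>0 \<and>
      \<comment> \<open>(4)\<close>
      (\<exists>r. R\<^sub>0 < r \<and> ereal r < Rmax \<Omega>tot \<and>
         (\<forall>g\<in>G.
            closure (\<Omega>int g) \<subseteq> {x. x $ 3 \<in> {-r..r}} \<and>
            (\<lambda>t. A g - g * t) ` {-r..r} \<subseteq> eta Pint \<rho>ext ` {0<..} \<and>
            \<rho>int g ` closure (\<Omega>int g) \<subseteq> {0<..} \<and>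
            smooth_on (closure (\<Omega>int g)) (\<rho>int g))) \<and>
      \<comment> \<open>(5)\<close>
      (\<forall>g\<in>G.
         (\<forall>x\<in>\<Omega>ext g. GDERIV (Pext g) x :> (- (\<rho>ext * g)) *\<^sub>R e\<^sub>3) \<and>
         (\<forall>x\<in>\<Omega>int g. GDERIV (Pint \<circ> \<rho>int g) x :> (- (\<rho>int g x * g)) *\<^sub>R e\<^sub>3) \<and>
         (\<forall>x\<in>Surf g. \<sigma> * total_curvature (\<Omega>int g) (Surf g) x = Pint (\<rho>int g x) - Pext g x))"
proof -
  interpret equation_of_state Pint \<rho>ext
    by unfold_locales (use assms smooth_on_open_iff[of "{0<..}" Pint] in auto)
  let ?J = "eta Pint \<rho>ext ` {0<..}"
  obtain r where r: "Pext_star < Pint \<rho>ext" "2 * \<sigma> / (Pint \<rho>ext - Pext_star) < r" "ereal r < Rmax \<Omega>tot"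
    "cball 0 r \<subseteq> \<Omega>tot" and jump: "0 \<le> min_pressure_jump \<sigma> \<Omega>tot" "min_pressure_jump \<sigma> \<Omega>tot + Pext_star < Pint \<rho>ext"
    by (rule radius_bounds[OF assms(1-3,10)]) (rule that; assumption)
  define R where "R = 2 * \<sigma> / (Pint \<rho>ext - Pext_star)"
  have R: "0 < R" "R < r" using r assms(3) by (simp_all add: R_def)
  obtain \<delta> W where \<delta>: "0 < \<delta>" and W: "Cinf_on ({-\<delta><..<\<delta>} \<times> {-(11/10*R)<..<11/10*R}) W"
    and W0: "\<And>z. z \<in> {-(11/10*R)<..<11/10*R} \<Longrightarrow> W (0, z) = R\<^sup>2 - z\<^sup>2"
    and law: "\<And>g z. (g, z) \<in> {-\<delta><..<\<delta>} \<times> {-(11/10*R)<..<11/10*R} \<Longrightarrow>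
      0 < W (g, z) + (pd2 W (g, z))\<^sup>2 / 4 \<and>
      \<sigma> * (2 * (W (g, z) + (pd2 W (g, z))\<^sup>2 / 4) - W (g, z) * (1 + pd2 (pd2 W) (g, z) / 2))
        = (frakP Pint \<rho>ext (- (g * z)) + \<rho>ext * (g * z) - Pext_star) * sqrt (W (g, z) + (pd2 W (g, z))\<^sup>2 / 4) ^ 3"
    by (rule scaled_profile_exists[OF assms(3) r(1) R_def]) (rule that; assumption)
  obtain a b V f where a: "0 < a" "a \<le> \<delta>" and b: "b < 11/10*R" and V: "open V" "Cinf_on V f" "{-a<..<a} \<times> {-1..1} \<subseteq> V"
    and f0: "\<And>\<zeta>. \<zeta> \<in> {-1..1} \<Longrightarrow> f (0, \<zeta>) = R"
    and f_le: "\<And>g \<zeta>. \<bar>g\<bar> < a \<Longrightarrow> \<zeta> \<in> {-1..1} \<Longrightarrow> f (g, \<zeta>) \<le> r"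
    and graph: "\<And>g. \<bar>g\<bar> < a \<Longrightarrow> radial_graph {-b<..<b} {\<zeta>. (g, \<zeta>) \<in> V} (\<lambda>z. W (g, z)) (\<lambda>\<zeta>. f (g, \<zeta>))
        (\<lambda>z. pd2 W (g, z)) (\<lambda>z. pd2 (pd2 W) (g, z))"
    by (rule radial_family[OF R \<delta> W W0 conjunct1[OF law]], assumption, assumption, (rule that; assumption))
  obtain e where e: "0 < e" "ball 0 e \<subseteq> ?J" using openE[OF eta_image(1) zero_in_eta] .
  \<comment> \<open>With |g| < e / r every product g t with |t| <= r stays in the e-ball around 0
    contained in the range of eta.\<close>
  define a' where "a' = min a (e / r)"
  have a': "0 < a'" "a' \<le> a" using a e R by (simp_all add: a'_def)
  define G where "G = {-a'<..<a'}"
  have G: "g \<in> G \<longleftrightarrow> \<bar>g\<bar> < a'" for g by (auto simp: G_def)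
  have Ga: "\<bar>g\<bar> < a" if "g \<in> G" for g using that a' G by simp
  have inJ: "0 - g * t \<in> ?J" if g: "g \<in> G" and t: "\<bar>t\<bar> \<le> r" for g t
  proof -
    have "\<bar>g * t\<bar> \<le> \<bar>g\<bar> * r" unfolding abs_mult using t by (intro mult_left_mono) auto
    also have "\<dots> < e" using g R by (simp add: G a'_def pos_less_divide_eq)
    finally show ?thesis using e(2) by (auto simp: subset_iff dist_real_def)
  qed
  define Lam where "Lam g = (\<lambda>x :: real^3. f (g, x $ 3) *\<^sub>R x)" for g
  \<comment> \<open>With \<open>A = 0\<close> the reference radius is R for every g, since
    \<open>frakP\<close> takes the value Pint \<rho>ext at 0; the choice \<phi> g = f (g, _) - R
    therefore leaves the radial function f.\<close>
  have LamE: "(\<lambda>x :: real^3. (bubble_radius \<sigma> \<rho>ext Pext_star Pint 0 + (f (g, x $ 3) - R)) *\<^sub>R x) = Lam g" for g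
    by (simp add: Lam_def bubble_radius_def frakP_zero R_def)
  have unit3: "x $ 3 \<in> {-1..1}" if "norm x \<le> 1" for x :: "real^3"
    using component_le_norm_cart[of x 3] that by (simp add: abs_le_iff)
  have geo: "smooth_diffeo (cball 0 1) (Lam g ` cball 0 1) (Lam g) \<and>
         smooth_manifold_with_boundary TYPE(real^3) (closure (Lam g ` ball 0 1)) \<and>
         compact (closure (Lam g ` ball 0 1)) \<and> simply_connected (closure (Lam g ` ball 0 1)) \<and>
         Lam g ` sphere 0 1 = manifold_boundary TYPE(real^3) (closure (Lam g ` ball 0 1)) \<and>
         smooth_manifold TYPE(real^2) (Lam g ` sphere 0 1) \<and>
         compact (Lam g ` sphere 0 1) \<and> simply_connected (Lam g ` sphere 0 1)"
    and cl: "closure (Lam g ` ball 0 1) = Lam g ` cball 0 1"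
    and curv: "\<And>x. x \<in> Lam g ` sphere 0 1 \<Longrightarrow> \<sigma> * total_curvature (Lam g ` ball 0 1) (Lam g ` sphere 0 1) x
        = Pint (eta_inv Pint \<rho>ext (0 - g * x $ 3)) - (Pext_star - g * \<rho>ext * x $ 3)"
    if g: "g \<in> G" for g
  proof -
    interpret radial_graph "{-b<..<b}" "{\<zeta>. (g, \<zeta>) \<in> V}" "\<lambda>z. W (g, z)" "\<lambda>\<zeta>. f (g, \<zeta>)"
      "\<lambda>z. pd2 W (g, z)" "\<lambda>z. pd2 (pd2 W) (g, z)" by (rule graph[OF Ga[OF g]])
    have L: "L = Lam g" by (simp add: fun_eq_iff L_def Lam_def)
    show "smooth_diffeo (cball 0 1) (Lam g ` cball 0 1) (Lam g) \<and>
         smooth_manifold_with_boundary TYPE(real^3) (closure (Lam g ` ball 0 1)) \<and>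
         compact (closure (Lam g ` ball 0 1)) \<and> simply_connected (closure (Lam g ` ball 0 1)) \<and>
         Lam g ` sphere 0 1 = manifold_boundary TYPE(real^3) (closure (Lam g ` ball 0 1)) \<and>
         smooth_manifold TYPE(real^2) (Lam g ` sphere 0 1) \<and>
         compact (Lam g ` sphere 0 1) \<and> simply_connected (Lam g ` sphere 0 1)"
      using geometry unfolding L by (intro conjI)
    show "closure (Lam g ` ball 0 1) = Lam g ` cball 0 1" using closure_image unfolding L .
    fix x assume x: "x \<in> Lam g ` sphere 0 1"
    then have "x \<in> L ` sphere 0 1" unfolding L .
    note K = total_curvature_surface[OF this, unfolded L]
    have "x \<in> V0" using \<open>x \<in> L ` sphere 0 1\<close> unfolding image_level(1) by simp
    then have z: "(g, x $ 3) \<in> {-\<delta><..<\<delta>} \<times> {-(11/10*R)<..<11/10*R}"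
      using Ga[OF g] a b by (auto simp: V0_def)
    define E where "E = W (g, x $ 3) + (pd2 W (g, x $ 3))\<^sup>2 / 4"
    have E: "0 < sqrt E ^ 3" using law[OF z] by (simp add: E_def)
    have "\<sigma> * total_curvature (Lam g ` ball 0 1) (Lam g ` sphere 0 1) x
        = \<sigma> * (2 * E - W (g, x $ 3) * (1 + pd2 (pd2 W) (g, x $ 3) / 2)) / sqrt E ^ 3"
      unfolding K E_def by simp
    also have "\<dots> = frakP Pint \<rho>ext (- (g * x $ 3)) + \<rho>ext * (g * x $ 3) - Pext_star"
      unfolding conjunct2[OF law[OF z], folded E_def] using E by (intro nonzero_mult_div_cancel_right) simp
    finally show "\<sigma> * total_curvature (Lam g ` ball 0 1) (Lam g ` sphere 0 1) x
        = Pint (eta_inv Pint \<rho>ext (0 - g * x $ 3)) - (Pext_star - g * \<rho>ext * x $ 3)"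
      by (simp add: frakP_def)
  qed
  have f_pos: "0 < f (g, \<zeta>)" if "g \<in> G" "\<zeta> \<in> {-1..1}" for g \<zeta>
  proof -
    have "(g, \<zeta>) \<in> V" by (rule subsetD[OF V(3)]) (use Ga[OF that(1)] that(2) in auto)
    then show ?thesis using radial_graph.f_pos[OF graph[OF Ga[OF that(1)]], of \<zeta>] by simp
  qed
  have Lam_r: "Lam g ` cball 0 1 \<subseteq> cball 0 r" if g: "g \<in> G" for g
  proof
    fix y assume "y \<in> Lam g ` cball 0 1"
    then obtain x where x: "norm x \<le> 1" "y = Lam g x" by auto
    note z = unit3[OF x(1)]
    have "norm y = f (g, x $ 3) * norm x" using f_pos[OF g z] by (simp add: x Lam_def)
    also have "\<dots> \<le> r * 1"
      by (rule mult_mono) (use f_le[OF Ga[OF g] z] x R f_pos[OF g z] in auto)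
    finally show "y \<in> cball 0 r" by simp
  qed
  have height: "\<bar>x $ 3\<bar> \<le> r" if "g \<in> G" "x \<in> closure (Lam g ` ball 0 1)" for g x
  proof -
    have "norm x \<le> r" using Lam_r[OF that(1)] that(2) unfolding cl[OF that(1)] by auto
    then show ?thesis using component_le_norm_cart[of x 3] by simp
  qed
  have zero: "0 \<in> G" using a' G by simp
  have Lam0: "Lam 0 ` X = (*\<^sub>R) R ` X" if "X \<subseteq> cball 0 1" for X :: "(real^3) set"
  proof (rule image_cong[OF refl])
    fix x assume "x \<in> X"
    then have "norm x \<le> 1" using that by auto
    from f0[OF unit3[OF this]] show "Lam 0 x = R *\<^sub>R x" by (simp add: Lam_def)
  qed
  have curve: "(\<lambda>\<zeta>. f (g, \<zeta>) - R) \<in> Cinf_I" "smooth_Cm_curve m G (\<lambda>g \<zeta>. f (g, \<zeta>) - R)" if "g \<in> G" for g m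
  proof -
    have sub: "G \<times> {-1..1} \<subseteq> V" using V(3) a' by (auto simp: G_def)
    have oG: "open G" by (simp add: G_def)
    have "Cinf_on V (\<lambda>q. f q - R)" by (intro smooth_intros V)
    from smooth_family_Cm_curve[OF V(1) oG sub this] that
    show "(\<lambda>\<zeta>. f (g, \<zeta>) - R) \<in> Cinf_I" "smooth_Cm_curve m G (\<lambda>g \<zeta>. f (g, \<zeta>) - R)" by simp_all
  qed
  have GP: "GDERIV (Pint \<circ> (\<lambda>x :: real^3. eta_inv Pint \<rho>ext (0 - g * x $ 3))) x :>
      (- (eta_inv Pint \<rho>ext (0 - g * x $ 3) * g)) *\<^sub>R axis 3 1"
    if "g \<in> G" "x \<in> Lam g ` ball 0 1" for g and x :: "real^3"
  proof -
    have "x \<in> closure (Lam g ` ball 0 1)" by (rule subsetD[OF closure_subset that(2)])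
    from inJ[OF that(1) height[OF that(1) this]]
    have "(frakP Pint \<rho>ext has_real_derivative eta_inv Pint \<rho>ext (0 - g * x $ 3)) (at (0 - g * x $ 3))"
      by (rule frakP_derivative(1))
    from GDERIV_DERIV_compose[OF gderiv_affine_third[of 0 g x] this]
    show ?thesis by (simp add: frakP_def o_def)
  qed
  have density: "smooth_on (closure (Lam g ` ball 0 1)) (\<lambda>x. eta_inv Pint \<rho>ext (0 - g * x $ 3))" if g: "g \<in> G" for g
  proof -
    let ?X = "(\<lambda>x :: real^3. 0 - g * x $ 3) -` ?J"
    have c: "Cinf_on UNIV (\<lambda>x :: real^3. 0 - g * x $ 3)"
      by (intro Cinf_on_diff Cinf_on_mult Cinf_on_const Cinf_on_vec_nth Cinf_on_ident open_UNIV)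
    have o: "open ?X" by (rule open_vimage[OF eta_image(1) Cinf_on_imp_continuous_on[OF c]])
    have "Cinf_on ?X (\<lambda>x. eta_inv Pint \<rho>ext (0 - g * x $ 3))"
      by (rule Cinf_on_compose[OF o eta_image(1) _ Cinf_on_subset[OF c subset_UNIV] eta_image(2)]) auto
    then show ?thesis
      by (rule Cinf_on_imp_smooth_on[OF _ o]) (use inJ[OF g] height[OF g] in auto)
  qed
  have grad: "GDERIV (\<lambda>x :: real^3. Pext_star - g * \<rho>ext * x $ 3) x :> (- (\<rho>ext * g)) *\<^sub>R axis 3 1" for g x
    using gderiv_affine_third[of Pext_star "g * \<rho>ext" x] by (simp add: mult.commute)
  have balls: "Lam 0 ` ball 0 1 = ball 0 R" "Lam 0 ` sphere 0 1 = sphere 0 R"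
  proof -
    have "Lam 0 ` ball 0 1 = (*\<^sub>R) R ` ball 0 1" by (rule Lam0[OF ball_subset_cball])
    also have "\<dots> = ball 0 R" using ball_scale[of R "0 :: real^3" 1] R(1) by simp
    finally show "Lam 0 ` ball 0 1 = ball 0 R" .
    have "Lam 0 ` sphere 0 1 = (*\<^sub>R) R ` sphere 0 1" by (rule Lam0[OF sphere_cball])
    also have "\<dots> = sphere 0 R" using sphere_scale[of R "0 :: real^3" 1] R(1) by simp
    finally show "Lam 0 ` sphere 0 1 = sphere 0 R" .
  qed
  show ?thesis
    unfolding Let_def R_def[symmetric]
  proof (rule exI[of _ G], rule exI[of _ "\<lambda>_. 0"], rule exI[of _ "\<lambda>g \<zeta>. f (g, \<zeta>) - R"], unfold LamE,
      intro conjI)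
    show "open G" "is_interval G" by (simp_all add: G_def is_interval_convex_1)
    show "0 \<in> G" by (rule zero)
    show "\<forall>g\<in>G. frakP_inv Pint \<rho>ext (min_pressure_jump \<sigma> \<Omega>tot + Pext_star) < 0 \<and> ereal 0 < eta_max Pint \<rho>ext"
      using frakP_inv_negative[OF assms(9) _ jump(2)] jump(1) assms(5) eta_max_pos by (simp add: zero_ereal_def)
    show "smooth_on G (\<lambda>_. 0 :: real)"
      by (rule Cinf_on_imp_smooth_on[OF Cinf_on_const _ subset_refl]) (simp add: G_def)
    show "\<forall>g\<in>G. (\<lambda>\<zeta>. f (g, \<zeta>) - R) \<in> Cinf_I" using curve(1) by blast
    show "\<forall>\<zeta>\<in>{-1..1}. f (0, \<zeta>) - R = 0" using f0 by simp
    show "\<forall>m. smooth_Cm_curve m G (\<lambda>g \<zeta>. f (g, \<zeta>) - R)" using curve(2)[OF zero] by blast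
    show "\<forall>g\<in>G. smooth_diffeo (cball 0 1) (Lam g ` cball 0 1) (Lam g) \<and>
         smooth_manifold_with_boundary TYPE(real^3) (closure (Lam g ` ball 0 1)) \<and>
         compact (closure (Lam g ` ball 0 1)) \<and> simply_connected (closure (Lam g ` ball 0 1)) \<and>
         Lam g ` sphere 0 1 = manifold_boundary TYPE(real^3) (closure (Lam g ` ball 0 1)) \<and>
         smooth_manifold TYPE(real^2) (Lam g ` sphere 0 1) \<and>
         compact (Lam g ` sphere 0 1) \<and> simply_connected (Lam g ` sphere 0 1) \<and>
         closure (Lam g ` ball 0 1) \<subseteq> \<Omega>tot \<and> open (\<Omega>tot - closure (Lam g ` ball 0 1))"
    proof
      fix g assume g: "g \<in> G"
      have "closure (Lam g ` ball 0 1) \<subseteq> \<Omega>tot"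
        unfolding cl[OF g] using Lam_r[OF g] r(4) by (rule subset_trans)
      moreover have "open (\<Omega>tot - closure (Lam g ` ball 0 1))"
        by (intro open_Diff assms(1) closed_closure)
      ultimately show "smooth_diffeo (cball 0 1) (Lam g ` cball 0 1) (Lam g) \<and>
         smooth_manifold_with_boundary TYPE(real^3) (closure (Lam g ` ball 0 1)) \<and>
         compact (closure (Lam g ` ball 0 1)) \<and> simply_connected (closure (Lam g ` ball 0 1)) \<and>
         Lam g ` sphere 0 1 = manifold_boundary TYPE(real^3) (closure (Lam g ` ball 0 1)) \<and>
         smooth_manifold TYPE(real^2) (Lam g ` sphere 0 1) \<and>
         compact (Lam g ` sphere 0 1) \<and> simply_connected (Lam g ` sphere 0 1) \<and>
         closure (Lam g ` ball 0 1) \<subseteq> \<Omega>tot \<and> open (\<Omega>tot - closure (Lam g ` ball 0 1))"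
        using geo[OF g] by (elim conjE) (intro conjI)
    qed
    show "Lam 0 ` ball 0 1 = ball 0 R" "Lam 0 ` sphere 0 1 = sphere 0 R"
      by (rule balls)+
    show "\<exists>r. R < r \<and> ereal r < Rmax \<Omega>tot \<and> (\<forall>g\<in>G. closure (Lam g ` ball 0 1) \<subseteq> {x. x $ 3 \<in> {-r..r}} \<and>
        (\<lambda>t. 0 - g * t) ` {-r..r} \<subseteq> ?J \<and>
        (\<lambda>x. eta_inv Pint \<rho>ext (0 - g * x $ 3)) ` closure (Lam g ` ball 0 1) \<subseteq> {0<..} \<and>
        smooth_on (closure (Lam g ` ball 0 1)) (\<lambda>x. eta_inv Pint \<rho>ext (0 - g * x $ 3)))"
    proof (rule exI[of _ r], intro conjI ballI)
      show "R < r" "ereal r < Rmax \<Omega>tot" by fact+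
      fix g assume g: "g \<in> G"
      show "closure (Lam g ` ball 0 1) \<subseteq> {x. x $ 3 \<in> {-r..r}}"
      proof
        fix x assume "x \<in> closure (Lam g ` ball 0 1)"
        from height[OF g this] show "x \<in> {x. x $ 3 \<in> {-r..r}}" by auto
      qed
      show "(\<lambda>t. 0 - g * t) ` {-r..r} \<subseteq> ?J" by (rule image_subsetI, rule inJ[OF g]) auto
      show "(\<lambda>x. eta_inv Pint \<rho>ext (0 - g * x $ 3)) ` closure (Lam g ` ball 0 1) \<subseteq> {0<..}"
        by (rule image_subsetI) (use eta_inv_pos[OF inJ[OF g height[OF g]]] in simp)
      show "smooth_on (closure (Lam g ` ball 0 1)) (\<lambda>x. eta_inv Pint \<rho>ext (0 - g * x $ 3))"
        by (rule density[OF g])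
    qed
    show "\<forall>g\<in>G. (\<forall>x\<in>\<Omega>tot - closure (Lam g ` ball 0 1). GDERIV (\<lambda>x. Pext_star - g * \<rho>ext * x $ 3) x :> (- (\<rho>ext * g)) *\<^sub>R axis 3 1) \<and>
         (\<forall>x\<in>Lam g ` ball 0 1. GDERIV (Pint \<circ> (\<lambda>x. eta_inv Pint \<rho>ext (0 - g * x $ 3))) x :>
            (- (eta_inv Pint \<rho>ext (0 - g * x $ 3) * g)) *\<^sub>R axis 3 1) \<and>
         (\<forall>x\<in>Lam g ` sphere 0 1. \<sigma> * total_curvature (Lam g ` ball 0 1) (Lam g ` sphere 0 1) x
            = Pint (eta_inv Pint \<rho>ext (0 - g * x $ 3)) - (Pext_star - g * \<rho>ext * x $ 3))"
      by (intro ballI conjI) (rule grad GP curv; assumption?)+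
  qed (rule refl)
qed

end
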